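(* Let $d$ be a fixed constant, let $\delta\in(0,1)$ and $\rho>0$ be arbitrary constants, and let $c$, $c_0$ be suitable constants. Let $\alpha$ be an arbitrary integer with $1\le\alpha\le\log^* n-c_0$. Let $P$ be any set of $n$ points in $\mathbb{R}^d$, let $k<n$ be an integer with $k=\Omega((\log n)^c)$, and let $\mathrm{OPT}$ denote the optimal cost of the $k$-center clustering problem for $P$. There exists an MPC algorithm that in $\mathcal{O}(\log\log n)$ rounds determines, with high probability, a set $T\subseteq P$ of centers such that $\mathrm{COST}(P,T)=\mathcal{O}\big(\alpha+\log^{(\alpha+1)}n\big)\cdot\mathrm{OPT}$ and $$|T|\le k\cdot\Big(1+\frac{1}{\widetilde{\Theta}(\log^{(\alpha)}n)}\Big)+\widetilde{\Theta}\big((\log^{(\alpha)}n)^3\big).$$ The MPC uses local space $\mathcal{S}=\mathcal{O}(n^{\delta})$ and global space $\mathcal{T}=\widetilde{\mathcal{O}}(n^{1+\rho}\cdot\log^2\Delta)$.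
   Context: MPC model: $\mathcal{M}$ machines, each with $\mathcal{S}$ words of local memory; global space $\mathcal{T}=\mathcal{S}\cdot\mathcal{M}$; synchronous rounds, in each of which machines compute locally and then exchange messages, each machine sending and receiving at most $\mathcal{S}$ words per round. Distances are Euclidean; $d(p,S)=\min_{q\in S}d(p,q)$; $\mathrm{COST}(P,S)=\max_{p\in P}d(p,S)$. The input is rescaled so the minimum pairwise distance in $P$ is $1$; $\Delta$ is the maximum pairwise distance. $\mathrm{OPT}=\min_{S\subseteq P,|S|=k}\mathrm{COST}(P,S)$. $\log^{(i)}n$ denotes the $i$-fold iterated logarithm ($\log^{(0)}n=n$), and $\log^* n$ the iterated logarithm. $\widetilde{\mathcal{O}}(f)$, $\widetilde{\Theta}(f)$ hide factors polynomial in $\log f$. "With high probability" means with probability at least $1-1/n^{\Omega(1)}$. *)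

theory Defs
  imports "HOL-Probability.Probability" "HOL-Library.Landau_Symbols"
begin

section \<open>Clustering\<close>

text \<open>\<^const>\<open>infdist\<close> is the minimum distance only for nonempty finite center sets
  (\<open>infdist p {} = 0\<close>), so uses of \<open>kcenter_cost P S\<close> have to ensure \<open>S \<noteq> {}\<close>.\<close>

definition kcenter_cost :: "'a::metric_space set \<Rightarrow> 'a set \<Rightarrow> real" where
  "kcenter_cost P S = Max ((\<lambda>p. infdist p S) ` P)"

definition kcenter_opt :: "'a::metric_space set \<Rightarrow> nat \<Rightarrow> real" where
  "kcenter_opt P k = Min (kcenter_cost P ` {S. S \<subseteq> P \<and> card S = k})"

definition min_pairwise_dist :: "'a::metric_space set \<Rightarrow> real" where
  "min_pairwise_dist P = Min {dist p q | p q. p \<in> P \<and> q \<in> P \<and> p \<noteq> q}"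


section \<open>Iterated logarithms and soft asymptotic notation\<close>

definition iter_log :: "nat \<Rightarrow> real \<Rightarrow> real" where
  "iter_log i x = (log 2 ^^ i) x"

definition log_star :: "real \<Rightarrow> nat" where
  "log_star x = (LEAST i. iter_log i x \<le> 1)"

text \<open>With a filter of the form \<open>principal A\<close>, these classes (like the Landau symbols they are built
  from) mean bounds that hold uniformly for all elements of \<open>A\<close>.\<close>

definition soft_O :: "'a filter \<Rightarrow> ('a \<Rightarrow> real) \<Rightarrow> ('a \<Rightarrow> real) set" where
  "soft_O F f = {g. \<exists>q::nat. g \<in> O[F](\<lambda>x. f x * ln (f x) ^ q)}"

definition soft_Theta :: "'a filter \<Rightarrow> ('a \<Rightarrow> real) \<Rightarrow> ('a \<Rightarrow> real) set" where
  "soft_Theta F f =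
     {g \<in> soft_O F f. \<exists>q::nat. f \<in> O[F](\<lambda>x. g x * ln (f x) ^ q)}"


section \<open>The MPC model\<close>

text \<open>A memory cell holds either a number of bounded bit width or an input point. Points are
  indivisible: a machine may inspect, copy, discard and send the points it holds, but it cannot make
  up others. (If words were arbitrary reals, a single word could encode an entire memory and the
  space bounds would be void.) A point of \<open>\<real>\<^sup>d\<close> occupies \<open>d\<close> words.\<close>

datatype 'd::finite cell = Pt "real ^ 'd" | Num nat

primrec cell_words :: "'d::finite cell \<Rightarrow> nat" where
  "cell_words (Pt p) = CARD('d)"
| "cell_words (Num v) = 1"

definition num_words :: "'d::finite cell list \<Rightarrow> nat" where
  "num_words xs = sum_list (map cell_words xs)"

text \<open>Machines are numbered from \<open>0\<close>. The local computation \<open>mpc_step A r i\<close> of machine \<open>i\<close> in round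
  \<open>r\<close> is an arbitrary randomized map (the model does not charge for
  local computation) from the memory contents to the contents that are kept and the list of
  cells that are sent, each with its destination. Randomness that is needed in later rounds has to be
  stored in memory.\<close>

record 'd::finite mpc =
  mpc_machines :: nat
  mpc_space :: nat
  mpc_width :: nat
  mpc_rounds :: nat
  mpc_step :: "nat \<Rightarrow> nat \<Rightarrow> 'd cell list \<Rightarrow> ('d cell list \<times> (nat \<times> 'd cell) list) pmf"

type_synonym 'd config = "nat \<Rightarrow> 'd cell list"

definition global_space :: "'d::finite mpc \<Rightarrow> nat" where
  "global_space A = mpc_space A * mpc_machines A"

fun cell_allowed :: "'d::finite mpc \<Rightarrow> 'd cell list \<Rightarrow> 'd cell \<Rightarrow> bool" where
  "cell_allowed A mem (Pt p) \<longleftrightarrow> Pt p \<in> set mem"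
| "cell_allowed A mem (Num v) \<longleftrightarrow> v < 2 ^ mpc_width A"

fun local_step_ok ::
  "'d::finite mpc \<Rightarrow> 'd cell list \<Rightarrow> 'd cell list \<times> (nat \<times> 'd cell) list \<Rightarrow> bool" where
  "local_step_ok A mem (keep, sent) \<longleftrightarrow>
     num_words keep \<le> mpc_space A \<and>
     num_words (map snd sent) \<le> mpc_space A \<and>
     (\<forall>i \<in> fst ` set sent. i < mpc_machines A) \<and>
     (\<forall>x \<in> set keep \<union> snd ` set sent. cell_allowed A mem x)"

text \<open>Received cells are ordered by sender and appended to the kept ones.\<close>

definition deliver ::
  "'d::finite mpc \<Rightarrow> (nat \<Rightarrow> 'd cell list \<times> (nat \<times> 'd cell) list) \<Rightarrow> 'd config" where
  "deliver A y j = (if j < mpc_machines A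
     then fst (y j) @
       concat (map (\<lambda>i. map snd (filter (\<lambda>m. fst m = j) (snd (y i)))) [0..<mpc_machines A])
     else [])"

text \<open>The resource limits are hard: a round that violates one aborts the run (\<open>None\<close>). The bound on
  the contents after delivery also limits the number of words received.\<close>

definition mpc_round :: "'d::finite mpc \<Rightarrow> nat \<Rightarrow> 'd config \<Rightarrow> 'd config option pmf" where
  "mpc_round A r s =
     map_pmf
       (\<lambda>y. if (\<forall>i < mpc_machines A. local_step_ok A (s i) (y i)) \<and>
               (\<forall>j < mpc_machines A. num_words (deliver A y j) \<le> mpc_space A)
            then Some (deliver A y) else None)
       (Pi_pmf {..<mpc_machines A} ([], []) (\<lambda>i. mpc_step A r i (s i)))"

primrec mpc_run_upto :: "'d::finite mpc \<Rightarrow> 'd config \<Rightarrow> nat \<Rightarrow> 'd config option pmf" where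
  "mpc_run_upto A s 0 = return_pmf (Some s)"
| "mpc_run_upto A s (Suc r) =
     bind_pmf (mpc_run_upto A s r)
       (\<lambda>t. case t of None \<Rightarrow> return_pmf None | Some u \<Rightarrow> mpc_round A r u)"

definition mpc_run :: "'d::finite mpc \<Rightarrow> 'd config \<Rightarrow> 'd config option pmf" where
  "mpc_run A s = mpc_run_upto A s (mpc_rounds A)"

text \<open>Initially every input point is stored exactly once; its location is arbitrary.\<close>

definition input_placement :: "'d::finite mpc \<Rightarrow> (real ^ 'd) set \<Rightarrow> 'd config \<Rightarrow> bool" where
  "input_placement A P s \<longleftrightarrow>
     mset (concat (map s [0..<mpc_machines A])) = image_mset Pt (mset_set P) \<and>
     (\<forall>i < mpc_machines A. num_words (s i) \<le> mpc_space A) \<and>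
     (\<forall>i \<ge> mpc_machines A. s i = [])"

text \<open>The output is the set of all points that are still stored somewhere at the end.\<close>

definition mpc_output :: "'d::finite mpc \<Rightarrow> 'd config \<Rightarrow> (real ^ 'd) set" where
  "mpc_output A s = {p. \<exists>i < mpc_machines A. Pt p \<in> set (s i)}"


section \<open>Problem instances\<close>

text \<open>Instances are triples of the point set, the number of centers and the parameter \<open>\<alpha>\<close>; \<open>\<kappa>\<close> is the
  hidden constant of \<open>k = \<Omega>((log n)\<^sup>c)\<close>.\<close>

definition kcenter_instances ::
  "real \<Rightarrow> nat \<Rightarrow> real \<Rightarrow> ((real ^ 'd::finite) set \<times> nat \<times> nat) set" where
  "kcenter_instances c c0 \<kappa> = {(P, k, \<alpha>).
     finite P \<and> min_pairwise_dist P = 1 \<and>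
     k < card P \<and> real k \<ge> \<kappa> * log 2 (card P) powr c \<and>
     1 \<le> \<alpha> \<and> \<alpha> + c0 \<le> log_star (card P)}"

text \<open>What an algorithm is told about its input besides the points: \<open>n\<close>, \<open>k\<close>, \<open>\<alpha>\<close>, and the number of
  distance scales, on which the number of machines depends.\<close>

definition alg_for ::
  "(nat \<Rightarrow> nat \<Rightarrow> nat \<Rightarrow> nat \<Rightarrow> 'd mpc) \<Rightarrow> (real ^ 'd::finite) set \<times> nat \<times> nat \<Rightarrow> 'd mpc" where
  "alg_for alg = (\<lambda>(P, k, \<alpha>). alg (card P) k \<alpha> (nat \<lceil>log 2 (diameter P)\<rceil>))"

end

theory Submission
  imports Defs
begin

text \<open>Since \<open>d\<close> is constant, a constant approximation with at most \<open>k\<close> centers is possible in constantly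
  many rounds. At scale \<open>i\<close>, cover the points by grid cells of side \<open>2\<^sup>i\<close> and select greedily a maximal
  set of occupied cells without neighbors, with one point per selected cell. If \<open>2\<^sup>i\<close> is at least
  the optimum, then no two selected points are served by the same optimal center, so at most \<open>k\<close> are selected;
  conversely every point is within \<open>O(2\<^sup>i)\<close> of a selected one. The output is the selection at the
  smallest scale with at most \<open>k\<close> selected points. Processing the cells by color makes the greedy rule local.

  All scales are handled in parallel, each by a block of machines with fan-in \<open>B \<approx> n\<^bsup>1/m\<^esup>\<close>. Points of the same
  cell find each other by hashing: for every cell there is a \<open>B\<close>-ary tree over the positions of
  the points, whose occupied nodes are hashed to bucket machines and which computes the smallest position of a
  point in the cell. The hash function is drawn from a short list so that its index fits into a
  single word. If there are more scales than machines to handle them, only those that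
  occur as distances of two points are tried. Apart from the hash function, randomness is only used to
  spread the arbitrarily placed input.\<close>

text \<open>The obstacle is the word length. Describing a grid cell takes about \<open>d * L\<close>
  bits, where \<open>L\<close> is about the logarithm of the diameter, but a number may only have
  O(log of the global space) bits, and the diameter is not bounded in terms of n. So no message
  contains a cell: cells and tree nodes are represented by hash values, which have to be injective
  on the nodes that occur and to put few of them into one bucket. A random hash function does not
  fit into a memory either; a fixed list of polynomially many functions does equally well. One cell
  may contain nearly all points, so collecting them in one bucket would exceed the local space. In a
  \<open>B\<close>-ary tree a node has at most \<open>B\<close> children, and a bucket with a
  constant number \<open>t0\<close> of nodes stores at most \<open>t0 * B\<close> reports, below the
  capacity \<open>B ^ 2\<close>. An unbounded diameter also means that a broadcast to all scales
  with fan-out \<open>B\<close> need not end after constantly many rounds. This is why the number of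
  blocks is capped at a power of \<open>B\<close> and candidates are then taken from pairs of
  points: the optimum is a distance of two points.\<close>

section \<open>Hash functions with bounded bucket loads, and a short list of them\<close>

definition crowded :: "nat \<Rightarrow> nat \<Rightarrow> 'b set \<Rightarrow> ('b \<Rightarrow> nat) \<Rightarrow> bool" where
  "crowded t c S h \<longleftrightarrow> (\<exists>T\<subseteq>S. card T = Suc t \<and> (\<exists>b<c. \<forall>x\<in>T. h x mod c = b))"

lemma not_crowdedD:
  assumes "\<not> crowded t c S h" "finite S" "c > 0"
  shows "card {x\<in>S. h x mod c = b} \<le> t"
proof (rule ccontr)
  assume "\<not> ?thesis"
  hence *: "Suc t \<le> card {x\<in>S. h x mod c = b}" by simp
  then obtain T where T: "T \<subseteq> {x\<in>S. h x mod c = b}" "card T = Suc t"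
    using obtain_subset_with_card_n[OF *] by blast
  then obtain x where "x \<in> T" by fastforce
  hence "b < c" using T(1) assms(3) by auto
  with T have "crowded t c S h"
    unfolding crowded_def by (intro exI[of _ T]) auto
  with assms(1) show False by simp
qed

text \<open>Hash values range over \<open>c * c'\<close> numbers: the value itself serves as the
  name of the hashed object, its residue modulo \<open>c\<close> as the bucket. The range is
  divisible by \<open>c\<close> to make the bucket uniform.\<close>

lemma prob_uniform_mod:
  fixes c c' :: nat
  assumes "b < c" "c' > 0"
  shows "measure_pmf.prob (pmf_of_set {..<c * c'}) {x. x mod c = b} = 1 / real c"
proof -
  have c: "c > 0" using assms by simp
  have "{..<c * c'} \<inter> {x. x mod c = b} = (\<lambda>i. b + c * i) ` {..<c'}"
  proof (intro equalityI subsetI)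
    fix x assume x: "x \<in> {..<c * c'} \<inter> {x. x mod c = b}"
    have "x = b + c * (x div c)" using x mult_div_mod_eq[of c x] by simp
    moreover have "x div c < c'" using x less_mult_imp_div_less[of x c' c] by (simp add: mult.commute)
    ultimately show "x \<in> (\<lambda>i. b + c * i) ` {..<c'}" by blast
  next
    fix x assume "x \<in> (\<lambda>i. b + c * i) ` {..<c'}"
    then obtain i where i: "i < c'" "x = b + c * i" by blast
    have "b + c * i < c + c * i" using assms by simp
    also have "\<dots> = c * Suc i" by simp
    also have "\<dots> \<le> c * c'" using i by (intro mult_left_mono) auto
    finally show "x \<in> {..<c * c'} \<inter> {x. x mod c = b}" using i assms by auto
  qed
  moreover have "card ((\<lambda>i. b + c * i) ` {..<c'}) = c'"
    using c by (subst card_image) (auto simp: inj_on_def)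
  moreover have "{..<c * c'} \<noteq> {}" using c assms by (metis lessThan_iff emptyE mult_pos_pos)
  ultimately show ?thesis using c assms by (subst measure_pmf_of_set) (auto simp: field_simps)
qed

text \<open>Union bound over sets of \<open>Suc t\<close> elements and over buckets: at most
  \<open>card S ^ Suc t\<close> sets, \<open>c\<close> buckets, and a given set falls into a given
  bucket with probability \<open>(1 / c) ^ Suc t\<close>.\<close>

lemma prob_crowded:
  fixes c c' t :: nat
  assumes "finite U" "S \<subseteq> U" "c > 0" "c' > 0"
  shows "measure_pmf.prob (Pi_pmf U d (\<lambda>_. pmf_of_set {..<c * c'})) {h. crowded t c S h}
           \<le> real (card S) ^ Suc t / real c ^ t"
proof -
  let ?p = "Pi_pmf U d (\<lambda>_. pmf_of_set {..<c * c'})"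
  define TT where "TT = {T. T \<subseteq> S \<and> card T = Suc t}"
  have finS: "finite S" using assms finite_subset by blast
  have finTT: "finite TT" unfolding TT_def using finS by simp
  have cardTT: "real (card TT) \<le> real (card S) ^ Suc t"
  proof -
    have "card TT = card S choose Suc t" unfolding TT_def using finS n_subsets by blast
    also have "\<dots> \<le> card S ^ Suc t"
      by (cases "Suc t \<le> card S") (use binomial_le_pow[of "Suc t" "card S"] in \<open>simp_all add: binomial_eq_0\<close>)
    finally show ?thesis by (metis of_nat_le_iff of_nat_power)
  qed
  have one: "measure_pmf.prob ?p {h. \<forall>x\<in>T. h x mod c = b} = (1 / real c) ^ Suc t"
    if "T \<in> TT" "b < c" for T b
  proof -
    have TU: "T \<subseteq> U" "card T = Suc t" using that assms(2) by (auto simp: TT_def)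
    \<comment> \<open>Coordinates outside \<open>T\<close> are unrestricted, so the event is a
      product set and its probability factorizes.\<close>
    let ?B = "\<lambda>x. if x \<in> T then {y. y mod c = b} else UNIV"
    have eq: "{h. \<forall>x\<in>T. h x mod c = b} = Pi U ?B" using TU by (auto simp: Pi_def)
    have "measure_pmf.prob ?p {h. \<forall>x\<in>T. h x mod c = b}
        = (\<Prod>x\<in>U. measure_pmf.prob (pmf_of_set {..<c * c'}) (?B x))"
      unfolding eq by (rule measure_Pi_pmf_Pi[OF assms(1)])
    also have "\<dots> = (\<Prod>x\<in>U. if x \<in> T then 1 / real c else 1)"
      using prob_uniform_mod[OF that(2) assms(4)] by (intro prod.cong) auto
    also have "\<dots> = (\<Prod>x\<in>T. 1 / real c)"
      using TU assms(1) by (simp add: prod.If_cases Int_absorb1)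
    finally show ?thesis using TU by simp
  qed
  have "{h. crowded t c S h} = (\<Union>z\<in>TT\<times>{..<c}. {h. \<forall>x\<in>fst z. h x mod c = snd z})"
    unfolding crowded_def TT_def set_eq_iff UN_iff Bex_def mem_Sigma_iff split_paired_Ex
    by (simp only: mem_Collect_eq fst_conv snd_conv lessThan_iff) blast
  hence "measure_pmf.prob ?p {h. crowded t c S h}
      \<le> (\<Sum>z\<in>TT\<times>{..<c}. measure_pmf.prob ?p {h. \<forall>x\<in>fst z. h x mod c = snd z})"
    using finTT by (auto intro!: measure_pmf.finite_measure_subadditive_finite)
  also have "\<dots> = (\<Sum>z\<in>TT\<times>{..<c}. (1 / real c) ^ Suc t)"
    using one by (intro sum.cong) auto
  also have "\<dots> = real (card TT) / real c ^ t"
    using assms(3) by (simp add: card_cartesian_product field_simps)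
  also have "\<dots> \<le> real (card S) ^ Suc t / real c ^ t"
    using cardTT assms(3) by (intro divide_right_mono) auto
  finally show ?thesis .
qed

text \<open>If every instance is bad for at most an \<open>\<epsilon>\<close>-fraction of the support, then a multiplicative-weights
  potential argument yields a short list of elements of the support most of which are good for every
  single instance.\<close>

lemma derandomized_list:
  fixes p :: "'h pmf" and bad :: "'i \<Rightarrow> 'h \<Rightarrow> bool"
  assumes fin: "finite I" and eps: "\<And>i. i \<in> I \<Longrightarrow> measure_pmf.prob p {h. bad i h} \<le> \<epsilon>" "\<epsilon> \<ge> 0"
    and cardI: "card I \<le> 2 ^ N"
  shows "\<exists>hs :: nat \<Rightarrow> 'h. (\<forall>a. hs a \<in> set_pmf p) \<and>
           (\<forall>i\<in>I. real (card {a. a < F \<and> bad i (hs a)}) \<le> real N + 2 * \<epsilon> * real F)"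
proof -
  \<comment> \<open>\<open>X F hs i\<close> counts the bad functions for instance \<open>i\<close>
    among the first \<open>F\<close>. The potential is the sum of \<open>2 ^ X F hs i\<close> over
    all instances.\<close>
  define X where "X = (\<lambda>F (hs :: nat \<Rightarrow> 'h) i. card {a. a < F \<and> bad i (hs a)})"
  \<comment> \<open>Averaging: a random next function multiplies the weighted sum by at most
    \<open>1 + \<epsilon>\<close> in expectation, so some element of the support does no
    worse.\<close>
  have step: "\<exists>h\<in>set_pmf p. (\<Sum>i\<in>I. w i * (if bad i h then 2 else 1)) \<le> (1 + \<epsilon>) * (\<Sum>i\<in>I. w i)"
    if w: "\<And>i. i \<in> I \<Longrightarrow> w i \<ge> 0" for w :: "'i \<Rightarrow> real"
  proof (rule ccontr)
    let ?f = "\<lambda>h. \<Sum>i\<in>I. w i * (if bad i h then 2 else 1)"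
    assume "\<not> ?thesis"
    hence gt: "?f h > (1 + \<epsilon>) * (\<Sum>i\<in>I. w i)" if "h \<in> set_pmf p" for h using that by force
    have f_eq: "?f = (\<lambda>h. \<Sum>i\<in>I. w i * (1 + indicator {h. bad i h} h))"
      by (intro ext sum.cong) (auto simp: indicator_def)
    have int: "integrable (measure_pmf p) ?f"
      unfolding f_eq
      by (intro Bochner_Integration.integrable_sum integrable_mult_right Bochner_Integration.integrable_add)
        (auto simp: measure_pmf.emeasure_eq_measure)
    have "measure_pmf.expectation p ?f
        = (\<Sum>i\<in>I. w i * (1 + measure_pmf.prob p {h. bad i h}))"
      unfolding f_eq
      by (subst Bochner_Integration.integral_sum)
         (auto simp: measure_pmf.emeasure_eq_measure intro!: sum.cong)
    also have "\<dots> \<le> (\<Sum>i\<in>I. w i * (1 + \<epsilon>))"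
      using eps w by (intro sum_mono mult_left_mono) auto
    also have "\<dots> = (1 + \<epsilon>) * (\<Sum>i\<in>I. w i)" by (simp add: sum_distrib_left mult.commute)
    finally have le: "measure_pmf.expectation p ?f \<le> (1 + \<epsilon>) * (\<Sum>i\<in>I. w i)" .
    have "(1 + \<epsilon>) * (\<Sum>i\<in>I. w i) < measure_pmf.expectation p ?f"
      using int gt by (intro measure_pmf.expectation_greater) (auto simp: AE_measure_pmf_iff)
    with le show False by simp
  qed
  \<comment> \<open>The potential starts at \<open>card I\<close>, and every appended function costs
    a factor \<open>1 + \<epsilon>\<close>.\<close>
  have "\<exists>hs. (\<forall>a. hs a \<in> set_pmf p) \<and> (\<Sum>i\<in>I. 2 ^ X F hs i) \<le> (1 + \<epsilon>) ^ F * real (card I)"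
  proof (induction F)
    case 0
    obtain h where "h \<in> set_pmf p" using set_pmf_not_empty by fast
    thus ?case by (intro exI[of _ "\<lambda>_. h"]) (simp add: X_def)
  next
    case (Suc F)
    then obtain hs where hs: "\<forall>a. hs a \<in> set_pmf p"
      "(\<Sum>i\<in>I. 2 ^ X F hs i) \<le> (1 + \<epsilon>) ^ F * real (card I)" by blast
    from step[of "\<lambda>i. 2 ^ X F hs i"] obtain h where h: "h \<in> set_pmf p"
      "(\<Sum>i\<in>I. 2 ^ X F hs i * (if bad i h then 2 else 1)) \<le> (1 + \<epsilon>) * (\<Sum>i\<in>I. 2 ^ X F hs i)" by auto
    have X: "X (Suc F) (hs(F := h)) i = X F hs i + (if bad i h then 1 else 0)" for i
    proof -
      have "{a. a < Suc F \<and> bad i ((hs(F := h)) a)}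
          = {a. a < F \<and> bad i (hs a)} \<union> (if bad i h then {F} else {})"
        by (auto simp: less_Suc_eq)
      moreover have "finite {a. a < F \<and> bad i (hs a)}" by simp
      ultimately show ?thesis unfolding X_def by (auto simp: card_insert_if)
    qed
    have "(\<Sum>i\<in>I. 2 ^ X (Suc F) (hs(F := h)) i) = (\<Sum>i\<in>I. 2 ^ X F hs i * (if bad i h then 2 else (1::real)))"
      by (intro sum.cong) (auto simp: X)
    also have "\<dots> \<le> (1 + \<epsilon>) * ((1 + \<epsilon>) ^ F * real (card I))"
      by (rule order_trans[OF h(2)], rule mult_left_mono[OF hs(2)]) (use eps(2) in simp)
    finally have "(\<Sum>i\<in>I. 2 ^ X (Suc F) (hs(F := h)) i) \<le> (1 + \<epsilon>) ^ Suc F * real (card I)"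
      by (simp add: mult.assoc)
    moreover have "\<forall>a. (hs(F := h)) a \<in> set_pmf p" using hs(1) h(1) by simp
    ultimately show ?case by blast
  qed
  then obtain hs where hs: "\<forall>a. hs a \<in> set_pmf p"
    "(\<Sum>i\<in>I. 2 ^ X F hs i) \<le> (1 + \<epsilon>) ^ F * real (card I)" by blast
  have "real (X F hs i) \<le> real N + 2 * \<epsilon> * real F" if "i \<in> I" for i
  proof -
    have "2 ^ X F hs i \<le> (\<Sum>i\<in>I. 2 ^ X F hs i :: real)" using fin that by (intro member_le_sum) auto
    also have "\<dots> \<le> (1 + \<epsilon>) ^ F * 2 ^ N"
    proof (rule order_trans[OF hs(2)], rule mult_left_mono)
      have "real (card I) \<le> real (2 ^ N)" using cardI by (simp only: of_nat_le_iff)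
      thus "real (card I) \<le> 2 ^ N" by simp
    qed (use eps(2) in simp)
    also have "\<dots> \<le> exp \<epsilon> ^ F * 2 ^ N"
      using eps(2) exp_ge_add_one_self[of \<epsilon>] by (intro mult_right_mono power_mono) auto
    also have "\<dots> = exp (\<epsilon> * real F) * 2 ^ N" by (simp add: exp_of_nat_mult[symmetric] mult.commute)
    finally have "ln (2 ^ X F hs i :: real) \<le> ln (exp (\<epsilon> * real F) * 2 ^ N)" by (subst ln_le_cancel_iff) auto
    hence "real (X F hs i) * ln 2 \<le> \<epsilon> * real F + real N * ln 2"
      by (simp add: ln_mult ln_realpow)
    \<comment> \<open>Changing the exponent to base 2 with \<open>ln 2 \<ge> 1/2\<close> is the
      origin of the factor 2 in front of \<epsilon>.\<close>
    moreover have "\<epsilon> * real F \<le> (2 * \<epsilon> * real F) * ln 2"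
      using ln2_ge_two_thirds mult_left_mono[of "1/2" "ln 2" "2 * \<epsilon> * real F"] eps(2) by simp
    ultimately have "real (X F hs i) * ln 2 \<le> (real N + 2 * \<epsilon> * real F) * ln 2"
      by (simp add: algebra_simps)
    thus ?thesis by (simp add: mult_le_cancel_right)
  qed
  thus ?thesis using hs(1) unfolding X_def by blast
qed

text \<open>A random function fails in two ways, each of probability at most \<open>1 / B\<close>:
  an overfull bucket (by \<open>load\<close>) or a collision of full values (by \<open>inj\<close>).
  So \<epsilon> is \<open>2 / B\<close> in \<open>derandomized_list\<close>, which yields
  \<open>4 / B * F\<close>; the additive term \<open>u * s\<close> is the logarithm of the number of
  instances.\<close>

lemma hash_family:
  fixes U :: "'b set" and s t c c' B F N :: nat
  assumes fin: "finite U" and U: "card U \<le> 2 ^ u"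
    and s: "s > 0" and B: "B > 0" and c: "c > 0" "c' > 0"
    and load: "real B * real s ^ Suc t \<le> real c ^ t"
    and inj: "real B * real s ^ 2 \<le> real (c * c')"
  shows "\<exists>h :: nat \<Rightarrow> 'b \<Rightarrow> nat. (\<forall>a. \<forall>x\<in>U. h a x < c * c') \<and>
     (\<forall>S\<subseteq>U. card S \<le> s \<longrightarrow>
        real (card {a. a < F \<and> \<not> (inj_on (h a) S \<and> (\<forall>b. card {x\<in>S. h a x mod c = b} \<le> t))})
          \<le> real (u * s) + 4 / real B * real F)"
proof -
  define p where "p = Pi_pmf U 0 (\<lambda>_. pmf_of_set {..<c * c'})"
  \<comment> \<open>Lists of length exactly \<open>s\<close> stand for the sets of size at most
    \<open>s\<close>, since they are easy to count.\<close>
  define I where "I = {xs. set xs \<subseteq> U \<and> length xs = s}"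
  \<comment> \<open>Injectivity is the case of \<open>crowded\<close> with load 1 in which all
    \<open>c * c'\<close> values are buckets.\<close>
  define bad where "bad = (\<lambda>(xs :: 'b list) h. crowded t c (set xs) h \<or> crowded 1 (c * c') (set xs) h)"
  have finI: "finite I" unfolding I_def using finite_lists_length_eq[OF fin] by blast
  have cardI: "card I \<le> 2 ^ (u * s)"
    using card_lists_length_eq[OF fin, of s] power_mono[OF U, of s]
    unfolding I_def by (simp add: power_mult)
  have R: "c * c' > 0" using c by simp
  have pr: "measure_pmf.prob p {h. bad xs h} \<le> 2 / real B" if "xs \<in> I" for xs
  proof -
    have xs: "set xs \<subseteq> U" "card (set xs) \<le> s" using that card_length[of xs] by (auto simp: I_def)
    have "measure_pmf.prob p {h. bad xs h} \<le> measure_pmf.prob p {h. crowded t c (set xs) h}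
            + measure_pmf.prob p {h. crowded 1 (c * c') (set xs) h}"
    proof -
      have "{h. bad xs h} = {h. crowded t c (set xs) h} \<union> {h. crowded 1 (c * c') (set xs) h}"
        by (auto simp: bad_def)
      thus ?thesis by (simp add: measure_Un_le)
    qed
    also have "\<dots> \<le> real (card (set xs)) ^ Suc t / real c ^ t + real (card (set xs)) ^ Suc 1 / real (c * c') ^ 1"
      unfolding p_def using prob_crowded[OF fin xs(1) c] prob_crowded[OF fin xs(1) R, where c' = 1 and t = 1 and d = 0]
      by (intro add_mono) (simp_all del: power_Suc)
    also have "\<dots> \<le> real s ^ Suc t / real c ^ t + real s ^ Suc 1 / real (c * c') ^ 1"
      using xs(2) by (intro add_mono divide_right_mono power_mono) auto
    also have "\<dots> \<le> 1 / real B + 1 / real B"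
      using load inj B c by (intro add_mono) (auto simp: field_simps power2_eq_square)
    finally show ?thesis by simp
  qed
  have "\<exists>hs :: nat \<Rightarrow> 'b \<Rightarrow> nat. (\<forall>a. hs a \<in> set_pmf p) \<and>
      (\<forall>xs\<in>I. real (card {a. a < F \<and> bad xs (hs a)}) \<le> real (u * s) + 2 * (2 / real B) * real F)"
    by (rule derandomized_list[OF finI pr _ cardI]) auto
  then obtain h where h:
    "\<And>a. h a \<in> set_pmf p"
    "\<And>xs. xs \<in> I \<Longrightarrow> real (card {a. a < F \<and> bad xs (h a)}) \<le> real (u * s) + 2 * (2 / real B) * real F"
    by auto
  have "h a x < c * c'" if "x \<in> U" for a x
  proof -
    have "0 \<in> {..<c * c'}" using R by simp
    hence ne: "{..<c * c'} \<noteq> {}" by blast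
    have "h a \<in> PiE_dflt U 0 (set_pmf \<circ> (\<lambda>_. pmf_of_set {..<c * c'}))"
      using h(1)[of a] set_Pi_pmf_subset'[OF fin] unfolding p_def by fast
    thus ?thesis using that ne by (auto simp: PiE_dflt_def set_pmf_of_set)
  qed note lt = this
  have "real (card {a. a < F \<and> \<not> (inj_on (h a) S \<and> (\<forall>b. card {x\<in>S. h a x mod c = b} \<le> t))})
          \<le> real (u * s) + 4 / real B * real F" if S: "S \<subseteq> U" "card S \<le> s" for S
  proof (cases "S = {}")
    case True thus ?thesis by simp
  next
    case False
    have finS: "finite S" using S fin finite_subset by blast
    obtain ys where ys: "set ys = S" "distinct ys" using finite_distinct_list[OF finS] by blast
    have len: "length ys \<le> s" using ys S distinct_card by fastforce
    \<comment> \<open>Repeating an element brings the list to length \<open>s\<close> without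
      changing its set.\<close>
    define xs where "xs = ys @ replicate (s - length ys) (hd ys)"
    have ysne: "ys \<noteq> []" using ys False by auto
    have set_xs: "set xs = S" using ys ysne hd_in_set[of ys] by (auto simp: xs_def)
    have xs: "xs \<in> I" using set_xs S len by (auto simp: I_def xs_def)
    have sub: "{a. a < F \<and> \<not> (inj_on (h a) S \<and> (\<forall>b. card {x\<in>S. h a x mod c = b} \<le> t))}
        \<subseteq> {a. a < F \<and> bad xs (h a)}"
    proof (intro subsetI, rule ccontr)
      fix a assume a: "a \<in> {a. a < F \<and> \<not> (inj_on (h a) S \<and> (\<forall>b. card {x\<in>S. h a x mod c = b} \<le> t))}"
        and "a \<notin> {a. a < F \<and> bad xs (h a)}"
      hence nc: "\<not> crowded t c S (h a)" "\<not> crowded 1 (c * c') S (h a)" by (auto simp: bad_def set_xs)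
      have "inj_on (h a) S"
      proof (rule inj_onI, rule ccontr)
        fix x y assume xy: "x \<in> S" "y \<in> S" "h a x = h a y" "x \<noteq> y"
        have "crowded 1 (c * c') S (h a)"
          unfolding crowded_def using xy S lt[of x a]
          by (intro exI[of _ "{x,y}"] conjI exI[of _ "h a x"]) auto
        thus False using nc by simp
      qed
      thus False using a not_crowdedD[OF nc(1) finS c(1)] by simp
    qed
    have "card {a. a < F \<and> \<not> (inj_on (h a) S \<and> (\<forall>b. card {x\<in>S. h a x mod c = b} \<le> t))}
        \<le> card {a. a < F \<and> bad xs (h a)}" by (rule card_mono[OF _ sub]) simp
    thus ?thesis using h(2)[OF xs] by simp
  qed
  thus ?thesis using lt by blast
qed

section \<open>Success probability of a run, round by round\<close>

text \<open>\<open>(1 - a) * (1 - b)\<close> is at least \<open>1 - (a + b)\<close>. Multiplying by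
  \<open>1 - b\<close> needs \<open>b \<le> 1\<close>; for larger \<open>b\<close> the bound is
  negative.\<close>

lemma prob_bind_ge:
  assumes "measure_pmf.prob p G \<ge> 1 - a" "\<And>x. x \<in> G \<Longrightarrow> measure_pmf.prob (f x) A \<ge> 1 - b" "a \<ge> 0" "b \<ge> 0"
  shows "measure_pmf.prob (bind_pmf p f) A \<ge> 1 - (a + b)"
proof (cases "b \<le> 1")
  case True
  have "1 - (a + b) \<le> (1 - b) * (1 - a)" using assms by (simp add: algebra_simps)
  also have "\<dots> \<le> (1 - b) * measure_pmf.prob p G" using True assms by (intro mult_left_mono) auto
  also have "\<dots> = measure_pmf.expectation p (\<lambda>x. (1 - b) * indicator G x)"
    by (simp add: measure_pmf.emeasure_eq_measure)
  also have "\<dots> \<le> measure_pmf.expectation p (\<lambda>x. measure_pmf.prob (f x) A)"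
    using assms(2) by (intro integral_mono measure_pmf.integrable_const_bound[where B = 1]
        integrable_mult_right) (auto simp: indicator_def measure_pmf.emeasure_eq_measure)
  also have "\<dots> = measure_pmf.prob (bind_pmf p f) A"
    unfolding measure_def[of "measure_pmf (bind_pmf p f)"]
    by (subst integral_eq_nn_integral) (auto simp: measure_pmf.emeasure_eq_measure[symmetric])
  finally show ?thesis .
next
  case False
  thus ?thesis using assms measure_nonneg[of "measure_pmf (bind_pmf p f)" A] by linarith
qed

text \<open>\<open>G\<close> is an invariant indexed by rounds. Aborted runs do not have the form
  \<open>Some u\<close>, so they count as failures just like violations of \<open>G\<close>.\<close>

lemma mpc_run_upto_prob:
  assumes "G 0 s" "\<And>r. \<epsilon> r \<ge> 0"
    and "\<And>r t. r < T \<Longrightarrow> G r t \<Longrightarrow> measure_pmf.prob (mpc_round A r t) {Some u |u. G (Suc r) u} \<ge> 1 - \<epsilon> r"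
  shows "measure_pmf.prob (mpc_run_upto A s T) {Some t |t. G T t} \<ge> 1 - (\<Sum>r<T. \<epsilon> r)"
  using assms(3)
proof (induction T)
  case 0
  thus ?case using assms(1) by (simp add: indicator_def)
next
  case (Suc T)
  have "measure_pmf.prob (mpc_run_upto A s (Suc T)) {Some u |u. G (Suc T) u} \<ge> 1 - ((\<Sum>r<T. \<epsilon> r) + \<epsilon> T)"
    unfolding mpc_run_upto.simps
  proof (rule prob_bind_ge)
    show "1 - (\<Sum>r<T. \<epsilon> r) \<le> measure_pmf.prob (mpc_run_upto A s T) {Some t |t. G T t}"
      using Suc by simp
  qed (use Suc.prems assms(2) in \<open>auto intro: sum_nonneg\<close>)
  thus ?case by simp
qed

lemma prob_map_ge:
  assumes "measure_pmf.prob p E \<ge> c" "\<And>f. f \<in> E \<Longrightarrow> F f \<in> A"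
  shows "measure_pmf.prob (map_pmf F p) A \<ge> c"
proof -
  have "measure_pmf.prob p E \<le> measure_pmf.prob p (F -` A)"
    using assms(2) by (intro measure_pmf.finite_measure_mono) auto
  thus ?thesis using assms(1) by simp
qed

definition set_list :: "'a set \<Rightarrow> 'a list" where
  "set_list A = (SOME xs. set xs = A \<and> distinct xs)"

lemma set_list:
  assumes "finite A"
  shows "set (set_list A) = A" "distinct (set_list A)"
proof -
  have "set (set_list A) = A \<and> distinct (set_list A)"
    unfolding set_list_def by (rule someI_ex) (use finite_distinct_list[OF assms] in blast)
  thus "set (set_list A) = A" "distinct (set_list A)" by auto
qed

lemma length_set_list: "finite A \<Longrightarrow> length (set_list A) = card A"
  by (metis set_list distinct_card)

lemma num_words_le: "num_words (xs :: 'd::finite cell list) \<le> CARD('d) * length xs"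
proof (induction xs)
  case (Cons x xs)
  have "cell_words x \<le> CARD('d)" by (cases x) (auto simp: Suc_le_eq)
  thus ?case using Cons by (simp add: num_words_def)
qed (simp add: num_words_def)

section \<open>Set-based MPC programs\<close>

text \<open>Memories are represented by sets, machines by structured addresses, and words by structured
  items; the order and multiplicity of the cells in a memory carry no information. The program says
  which items a machine \<open>a\<close> with memory \<open>A\<close> sends to a machine \<open>j\<close>, possibly depending on a random
  number drawn by \<open>a\<close>; what is kept is sent to oneself.\<close>

locale set_mpc =
  fixes Ad :: "'a set" and enc :: "'a \<Rightarrow> nat" and Items :: "'i set" and en :: "'i \<Rightarrow> nat"
    and cap wd rounds :: nat and rnd :: "nat \<Rightarrow> nat"
    and msg :: "nat \<Rightarrow> nat \<Rightarrow> 'a \<Rightarrow> 'a \<Rightarrow> ((real^'d::finite) + 'i) set \<Rightarrow> ((real^'d) + 'i) set"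
begin

definition "enc_cell c = (case c of Inl p \<Rightarrow> Pt p | Inr f \<Rightarrow> Num (en f))"
definition "valid = range Inl \<union> Inr ` Items"
definition "absmem mem = {c \<in> valid. enc_cell c \<in> set mem}"
definition "outbox r x i mem =
  set_list {(enc j, enc_cell c) |j c. j \<in> Ad \<and> c \<in> msg r x (inv_into Ad enc i) j (absmem mem)}"

definition machine :: "'d mpc" where
  "machine = \<lparr>mpc_machines = card Ad, mpc_space = CARD('d) * cap, mpc_width = wd,
     mpc_rounds = rounds,
     mpc_step = \<lambda>r i mem. map_pmf (\<lambda>x. ([], outbox r x i mem)) (pmf_of_set {..<rnd r})\<rparr>"

lemma machine_simps [simp]:
  "mpc_machines machine = card Ad" "mpc_space machine = CARD('d) * cap"
  "mpc_width machine = wd" "mpc_rounds machine = rounds"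
  "mpc_step machine r i mem = map_pmf (\<lambda>x. ([], outbox r x i mem)) (pmf_of_set {..<rnd r})"
  by (simp_all add: machine_def)

definition "rep s C \<longleftrightarrow> (\<forall>a\<in>Ad. C a \<subseteq> valid \<and> set (s (enc a)) = enc_cell ` C a)"

definition "succ_conf r x C j = (\<Union>a\<in>Ad. msg r (x a) a j (C a))"

text \<open>The conditions under which the concrete round does not abort. Incoming cells are counted
  together with their senders, since equal cells from two senders occupy space twice. Finiteness is
  demanded because \<open>card\<close> is 0 on infinite sets. The last condition says that points
  can be copied but not made up.\<close>

definition "step_ok r x C \<longleftrightarrow>
  (\<forall>a\<in>Ad. finite {(j, c). j \<in> Ad \<and> c \<in> msg r (x a) a j (C a)} \<and>
          card {(j, c). j \<in> Ad \<and> c \<in> msg r (x a) a j (C a)} \<le> cap) \<and>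
  (\<forall>j\<in>Ad. card {(a, c). a \<in> Ad \<and> c \<in> msg r (x a) a j (C a)} \<le> cap) \<and>
  (\<forall>a\<in>Ad. \<forall>j\<in>Ad. msg r (x a) a j (C a) \<subseteq> C a \<inter> range Inl \<union> Inr ` Items)"

end

locale set_mpc_encoded = set_mpc Ad enc Items en cap wd rounds rnd msg
  for Ad :: "'a set" and enc :: "'a \<Rightarrow> nat" and Items :: "'i set" and en :: "'i \<Rightarrow> nat"
    and cap wd rounds :: nat and rnd :: "nat \<Rightarrow> nat"
    and msg :: "nat \<Rightarrow> nat \<Rightarrow> 'a \<Rightarrow> 'a \<Rightarrow> ((real^'d::finite) + 'i) set \<Rightarrow> ((real^'d) + 'i) set" +
  assumes finAd: "finite Ad" and enc: "bij_betw enc Ad {..<card Ad}"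
    and en: "inj_on en Items" "\<And>f. f \<in> Items \<Longrightarrow> en f < 2 ^ wd"
begin

lemma inj_enc: "inj_on enc Ad" using enc by (simp add: bij_betw_def)

lemma enc_less: "a \<in> Ad \<Longrightarrow> enc a < card Ad" using enc by (auto simp: bij_betw_def)

lemma inj_enc_cell: "inj_on enc_cell valid"
proof (rule inj_onI)
  fix c c' assume "c \<in> valid" "c' \<in> valid" "enc_cell c = enc_cell c'"
  thus "c = c'"
    by (cases c; cases c') (auto simp: enc_cell_def valid_def dest: inj_onD[OF en(1)])
qed

lemma absmem_rep: "rep s C \<Longrightarrow> a \<in> Ad \<Longrightarrow> absmem (s (enc a)) = C a"
proof -
  assume "rep s C" "a \<in> Ad"
  hence *: "C a \<subseteq> valid" "set (s (enc a)) = enc_cell ` C a" by (auto simp: rep_def)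
  show ?thesis unfolding absmem_def *(2)
    using *(1) inj_enc_cell by (auto dest: inj_onD)
qed

definition "draw r = Pi_pmf {..<card Ad} (0::nat) (\<lambda>_. pmf_of_set {..<rnd r})"

definition "sent r f s = (\<lambda>i. if i \<in> {..<card Ad} then ([], outbox r (f i) i (s i)) else ([], []))"

text \<open>The machines draw independently, so the randomness of a round can be moved to its front:
  the round is a deterministic function of the vector \<open>f\<close> of drawn numbers.\<close>

lemma mpc_round_machine:
  "mpc_round machine r s = map_pmf
     (\<lambda>f. if (\<forall>i < card Ad. local_step_ok machine (s i) (sent r f s i)) \<and>
             (\<forall>j < card Ad. num_words (deliver machine (sent r f s) j) \<le> CARD('d) * cap)
          then Some (deliver machine (sent r f s)) else None) (draw r)"
proof -
  have "Pi_pmf {..<card Ad} ([], []) (\<lambda>i. mpc_step machine r i (s i))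
      = Pi_pmf {..<card Ad} ([], []) (\<lambda>i. bind_pmf (pmf_of_set {..<rnd r})
           (\<lambda>x. return_pmf ([], outbox r x i (s i))))"
    by (simp add: map_pmf_def)
  also have "\<dots> = map_pmf (\<lambda>f. sent r f s) (draw r)"
    unfolding draw_def by (subst Pi_pmf_bind[where d' = 0]) (auto simp: map_pmf_def sent_def)
  finally show ?thesis
    unfolding mpc_round_def by (simp add: map_pmf_comp)
qed

lemma card_pairs:
  assumes "finite I" "\<And>i. i \<in> I \<Longrightarrow> finite (M i)"
  shows "card {(i, c). i \<in> I \<and> c \<in> M i} = (\<Sum>i\<in>I. card (M i))"
proof -
  have "{(i, c). i \<in> I \<and> c \<in> M i} = Sigma I M" by auto
  thus ?thesis using assms by (simp add: card_SigmaI)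
qed

text \<open>A round on sets is simulated by a round on lists. Outboxes are lists without repetition
  and the encoding is injective on valid cells, so list lengths are the cardinalities bounded by
  \<open>step_ok\<close>.\<close>

lemma round_step:
  assumes rep: "rep s C" and ok: "step_ok r x C" and x: "\<And>a. a \<in> Ad \<Longrightarrow> x a = f (enc a)"
  defines "y \<equiv> sent r f s"
  shows "\<forall>i < card Ad. local_step_ok machine (s i) (y i)"
    and "\<forall>j < card Ad. num_words (deliver machine y j) \<le> CARD('d) * cap"
    and "rep (deliver machine y) (succ_conf r x C)"
proof -
  define M where "M = (\<lambda>a j. msg r (x a) a j (C a))"
  define O' where "O' = (\<lambda>a. {(j, c). j \<in> Ad \<and> c \<in> M a j})"
  have Mval: "M a j \<subseteq> C a \<inter> range Inl \<union> Inr ` Items" if "a \<in> Ad" "j \<in> Ad" for a j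
    using ok that by (auto simp: step_ok_def M_def)
  have Cval: "C a \<subseteq> valid" if "a \<in> Ad" for a using rep that by (auto simp: rep_def)
  have Mv: "M a j \<subseteq> valid" if "a \<in> Ad" "j \<in> Ad" for a j
    using Mval[OF that] by (auto simp: valid_def)
  have finO: "finite (O' a)" if "a \<in> Ad" for a using ok that by (auto simp: step_ok_def O'_def M_def)
  have finM: "finite (M a j)" if "a \<in> Ad" "j \<in> Ad" for a j
  proof -
    have "M a j \<subseteq> snd ` O' a" using that by (force simp: O'_def)
    thus ?thesis using finO[OF that(1)] finite_surj by blast
  qed
  have out: "snd (y (enc a)) = set_list ((\<lambda>(j, c). (enc j, enc_cell c)) ` O' a)" if "a \<in> Ad" for a
  proof -
    have "inv_into Ad enc (enc a) = a" using inj_enc that by simp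
    hence "snd (y (enc a)) = set_list {(enc j, enc_cell c) |j c. j \<in> Ad \<and> c \<in> M a j}"
      using that x[OF that] enc_less[OF that] absmem_rep[OF rep that]
      by (simp add: y_def sent_def outbox_def M_def)
    also have "{(enc j, enc_cell c) |j c. j \<in> Ad \<and> c \<in> M a j} = (\<lambda>(j, c). (enc j, enc_cell c)) ` O' a"
      by (auto simp: O'_def)
    finally show ?thesis .
  qed
  have set_out: "set (snd (y (enc a))) = (\<lambda>(j, c). (enc j, enc_cell c)) ` O' a" if "a \<in> Ad" for a
    using out[OF that] finO[OF that] by (simp add: set_list)
  have keep: "fst (y i) = []" for i by (simp add: y_def sent_def)
  have ex: "\<exists>a\<in>Ad. i = enc a" if "i < card Ad" for i
  proof -
    have "i \<in> enc ` Ad" using enc that by (simp add: bij_betw_def)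
    thus ?thesis by blast
  qed
  have mem: "set (s (enc a)) = enc_cell ` C a" if "a \<in> Ad" for a using rep that by (auto simp: rep_def)
  show "\<forall>i < card Ad. local_step_ok machine (s i) (y i)"
  proof (intro allI impI)
    fix i assume "i < card Ad"
    then obtain a where a: "a \<in> Ad" "i = enc a" using ex by blast
    define os where "os = snd (y i)"
    have yi: "y i = ([], os)" using keep[of i] by (simp add: os_def prod_eq_iff)
    have os: "set os = (\<lambda>(j, c). (enc j, enc_cell c)) ` O' a" using set_out a by (simp add: os_def)
    have "length os \<le> card (O' a)"
      using out[OF a(1)] a finO[OF a(1)] by (simp add: os_def length_set_list card_image_le)
    also have "\<dots> \<le> cap" using ok a by (auto simp: step_ok_def O'_def M_def)
    finally have "length os \<le> cap" .
    hence "num_words (map snd os) \<le> CARD('d) * cap"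
      by (intro order_trans[OF num_words_le]) simp
    moreover have "cell_allowed machine (s i) z" if z: "z \<in> snd ` set os" for z
    proof -
      from z obtain j c where jc: "j \<in> Ad" "c \<in> M a j" "z = enc_cell c"
        unfolding os by (auto simp: O'_def)
      show ?thesis
      proof (cases c)
        case (Inl p)
        hence "c \<in> C a" using Mval[OF a(1) jc(1)] jc(2) by auto
        hence "enc_cell c \<in> set (s i)" using mem[OF a(1)] a(2) by simp
        thus ?thesis using jc(3) Inl by (simp add: enc_cell_def)
      next
        case (Inr g)
        hence "g \<in> Items" using Mval[OF a(1) jc(1)] jc(2) by auto
        thus ?thesis using jc(3) Inr en(2) by (simp add: enc_cell_def)
      qed
    qed
    moreover have "\<forall>i\<in>fst ` set os. i < card Ad"
      unfolding os using enc_less by (auto simp: O'_def)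
    ultimately show "local_step_ok machine (s i) (y i)"
      unfolding yi by (auto simp: num_words_def)
  qed
  have del: "deliver machine y (enc j) =
      concat (map (\<lambda>i. map snd (filter (\<lambda>m. fst m = enc j) (snd (y i)))) [0..<card Ad])"
    if "j \<in> Ad" for j using enc_less[OF that] keep by (simp add: deliver_def)
  have setfil: "set (filter (\<lambda>m. fst m = enc j) (snd (y (enc a)))) = (\<lambda>c. (enc j, enc_cell c)) ` M a j"
    if "j \<in> Ad" "a \<in> Ad" for a j
    using that inj_enc by (auto simp: set_out O'_def inj_on_eq_iff image_iff)
  show "\<forall>j < card Ad. num_words (deliver machine y j) \<le> CARD('d) * cap"
  proof (intro allI impI)
    fix j' assume "j' < card Ad"
    then obtain j where j: "j \<in> Ad" "j' = enc j" using ex by blast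
    have len: "length (filter (\<lambda>m. fst m = enc j) (snd (y (enc a)))) = card (M a j)" if "a \<in> Ad" for a
    proof -
      have "distinct (filter (\<lambda>m. fst m = enc j) (snd (y (enc a))))"
        using out[OF that] finO[OF that] by (simp add: set_list)
      hence "length (filter (\<lambda>m. fst m = enc j) (snd (y (enc a))))
          = card ((\<lambda>c. (enc j, enc_cell c)) ` M a j)"
        using setfil[OF j(1) that] distinct_card by metis
      also have "\<dots> = card (M a j)"
        using inj_enc_cell Mv[OF that j(1)] by (intro card_image) (auto simp: inj_on_def)
      finally show ?thesis .
    qed
    have "length (deliver machine y j') = (\<Sum>i<card Ad. length (filter (\<lambda>m. fst m = enc j) (snd (y i))))"
      unfolding j(2) del[OF j(1)]
      by (simp add: length_concat sum_list_sum_nth atLeast0LessThan o_def)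
    also have "\<dots> = (\<Sum>a\<in>Ad. length (filter (\<lambda>m. fst m = enc j) (snd (y (enc a)))))"
      using enc by (intro sum.reindex_bij_betw[symmetric])
    also have "\<dots> = (\<Sum>a\<in>Ad. card (M a j))" using len by (intro sum.cong) auto
    also have "\<dots> = card {(a, c). a \<in> Ad \<and> c \<in> M a j}"
      using finAd finM[OF _ j(1)] by (intro card_pairs[symmetric])
    also have "\<dots> \<le> cap" using ok j(1) by (auto simp: step_ok_def M_def)
    finally show "num_words (deliver machine y j') \<le> CARD('d) * cap"
      by (intro order_trans[OF num_words_le] mult_le_mono2)
  qed
  show "rep (deliver machine y) (succ_conf r x C)"
    unfolding rep_def
  proof (intro ballI conjI)
    fix j assume j: "j \<in> Ad"
    show "succ_conf r x C j \<subseteq> valid" using Mv[OF _ j] by (auto simp: succ_conf_def M_def)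
    have "set (deliver machine y (enc j)) =
        (\<Union>i\<in>{..<card Ad}. snd ` set (filter (\<lambda>m. fst m = enc j) (snd (y i))))"
      unfolding del[OF j] by (auto simp: atLeast0LessThan)
    also have "{..<card Ad} = enc ` Ad" using enc by (simp add: bij_betw_def)
    also have "(\<Union>i\<in>enc ` Ad. snd ` set (filter (\<lambda>m. fst m = enc j) (snd (y i))))
        = (\<Union>a\<in>Ad. snd ` (\<lambda>c. (enc j, enc_cell c)) ` M a j)"
      using setfil[OF j] by (simp del: set_filter)
    also have "\<dots> = enc_cell ` succ_conf r x C j" by (auto simp: succ_conf_def M_def image_image image_UN)
    finally show "set (deliver machine y (enc j)) = enc_cell ` succ_conf r x C j" .
  qed
qed

text \<open>\<open>E\<close> is the event that the drawn numbers are favorable. Deterministic rounds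
  use \<open>E = UNIV\<close>; only two rounds need a proper event.\<close>

lemma prob_round:
  assumes rep: "rep s C"
    and "\<And>f. f \<in> E \<Longrightarrow> step_ok r (\<lambda>a. f (enc a)) C"
    and "\<And>f t. f \<in> E \<Longrightarrow> rep t (succ_conf r (\<lambda>a. f (enc a)) C) \<Longrightarrow> Q t"
    and "measure_pmf.prob (draw r) E \<ge> c"
  shows "measure_pmf.prob (mpc_round machine r s) {Some t |t. Q t} \<ge> c"
  unfolding mpc_round_machine
proof (rule prob_map_ge[OF assms(4)], goal_cases)
  case (1 f)
  note * = round_step[OF rep assms(2)[OF 1], of f]
  have "Q (deliver machine (sent r f s))" using * assms(3)[OF 1] by simp
  thus ?case using * by simp
qed

end

section \<open>Grid cells\<close>

definition cell :: "nat \<Rightarrow> real ^ 'd \<Rightarrow> 'd \<Rightarrow> int" where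
  "cell i p = (\<lambda>j. \<lfloor>p $ j / 2 ^ i\<rfloor>)"

text \<open>The radius 2 fits the analysis: points at distance at most \<open>2 * 2 ^ i\<close> lie
  in conflicting cells, while points in conflicting cells differ by at most \<open>3 * 2 ^ i\<close>
  in every coordinate.\<close>

definition conflict :: "('d \<Rightarrow> int) \<Rightarrow> ('d \<Rightarrow> int) \<Rightarrow> bool" where
  "conflict c c' \<longleftrightarrow> (\<forall>j. \<bar>c j - c' j\<bar> \<le> 2)"

text \<open>The vector of residues modulo 3, coded as a number so that colors can be processed in
  order. The modulus exceeds the conflict radius, hence distinct cells of one color never
  conflict.\<close>

definition color :: "('d::finite \<Rightarrow> int) \<Rightarrow> nat" where
  "color c = (SOME f. bij_betw f (UNIV \<rightarrow> {0..2::int}) {..<3 ^ CARD('d) :: nat}) (\<lambda>j. c j mod 3)"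

lemma card_funs: "finite A \<Longrightarrow> card ((UNIV :: 'd::finite set) \<rightarrow> A) = card A ^ CARD('d)"
  by (simp add: PiE_UNIV_domain[symmetric] card_PiE)

lemma finite_funs: "finite A \<Longrightarrow> finite ((UNIV :: 'd::finite set) \<rightarrow> A)"
  by (simp add: PiE_UNIV_domain[symmetric] finite_PiE)

lemma color_bij:
  "bij_betw (SOME f. bij_betw f ((UNIV :: 'd::finite set) \<rightarrow> {0..2::int}) {..<3 ^ CARD('d) :: nat})
     (UNIV \<rightarrow> {0..2::int}) {..<3 ^ CARD('d) :: nat}"
proof -
  have "\<exists>f. bij_betw f ((UNIV :: 'd set) \<rightarrow> {0..2::int}) {..<3 ^ CARD('d) :: nat}"
  proof (rule finite_same_card_bij)
    show "card ((UNIV :: 'd set) \<rightarrow> {0..2::int}) = card {..<3 ^ CARD('d) :: nat}"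
      by (subst card_funs) auto
  qed (auto intro: finite_funs)
  thus ?thesis by (rule someI_ex)
qed

lemma residues_in: "(\<lambda>j. c j mod 3) \<in> UNIV \<rightarrow> {0..2::int}" for c :: "'d \<Rightarrow> int"
proof
  fix j
  have "0 \<le> c j mod 3" "c j mod 3 < 3" by simp_all
  thus "c j mod 3 \<in> {0..2}" by simp
qed

lemma color_less: "color (c :: 'd::finite \<Rightarrow> int) < 3 ^ CARD('d)"
  using bij_betw_apply[OF color_bij residues_in[of c]] by (simp add: color_def)

lemma same_color_conflict:
  fixes c c' :: "'d::finite \<Rightarrow> int"
  assumes "color c = color c'" "conflict c c'"
  shows "c = c'"
proof
  fix j
  have "(\<lambda>j. c j mod 3) = (\<lambda>j. c' j mod 3)"
    using assms(1) color_bij residues_in unfolding color_def bij_betw_def by (auto dest!: inj_onD)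
  hence "c j mod 3 = c' j mod 3" by (rule fun_cong)
  moreover have "\<bar>c j - c' j\<bar> \<le> 2" using assms(2) by (simp add: conflict_def)
  ultimately show "c j = c' j" by presburger
qed

text \<open>Greedy independent set in the conflict graph, one color class after the other: whether a cell is
  chosen depends only on the occupied cells within a constant radius.\<close>

primrec greedy :: "('d::finite \<Rightarrow> int) set \<Rightarrow> nat \<Rightarrow> ('d \<Rightarrow> int) set" where
  "greedy Q 0 = {}"
| "greedy Q (Suc s) = greedy Q s \<union> {c \<in> Q. color c = s \<and> (\<forall>c'\<in>greedy Q s. \<not> conflict c c')}"

definition sel :: "('d::finite \<Rightarrow> int) set \<Rightarrow> ('d \<Rightarrow> int) set" where
  "sel Q = greedy Q (3 ^ CARD('d))"

definition box :: "('d \<Rightarrow> int) \<Rightarrow> nat \<Rightarrow> ('d \<Rightarrow> int) set" where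
  "box c r = {c'. \<forall>j. \<bar>c' j - c j\<bar> \<le> int r}"

lemma greedy_subset: "greedy Q s \<subseteq> Q"
  by (induction s) auto

lemma conflict_sym: "conflict c c' \<longleftrightarrow> conflict c' c"
  by (simp add: conflict_def abs_minus_commute)

lemma greedy_indep:
  "c \<in> greedy Q s \<Longrightarrow> c' \<in> greedy Q s \<Longrightarrow> conflict c c' \<Longrightarrow> c = c'"
proof (induction s)
  case (Suc s)
  show ?case
  proof (cases "c \<in> greedy Q s"; cases "c' \<in> greedy Q s")
    assume "c \<notin> greedy Q s" "c' \<notin> greedy Q s"
    hence "color c = color c'" using Suc.prems by auto
    thus ?thesis using same_color_conflict Suc.prems(3) by blast
  qed (use Suc in \<open>auto simp: conflict_sym\<close>)
qed simp

lemma greedy_maximal: "c \<in> Q \<Longrightarrow> color c < s \<Longrightarrow> \<exists>c'\<in>greedy Q s. conflict c c'"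
proof (induction s)
  case (Suc s)
  show ?case
  proof (cases "color c < s \<or> (\<exists>c'\<in>greedy Q s. conflict c c')")
    case True
    thus ?thesis using Suc by auto
  next
    case False
    hence "c \<in> greedy Q (Suc s)" using Suc.prems by auto
    thus ?thesis by (auto simp: conflict_def intro!: bexI[of _ c])
  qed
qed simp

text \<open>Adding one color class looks one conflict step further, that is by 2 in each coordinate;
  therefore the cell is generalized in the induction.\<close>

lemma greedy_local:
  "Q \<inter> box c (2 * s) = Q' \<inter> box c (2 * s) \<Longrightarrow> c \<in> greedy Q s \<longleftrightarrow> c \<in> greedy Q' s"
proof (induction s arbitrary: c)
  case (Suc s)
  have c: "c \<in> box c (2 * Suc s)" by (simp add: box_def)
  have near: "c' \<in> greedy Q s \<longleftrightarrow> c' \<in> greedy Q' s" if "conflict c c'" for c'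
  proof (rule Suc.IH)
    have "box c' (2 * s) \<subseteq> box c (2 * Suc s)"
    proof
      fix x assume "x \<in> box c' (2 * s)"
      have "\<bar>x j - c j\<bar> \<le> int (2 * Suc s)" for j
      proof -
        have "\<bar>x j - c' j\<bar> \<le> int (2 * s)" "\<bar>c j - c' j\<bar> \<le> 2"
          using that \<open>x \<in> box c' (2 * s)\<close> by (auto simp: box_def conflict_def)
        moreover have "int (2 * Suc s) = int (2 * s) + 2" by simp
        ultimately show ?thesis by linarith
      qed
      thus "x \<in> box c (2 * Suc s)" by (simp add: box_def)
    qed
    thus "Q \<inter> box c' (2 * s) = Q' \<inter> box c' (2 * s)" using Suc.prems by blast
  qed
  have "conflict c c" by (simp add: conflict_def)
  hence "c \<in> greedy Q s \<longleftrightarrow> c \<in> greedy Q' s" by (rule near)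
  moreover have "c \<in> Q \<longleftrightarrow> c \<in> Q'" using c Suc.prems by blast
  moreover have "(\<forall>c'\<in>greedy Q s. \<not> conflict c c') \<longleftrightarrow> (\<forall>c'\<in>greedy Q' s. \<not> conflict c c')"
    using near by blast
  ultimately show ?case by simp
qed simp

lemma sel_subset: "sel Q \<subseteq> Q" by (simp add: sel_def greedy_subset)

lemma sel_indep: "c \<in> sel Q \<Longrightarrow> c' \<in> sel Q \<Longrightarrow> conflict c c' \<Longrightarrow> c = c'"
  unfolding sel_def by (rule greedy_indep)

lemma sel_maximal: "c \<in> Q \<Longrightarrow> \<exists>c'\<in>sel Q. conflict c c'"
  unfolding sel_def by (intro greedy_maximal color_less)

lemma sel_local:
  fixes Q :: "('d::finite \<Rightarrow> int) set"
  assumes "Q \<inter> box c (2 * 3 ^ CARD('d)) = Q' \<inter> box c (2 * 3 ^ CARD('d))"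
  shows "c \<in> sel Q \<longleftrightarrow> c \<in> sel Q'"
  unfolding sel_def by (rule greedy_local[OF assms])

section \<open>Cells and Euclidean distances\<close>

text \<open>Rounding down moves both coordinates in the same direction by less than one cell, so the
  two errors differ by less than one cell.\<close>

lemma cell_diff:
  "\<bar>of_int (cell i p j - cell i q j) * 2 ^ i - (p $ j - q $ j)\<bar> < (2 ^ i :: real)"
proof -
  let ?x = "p $ j / 2 ^ i" and ?y = "q $ j / 2 ^ i"
  have "\<bar>of_int (\<lfloor>?x\<rfloor> - \<lfloor>?y\<rfloor>) - (?x - ?y)\<bar> < (1::real)"
    by linarith
  hence "\<bar>of_int (\<lfloor>?x\<rfloor> - \<lfloor>?y\<rfloor>) - (?x - ?y)\<bar> * 2 ^ i < 1 * (2 ^ i :: real)"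
    by (intro mult_strict_right_mono) auto
  moreover have "\<bar>of_int (\<lfloor>?x\<rfloor> - \<lfloor>?y\<rfloor>) - (?x - ?y)\<bar> * 2 ^ i
      = \<bar>(of_int (\<lfloor>?x\<rfloor> - \<lfloor>?y\<rfloor>) - (?x - ?y)) * 2 ^ i\<bar>" by (simp add: abs_mult)
  moreover have "(of_int (\<lfloor>?x\<rfloor> - \<lfloor>?y\<rfloor>) - (?x - ?y)) * 2 ^ i
      = of_int (cell i p j - cell i q j) * 2 ^ i - (p $ j - q $ j)"
    by (simp add: cell_def left_diff_distrib)
  ultimately show ?thesis by (metis mult_1)
qed

lemma dist_le_of_conflict:
  fixes p q :: "real ^ 'd::finite"
  assumes "conflict (cell i p) (cell i q)"
  shows "dist p q \<le> 3 * real CARD('d) * 2 ^ i"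
proof -
  have "\<bar>(p - q) $ j\<bar> \<le> 3 * 2 ^ i" for j
  proof -
    have "\<bar>cell i p j - cell i q j\<bar> \<le> 2" using assms by (simp add: conflict_def)
    hence "\<bar>of_int (cell i p j - cell i q j)\<bar> * 2 ^ i \<le> 2 * (2 ^ i :: real)"
      by (intro mult_right_mono) auto
    hence "\<bar>of_int (cell i p j - cell i q j) * 2 ^ i\<bar> \<le> 2 * (2 ^ i :: real)"
      by (simp add: abs_mult)
    thus ?thesis using cell_diff[of i p j q] by (simp only: vector_minus_component)
  qed
  hence "norm (p - q) \<le> (\<Sum>j\<in>(UNIV :: 'd set). 3 * 2 ^ i)"
    by (intro order_trans[OF norm_le_l1_cart] sum_mono)
  thus ?thesis by (simp add: dist_norm mult_ac)
qed

lemma dist_gt_of_not_conflict: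
  assumes "\<not> conflict (cell i p) (cell i q)"
  shows "dist p q > 2 * 2 ^ i"
proof -
  obtain j where "\<not> \<bar>cell i p j - cell i q j\<bar> \<le> 2"
    using assms unfolding conflict_def by blast
  hence "\<bar>cell i p j - cell i q j\<bar> \<ge> 3" by linarith
  hence "\<bar>of_int (cell i p j - cell i q j)\<bar> * 2 ^ i \<ge> 3 * (2 ^ i :: real)"
    by (intro mult_right_mono) (use \<open>\<bar>cell i p j - cell i q j\<bar> \<ge> 3\<close> in linarith, simp)
  hence "\<bar>of_int (cell i p j - cell i q j) * 2 ^ i\<bar> \<ge> 3 * (2 ^ i :: real)" by (simp add: abs_mult)
  hence "\<bar>p $ j - q $ j\<bar> > 2 * 2 ^ i" using cell_diff[of i p j q] by linarith
  also have "\<bar>p $ j - q $ j\<bar> \<le> dist p q"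
    using component_le_norm_cart[of "p - q" j] by (simp add: dist_norm)
  finally show ?thesis .
qed

text \<open>The bound is independent of the scale because \<open>2 ^ i \<ge> 1\<close>. It makes the
  cells of input points recognizable from residues modulo one fixed power of two.\<close>

lemma cell_close:
  assumes "dist p q \<le> 2 ^ L"
  shows "\<bar>cell i p j - cell i q j\<bar> \<le> 2 ^ L + 1"
proof -
  let ?D = "\<bar>of_int (cell i p j - cell i q j)\<bar> :: real"
  have "\<bar>p $ j - q $ j\<bar> \<le> 2 ^ L"
    using component_le_norm_cart[of "p - q" j] assms by (simp add: dist_norm)
  hence "\<bar>of_int (cell i p j - cell i q j) * 2 ^ i\<bar> \<le> 2 ^ L + (2 ^ i :: real)"
    using cell_diff[of i p j q] by linarith
  hence "?D * 2 ^ i \<le> 2 ^ L + (2 ^ i :: real)" by (simp add: abs_mult)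
  also have "\<dots> \<le> 2 ^ L * 2 ^ i + 2 ^ i" by simp
  also have "\<dots> = (2 ^ L + 1) * (2 ^ i :: real)" by (simp add: algebra_simps)
  finally have "?D \<le> 2 ^ L + 1" by (simp add: mult_le_cancel_right)
  hence "of_int \<bar>cell i p j - cell i q j\<bar> \<le> (of_int (2 ^ L + 1) :: real)" by simp
  thus ?thesis by (simp only: of_int_le_iff)
qed

section \<open>The clustering cost\<close>

lemma infdist_attained:
  assumes "finite S" "S \<noteq> {}"
  obtains q where "q \<in> S" "infdist p S = dist p q"
proof -
  have "infdist p S = Min (dist p ` S)"
    using assms by (simp add: infdist_def cInf_eq_Min)
  moreover have "Min (dist p ` S) \<in> dist p ` S" using assms by (intro Min_in) auto
  ultimately show ?thesis using that by auto
qed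

lemma infdist_le_cost: "finite P \<Longrightarrow> p \<in> P \<Longrightarrow> infdist p S \<le> kcenter_cost P S"
  unfolding kcenter_cost_def by (intro Max_ge) auto

lemma card_sel_le:
  fixes P S :: "(real ^ 'd::finite) set"
  assumes fin: "finite P" and S: "S \<subseteq> P" "S \<noteq> {}" and cost: "kcenter_cost P S \<le> 2 ^ i"
  shows "card (sel (cell i ` P)) \<le> card S"
proof -
  have finS: "finite S" using S fin finite_subset by blast
  have "\<exists>p q. p \<in> P \<and> cell i p = c \<and> q \<in> S \<and> dist p q \<le> 2 ^ i" if c: "c \<in> sel (cell i ` P)" for c
  proof -
    obtain p where p: "p \<in> P" "cell i p = c" using subsetD[OF sel_subset c] by auto
    obtain q where "q \<in> S" "infdist p S = dist p q" using infdist_attained[OF finS S(2)] by metis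
    moreover have "infdist p S \<le> 2 ^ i" using infdist_le_cost[OF fin p(1), of S] cost by simp
    ultimately show ?thesis using p by metis
  qed
  then obtain f g where fg: "\<And>c. c \<in> sel (cell i ` P) \<Longrightarrow>
      f c \<in> P \<and> cell i (f c) = c \<and> g c \<in> S \<and> dist (f c) (g c) \<le> 2 ^ i" by metis
  have "inj_on g (sel (cell i ` P))"
  proof (rule inj_onI)
    fix c c' assume c: "c \<in> sel (cell i ` P)" "c' \<in> sel (cell i ` P)" "g c = g c'"
    have "dist (f c) (f c') \<le> dist (f c) (g c) + dist (f c') (g c)" by (rule dist_triangle2)
    also have "\<dots> \<le> 2 * 2 ^ i" using fg[OF c(1)] fg[OF c(2)] c(3) by simp
    finally have "conflict (cell i (f c)) (cell i (f c'))"
      using dist_gt_of_not_conflict[of i "f c" "f c'"] by linarith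
    thus "c = c'" using fg[OF c(1)] fg[OF c(2)] sel_indep[OF c(1,2)] by simp
  qed
  moreover have "g ` sel (cell i ` P) \<subseteq> S" using fg by blast
  ultimately show ?thesis using finS card_inj_on_le by blast
qed

lemma cost_of_representatives:
  fixes P T :: "(real ^ 'd::finite) set"
  assumes fin: "finite P" "P \<noteq> {}" and T: "T \<subseteq> P" "sel (cell i ` P) \<subseteq> cell i ` T"
  shows "T \<noteq> {}" "kcenter_cost P T \<le> 3 * real CARD('d) * 2 ^ i"
proof -
  have "\<exists>q\<in>T. dist p q \<le> 3 * real CARD('d) * 2 ^ i" if pP: "p \<in> P" for p
  proof -
    obtain c where "c \<in> sel (cell i ` P)" "conflict (cell i p) c"
      using sel_maximal[OF imageI[OF pP]] by auto
    then obtain q where "q \<in> T" "c = cell i q" using T(2) by auto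
    thus ?thesis using \<open>conflict (cell i p) c\<close> dist_le_of_conflict by auto
  qed note * = this
  thus ne: "T \<noteq> {}" using fin(2) by blast
  show "kcenter_cost P T \<le> 3 * real CARD('d) * 2 ^ i"
    unfolding kcenter_cost_def
  proof (rule Max.boundedI)
    fix x assume "x \<in> (\<lambda>p. infdist p T) ` P"
    then obtain p where p: "p \<in> P" "x = infdist p T" by blast
    obtain q where "q \<in> T" "dist p q \<le> 3 * real CARD('d) * 2 ^ i" using * p by blast
    thus "x \<le> 3 * real CARD('d) * 2 ^ i" using infdist_le[of q T p] p by simp
  qed (use fin in auto)
qed

text \<open>The optimum is a maximum of minima over finite sets, hence a distance of two points, and
  it is positive because \<open>k < card P\<close> leaves a point outside \<open>S\<close>. So it
  suffices to try scales of distances that occur in \<open>P\<close>.\<close>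

lemma kcenter_opt_attained:
  assumes fin: "finite P" and k: "0 < k" "k < card P"
  obtains S p q where "S \<subseteq> P" "card S = k" "kcenter_cost P S = kcenter_opt P k"
    "p \<in> P" "q \<in> P" "p \<noteq> q" "kcenter_opt P k = dist p q"
proof -
  let ?SS = "{S. S \<subseteq> P \<and> card S = k}"
  have "finite ?SS" using fin by simp
  moreover have "?SS \<noteq> {}" using obtain_subset_with_card_n[of k P] k by fastforce
  ultimately have "kcenter_opt P k \<in> kcenter_cost P ` ?SS"
    unfolding kcenter_opt_def by (intro Min_in) auto
  then obtain S where S: "S \<subseteq> P" "card S = k" "kcenter_opt P k = kcenter_cost P S" by blast
  have finS: "finite S" using S fin finite_subset by blast
  have neS: "S \<noteq> {}" using S k by auto
  have neP: "P \<noteq> {}" using k by auto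
  have "kcenter_cost P S \<in> (\<lambda>p. infdist p S) ` P"
    unfolding kcenter_cost_def using fin neP by (intro Max_in) auto
  then obtain p where p: "p \<in> P" "kcenter_cost P S = infdist p S" by blast
  obtain q where q: "q \<in> S" "infdist p S = dist p q" using infdist_attained[OF finS neS] by metis
  have "p \<noteq> q"
  proof
    assume "p = q"
    have "S \<noteq> P" using S k by auto
    then obtain x where x: "x \<in> P" "x \<notin> S" using S by blast
    obtain y where y: "y \<in> S" "infdist x S = dist x y" using infdist_attained[OF finS neS] by metis
    have "dist x y \<le> 0" using infdist_le_cost[OF fin x(1), of S] y p(2) q(2) \<open>p = q\<close> by simp
    thus False using x y by auto
  qed
  thus ?thesis using that[of S p q] S p q by auto
qed

lemma min_pairwise_dist_le:
  assumes "finite P" "p \<in> P" "q \<in> P" "p \<noteq> q"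
  shows "min_pairwise_dist P \<le> dist p q"
proof -
  have "{dist p q | p q. p \<in> P \<and> q \<in> P \<and> p \<noteq> q} \<subseteq> (\<lambda>(p, q). dist p q) ` (P \<times> P)" by auto
  hence "finite {dist p q | p q. p \<in> P \<and> q \<in> P \<and> p \<noteq> q}"
    by (rule finite_subset) (use assms(1) in simp)
  thus ?thesis unfolding min_pairwise_dist_def using assms by (intro Min_le) auto
qed

text \<open>A grid of width \<open>1 / (2 * d)\<close> separates points at distance 1, and relative
  to one point a set of diameter 2 meets at most \<open>2 * (4 * d + 1) + 1\<close> indices per
  coordinate. Thus large instances have diameter above 2, which keeps the logarithm of the diameter
  away from 0.\<close>

lemma packing_bound:
  fixes P :: "(real ^ 'd::finite) set"
  assumes fin: "finite P" and sep: "\<And>p q. p \<in> P \<Longrightarrow> q \<in> P \<Longrightarrow> p \<noteq> q \<Longrightarrow> dist p q \<ge> 1"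
    and diam: "diameter P \<le> 2"
  shows "card P \<le> (8 * CARD('d) + 3) ^ CARD('d)"
proof (cases "P = {}")
  case False
  then obtain p0 where p0: "p0 \<in> P" by blast
  let ?d = "CARD('d)"
  define f where "f = (\<lambda>p :: real ^ 'd. \<lambda>j. \<lfloor>2 * real ?d * p $ j\<rfloor>)"
  have dpos: "real ?d > 0" by simp
  have scale: "\<bar>2 * real ?d * a - 2 * real ?d * b\<bar> = 2 * real ?d * \<bar>a - b\<bar>" for a b
    by (simp add: right_diff_distrib[symmetric] abs_mult)
  have img: "(\<lambda>j. f p j - f p0 j) \<in> UNIV \<rightarrow> {- (4 * int ?d + 1)..4 * int ?d + 1}" if "p \<in> P" for p
  proof
    fix j
    have "\<bar>p $ j - p0 $ j\<bar> \<le> dist p p0"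
      using component_le_norm_cart[of "p - p0" j] by (simp add: dist_norm)
    also have "\<dots> \<le> 2"
      using diameter_bounded_bound[OF finite_imp_bounded[OF fin] that p0] diam by simp
    finally have "2 * real ?d * \<bar>p $ j - p0 $ j\<bar> \<le> 2 * real ?d * 2" by (intro mult_left_mono) auto
    hence "\<bar>2 * real ?d * p $ j - 2 * real ?d * p0 $ j\<bar> \<le> 2 * real ?d * 2"
      by (simp only: scale)
    hence "\<bar>f p j - f p0 j\<bar> \<le> 4 * int ?d + 1" unfolding f_def by linarith
    thus "f p j - f p0 j \<in> {- (4 * int ?d + 1)..4 * int ?d + 1}" by auto
  qed
  have inj: "inj_on (\<lambda>p j. f p j - f p0 j) P"
  proof (rule inj_onI, rule ccontr)
    fix p q assume pq: "p \<in> P" "q \<in> P" "(\<lambda>j. f p j - f p0 j) = (\<lambda>j. f q j - f p0 j)" "p \<noteq> q"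
    have "\<bar>(p - q) $ j\<bar> \<le> 1 / (2 * real ?d)" for j
    proof -
      have "f p j = f q j" using fun_cong[OF pq(3), of j] by simp
      hence "\<bar>2 * real ?d * p $ j - 2 * real ?d * q $ j\<bar> \<le> 1" unfolding f_def by linarith
      hence "2 * real ?d * \<bar>p $ j - q $ j\<bar> \<le> 1"
        by (simp only: scale)
      thus ?thesis using dpos by (simp add: field_simps)
    qed
    hence "norm (p - q) \<le> (\<Sum>j\<in>(UNIV :: 'd set). 1 / (2 * real ?d))"
      by (intro order_trans[OF norm_le_l1_cart] sum_mono)
    also have "\<dots> = 1 / 2" by simp
    finally have "dist p q \<le> 1 / 2" by (simp add: dist_norm)
    thus False using sep[OF pq(1,2,4)] by simp
  qed
  have "card P \<le> card ((UNIV :: 'd set) \<rightarrow> {- (4 * int ?d + 1)..4 * int ?d + 1})"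
    using img by (intro card_inj_on_le[OF inj]) (auto intro: finite_funs)
  also have "\<dots> = (8 * ?d + 3) ^ ?d" by (subst card_funs) (auto simp: nat_add_distrib nat_mult_distrib add.commute)
  finally show ?thesis .
qed simp

section \<open>The algorithm\<close>

datatype addr = V nat nat | J nat nat | K nat | H nat | Idle nat

text \<open>\<open>Seed\<close> is the index of the hash function and \<open>Cand\<close> the scale
  of a block. \<open>Up xs v fr\<close> reports a node by the hash values on its path to the root,
  its minimum, and the address to which the answer returns; \<open>Down c r\<close> is the answer
  for the node with hash value \<open>c\<close>. \<open>Cnt\<close> is a partial count labelled by
  its subtree, \<open>Best\<close> an encoded valid scale, \<open>Win\<close> the mark of the chosen
  block.\<close>

datatype item = Seed nat | Cand nat | Up "nat list" nat addr | Down nat nat | Cnt nat nat | Best nat | Win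

text \<open>Level, prefix of a position in base \<open>B\<close>, number of the candidate scale, and
  cell modulo a power of two.\<close>

type_synonym 'd node = "nat \<times> nat \<times> nat \<times> ('d \<Rightarrow> int)"

type_synonym 'd mem = "((real ^ 'd) + item) set"

definition points :: "('p + 'i) set \<Rightarrow> 'p set" where
  "points A = {p. Inl p \<in> A}"

definition idx :: "'p set \<Rightarrow> 'p \<Rightarrow> nat" where
  "idx A = (SOME f. bij_betw f A {0..<card A})"

lemma idx_bij: "finite A \<Longrightarrow> bij_betw (idx A) A {0..<card A}"
  unfolding idx_def using someI_ex[OF ex_bij_betw_finite_nat] by fast

definition scale :: "'p::metric_space \<Rightarrow> 'p \<Rightarrow> nat" where
  "scale p q = nat \<lceil>log 2 (dist p q)\<rceil>"

text \<open>Roles of the machines: \<open>V\<close> receives the scattered input, \<open>J q w\<close> handles the point in slot \<open>w\<close> on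
  behalf of the candidate scale with number \<open>q\<close>, \<open>K q\<close> determines this scale from a pair of points (used
  only if there are more distance scales than pairs of slots), \<open>H\<close> are the hash buckets, and \<open>Idle\<close>
  only ensures that words are long enough for numbers up to the number of distance scales.\<close>

locale alg_params =
  fixes k L B m F :: nat and h :: "nat \<Rightarrow> 'd::finite node \<Rightarrow> nat"
begin

text \<open>A slot combines a row below \<open>B ^ (m + 2)\<close>, a column below
  \<open>B ^ 2\<close> and an index below \<open>B\<close>; hence \<open>B ^ (m + 5)\<close>
  slots.\<close>

definition "lv = m + 5"
text \<open>The exponent in \<open>B * ss \<le> B ^ t0\<close>: 1 for \<open>B\<close>,
  \<open>2 * lv\<close> for \<open>Q \<le> W * W\<close>, and \<open>m + 2\<close> for the rest of
  \<open>ss\<close>. It is the least load for which this estimate brings the union bound down to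
  \<open>1 / B\<close>.\<close>

definition "t0 = 3 * m + 13"
definition "W = B ^ lv"
text \<open>The cap \<open>W * W = B ^ (2 * lv)\<close> lets copying with fan-out \<open>B\<close>
  reach all blocks in \<open>2 * lv\<close> rounds, however large \<open>L\<close> is. It is also
  the number of ordered pairs of slots.\<close>

definition "Q = min (L + 1) (W * W)"
definition "big \<longleftrightarrow> W * W \<le> L + 1"
text \<open>\<open>B\<close> times as many buckets as \<open>ss\<close>, the bound on the number of
  nodes.\<close>

definition "Hr = Q * B ^ (m + 3)"
definition "ss = Q * B ^ (m + 2)"
definition "rad = (2 * 3 ^ CARD('d) :: nat)"
text \<open>\<open>2 ^ kb\<close> exceeds the difference of any two occupied cells even after a
  shift by \<open>rad\<close>, so cells may be compared modulo \<open>2 ^ kb\<close>.\<close>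

definition "kb = L + 1 + rad"
definition Off :: "('d \<Rightarrow> int) set" where "Off = UNIV \<rightarrow> {- int rad..int rad}"
definition "cap = B ^ 2"

definition Ad :: "addr set" where
  "Ad = (\<lambda>(b, l). V b l) ` ({..<B ^ (m + 2)} \<times> {..<B ^ 2}) \<union> (\<lambda>(q, w). J q w) ` ({..<Q} \<times> {..<W})
     \<union> K ` {..<Q} \<union> H ` {..<Hr} \<union> Idle ` {..<L + 1}"

text \<open>Coordinates of input points are unbounded; the reduction makes the set of conceivable
  nodes finite and independent of the input.\<close>

definition key :: "nat \<Rightarrow> real ^ 'd \<Rightarrow> ('d \<Rightarrow> int) \<Rightarrow> 'd \<Rightarrow> int" where
  "key i p z = (\<lambda>j. (cell i p j + z j) mod 2 ^ kb)"

definition anc :: "'d node \<Rightarrow> nat \<Rightarrow> 'd node" where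
  "anc = (\<lambda>(t, g, q, c) s. (t + s, g div B ^ s, q, c))"

text \<open>The whole path travels with a report because a bucket machine sees only hash values and
  cannot derive the parent of a node from them.\<close>

definition npath :: "nat \<Rightarrow> 'd node \<Rightarrow> nat list" where
  "npath a \<nu> = map (\<lambda>s. h a (anc \<nu> s)) [0..<Suc lv - fst \<nu>]"

definition slot :: "nat \<Rightarrow> nat \<Rightarrow> nat \<Rightarrow> nat" where
  "slot b l i = (b * B ^ 2 + l) * B + i"

text \<open>The drawn number selects a row of receivers, and the \<open>l\<close>-th point goes to
  column \<open>l\<close>. A receiver gets at most one point from each sender, so only the number of
  senders sharing a row has to be controlled.\<close>

definition msg_scatter :: "nat \<Rightarrow> addr \<Rightarrow> addr \<Rightarrow> 'd mem \<Rightarrow> 'd mem" where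
  "msg_scatter x a j A = (case j of
     V b l \<Rightarrow> if b = x then {Inl p |p. Inl p \<in> A \<and> idx (points A) p = l} else {} | _ \<Rightarrow> {})"

text \<open>Row, column and local index together form the slot, so distinct points get distinct
  slots of block 0. In the same round \<open>J 0 0\<close> draws the seed.\<close>

definition msg_split :: "nat \<Rightarrow> addr \<Rightarrow> addr \<Rightarrow> 'd mem \<Rightarrow> 'd mem" where
  "msg_split x a j A = (case (a, j) of
     (V b l, J q w) \<Rightarrow> if q = 0 then {Inl p |p. Inl p \<in> A \<and> slot b l (idx (points A) p) = w} else {}
   | (J q' w', J q w) \<Rightarrow> if q' = 0 \<and> w' = 0 \<and> q = 0 \<and> w = 0 then {Inr (Seed x)} else {}
   | _ \<Rightarrow> {})"

text \<open>Block 0 is its own child and every other block has a smaller parent, so after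
  \<open>t\<close> rounds the blocks below \<open>B ^ t\<close> are filled.\<close>

definition msg_copy :: "addr \<Rightarrow> addr \<Rightarrow> 'd mem \<Rightarrow> 'd mem" where
  "msg_copy a j A = (case (a, j) of (J q w, J q' w') \<Rightarrow> if w' = w \<and> q' div B = q then A else {} | _ \<Rightarrow> {})"

text \<open>The copy of slot \<open>w\<close> in block \<open>q\<close> serves the pair of slots
  \<open>q\<close> and \<open>w\<close> in both orders. No copy is sent to more than two pair
  machines, although each slot takes part in about \<open>2 * W\<close> pairs.\<close>

definition msg_pairs :: "addr \<Rightarrow> addr \<Rightarrow> 'd mem \<Rightarrow> 'd mem" where
  "msg_pairs a j A = (case (a, j) of
     (J q w, J q' w') \<Rightarrow> if w' = w \<and> q' = q then A else {}
   | (J q w, K z) \<Rightarrow> if big \<and> q < W \<and> (z = q * W + w \<or> z = w * W + q) then A \<inter> range Inl else {}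
   | _ \<Rightarrow> {})"

definition msg_cands :: "addr \<Rightarrow> addr \<Rightarrow> 'd mem \<Rightarrow> 'd mem" where
  "msg_cands a j A = (case (a, j) of
     (J q w, J q' w') \<Rightarrow> if w' = w \<and> q' = q then A \<union> (if \<not> big \<and> w = 0 then {Inr (Cand q)} else {}) else {}
   | (K z, J q w) \<Rightarrow> if q = z \<and> w = 0
       then {Inr (Cand (scale p p')) |p p'. Inl p \<in> A \<and> Inl p' \<in> A \<and> p \<noteq> p'} else {}
   | _ \<Rightarrow> {})"

definition msg_info :: "addr \<Rightarrow> addr \<Rightarrow> 'd mem \<Rightarrow> 'd mem" where
  "msg_info a j A = (case (a, j) of
     (J q w, J q' w') \<Rightarrow> (if q' = q \<and> w' = w then A \<inter> range Inl else {})
        \<union> (if q' = q \<and> w' div B = w then A \<inter> range Inr else {})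
   | _ \<Rightarrow> {})"

definition up_val :: "'d mem \<Rightarrow> nat list \<Rightarrow> nat" where
  "up_val A xs = Min {v. \<exists>c fr. Inr (Up (c # xs) v fr) \<in> A}"

text \<open>A point opens a leaf in the tree of every cell within the reach of the greedy rule. It
  reports its position only for its own cell; elsewhere it reports \<open>W\<close>, which stands
  for no point and merely requests the result. Memories keep the reports of all levels, so the
  length of the path tells which of them are due in round \<open>t\<close>.\<close>

definition msg_up :: "nat \<Rightarrow> addr \<Rightarrow> addr \<Rightarrow> 'd mem \<Rightarrow> 'd mem" where
  "msg_up t a j A = (case (a, j) of
     (J q w, J q' w') \<Rightarrow> if q' = q \<and> w' = w then A else {}
   | (J q w, H b) \<Rightarrow> if t = 0 then
       {Inr (Up (npath s (0, w, q, key i p z)) (if key i p z = key i p (\<lambda>_. 0) then w else W) a) |p s i z.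
          Inl p \<in> A \<and> Inr (Seed s) \<in> A \<and> Inr (Cand i) \<in> A \<and> z \<in> Off \<and>
          npath s (0, w, q, key i p z) ! 1 mod Hr = b} else {}
   | (H b', H b) \<Rightarrow> (if b' = b then A else {}) \<union>
       {Inr (Up (y # z # zs) (up_val A (y # z # zs)) a) |c y z zs v fr.
          Inr (Up (c # y # z # zs) v fr) \<in> A \<and> length zs + t + 1 = lv \<and> z mod Hr = b}
   | _ \<Rightarrow> {})"

text \<open>The stored reports are the routing tables for the way back: an answer for
  \<open>x\<close> goes to the origin of each report whose path continues with \<open>x\<close>. A
  path with two entries belongs to a child of the root, where the minimum is computed on the
  spot.\<close>

definition msg_down :: "addr \<Rightarrow> addr \<Rightarrow> 'd mem \<Rightarrow> 'd mem" where
  "msg_down a j A = (case a of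
     J q w \<Rightarrow> if j = a then A else {}
   | H b \<Rightarrow> (if j = a then A else {}) \<union>
       {Inr (Down c (up_val A [x])) |c x v. Inr (Up [c, x] v j) \<in> A} \<union>
       {Inr (Down c r) |c x zs v r. Inr (Up (c # x # zs) v j) \<in> A \<and> Inr (Down x r) \<in> A}
   | _ \<Rightarrow> {})"

text \<open>A point represents its cell if the tree of that cell returns its own position. Whether
  the cell is selected is decided locally from the surrounding cells with an answer below
  \<open>W\<close>, that is, the occupied ones.\<close>

definition flagged :: "nat \<Rightarrow> nat \<Rightarrow> 'd mem \<Rightarrow> (real ^ 'd) set" where
  "flagged q w A = {p. \<exists>s i. Inl p \<in> A \<and> Inr (Seed s) \<in> A \<and> Inr (Cand i) \<in> A \<and>
     Inr (Down (h s (0, w, q, key i p (\<lambda>_. 0))) w) \<in> A \<and>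
     cell i p \<in> sel {c. \<exists>z\<in>Off. c = (\<lambda>j. cell i p j + z j) \<and>
                       (\<exists>r<W. Inr (Down (h s (0, w, q, key i p z)) r) \<in> A)}}"

definition "cands = range (\<lambda>i. Inr (Cand i))"

definition msg_flag :: "addr \<Rightarrow> addr \<Rightarrow> 'd mem \<Rightarrow> 'd mem" where
  "msg_flag a j A = (case (a, j) of
     (J q w, J q' w') \<Rightarrow> (if q' = q \<and> w' = w then Inl ` flagged q w A \<union> A \<inter> cands else {})
       \<union> (if q' = q \<and> w' = w div B \<and> flagged q w A \<noteq> {} then {Inr (Cnt w 1)} else {})
   | _ \<Rightarrow> {})"

text \<open>The label \<open>g\<close> keeps equal counts of different children apart, which a
  memory, being a set, would merge.\<close>

definition total :: "'d mem \<Rightarrow> nat" where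
  "total A = (\<Sum>(g, c)\<in>{(g, c). Inr (Cnt g c) \<in> A}. c)"

definition msg_count :: "addr \<Rightarrow> addr \<Rightarrow> 'd mem \<Rightarrow> 'd mem" where
  "msg_count a j A = (case (a, j) of
     (J q w, J q' w') \<Rightarrow> (if q' = q \<and> w' = w then A \<inter> (range Inl \<union> cands) else {})
       \<union> (if q' = q \<and> w' = w div B \<and> (\<exists>g c. Inr (Cnt g c) \<in> A) then {Inr (Cnt w (total A))} else {})
   | _ \<Rightarrow> {})"

text \<open>\<open>i * Q + q\<close> orders candidates by scale first and returns the block as
  remainder modulo \<open>Q\<close>, so one minimum finds the smallest valid scale together with its
  block.\<close>

definition msg_valid :: "addr \<Rightarrow> addr \<Rightarrow> 'd mem \<Rightarrow> 'd mem" where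
  "msg_valid a j A = (case (a, j) of
     (J q w, J q' w') \<Rightarrow> (if q' = q \<and> w' = w then A \<inter> range Inl else {})
       \<union> (if w = 0 \<and> w' = 0 \<and> q' = q div B \<and> total A \<le> k
          then {Inr (Best (i * Q + q)) |i. Inr (Cand i) \<in> A} else {})
   | _ \<Rightarrow> {})"

definition msg_best :: "addr \<Rightarrow> addr \<Rightarrow> 'd mem \<Rightarrow> 'd mem" where
  "msg_best a j A = (case (a, j) of
     (J q w, J q' w') \<Rightarrow> (if q' = q \<and> w' = w then A \<inter> range Inl else {})
       \<union> (if w = 0 \<and> w' = 0 \<and> q' = q div B \<and> (\<exists>b. Inr (Best b) \<in> A)
          then {Inr (Best (Min {b. Inr (Best b) \<in> A}))} else {})
   | _ \<Rightarrow> {})"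

definition msg_announce :: "addr \<Rightarrow> addr \<Rightarrow> 'd mem \<Rightarrow> 'd mem" where
  "msg_announce a j A = (case (a, j) of
     (J q w, J q' w') \<Rightarrow> (if q' = q \<and> w' = w then A \<inter> range Inl else {})
       \<union> (if q = 0 \<and> w = 0 \<and> w' = 0 \<and> (\<exists>b. Inr (Best b) \<in> A \<and> q' = b mod Q) then {Inr Win} else {})
   | _ \<Rightarrow> {})"

definition msg_win :: "addr \<Rightarrow> addr \<Rightarrow> 'd mem \<Rightarrow> 'd mem" where
  "msg_win a j A = (case (a, j) of
     (J q w, J q' w') \<Rightarrow> (if q' = q \<and> w' = w then A \<inter> range Inl else {})
       \<union> (if q' = q \<and> w' div B = w \<and> Inr Win \<in> A then {Inr Win} else {})
   | _ \<Rightarrow> {})"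

definition msg_output :: "addr \<Rightarrow> addr \<Rightarrow> 'd mem \<Rightarrow> 'd mem" where
  "msg_output a j A = (case (a, j) of
     (J q w, J q' w') \<Rightarrow> (if q' = q \<and> w' = w \<and> Inr Win \<in> A then A \<inter> range Inl else {})
   | _ \<Rightarrow> {})"

text \<open>Starts of the phases. A tree over the \<open>B ^ lv\<close> slots of a block takes
  \<open>lv\<close> rounds, one over the at most \<open>B ^ (2 * lv)\<close> blocks takes
  \<open>2 * lv\<close>; the other summands are single rounds in between.\<close>

definition "T2 = 2 + 2 * lv"
definition "T3 = T2 + 2 + lv"
definition "T4 = T3 + lv"
definition "T5 = T4 + lv"
definition "T6 = T5 + 1 + lv"
definition "T7 = T6 + 1 + 2 * lv"
definition "T8 = T7 + 1 + lv"

definition msg :: "nat \<Rightarrow> nat \<Rightarrow> addr \<Rightarrow> addr \<Rightarrow> 'd mem \<Rightarrow> 'd mem" where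
  "msg r x = (if r = 0 then msg_scatter x else if r = 1 then msg_split x else if r < T2 then msg_copy
     else if r = T2 then msg_pairs else if r = T2 + 1 then msg_cands else if r < T3 then msg_info
     else if r < T4 then msg_up (r - T3) else if r < T5 then msg_down
     else if r = T5 then msg_flag else if r < T6 then msg_count
     else if r = T6 then msg_valid else if r < T7 then msg_best
     else if r = T7 then msg_announce else if r < T8 then msg_win else msg_output)"

definition Items :: "item set" where
  "Items = Seed ` {..<F} \<union> Cand ` {..L}
     \<union> (\<lambda>(xs, v, a). Up xs v a) ` ({xs. set xs \<subseteq> {..<Hr * ss} \<and> length xs \<le> Suc lv} \<times> {..W} \<times> Ad)
     \<union> (\<lambda>(c, r). Down c r) ` ({..<Hr * ss} \<times> {..W}) \<union> (\<lambda>(g, c). Cnt g c) ` ({..<W} \<times> {..W})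
     \<union> Best ` {..<(L + 1) * Q} \<union> {Win}"

definition "rnd r = (if r = 0 then B ^ (m + 2) else if r = 1 then F else (1::nat))"

definition "enc = (SOME f. bij_betw f Ad {..<card Ad})"
definition "en = (SOME f. bij_betw f Items {..<card Items})"
text \<open>Items are simply numbered, so bounding the word width amounts to bounding
  \<open>card Items\<close>.\<close>

definition "wd = nat \<lceil>log 2 (real (card Items))\<rceil>"

definition "program = set_mpc.machine Ad enc Items en cap wd (Suc T8) rnd msg"

lemma finite_Ad: "finite Ad" unfolding Ad_def by (intro finite_UnI finite_imageI) auto

lemma finite_Items: "finite Items"
  unfolding Items_def
  by (intro finite_UnI finite_imageI finite_cartesian_product finite_lists_length_le finite_Ad) auto

lemma Ad_simps [simp]:
  "V b l \<in> Ad \<longleftrightarrow> b < B ^ (m + 2) \<and> l < B ^ 2" "J q w \<in> Ad \<longleftrightarrow> q < Q \<and> w < W"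
  "K q \<in> Ad \<longleftrightarrow> q < Q" "H b \<in> Ad \<longleftrightarrow> b < Hr" "Idle i \<in> Ad \<longleftrightarrow> i < L + 1"
  by (auto simp: Ad_def)

lemma Items_simps [simp]:
  "Seed a \<in> Items \<longleftrightarrow> a < F" "Cand i \<in> Items \<longleftrightarrow> i \<le> L"
  "Up xs v fr \<in> Items \<longleftrightarrow> set xs \<subseteq> {..<Hr * ss} \<and> length xs \<le> Suc lv \<and> v \<le> W \<and> fr \<in> Ad"
  "Down c r \<in> Items \<longleftrightarrow> c < Hr * ss \<and> r \<le> W" "Cnt w c \<in> Items \<longleftrightarrow> w < W \<and> c \<le> W"
  "Best b \<in> Items \<longleftrightarrow> b < (L + 1) * Q" "Win \<in> Items"
  by (auto simp: Items_def image_iff Bex_def split_paired_Ex)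

lemma card_Items_pos: "card Items > 0"
  using finite_Items Items_simps(7) by (metis card_gt_0_iff empty_iff)

sublocale set_mpc_encoded Ad enc Items en cap wd "Suc T8" rnd msg
proof
  show "finite Ad" by (rule finite_Ad)
  have "\<exists>f. bij_betw f Ad {..<card Ad}"
    using ex_bij_betw_finite_nat[OF finite_Ad] by (simp add: atLeast0LessThan)
  thus "bij_betw enc Ad {..<card Ad}" unfolding enc_def by (rule someI_ex)
  have "\<exists>f. bij_betw f Items {..<card Items}"
    using ex_bij_betw_finite_nat[OF finite_Items] by (simp add: atLeast0LessThan)
  hence en: "bij_betw en Items {..<card Items}" unfolding en_def by (rule someI_ex)
  thus "inj_on en Items" by (simp add: bij_betw_def)
  have "real (card Items) = 2 powr log 2 (real (card Items))" using card_Items_pos by simp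
  also have "\<dots> \<le> 2 powr real wd" unfolding wd_def by (intro powr_mono) linarith+
  also have "\<dots> = real (2 ^ wd)" by (simp add: powr_realpow)
  finally have "card Items \<le> 2 ^ wd" by (simp only: of_nat_le_iff)
  thus "en f < 2 ^ wd" if "f \<in> Items" for f
    using bij_betw_apply[OF en that] by simp
qed

definition "round_ok r x C C' \<longleftrightarrow> step_ok r x C \<and> (\<forall>j\<in>Ad. succ_conf r x C j = C' j)"

lemma rep_cong: "rep t C \<Longrightarrow> (\<And>j. j \<in> Ad \<Longrightarrow> C j = C' j) \<Longrightarrow> rep t C'"
  by (simp add: rep_def)

lemma round_okI:
  assumes "\<And>a. a \<in> Ad \<Longrightarrow> \<exists>Z. {(j, c). j \<in> Ad \<and> c \<in> msg r (x a) a j (C a)} \<subseteq> Z \<and> finite Z \<and> card Z \<le> cap"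
    and "\<And>j. j \<in> Ad \<Longrightarrow> \<exists>Z. {(a, c). a \<in> Ad \<and> c \<in> msg r (x a) a j (C a)} \<subseteq> Z \<and> finite Z \<and> card Z \<le> cap"
    and "\<And>a j. a \<in> Ad \<Longrightarrow> j \<in> Ad \<Longrightarrow> msg r (x a) a j (C a) \<subseteq> C a \<inter> range Inl \<union> Inr ` Items"
    and "\<And>j. j \<in> Ad \<Longrightarrow> (\<Union>a\<in>Ad. msg r (x a) a j (C a)) = C' j"
  shows "round_ok r x C C'"
  unfolding round_ok_def step_ok_def succ_conf_def
proof (intro conjI ballI)
  fix a assume "a \<in> Ad"
  from assms(1)[OF this] obtain Z where "{(j, c). j \<in> Ad \<and> c \<in> msg r (x a) a j (C a)} \<subseteq> Z"
    "finite Z" "card Z \<le> cap" by blast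
  thus "finite {(j, c). j \<in> Ad \<and> c \<in> msg r (x a) a j (C a)}"
    "card {(j, c). j \<in> Ad \<and> c \<in> msg r (x a) a j (C a)} \<le> cap"
    using finite_subset card_mono order_trans by (blast, meson card_mono order_trans)
next
  fix j assume "j \<in> Ad"
  from assms(2)[OF this] obtain Z where "{(a, c). a \<in> Ad \<and> c \<in> msg r (x a) a j (C a)} \<subseteq> Z"
    "finite Z" "card Z \<le> cap" by blast
  thus "card {(a, c). a \<in> Ad \<and> c \<in> msg r (x a) a j (C a)} \<le> cap"
    by (meson card_mono order_trans)
qed (use assms(3,4) in auto)

end

section \<open>The deterministic rounds for fixed slots and a fixed seed\<close>

text \<open>The outcome of the random rounds enters as parameters: the slots \<open>pos\<close> of
  the points and the index \<open>a\<close> of the hash function.\<close>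

locale alg_run = alg_params k L B m F h
  for k L B m F :: nat and h :: "nat \<Rightarrow> 'd::finite node \<Rightarrow> nat" +
  fixes P :: "(real ^ 'd) set" and pos :: "real ^ 'd \<Rightarrow> nat" and a :: nat
  assumes finP: "finite P" and pos_inj: "inj_on pos P" and pos_less: "p \<in> P \<Longrightarrow> pos p < W"
    and aF: "a < F"
    and B_large: "8 * (t0 + 2) * (card Off + 6) \<le> B"
    and dist_ge: "p \<in> P \<Longrightarrow> q \<in> P \<Longrightarrow> p \<noteq> q \<Longrightarrow> 1 \<le> dist p q"
    and dist_le: "p \<in> P \<Longrightarrow> q \<in> P \<Longrightarrow> dist p q \<le> 2 ^ L"
begin

lemma finite_Off: "finite Off" unfolding Off_def by (intro finite_funs) auto

lemma zero_Off: "(\<lambda>_. 0) \<in> Off" by (auto simp: Off_def)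

lemma B_ge: "B \<ge> 96" "B \<ge> 8 * (t0 + 2)" "B \<ge> 16 * (card Off + 6)"
proof -
  have *: "c \<le> B" if "c \<le> 8 * (t0 + 2) * (card Off + 6)" for c using that B_large by linarith
  have "8 * 2 * 6 \<le> 8 * (t0 + 2) * (card Off + 6)" by (intro mult_le_mono) auto
  thus "B \<ge> 96" by (intro *) simp
  have "8 * (t0 + 2) * 1 \<le> 8 * (t0 + 2) * (card Off + 6)" by (intro mult_le_mono) auto
  thus "B \<ge> 8 * (t0 + 2)" by (intro *) simp
  have "8 * 2 * (card Off + 6) \<le> 8 * (t0 + 2) * (card Off + 6)" by (intro mult_le_mono) auto
  thus "B \<ge> 16 * (card Off + 6)" by (intro *) simp
qed

lemma B_pos: "B > 0" using B_ge(1) by simp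
lemma W_pos: "W > 0" using B_pos by (simp add: W_def)
lemma Q_pos: "Q > 0" using W_pos by (simp add: Q_def)
lemma Q_le: "Q \<le> W * W" "Q \<le> L + 1" by (simp_all add: Q_def)
lemma big_Q: "big \<Longrightarrow> Q = W * W" by (simp add: Q_def big_def)
lemma not_big_Q: "\<not> big \<Longrightarrow> Q = L + 1" by (simp add: Q_def big_def)
lemma W_le_Q: "big \<Longrightarrow> W \<le> Q" using big_Q W_pos by simp
lemma BB: "B ^ (2 * lv) = W * W" by (simp add: W_def mult_2 power_add)

lemma cap_ge: "c \<le> B \<Longrightarrow> c * B \<le> cap" "c \<le> B \<Longrightarrow> c \<le> cap"
  using B_pos by (auto simp: cap_def power2_eq_square intro: order_trans[of c B])

lemma div_B_iff: "w' div B = w \<longleftrightarrow> w * B \<le> w' \<and> w' < w * B + B"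
  using B_pos by (metis div_nat_eqI dividend_less_div_times div_times_less_eq_dividend mult.commute add.commute mult_Suc_right mult_Suc)

lemma children: "{w'. w' div B = w} = {w * B..<w * B + B}"
  by (auto simp: div_B_iff)

lemma finite_children [simp]: "finite {w'. w' div B = w}" and card_children [simp]: "card {w'. w' div B = w} = B"
  by (simp_all add: children)

lemma div_B_less: "q div B < B ^ t \<longleftrightarrow> q < B ^ Suc t"
  using B_pos by (simp add: div_less_iff_less_mult mult.commute)

lemma div_B_le: "q div B \<le> q" by simp

definition pts :: "nat \<Rightarrow> 'd mem" where "pts w = {Inl p |p. p \<in> P \<and> pos p = w}"

lemma card_pts: "finite (pts w)" "card (pts w) \<le> 1"
proof -
  have "pts w = Inl ` {p \<in> P. pos p = w}" by (auto simp: pts_def)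
  thus "finite (pts w)" using finP by simp
  have "p = q" if "p \<in> pts w" "q \<in> pts w" for p q
    using that pos_inj by (auto simp: pts_def dest: inj_onD)
  thus "card (pts w) \<le> 1" by (metis card_le_Suc0_iff_eq \<open>finite (pts w)\<close> One_nat_def)
qed

definition onJ :: "(nat \<Rightarrow> nat \<Rightarrow> 'd mem) \<Rightarrow> addr \<Rightarrow> 'd mem" where
  "onJ f x = (case x of J q w \<Rightarrow> f q w | _ \<Rightarrow> {})"

lemma onJ_simps [simp]: "onJ f (J q w) = f q w" "onJ f (V b l) = {}" "onJ f (K z) = {}"
  "onJ f (H b) = {}" "onJ f (Idle i) = {}"
  by (simp_all add: onJ_def)

lemma round_okJ:
  assumes M: "\<And>x a j A. msg r x a j A = (case (a, j) of (J q w, J q' w') \<Rightarrow> M q w q' w' A | _ \<Rightarrow> {})"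
    and out: "\<And>q w. q < Q \<Longrightarrow> w < W \<Longrightarrow>
      \<exists>Z. {(q', w', c). c \<in> M q w q' w' (f q w)} \<subseteq> Z \<and> finite Z \<and> card Z \<le> cap"
    and inn: "\<And>q' w'. q' < Q \<Longrightarrow> w' < W \<Longrightarrow>
      \<exists>Z. {(q, w, c). c \<in> M q w q' w' (f q w)} \<subseteq> Z \<and> finite Z \<and> card Z \<le> cap"
    and val: "\<And>q w q' w' c. q < Q \<Longrightarrow> w < W \<Longrightarrow> q' < Q \<Longrightarrow> w' < W \<Longrightarrow> c \<in> M q w q' w' (f q w) \<Longrightarrow>
       c \<in> f q w \<inter> range Inl \<union> Inr ` Items"
    and eq: "\<And>q' w'. q' < Q \<Longrightarrow> w' < W \<Longrightarrow> (\<Union>q<Q. \<Union>w<W. M q w q' w' (f q w)) = f' q' w'"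
  shows "round_ok r x (onJ f) (onJ f')"
proof (rule round_okI)
  fix b assume b: "b \<in> Ad"
  show "\<exists>Z. {(j, c). j \<in> Ad \<and> c \<in> msg r (x b) b j (onJ f b)} \<subseteq> Z \<and> finite Z \<and> card Z \<le> cap"
  proof (cases b)
    case (J q w)
    then obtain Z where Z: "{(q', w', c). c \<in> M q w q' w' (f q w)} \<subseteq> Z" "finite Z" "card Z \<le> cap"
      using out b by force
    have "{(j, c). j \<in> Ad \<and> c \<in> msg r (x b) b j (onJ f b)} \<subseteq> (\<lambda>(q', w', c). (J q' w', c)) ` Z"
      using Z(1) J by (auto simp: M split: addr.splits) force
    moreover have "card ((\<lambda>(q', w', c). (J q' w', c)) ` Z) \<le> cap"
      using Z card_image_le order_trans by blast
    ultimately show ?thesis using Z(2) by blast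
  qed (auto simp: M intro!: exI[of _ "{}"])
next
  fix j assume j: "j \<in> Ad"
  show "\<exists>Z. {(b, c). b \<in> Ad \<and> c \<in> msg r (x b) b j (onJ f b)} \<subseteq> Z \<and> finite Z \<and> card Z \<le> cap"
  proof (cases j)
    case (J q' w')
    then obtain Z where Z: "{(q, w, c). c \<in> M q w q' w' (f q w)} \<subseteq> Z" "finite Z" "card Z \<le> cap"
      using inn j by force
    have "{(b, c). b \<in> Ad \<and> c \<in> msg r (x b) b j (onJ f b)} \<subseteq> (\<lambda>(q', w', c). (J q' w', c)) ` Z"
      using Z(1) J by (auto simp: M split: addr.splits) force
    moreover have "card ((\<lambda>(q', w', c). (J q' w', c)) ` Z) \<le> cap"
      using Z card_image_le order_trans by blast
    ultimately show ?thesis using Z(2) by blast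
  qed (auto simp: M split: addr.splits intro!: exI[of _ "{}"])
next
  fix b j assume bj: "b \<in> Ad" "j \<in> Ad"
  show "msg r (x b) b j (onJ f b) \<subseteq> onJ f b \<inter> range Inl \<union> Inr ` Items"
  proof (cases b; cases j)
    fix q w q' w' assume "b = J q w" "j = J q' w'"
    thus ?thesis using val[of q w q' w'] bj by (auto simp: M)
  qed (auto simp: M)
next
  fix j assume j: "j \<in> Ad"
  show "(\<Union>b\<in>Ad. msg r (x b) b j (onJ f b)) = onJ f' j"
  proof (cases j)
    case (J q' w')
    have "(\<Union>b\<in>Ad. msg r (x b) b j (onJ f b)) = (\<Union>q<Q. \<Union>w<W. M q w q' w' (f q w))"
    proof (intro equalityI subsetI)
      fix c assume "c \<in> (\<Union>b\<in>Ad. msg r (x b) b j (onJ f b))"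
      then obtain b where b: "b \<in> Ad" "c \<in> msg r (x b) b j (onJ f b)" by blast
      show "c \<in> (\<Union>q<Q. \<Union>w<W. M q w q' w' (f q w))"
        using b by (cases b) (auto simp: M J)
    next
      fix c assume "c \<in> (\<Union>q<Q. \<Union>w<W. M q w q' w' (f q w))"
      then obtain q w where qw: "q < Q" "w < W" "c \<in> M q w q' w' (f q w)" by blast
      thus "c \<in> (\<Union>b\<in>Ad. msg r (x b) b j (onJ f b))"
        by (intro UN_I[of "J q w"]) (auto simp: M J)
    qed
    thus ?thesis using eq[of q' w'] j J by simp
  qed (auto simp: M split: addr.splits)
qed

lemma card_le2:
  assumes "finite X" "finite Y" "card X \<le> x" "card Y \<le> y"
  shows "finite (X \<times> Y)" "card (X \<times> Y) \<le> x * y"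
  using assms by (auto simp: card_cartesian_product intro: mult_le_mono)

subsection \<open>Copying the points to all blocks\<close>

definition "base w = pts w \<union> (if w = 0 then {Inr (Seed a)} else {})"

lemma card_base: "finite (base w)" "card (base w) \<le> 2"
  using card_pts[of w] by (auto simp: base_def card_insert_if)

definition "cfgM t q w = (if q < B ^ t then base w else {})"

lemma round_copy:
  assumes "t < 2 * lv"
  shows "round_ok (2 + t) x (onJ (cfgM t)) (onJ (cfgM (Suc t)))"
proof (rule round_okJ[where M = "\<lambda>q w q' w' A. if w' = w \<and> q' div B = q then A else {}"])
  show "msg (2 + t) x a j A = (case (a, j) of (J q w, J q' w') \<Rightarrow> if w' = w \<and> q' div B = q then A else {} | _ \<Rightarrow> {})"
    for x a j A using assms by (simp add: msg_def msg_copy_def T2_def)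
  fix q w :: nat
  have cM: "finite (cfgM t q w)" "card (cfgM t q w) \<le> 2" using card_base[of w] by (auto simp: cfgM_def)
  show "\<exists>Z. {(q', w', c). c \<in> (if w' = w \<and> q' div B = q then cfgM t q w else {})} \<subseteq> Z \<and> finite Z \<and> card Z \<le> cap"
  proof (intro exI conjI)
    let ?X = "(\<lambda>q'. (q', w)) ` {q'. q' div B = q}"
    have X: "finite ?X" "card ?X \<le> B" using card_image_le[of "{q'. q' div B = q}" "\<lambda>q'. (q', w)"] by simp_all
    let ?Z = "(\<lambda>((q', w'), c). (q', w', c)) ` (?X \<times> cfgM t q w)"
    show "{(q', w', c). c \<in> (if w' = w \<and> q' div B = q then cfgM t q w else {})} \<subseteq> ?Z"
      by (auto split: if_splits intro!: image_eqI[where x = "((_, _), _)"])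
    show "finite ?Z" using card_le2(1)[OF X(1) cM(1)] by auto
    have "card ?Z \<le> card (?X \<times> cfgM t q w)" using card_le2(1)[OF X(1) cM(1)] by (auto intro: card_image_le)
    also have "\<dots> \<le> B * 2" using card_le2(2)[OF X(1) cM(1) X(2) cM(2)] by simp
    also have "\<dots> \<le> cap" using cap_ge(1)[of 2] B_ge by (simp add: mult.commute)
    finally show "card ?Z \<le> cap" .
  qed
  show "c \<in> cfgM t q w \<inter> range Inl \<union> Inr ` Items"
    if "c \<in> (if w' = w \<and> q' div B = q then cfgM t q w else {})" for q' w' c
    using that aF by (auto simp: cfgM_def base_def pts_def split: if_splits)
next
  fix q' w' :: nat
  show "\<exists>Z. {(q, w, c). c \<in> (if w' = w \<and> q' div B = q then cfgM t q w else {})} \<subseteq> Z \<and> finite Z \<and> card Z \<le> cap"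
  proof (intro exI conjI)
    let ?Z = "(\<lambda>c. (q' div B, w', c)) ` base w'"
    show "{(q, w, c). c \<in> (if w' = w \<and> q' div B = q then cfgM t q w else {})} \<subseteq> ?Z"
      by (auto simp: cfgM_def split: if_splits)
    show "finite ?Z" using card_base by simp
    have "card ?Z \<le> 2" using card_base card_image_le order_trans by blast
    thus "card ?Z \<le> cap" using cap_ge(2)[of 2] B_ge by simp
  qed
  assume q': "q' < Q" and w': "w' < W"
  have "q' div B < Q" using q' div_B_le[of q'] by linarith
  thus "(\<Union>q<Q. \<Union>w<W. if w' = w \<and> q' div B = q then cfgM t q w else {}) = cfgM (Suc t) q' w'"
    using w' div_B_less[of q' t] by (auto simp: cfgM_def split: if_splits)
qed

end

section \<open>Rounds along trees of fan-out \<open>B\<close>\<close>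

context alg_run
begin

text \<open>The accounting shared by broadcasts and aggregations: at most \<open>2 * B\<close> cells
  are kept, and at most 4 items cross each edge of a relation with in- and out-degree at most
  \<open>B\<close>. The traffic \<open>6 * B\<close> is within the capacity
  \<open>B ^ 2\<close>.\<close>

lemma round_ok_tree:
  assumes msg: "\<And>x a j A. msg r x a j A = (case (a, j) of (J q w, J q' w') \<Rightarrow> M q w q' w' A | _ \<Rightarrow> {})"
    and M: "\<And>q w q' w'. M q w q' w' (f q w)
       = (if q' = q \<and> w' = w then Kp q w else {}) \<union> (if R q w q' w' then S q w else {})"
    and Kp: "\<And>q w. finite (Kp q w)" "\<And>q w. card (Kp q w) \<le> 2 * B"
    and S: "\<And>q w. finite (S q w)" "\<And>q w. card (S q w) \<le> 4"
    and outR: "\<And>q w. finite {(q', w'). R q w q' w'}" "\<And>q w. card {(q', w'). R q w q' w'} \<le> B"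
    and inR: "\<And>q' w'. finite {(q, w). R q w q' w'}" "\<And>q' w'. card {(q, w). R q w q' w'} \<le> B"
    and valKp: "\<And>q w. q < Q \<Longrightarrow> w < W \<Longrightarrow> Kp q w \<subseteq> f q w \<inter> range Inl \<union> Inr ` Items"
    and valS: "\<And>q w q' w'. q < Q \<Longrightarrow> w < W \<Longrightarrow> R q w q' w' \<Longrightarrow> S q w \<subseteq> f q w \<inter> range Inl \<union> Inr ` Items"
    and eq: "\<And>q' w'. q' < Q \<Longrightarrow> w' < W \<Longrightarrow>
       Kp q' w' \<union> \<Union>{S q w |q w. q < Q \<and> w < W \<and> R q w q' w'} = f' q' w'"
  shows "round_ok r x (onJ f) (onJ f')"
proof (rule round_okJ[where M = M])
  show "msg r x a j A = (case (a, j) of (J q w, J q' w') \<Rightarrow> M q w q' w' A | _ \<Rightarrow> {})" for x a j A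
    by (rule msg)
  have bound: "card (Kp q w) + c * 4 \<le> cap" if "c \<le> B" for q w c
  proof -
    have "card (Kp q w) + c * 4 \<le> 6 * B" using Kp(2)[of q w] that by linarith
    thus ?thesis using cap_ge(1)[of 6] B_ge by linarith
  qed
  show "\<exists>Z. {(q', w', c). c \<in> M q w q' w' (f q w)} \<subseteq> Z \<and> finite Z \<and> card Z \<le> cap" for q w
  proof (intro exI conjI)
    let ?R = "{(q', w'). R q w q' w'}"
    let ?Z1 = "(\<lambda>c. (q, w, c)) ` Kp q w"
    let ?Z2 = "(\<lambda>((q', w'), c). (q', w', c)) ` (?R \<times> S q w)"
    show "{(q', w', c). c \<in> M q w q' w' (f q w)} \<subseteq> ?Z1 \<union> ?Z2"
      by (auto simp: M split: if_splits intro!: image_eqI[where x = "((_, _), _)"])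
    have fin: "finite (?R \<times> S q w)" using outR(1) S(1) by blast
    thus "finite (?Z1 \<union> ?Z2)" using Kp(1) by blast
    have "card (?Z1 \<union> ?Z2) \<le> card ?Z1 + card ?Z2" by (rule card_Un_le)
    also have "\<dots> \<le> card (Kp q w) + card (?R \<times> S q w)"
      using Kp(1) fin by (intro add_mono card_image_le)
    also have "\<dots> \<le> card (Kp q w) + card ?R * 4"
      using S(2)[of q w] by (simp add: card_cartesian_product)
    also have "\<dots> \<le> cap" by (rule bound[OF outR(2)])
    finally show "card (?Z1 \<union> ?Z2) \<le> cap" .
  qed
  show "\<exists>Z. {(q, w, c). c \<in> M q w q' w' (f q w)} \<subseteq> Z \<and> finite Z \<and> card Z \<le> cap" for q' w'
  proof (intro exI conjI)
    let ?R = "{(q, w). R q w q' w'}"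
    let ?Z1 = "(\<lambda>c. (q', w', c)) ` Kp q' w'"
    let ?Sg = "Sigma ?R (\<lambda>(q, w). S q w)"
    let ?Z2 = "(\<lambda>((q, w), c). (q, w, c)) ` ?Sg"
    show "{(q, w, c). c \<in> M q w q' w' (f q w)} \<subseteq> ?Z1 \<union> ?Z2"
      by (auto simp: M split: if_splits intro!: image_eqI[where x = "((_, _), _)"])
    have fin: "finite ?Sg" using inR(1) S(1) by (intro finite_SigmaI) auto
    thus "finite (?Z1 \<union> ?Z2)" using Kp(1) by blast
    have "card (?Z1 \<union> ?Z2) \<le> card ?Z1 + card ?Z2" by (rule card_Un_le)
    also have "\<dots> \<le> card (Kp q' w') + card ?Sg"
      using Kp(1) fin by (intro add_mono card_image_le)
    also have "card ?Sg = (\<Sum>z\<in>?R. card (case z of (q, w) \<Rightarrow> S q w))"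
      using inR(1) S(1) by (intro card_SigmaI) auto
    also have "\<dots> \<le> card ?R * 4"
      using sum_bounded_above[of ?R "\<lambda>z. card (case z of (q, w) \<Rightarrow> S q w)" 4] S(2) by auto
    also have "card (Kp q' w') + card ?R * 4 \<le> cap" by (rule bound[OF inR(2)])
    finally show "card (?Z1 \<union> ?Z2) \<le> cap" by simp
  qed
  show "c \<in> f q w \<inter> range Inl \<union> Inr ` Items"
    if "q < Q" "w < W" "c \<in> M q w q' w' (f q w)" for q w q' w' c
    using that(3) valKp[OF that(1,2)] valS[OF that(1,2), of q' w'] unfolding M by (auto split: if_splits)
  show "(\<Union>q<Q. \<Union>w<W. M q w q' w' (f q w)) = f' q' w'" if "q' < Q" "w' < W" for q' w'
  proof -
    let ?U = "\<Union>{S q w |q w. q < Q \<and> w < W \<and> R q w q' w'}"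
    have "(\<Union>q<Q. \<Union>w<W. M q w q' w' (f q w)) = Kp q' w' \<union> ?U"
    proof (intro equalityI subsetI)
      fix c assume "c \<in> (\<Union>q<Q. \<Union>w<W. M q w q' w' (f q w))"
      then obtain q w where qw: "q < Q" "w < W" "c \<in> M q w q' w' (f q w)" by blast
      from qw(3) consider "q' = q" "w' = w" "c \<in> Kp q w" | "R q w q' w'" "c \<in> S q w"
        unfolding M by (auto split: if_splits)
      thus "c \<in> Kp q' w' \<union> ?U" using qw(1,2) by cases blast+
    next
      fix c assume "c \<in> Kp q' w' \<union> ?U"
      then consider "c \<in> Kp q' w'" | q w where "q < Q" "w < W" "R q w q' w'" "c \<in> S q w" by blast
      hence "\<exists>q w. q < Q \<and> w < W \<and> c \<in> M q w q' w' (f q w)"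
        by cases (use that in \<open>auto simp: M\<close>)
      thus "c \<in> (\<Union>q<Q. \<Union>w<W. M q w q' w' (f q w))" by blast
    qed
    thus ?thesis using eq[OF that] by simp
  qed
qed

lemma tree_sets [simp]:
  "card {(q', w'). q' = q \<and> w' div B = w} = B"
  "{(q, w). q' = q \<and> w' div B = w} = {(q', w' div B)}" "{(q', w'). q' = q \<and> w' = w div B} = {(q, w div B)}"
  "finite {(q, w). q' = q \<and> w' = w div B}" "card {(q, w). q' = q \<and> w' = w div B} = B"
proof -
  have *: "{(q', w'). q' = q \<and> w' div B = w} = Pair q ` {w'. w' div B = w}" for q w :: nat by auto
  have **: "{(q, w). q' = q \<and> w' = w div B} = Pair q' ` {w. w div B = w'}" for q' w' :: nat by auto
  show "card {(q', w'). q' = q \<and> w' div B = w} = B"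
    unfolding * by (simp_all add: card_image inj_on_def)
  have [simp]: "{w. w' = w div B} = {w. w div B = w'}" for w' by auto
  show "finite {(q, w). q' = q \<and> w' = w div B}" "card {(q, w). q' = q \<and> w' = w div B} = B"
    unfolding ** by (simp_all add: card_image inj_on_def)
qed auto

subsection \<open>Candidate scales\<close>

lemma card_insert_le3: "card {x, y} \<le> 2" "card {x, y, z} \<le> 3" for x y z :: addr
  by (simp_all add: card_insert_if)

definition "cfgK x = (case x of J q w \<Rightarrow> base w
   | K z \<Rightarrow> if big then pts (z div W) \<union> pts (z mod W) else {} | _ \<Rightarrow> {})"

lemma base_valid: "base w \<subseteq> base w \<inter> range Inl \<union> Inr ` Items"
  using aF by (auto simp: base_def pts_def)

lemma base_Inl: "base w \<inter> range Inl = pts w"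
  by (auto simp: base_def pts_def)

lemma card_pts2: "finite (pts w \<union> pts w')" "card (pts w \<union> pts w') \<le> 2"
  using card_pts[of w] card_pts[of w'] card_Un_le[of "pts w" "pts w'"] by auto

lemma small_cap: "c \<le> 96 \<Longrightarrow> c \<le> cap"
  using cap_ge(2)[of c] B_ge by linarith

lemma ex_bound: "Y \<subseteq> Z \<Longrightarrow> finite Z \<Longrightarrow> card Z \<le> 96 \<Longrightarrow> \<exists>Z. Y \<subseteq> Z \<and> finite Z \<and> card Z \<le> cap"
  using small_cap by blast

lemma round_pairs: "round_ok T2 x (onJ (\<lambda>q w. base w)) cfgK"
proof -
  have msg: "msg T2 x = msg_pairs" for x by (simp add: msg_def T2_def)
  show ?thesis
  proof (rule round_okI, unfold msg)
    fix b assume b: "b \<in> Ad"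
    show "\<exists>Z. {(j, c). j \<in> Ad \<and> c \<in> msg_pairs b j (onJ (\<lambda>q w. base w) b)} \<subseteq> Z \<and> finite Z \<and> card Z \<le> cap"
    proof (cases b)
      case (J q w)
      let ?Z = "{J q w, K (q * W + w), K (w * W + q)} \<times> base w"
      have "{(j, c). j \<in> Ad \<and> c \<in> msg_pairs b j (onJ (\<lambda>q w. base w) b)} \<subseteq> ?Z"
        using J by (auto simp: msg_pairs_def split: addr.splits if_splits)
      moreover have "finite ?Z" using card_base by simp
      moreover have "card ?Z \<le> 3 * 2"
        by (rule card_le2(2)[OF _ _ card_insert_le3(2)]) (use card_base in auto)
      ultimately show ?thesis by (intro ex_bound[of _ ?Z]) auto
    qed (auto simp: msg_pairs_def intro!: exI[of _ "{}"])
  next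
    fix j assume j: "j \<in> Ad"
    show "\<exists>Z. {(b, c). b \<in> Ad \<and> c \<in> msg_pairs b j (onJ (\<lambda>q w. base w) b)} \<subseteq> Z \<and> finite Z \<and> card Z \<le> cap"
    proof (cases j)
      case (J q w)
      let ?Z = "{J q w} \<times> base w"
      have "{(b, c). b \<in> Ad \<and> c \<in> msg_pairs b j (onJ (\<lambda>q w. base w) b)} \<subseteq> ?Z"
        using J by (auto simp: msg_pairs_def split: addr.splits if_splits)
      moreover have "card ?Z \<le> 2" using card_base by (simp add: card_cartesian_product)
      ultimately show ?thesis using card_base[of w] by (intro ex_bound[of _ ?Z]) auto
    next
      case (K z)
      let ?u = "z div W" and ?v = "z mod W"
      let ?Z = "{J ?u ?v, J ?v ?u} \<times> (pts ?u \<union> pts ?v)"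
      have "{(b, c). b \<in> Ad \<and> c \<in> msg_pairs b j (onJ (\<lambda>q w. base w) b)} \<subseteq> ?Z"
        using K by (auto simp: msg_pairs_def base_Inl split: addr.splits if_splits)
      moreover have "finite ?Z" using card_pts2 by simp
      moreover have "card ?Z \<le> 2 * 2"
        by (rule card_le2(2)[OF _ _ card_insert_le3(1)]) (use card_pts2 in auto)
      ultimately show ?thesis by (intro ex_bound[of _ ?Z]) auto
    qed (auto simp: msg_pairs_def split: addr.splits intro!: exI[of _ "{}"])
  next
    fix b j assume "b \<in> Ad" "j \<in> Ad"
    show "msg_pairs b j (onJ (\<lambda>q w. base w) b) \<subseteq> onJ (\<lambda>q w. base w) b \<inter> range Inl \<union> Inr ` Items"
    proof (cases b; cases j)
      fix q w q' w' assume "b = J q w" "j = J q' w'"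
      thus ?thesis using base_valid[of w] by (simp add: msg_pairs_def)
    qed (simp_all add: msg_pairs_def)
  next
    fix j assume j: "j \<in> Ad"
    show "(\<Union>b\<in>Ad. msg_pairs b j (onJ (\<lambda>q w. base w) b)) = cfgK j" (is "?L = _")
    proof (cases j)
      case (J q w)
      have "?L \<subseteq> base w" using J by (auto simp: msg_pairs_def split: addr.splits if_splits)
      moreover have "base w \<subseteq> ?L"
        using J j by (auto simp: msg_pairs_def intro!: bexI[of _ "J q w"])
      ultimately show ?thesis using J by (simp add: cfgK_def)
    next
      case (K z)
      let ?u = "z div W" and ?v = "z mod W"
      show ?thesis
      proof (cases big)
        case True
        have z: "z < W * W" using j K big_Q[OF True] by simp
        have uv: "?u < W" "?v < W" using z W_pos by (auto simp: less_mult_imp_div_less)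
        have zz: "(z = ?u * W + ?v) = True" by (simp only: div_mult_mod_eq simp_thms)
        have "?L \<subseteq> pts ?u \<union> pts ?v"
          using K by (auto simp: msg_pairs_def base_Inl split: addr.splits if_splits)
        \<comment> \<open>\<open>J u v\<close> holds the point of slot \<open>v\<close>, so the two
          points of a pair come from two mirrored machines.\<close>
        moreover have "pts ?v \<subseteq> ?L"
        proof -
          have "J ?u ?v \<in> Ad" using less_le_trans[OF uv(1) W_le_Q[OF True]] uv by simp
          moreover have "pts ?v \<subseteq> msg_pairs (J ?u ?v) j (onJ (\<lambda>q w. base w) (J ?u ?v))"
            using K True uv by (simp add: msg_pairs_def base_Inl zz)
          ultimately show ?thesis by blast
        qed
        moreover have "pts ?u \<subseteq> ?L"
        proof -
          have "J ?v ?u \<in> Ad" using less_le_trans[OF uv(2) W_le_Q[OF True]] uv by simp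
          moreover have "pts ?u \<subseteq> msg_pairs (J ?v ?u) j (onJ (\<lambda>q w. base w) (J ?v ?u))"
            using K True uv by (simp add: msg_pairs_def base_Inl zz)
          ultimately show ?thesis by blast
        qed
        ultimately have "?L = pts ?u \<union> pts ?v" by blast
        thus ?thesis using K True by (simp add: cfgK_def)
      next
        case False
        thus ?thesis using K by (auto simp: msg_pairs_def cfgK_def split: addr.splits)
      qed
    qed (auto simp: msg_pairs_def cfgK_def split: addr.splits)
  qed
qed

text \<open>With \<open>big\<close>, block \<open>q\<close> stands for the pair of slots coded by
  \<open>q\<close>, and it has no scale if one of them is empty or both coincide.\<close>

definition "sc q = (if big then {scale p p' |p p'. p \<in> P \<and> p' \<in> P \<and> p \<noteq> p' \<and>
    pos p \<in> {q div W, q mod W} \<and> pos p' \<in> {q div W, q mod W}} else {q})"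

lemma scale_le: "p \<in> P \<Longrightarrow> p' \<in> P \<Longrightarrow> p \<noteq> p' \<Longrightarrow> scale p p' \<le> L"
proof -
  assume p: "p \<in> P" "p' \<in> P" "p \<noteq> p'"
  have "log 2 (dist p p') \<le> log 2 (2 ^ L)" using dist_ge[OF p] dist_le[OF p(1,2)] by (subst log_le_cancel_iff) auto
  hence "log 2 (dist p p') \<le> real L" by (simp add: log_nat_power)
  thus ?thesis unfolding scale_def by linarith
qed

lemma sc_le: "i \<in> sc q \<Longrightarrow> q < Q \<Longrightarrow> i \<le> L"
  using scale_le not_big_Q by (auto simp: sc_def split: if_splits)

text \<open>Distinct points in the two slots are determined up to order, and the distance is
  symmetric.\<close>

lemma sc_unique:
  assumes "i \<in> sc q" "i' \<in> sc q"
  shows "i = i'"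
proof (cases big)
  case True
  from assms(1) True obtain p p' where p: "i = scale p p'" "p \<in> P" "p' \<in> P" "p \<noteq> p'"
    "pos p \<in> {q div W, q mod W}" "pos p' \<in> {q div W, q mod W}" by (auto simp: sc_def)
  from assms(2) True obtain r r' where r: "i' = scale r r'" "r \<in> P" "r' \<in> P" "r \<noteq> r'"
    "pos r \<in> {q div W, q mod W}" "pos r' \<in> {q div W, q mod W}" by (auto simp: sc_def)
  have "pos p \<noteq> pos p'" "pos r \<noteq> pos r'" using p r pos_inj by (auto dest: inj_onD)
  hence "pos r = pos p \<and> pos r' = pos p' \<or> pos r = pos p' \<and> pos r' = pos p" using p r by auto
  hence "r = p \<and> r' = p' \<or> r = p' \<and> r' = p" using p r pos_inj by (auto dest: inj_onD)
  thus ?thesis using p(1) r(1) by (auto simp: scale_def dist_commute)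
qed (use assms in \<open>auto simp: sc_def\<close>)

lemma card_sc: "finite (sc q)" "card (sc q) \<le> 1"
proof -
  show "finite (sc q)"
  proof (cases "sc q = {}")
    case False
    then obtain i where "i \<in> sc q" by blast
    hence "sc q \<subseteq> {i}" using sc_unique by blast
    thus ?thesis using finite_subset by blast
  qed simp
  thus "card (sc q) \<le> 1" using sc_unique by (metis card_le_Suc0_iff_eq One_nat_def)
qed

definition info :: "nat \<Rightarrow> 'd mem" where "info q = insert (Inr (Seed a)) {Inr (Cand i) |i. i \<in> sc q}"

lemma card_info: "finite (info q)" "card (info q) \<le> 2"
proof -
  have eq: "info q = insert (Inr (Seed a)) ((\<lambda>i. Inr (Cand i)) ` sc q)" by (auto simp: info_def)
  show "finite (info q)" using card_sc by (simp add: eq)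
  have "card ((\<lambda>i. Inr (Cand i)) ` sc q) \<le> 1" using card_sc card_image_le order_trans by blast
  thus "card (info q) \<le> 2" using card_sc unfolding eq by (auto simp: card_insert_if)
qed

lemma info_valid: "q < Q \<Longrightarrow> info q \<subseteq> Inr ` Items"
  using aF sc_le by (auto simp: info_def)

definition "cfgI t q w = pts w \<union> (if w < B ^ t then info q else {})"

lemma round_cands: "round_ok (T2 + 1) x cfgK (onJ (cfgI 0))"
proof -
  have msg: "msg (T2 + 1) x = msg_cands" for x by (simp add: msg_def T2_def T3_def)
  have candK: "{Inr (Cand (scale p p')) |p p'. Inl p \<in> cfgK (K z) \<and> Inl p' \<in> cfgK (K z) \<and> p \<noteq> p'}
      = (if big then (\<lambda>i. Inr (Cand i)) ` sc z else {})" (is "?C z = _") for z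
    by (auto simp: cfgK_def pts_def sc_def image_iff)
  define A' :: "nat \<Rightarrow> nat \<Rightarrow> 'd mem"
    where "A' = (\<lambda>q w. base w \<union> (if \<not> big \<and> w = 0 then {Inr (Cand q)} else {}))"
  have A: "finite (A' q w)" "card (A' q w) \<le> 3" for q w
    using card_base[of w] by (auto simp: card_insert_if A'_def)
  have Csub: "?C q \<subseteq> info q" for q unfolding candK by (auto simp: info_def)
  show ?thesis
  proof (rule round_okI, unfold msg)
    fix b assume b: "b \<in> Ad"
    show "\<exists>Z. {(j, c). j \<in> Ad \<and> c \<in> msg_cands b j (cfgK b)} \<subseteq> Z \<and> finite Z \<and> card Z \<le> cap"
    proof (cases b)
      case (J q w)
      let ?Z = "{J q w} \<times> A' q w"
      have "{(j, c). j \<in> Ad \<and> c \<in> msg_cands b j (cfgK b)} \<subseteq> ?Z"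
        using J by (auto simp: msg_cands_def cfgK_def A'_def split: addr.splits if_splits)
      moreover have "card ?Z \<le> 3" using A(2)[of q w] by (simp add: card_cartesian_product)
      ultimately show ?thesis using A[of q w] by (intro ex_bound[of _ ?Z]) auto
    next
      case (K z)
      let ?Z = "{J z 0} \<times> info z"
      have "{(j, c). j \<in> Ad \<and> c \<in> msg_cands b j (cfgK b)} \<subseteq> ?Z"
        using K Csub[of z] by (auto simp: msg_cands_def split: addr.splits if_splits)
      moreover have "card ?Z \<le> 2" using card_info[of z] by (simp add: card_cartesian_product)
      ultimately show ?thesis using card_info[of z] by (intro ex_bound[of _ ?Z]) auto
    qed (auto simp: msg_cands_def intro!: exI[of _ "{}"])
  next
    fix j assume j: "j \<in> Ad"
    show "\<exists>Z. {(b, c). b \<in> Ad \<and> c \<in> msg_cands b j (cfgK b)} \<subseteq> Z \<and> finite Z \<and> card Z \<le> cap"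
    proof (cases j)
      case (J q w)
      let ?Z = "{J q w, K q} \<times> (A' q w \<union> info q)"
      have "{(b, c). b \<in> Ad \<and> c \<in> msg_cands b j (cfgK b)} \<subseteq> ?Z"
      proof
        fix z assume "z \<in> {(b, c). b \<in> Ad \<and> c \<in> msg_cands b j (cfgK b)}"
        then obtain b c where z: "z = (b, c)" "c \<in> msg_cands b j (cfgK b)" by auto
        show "z \<in> ?Z"
        proof (cases b)
          case (K y)
          thus ?thesis using z J Csub[of q] by (auto simp: msg_cands_def split: if_splits)
        qed (use z J in \<open>auto simp: msg_cands_def cfgK_def A'_def split: if_splits\<close>)
      qed
      moreover have fin: "finite (A' q w \<union> info q)" using A card_info by simp
      moreover have "card (A' q w \<union> info q) \<le> 5"
        using card_Un_le[of "A' q w" "info q"] A(2)[of q w] card_info[of q] by linarith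
      hence "card ?Z \<le> 2 * 5" using fin by (intro card_le2(2)[OF _ _ card_insert_le3(1)]) auto
      ultimately show ?thesis by (intro ex_bound[of _ ?Z]) auto
    qed (auto simp: msg_cands_def split: addr.splits intro!: exI[of _ "{}"])
  next
    fix b j assume bj: "b \<in> Ad" "j \<in> Ad"
    show "msg_cands b j (cfgK b) \<subseteq> cfgK b \<inter> range Inl \<union> Inr ` Items"
    proof (cases b; cases j)
      fix q w q' w' assume *: "b = J q w" "j = J q' w'"
      have "Cand q \<in> Items" if "\<not> big" using not_big_Q[OF that] bj * by simp
      thus ?thesis using base_valid[of w] * by (auto simp: msg_cands_def cfgK_def A'_def)
    next
      fix z q w assume *: "b = K z" "j = J q w"
      thus ?thesis using Csub[of z] info_valid[of z] bj unfolding msg_cands_def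
        by (auto split: if_splits)
    qed (auto simp: msg_cands_def)
  next
    fix j assume j: "j \<in> Ad"
    show "(\<Union>b\<in>Ad. msg_cands b j (cfgK b)) = onJ (cfgI 0) j" (is "?L = _")
    proof (cases j)
      case (J q w)
      have "?L = msg_cands (J q w) j (cfgK (J q w)) \<union> msg_cands (K q) j (cfgK (K q))"
      proof (intro equalityI subsetI)
        fix c assume "c \<in> ?L"
        then obtain b where b: "b \<in> Ad" "c \<in> msg_cands b j (cfgK b)" by blast
        show "c \<in> msg_cands (J q w) j (cfgK (J q w)) \<union> msg_cands (K q) j (cfgK (K q))"
          using b J by (cases b) (auto simp: msg_cands_def split: if_splits)
      next
        fix c assume "c \<in> msg_cands (J q w) j (cfgK (J q w)) \<union> msg_cands (K q) j (cfgK (K q))"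
        moreover have "J q w \<in> Ad" "K q \<in> Ad" using j J by auto
        ultimately show "c \<in> ?L" by blast
      qed
      also have "msg_cands (J q w) j (cfgK (J q w)) = A' q w"
        using J by (simp add: msg_cands_def cfgK_def A'_def)
      also have "msg_cands (K q) j (cfgK (K q)) = (if w = 0 then ?C q else {})"
        using J by (simp add: msg_cands_def)
      also have "A' q w \<union> (if w = 0 then ?C q else {}) = cfgI 0 q w"
        unfolding candK A'_def by (auto simp: cfgI_def base_def info_def sc_def)
      finally show ?thesis using J by simp
    qed (auto simp: msg_cands_def split: addr.splits)
  qed
qed

lemma card_pts_info: "finite (pts w \<union> info q)" "card (pts w \<union> info q) \<le> 3"
proof -
  show "finite (pts w \<union> info q)" using card_pts card_info by simp
  show "card (pts w \<union> info q) \<le> 3"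
    using card_pts[of w] card_info[of q] card_Un_le[of "pts w" "info q"] by linarith
qed

lemma pts_Inl: "pts w \<inter> range Inl = pts w" "pts w \<inter> range Inr = {}"
  by (auto simp: pts_def)

lemma info_Inr: "info q \<inter> range Inl = {}" "info q \<inter> range Inr = info q"
  by (auto simp: info_def)

lemma round_info:
  assumes "t < lv"
  shows "round_ok (T2 + 2 + t) x (onJ (cfgI t)) (onJ (cfgI (Suc t)))"
proof (rule round_ok_tree[where M = "\<lambda>q w q' w' A. (if q' = q \<and> w' = w then A \<inter> range Inl else {})
        \<union> (if q' = q \<and> w' div B = w then A \<inter> range Inr else {})"
      and Kp = "\<lambda>q w. pts w" and S = "\<lambda>q w. if w < B ^ t then info q else {}"
      and R = "\<lambda>q w q' w'. q' = q \<and> w' div B = w"])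
  show "msg (T2 + 2 + t) x a j A = (case (a, j) of (J q w, J q' w') \<Rightarrow>
      (if q' = q \<and> w' = w then A \<inter> range Inl else {}) \<union> (if q' = q \<and> w' div B = w then A \<inter> range Inr else {})
      | _ \<Rightarrow> {})" for x a j A
    using assms by (simp add: msg_def msg_info_def T2_def T3_def)
  show "(if q' = q \<and> w' = w then cfgI t q w \<inter> range Inl else {})
      \<union> (if q' = q \<and> w' div B = w then cfgI t q w \<inter> range Inr else {}) =
      (if q' = q \<and> w' = w then pts w else {})
      \<union> (if q' = q \<and> w' div B = w then if w < B ^ t then info q else {} else {})" for q w q' w'
    by (auto simp: cfgI_def pts_Inl info_Inr Int_Un_distrib2)
  show "pts w \<union> \<Union> {if w' < B ^ t then info q' else {} |q' w'. q' < Q \<and> w' < W \<and> q = q' \<and> w div B = w'}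
      = cfgI (Suc t) q w" if "q < Q" "w < W" for q w
  proof -
    have "w div B < W" using that(2) div_B_le[of w] by linarith
    hence *: "{if w' < B ^ t then info q' else {} |q' w'. q' < Q \<and> w' < W \<and> q = q' \<and> w div B = w'}
      = {if w div B < B ^ t then info q else {}}" using that by auto
    show ?thesis unfolding * using div_B_less[of w t] by (auto simp: cfgI_def)
  qed
  show "card (pts w) \<le> 2 * B" for w using card_pts(2)[of w] B_pos by linarith
  show "card (if w < B ^ t then info q else {}) \<le> 4" for q w using card_info[of q] by auto
  show "pts w \<subseteq> cfgI t q w \<inter> range Inl \<union> Inr ` Items" for q w by (auto simp: pts_def cfgI_def)
  show "(if w < B ^ t then info q else {}) \<subseteq> cfgI t q w \<inter> range Inl \<union> Inr ` Items" if "q < Q" for q w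
    using info_valid[OF that] by auto
qed (use card_pts card_info B_pos in auto)

end

section \<open>The hash trees: nodes, their locations and their values\<close>

context alg_run
begin

definition node :: "nat \<Rightarrow> nat \<Rightarrow> real ^ 'd \<Rightarrow> nat \<Rightarrow> ('d \<Rightarrow> int) \<Rightarrow> 'd node" where
  "node t q p i z = (t, pos p div B ^ t, q, key i p z)"

definition nodes :: "nat \<Rightarrow> 'd node set" where
  "nodes t = {node t q p i z |q p i z. q < Q \<and> p \<in> P \<and> i \<in> sc q \<and> z \<in> Off}"

definition allnodes :: "'d node set" where "allnodes = (\<Union>t\<in>{..lv}. nodes t)"

definition par :: "'d node \<Rightarrow> 'd node" where "par = (\<lambda>(t, g, q, c). (Suc t, g div B, q, c))"

end

text \<open>What makes a seed usable. Only nodes that occur for the given input and slots are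
  involved, which is why most functions of the list qualify.\<close>

locale alg_hash = alg_run k L B m F h P pos a
  for k L B m F :: nat and h :: "nat \<Rightarrow> 'd::finite node \<Rightarrow> nat"
    and P :: "(real ^ 'd) set" and pos :: "real ^ 'd \<Rightarrow> nat" and a :: nat +
  assumes h_less: "\<nu> \<in> allnodes \<Longrightarrow> h a \<nu> < Hr * ss"
    and h_inj: "inj_on (h a) allnodes"
    and h_load: "card {\<nu> \<in> allnodes. h a \<nu> mod Hr = b} \<le> t0"
begin

lemma nodes_level: "\<nu> \<in> nodes t \<Longrightarrow> fst \<nu> = t"
  by (auto simp: nodes_def node_def)

lemma par_node: "par (node t q p i z) = node (Suc t) q p i z"
  by (simp add: par_def node_def div_mult2_eq[symmetric] mult.commute)

lemma par_in: "\<nu> \<in> nodes t \<Longrightarrow> par \<nu> \<in> nodes (Suc t)"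
proof -
  assume "\<nu> \<in> nodes t"
  then obtain q p i z where *: "q < Q" "p \<in> P" "i \<in> sc q" "z \<in> Off" "\<nu> = node t q p i z"
    unfolding nodes_def by blast
  thus ?thesis unfolding nodes_def using par_node by blast
qed

lemma par_surj: "\<mu> \<in> nodes (Suc t) \<Longrightarrow> \<exists>\<nu>\<in>nodes t. par \<nu> = \<mu>"
proof -
  assume "\<mu> \<in> nodes (Suc t)"
  then obtain q p i z where *: "q < Q" "p \<in> P" "i \<in> sc q" "z \<in> Off" "\<mu> = node (Suc t) q p i z"
    unfolding nodes_def by blast
  have "node t q p i z \<in> nodes t" unfolding nodes_def using * by blast
  thus ?thesis using * par_node by blast
qed

lemma nodes_all: "\<nu> \<in> nodes t \<Longrightarrow> t \<le> lv \<Longrightarrow> \<nu> \<in> allnodes"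
  by (auto simp: allnodes_def)

lemma finite_nodes: "finite (nodes t)"
proof -
  have "nodes t \<subseteq> (\<lambda>(q, p, i, z). node t q p i z) ` ({..<Q} \<times> P \<times> (\<Union>q<Q. sc q) \<times> Off)"
    unfolding nodes_def by (auto intro!: image_eqI[where x = "(_, _, _, _)"])
  thus ?thesis using finP finite_Off card_sc(1) by (rule_tac finite_subset) auto
qed

lemma finite_allnodes: "finite allnodes" by (simp add: allnodes_def finite_nodes)

lemma h_eq: "\<nu> \<in> nodes s \<Longrightarrow> \<mu> \<in> nodes t \<Longrightarrow> s \<le> lv \<Longrightarrow> t \<le> lv \<Longrightarrow> h a \<nu> = h a \<mu> \<longleftrightarrow> \<nu> = \<mu>"
  using h_inj nodes_all by (meson inj_on_eq_iff)

lemma anc_0: "anc \<nu> 0 = \<nu>" by (cases \<nu>) (simp add: anc_def)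

lemma anc_Suc: "anc \<nu> (Suc s) = anc (par \<nu>) s"
  by (cases \<nu>) (simp add: anc_def par_def div_mult2_eq)

lemma npath_Cons: "fst \<nu> \<le> lv \<Longrightarrow> npath a \<nu> = h a \<nu> # npath a (par \<nu>)"
proof -
  assume "fst \<nu> \<le> lv"
  hence "[0..<Suc lv - fst \<nu>] = 0 # map Suc [0..<lv - fst \<nu>]"
    by (simp add: Suc_diff_le upt_conv_Cons map_Suc_upt del: upt_Suc)
  moreover have "fst (par \<nu>) = Suc (fst \<nu>)" by (cases \<nu>) (simp add: par_def)
  ultimately show ?thesis by (simp add: npath_def anc_0 anc_Suc o_def)
qed

lemma npath_Nil: "fst \<nu> > lv \<Longrightarrow> npath a \<nu> = []"
  by (simp add: npath_def)

lemma length_npath: "length (npath a \<nu>) = Suc lv - fst \<nu>"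
  by (simp add: npath_def)

lemma npath_set: "\<nu> \<in> nodes t \<Longrightarrow> set (npath a \<nu>) \<subseteq> {..<Hr * ss}"
proof
  fix x assume \<nu>: "\<nu> \<in> nodes t" and "x \<in> set (npath a \<nu>)"
  then obtain s where s: "s < Suc lv - t" "x = h a (anc \<nu> s)"
    using nodes_level[OF \<nu>] by (auto simp: npath_def)
  have "anc \<nu> s \<in> nodes (t + s)"
  proof -
    obtain q p i z where "q < Q" "p \<in> P" "i \<in> sc q" "z \<in> Off" "\<nu> = node t q p i z"
      using \<nu> by (auto simp: nodes_def)
    moreover have "anc (node t q p i z) s = node (t + s) q p i z" for q p i z
      by (simp add: anc_def node_def div_mult2_eq[symmetric] power_add)
    ultimately show ?thesis unfolding nodes_def by blast
  qed
  thus "x \<in> {..<Hr * ss}" using s h_less nodes_all by simp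
qed

text \<open>Leaves stay with the machine of their point; the bucket decides only where inner nodes
  are processed.\<close>

definition loc :: "'d node \<Rightarrow> addr" where
  "loc \<nu> = (case \<nu> of (t, g, q, c) \<Rightarrow> if t = 0 then J q g else H (h a \<nu> mod Hr))"

text \<open>The intended minimum at a node. Only points whose own cell is \<open>c\<close> count,
  not those that merely ask about it; \<open>W\<close> stands for none.\<close>

definition val :: "'d node \<Rightarrow> nat" where
  "val = (\<lambda>(t, g, q, c). Min (insert W {pos p |p. p \<in> P \<and> (\<exists>i\<in>sc q. key i p (\<lambda>_. 0) = c) \<and> pos p div B ^ t = g}))"

lemma Hr_pos: "Hr > 0" using Q_pos B_pos by (simp add: Hr_def)

lemma loc_0: "\<nu> \<in> nodes 0 \<Longrightarrow> \<exists>q w. loc \<nu> = J q w \<and> q < Q \<and> w < W"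
  using pos_less by (auto simp: nodes_def node_def loc_def)

lemma loc_Suc: "\<nu> \<in> nodes (Suc t) \<Longrightarrow> loc \<nu> = H (h a \<nu> mod Hr)"
  by (auto simp: nodes_def node_def loc_def)

lemma loc_Ad: "\<nu> \<in> nodes t \<Longrightarrow> loc \<nu> \<in> Ad"
proof -
  assume \<nu>: "\<nu> \<in> nodes t"
  show ?thesis
  proof (cases t)
    case 0
    then obtain q w where "loc \<nu> = J q w" "q < Q" "w < W" using loc_0 \<nu> by blast
    thus ?thesis by simp
  next
    case (Suc t')
    hence "loc \<nu> = H (h a \<nu> mod Hr)" using loc_Suc \<nu> by blast
    thus ?thesis using Hr_pos by simp
  qed
qed

lemma finite_owners: "finite {pos p |p. p \<in> P \<and> R p}"
  using finP by simp

lemma val_le: "val \<nu> \<le> W"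
  by (cases \<nu>) (auto simp: val_def finite_owners)

lemma val_level0:
  assumes "p \<in> P" "i \<in> sc q"
  shows "val (0, pos p, q, c) = (if c = key i p (\<lambda>_. 0) then pos p else W)"
proof -
  have "{pos p' |p'. p' \<in> P \<and> (\<exists>i\<in>sc q. key i p' (\<lambda>_. 0) = c) \<and> pos p' div B ^ 0 = pos p}
      = (if c = key i p (\<lambda>_. 0) then {pos p} else {})"
  proof (intro equalityI subsetI)
    fix x assume "x \<in> {pos p' |p'. p' \<in> P \<and> (\<exists>i\<in>sc q. key i p' (\<lambda>_. 0) = c) \<and> pos p' div B ^ 0 = pos p}"
    then obtain p' i' where *: "x = pos p'" "p' \<in> P" "i' \<in> sc q" "key i' p' (\<lambda>_. 0) = c" "pos p' = pos p"
      by (simp only: mem_Collect_eq power_0 div_by_1) blast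
    have "p' = p" "i' = i" using inj_onD[OF pos_inj *(5,2) assms(1)] sc_unique[OF *(3) assms(2)] by blast+
    thus "x \<in> (if c = key i p (\<lambda>_. 0) then {pos p} else {})" using *(1,4) by simp
  next
    fix x assume "x \<in> (if c = key i p (\<lambda>_. 0) then {pos p} else {})"
    hence "x = pos p" "key i p (\<lambda>_. 0) = c" by (simp_all split: if_splits)
    thus "x \<in> {pos p' |p'. p' \<in> P \<and> (\<exists>i\<in>sc q. key i p' (\<lambda>_. 0) = c) \<and> pos p' div B ^ 0 = pos p}"
      using assms by (simp only: mem_Collect_eq power_0 div_by_1) blast
  qed
  thus ?thesis using pos_less[OF assms(1)] by (simp add: val_def min_def)
qed

text \<open>Every point that counts for \<mu> lies below an existing child, since its own cell is
  among the announced ones (\<open>zero_Off\<close>). If no point counts, the value is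
  \<open>W\<close> on both sides, and a child exists by \<open>par_surj\<close>.\<close>

lemma val_Suc:
  assumes "\<mu> \<in> nodes (Suc t)"
  shows "Min (val ` {\<nu> \<in> nodes t. par \<nu> = \<mu>}) = val \<mu>"
proof (rule Min_eqI)
  show "finite (val ` {\<nu> \<in> nodes t. par \<nu> = \<mu>})" using finite_nodes by simp
  have anti: "val \<mu> \<le> val \<nu>" if child: "\<nu> \<in> nodes t" "par \<nu> = \<mu>" for \<nu>
  proof -
    obtain g q c where \<nu>: "\<nu> = (t, g, q, c)" using nodes_level[OF child(1)] by (cases \<nu>) auto
    have \<mu>: "\<mu> = (Suc t, g div B, q, c)" using child(2) \<nu> by (simp add: par_def)
    have dv: "x div B ^ Suc t = x div B ^ t div B" for x
      by (simp add: div_mult2_eq[symmetric] mult.commute)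
    show ?thesis unfolding \<nu> \<mu> val_def
      by (simp only: prod.case, rule Min_antimono) (auto simp: finite_owners dv simp del: power_Suc)
  qed
  thus "\<And>y. y \<in> val ` {\<nu> \<in> nodes t. par \<nu> = \<mu>} \<Longrightarrow> val \<mu> \<le> y" by auto
  obtain g q c where \<mu>: "\<mu> = (Suc t, g, q, c)" using nodes_level[OF assms] by (cases \<mu>) auto
  let ?M = "{pos p |p. p \<in> P \<and> (\<exists>i\<in>sc q. key i p (\<lambda>_. 0) = c) \<and> pos p div B ^ Suc t = g}"
  have "val \<mu> \<in> insert W ?M" unfolding \<mu> val_def prod.case by (rule Min_in) (auto simp: finite_owners)
  then consider "val \<mu> = W" | p i where "val \<mu> = pos p" "p \<in> P" "i \<in> sc q" "key i p (\<lambda>_. 0) = c" "pos p div B ^ Suc t = g"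
    by blast
  thus "val \<mu> \<in> val ` {\<nu> \<in> nodes t. par \<nu> = \<mu>}"
  proof cases
    case 1
    obtain \<nu> where \<nu>: "\<nu> \<in> nodes t" "par \<nu> = \<mu>" using par_surj[OF assms] by blast
    have "val \<nu> = val \<mu>" using anti[OF \<nu>] val_le[of \<nu>] 1 by simp
    thus ?thesis using \<nu> by (intro image_eqI[of _ _ \<nu>]) auto
  next
    case 2
    let ?\<nu> = "node t q p i (\<lambda>_. 0)"
    have q: "q < Q" using assms \<mu> by (auto simp: nodes_def node_def)
    have in_t: "?\<nu> \<in> nodes t" unfolding nodes_def using q 2 zero_Off by blast
    have par: "par ?\<nu> = \<mu>" using 2 by (simp add: par_node \<mu>) (simp add: node_def)
    have "val ?\<nu> \<le> pos p"
      unfolding node_def val_def prod.case using 2 by (intro Min_le) (auto simp: finite_owners)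
    hence "val ?\<nu> = val \<mu>" using anti[OF in_t par] 2 by simp
    thus ?thesis using in_t par by (intro image_eqI[of _ _ ?\<nu>]) auto
  qed
qed

text \<open>Children of a node differ only in the last digit of the prefix. The bound does not
  depend on the number of points in the cell, which is the reason for using trees.\<close>

lemma card_children_nodes: "card {\<nu> \<in> nodes t. par \<nu> = \<mu>} \<le> B"
proof -
  have "inj_on (\<lambda>\<nu>. fst (snd \<nu>)) {\<nu> \<in> nodes t. par \<nu> = \<mu>}"
    by (rule inj_onI) (auto simp: par_def dest: nodes_level split: prod.splits)
  moreover have "(\<lambda>\<nu>. fst (snd \<nu>)) ` {\<nu> \<in> nodes t. par \<nu> = \<mu>} \<subseteq> {g. g div B = fst (snd \<mu>)}"
    by (auto simp: par_def)
  ultimately have "card {\<nu> \<in> nodes t. par \<nu> = \<mu>} \<le> card {g. g div B = fst (snd \<mu>)}"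
    by (rule card_inj_on_le) simp
  thus ?thesis by simp
qed

definition upmsg :: "'d node \<Rightarrow> (real ^ 'd) + item" where
  "upmsg \<nu> = Inr (Up (npath a \<nu>) (val \<nu>) (loc \<nu>))"

definition upset :: "nat \<Rightarrow> nat \<Rightarrow> 'd node set" where
  "upset t b = {\<nu>. \<exists>s<t. \<nu> \<in> nodes s \<and> loc (par \<nu>) = H b}"

definition jb :: "nat \<Rightarrow> nat \<Rightarrow> 'd mem" where "jb q w = pts w \<union> info q"

definition cfgU :: "nat \<Rightarrow> addr \<Rightarrow> 'd mem" where
  "cfgU t x = (case x of J q w \<Rightarrow> jb q w | H b \<Rightarrow> upmsg ` upset t b | _ \<Rightarrow> {})"

lemma finite_upset: "finite (upset t b)"
proof -
  have "upset t b \<subseteq> (\<Union>s<t. nodes s)" by (auto simp: upset_def)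
  thus ?thesis using finite_nodes finite_subset by blast
qed

text \<open>A bucket is responsible for at most \<open>t0\<close> nodes of all levels together, each
  with at most \<open>B\<close> children, so the reports of all rounds can be stored at
  once.\<close>

lemma card_upset: "t \<le> lv \<Longrightarrow> card (upset t b) \<le> t0 * B"
proof -
  assume t: "t \<le> lv"
  let ?M = "{\<mu> \<in> allnodes. h a \<mu> mod Hr = b}"
  have finM: "finite ?M" using finite_allnodes by simp
  have ch2: "finite {\<nu>. par \<nu> = \<mu> \<and> (\<exists>s<t. \<nu> \<in> nodes s)}"
    "card {\<nu>. par \<nu> = \<mu> \<and> (\<exists>s<t. \<nu> \<in> nodes s)} \<le> B" for \<mu>
  proof -
    \<comment> \<open>All children of \<mu> lie on the level just below it, so only one value of
      \<open>s\<close> contributes.\<close>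
    have sub: "{\<nu>. par \<nu> = \<mu> \<and> (\<exists>s<t. \<nu> \<in> nodes s)} \<subseteq> {\<nu> \<in> nodes (fst \<mu> - 1). par \<nu> = \<mu>}"
    proof
      fix \<nu> assume "\<nu> \<in> {\<nu>. par \<nu> = \<mu> \<and> (\<exists>s<t. \<nu> \<in> nodes s)}"
      then obtain s where s: "par \<nu> = \<mu>" "\<nu> \<in> nodes s" by blast
      have "fst \<mu> = Suc s" using nodes_level[OF par_in[OF s(2)]] s(1) by simp
      thus "\<nu> \<in> {\<nu> \<in> nodes (fst \<mu> - 1). par \<nu> = \<mu>}" using s by simp
    qed
    have fin: "finite {\<nu> \<in> nodes (fst \<mu> - 1). par \<nu> = \<mu>}" using finite_nodes by simp
    show "finite {\<nu>. par \<nu> = \<mu> \<and> (\<exists>s<t. \<nu> \<in> nodes s)}" using finite_subset[OF sub fin] .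
    show "card {\<nu>. par \<nu> = \<mu> \<and> (\<exists>s<t. \<nu> \<in> nodes s)} \<le> B"
      using card_mono[OF fin sub] card_children_nodes order_trans by blast
  qed
  have "upset t b \<subseteq> (\<Union>\<mu>\<in>?M. {\<nu>. par \<nu> = \<mu> \<and> (\<exists>s<t. \<nu> \<in> nodes s)})"
  proof
    fix \<nu> assume "\<nu> \<in> upset t b"
    then obtain s where s: "s < t" "\<nu> \<in> nodes s" "loc (par \<nu>) = H b" by (auto simp: upset_def)
    have "par \<nu> \<in> nodes (Suc s)" using par_in[OF s(2)] .
    hence "par \<nu> \<in> ?M" using nodes_all[of "par \<nu>" "Suc s"] loc_Suc s t by auto
    thus "\<nu> \<in> (\<Union>\<mu>\<in>?M. {\<nu>. par \<nu> = \<mu> \<and> (\<exists>s<t. \<nu> \<in> nodes s)})" using s by blast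
  qed
  hence "card (upset t b) \<le> card (\<Union>\<mu>\<in>?M. {\<nu>. par \<nu> = \<mu> \<and> (\<exists>s<t. \<nu> \<in> nodes s)})"
    using finM ch2(1) by (intro card_mono finite_UN_I) auto
  also have "\<dots> \<le> (\<Sum>\<mu>\<in>?M. card {\<nu>. par \<nu> = \<mu> \<and> (\<exists>s<t. \<nu> \<in> nodes s)})"
    using finM by (rule card_UN_le)
  also have "\<dots> \<le> card ?M * B" using ch2(2) sum_bounded_above[of ?M _ B] by simp
  also have "\<dots> \<le> t0 * B" using h_load by (intro mult_le_mono1)
  finally show ?thesis .
qed

definition locset :: "addr \<Rightarrow> 'd node set" where
  "locset x = {\<nu>. \<exists>s<lv. \<nu> \<in> nodes s \<and> loc \<nu> = x}"

lemma finite_locset: "finite (locset x)"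
proof -
  have "locset x \<subseteq> (\<Union>s<lv. nodes s)" by (auto simp: locset_def)
  thus ?thesis using finite_nodes finite_subset by blast
qed

lemma card_locset: "card (locset x) \<le> card Off + t0"
proof (cases x)
  case (J q w)
  have "locset x \<subseteq> {node 0 q p i z |p i z. p \<in> P \<and> pos p = w \<and> i \<in> sc q \<and> z \<in> Off}"
  proof
    fix \<nu> assume "\<nu> \<in> locset x"
    then obtain s where s: "\<nu> \<in> nodes s" "loc \<nu> = J q w" by (auto simp: locset_def J)
    hence "s = 0" using loc_Suc by (cases s) auto
    then obtain q' p i z where *: "p \<in> P" "i \<in> sc q'" "z \<in> Off" "\<nu> = node 0 q' p i z"
      using s(1) unfolding nodes_def by blast
    moreover have "q' = q" "pos p = w" using s(2) *(4) by (simp_all add: loc_def node_def)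
    ultimately show "\<nu> \<in> {node 0 q p i z |p i z. p \<in> P \<and> pos p = w \<and> i \<in> sc q \<and> z \<in> Off}"
      by blast
  qed
  also have "\<dots> = (\<lambda>(y, i, z). node 0 q y i z) ` ({p \<in> P. pos p = w} \<times> sc q \<times> Off)" by force
  finally have sub: "locset x \<subseteq> (\<lambda>(y, i, z). node 0 q y i z) ` ({p \<in> P. pos p = w} \<times> sc q \<times> Off)" .
  have fin: "finite ({p \<in> P. pos p = w} \<times> sc q \<times> Off)" using finP card_sc finite_Off by simp
  have one: "card {p \<in> P. pos p = w} \<le> 1"
  proof -
    have "\<forall>p\<in>{p \<in> P. pos p = w}. \<forall>p'\<in>{p \<in> P. pos p = w}. p = p'"
      by (intro ballI inj_onD[OF pos_inj]) auto
    moreover have "finite {p \<in> P. pos p = w}" using finP by simp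
    ultimately show ?thesis by (simp only: card_le_Suc0_iff_eq One_nat_def)
  qed
  have "card (locset x) \<le> card ((\<lambda>(y, i, z). node 0 q y i z) ` ({p \<in> P. pos p = w} \<times> sc q \<times> Off))"
    using fin by (intro card_mono[OF _ sub]) auto
  also have "\<dots> \<le> card ({p \<in> P. pos p = w} \<times> sc q \<times> Off)" using fin by (rule card_image_le)
  also have "\<dots> \<le> 1 * (1 * card Off)"
    unfolding card_cartesian_product using one card_sc(2) by (intro mult_le_mono) auto
  finally show ?thesis by simp
next
  case (H b)
  have "locset x \<subseteq> {\<nu> \<in> allnodes. h a \<nu> mod Hr = b}"
  proof
    fix \<nu> assume "\<nu> \<in> locset x"
    then obtain s where s: "\<nu> \<in> nodes s" "loc \<nu> = H b" "s < lv" by (auto simp: locset_def H)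
    hence "s \<noteq> 0" using loc_0[of \<nu>] by (cases s) auto
    then obtain s' where "s = Suc s'" by (cases s) auto
    hence "h a \<nu> mod Hr = b" using s loc_Suc by auto
    thus "\<nu> \<in> {\<nu> \<in> allnodes. h a \<nu> mod Hr = b}" using nodes_all[OF s(1)] s(3) by simp
  qed
  hence "card (locset x) \<le> card {\<nu> \<in> allnodes. h a \<nu> mod Hr = b}"
    using finite_allnodes by (intro card_mono) auto
  thus ?thesis using h_load[of b] by linarith
next
  have other: "locset x = {}" if "\<And>q w. x \<noteq> J q w" "\<And>b. x \<noteq> H b"
  proof -
    have "loc \<nu> \<noteq> x" for \<nu> using that by (cases \<nu>) (auto simp: loc_def)
    thus ?thesis by (auto simp: locset_def)
  qed
  { case (V b l) thus ?thesis using other by simp }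
  { case (K z) thus ?thesis using other by simp }
  { case (Idle z) thus ?thesis using other by simp }
qed

lemma lv_pos: "lv > 0" by (simp add: lv_def)

text \<open>The bucket recognizes the children of \<mu> by comparing tails of paths, without knowing
  any node. The comparison is exact because \<open>h a\<close> is injective on the nodes that
  occur.\<close>

lemma up_val_eq:
  assumes \<mu>: "\<mu> \<in> nodes (Suc s)" and s: "s < t" "t \<le> lv" and loc: "loc \<mu> = H b"
    and A: "\<And>xs v fr. Inr (Up xs v fr) \<in> A \<longleftrightarrow> Inr (Up xs v fr) \<in> upmsg ` upset t b"
  shows "up_val A (npath a \<mu>) = val \<mu>"
proof -
  have "{v. \<exists>c fr. Inr (Up (c # npath a \<mu>) v fr) \<in> A} = val ` {\<nu> \<in> nodes s. par \<nu> = \<mu>}"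
  proof (intro equalityI subsetI)
    fix v assume "v \<in> {v. \<exists>c fr. Inr (Up (c # npath a \<mu>) v fr) \<in> A}"
    then obtain c fr \<nu> where \<nu>: "\<nu> \<in> upset t b" "Inr (Up (c # npath a \<mu>) v fr) = upmsg \<nu>"
      using A by auto
    obtain s' where s': "s' < t" "\<nu> \<in> nodes s'" using \<nu> by (auto simp: upset_def)
    have lev: "fst \<nu> = s'" using nodes_level[OF s'(2)] .
    have eq: "npath a \<nu> = c # npath a \<mu>" "val \<nu> = v" using \<nu>(2) by (auto simp: upmsg_def)
    have "npath a (par \<nu>) = npath a \<mu>" using npath_Cons[of \<nu>] lev s' s eq by simp
    moreover have p: "par \<nu> \<in> nodes (Suc s')" using par_in[OF s'(2)] .
    ultimately have "h a (par \<nu>) = h a \<mu>"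
      using npath_Cons[of "par \<nu>"] npath_Cons[of \<mu>] nodes_level[OF p] nodes_level[OF \<mu>] s s' by simp
    hence "par \<nu> = \<mu>" using h_eq[OF p \<mu>] s s' by simp
    moreover hence "s' = s" using nodes_level[OF p] nodes_level[OF \<mu>] by simp
    ultimately show "v \<in> val ` {\<nu> \<in> nodes s. par \<nu> = \<mu>}" using s'(2) eq(2) by blast
  next
    fix v assume "v \<in> val ` {\<nu> \<in> nodes s. par \<nu> = \<mu>}"
    then obtain \<nu> where \<nu>: "v = val \<nu>" "\<nu> \<in> nodes s" "par \<nu> = \<mu>" by blast
    have "npath a \<nu> = h a \<nu> # npath a \<mu>" using npath_Cons[of \<nu>] nodes_level[OF \<nu>(2)] s \<nu>(3) by simp
    moreover have "\<nu> \<in> upset t b" using \<nu> s(1) loc by (auto simp: upset_def)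
    ultimately have "Inr (Up (h a \<nu> # npath a \<mu>) v (loc \<nu>)) \<in> A"
      unfolding A using \<nu>(1) by (auto simp: upmsg_def intro!: image_eqI[of _ _ \<nu>])
    thus "v \<in> {v. \<exists>c fr. Inr (Up (c # npath a \<mu>) v fr) \<in> A}" by blast
  qed
  thus ?thesis unfolding up_val_def using val_Suc[OF \<mu>] by simp
qed

lemma msg_up_J:
  assumes "q < Q" "t < lv"
  shows "msg_up t (J q w) (H b) (jb q w) = upmsg ` {\<nu> \<in> nodes t. loc \<nu> = J q w \<and> loc (par \<nu>) = H b}"
proof (cases t)
  case 0
  \<comment> \<open>Entry 1 of the path belongs to the parent; entry 0 is the leaf itself.\<close>
  have key: "npath a (0, w, q, key i p z) ! 1 = h a (par (0, w, q, key i p z))" for i p z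
    using npath_Cons[of "(0, w, q, key i p z)"] npath_Cons[of "par (0, w, q, key i p z)"] lv_pos
    by (simp add: par_def)
  have locp: "loc (par (0, w, q, c)) = H (h a (par (0, w, q, c)) mod Hr)" for c
    by (simp add: par_def loc_def)
  have mem: "Inl p \<in> jb q w \<longleftrightarrow> p \<in> P \<and> pos p = w" "Inr (Seed s) \<in> jb q w \<longleftrightarrow> s = a"
    "Inr (Cand i) \<in> jb q w \<longleftrightarrow> i \<in> sc q" for p s i
    by (auto simp: jb_def pts_def info_def)
  have up: "Inr (Up (npath a (0, w, q, key i p z)) (if key i p z = key i p (\<lambda>_. 0) then w else W) (J q w))
        = upmsg (node 0 q p i z)" and nd: "node 0 q p i z = (0, w, q, key i p z)"
    if "p \<in> P" "pos p = w" "i \<in> sc q" for p i z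
    using val_level0[OF that(1,3)] that(2) by (simp_all add: upmsg_def node_def loc_def)
  show ?thesis
  proof (intro equalityI subsetI)
    fix x assume "x \<in> msg_up t (J q w) (H b) (jb q w)"
    then obtain p s i z where x: "Inl p \<in> jb q w" "Inr (Seed s) \<in> jb q w" "Inr (Cand i) \<in> jb q w" "z \<in> Off"
      "npath s (0, w, q, key i p z) ! 1 mod Hr = b"
      "x = Inr (Up (npath s (0, w, q, key i p z)) (if key i p z = key i p (\<lambda>_. 0) then w else W) (J q w))"
      using 0 unfolding msg_up_def by auto
    have p: "p \<in> P" "pos p = w" "i \<in> sc q" "s = a" using x(1-3) mem by blast+
    have "node 0 q p i z \<in> nodes t" unfolding nodes_def using p x(4) 0 assms by blast
    moreover have "loc (node 0 q p i z) = J q w" using p by (simp add: loc_def node_def)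
    moreover have "loc (par (node 0 q p i z)) = H b" using x(5) p nd locp key by simp
    moreover have "x = upmsg (node 0 q p i z)" using x(6) p up by simp
    ultimately show "x \<in> upmsg ` {\<nu> \<in> nodes t. loc \<nu> = J q w \<and> loc (par \<nu>) = H b}" by blast
  next
    fix x assume "x \<in> upmsg ` {\<nu> \<in> nodes t. loc \<nu> = J q w \<and> loc (par \<nu>) = H b}"
    then obtain q' p i z where *: "x = upmsg (node 0 q' p i z)" "p \<in> P" "i \<in> sc q'" "z \<in> Off"
      "loc (node 0 q' p i z) = J q w" "loc (par (node 0 q' p i z)) = H b"
      unfolding nodes_def 0 by blast
    have qw: "q' = q" "pos p = w" using *(5) by (simp_all add: loc_def node_def)
    hence "npath a (0, w, q, key i p z) ! 1 mod Hr = b" using *(6) nd[OF *(2)] *(3) locp key by simp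
    moreover have "x = Inr (Up (npath a (0, w, q, key i p z)) (if key i p z = key i p (\<lambda>_. 0) then w else W) (J q w))"
      using up[OF *(2)] *(1,3) qw by simp
    moreover have "Inl p \<in> jb q w" "Inr (Seed a) \<in> jb q w" "Inr (Cand i) \<in> jb q w"
      using mem * qw by auto
    ultimately show "x \<in> msg_up t (J q w) (H b) (jb q w)"
      unfolding msg_up_def using 0 *(4) by (simp only: prod.case addr.case if_True mem_Collect_eq simp_thms) blast
  qed
next
  case (Suc t')
  hence "{\<nu> \<in> nodes t. loc \<nu> = J q w \<and> loc (par \<nu>) = H b} = {}" using loc_Suc by auto
  thus ?thesis using Suc by (simp add: msg_up_def)
qed

lemma msg_up_H:
  assumes "t < lv"
  shows "msg_up t (H b') (H b) (upmsg ` upset t b') = (if b' = b then upmsg ` upset t b' else {})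
     \<union> upmsg ` {\<nu> \<in> nodes t. loc \<nu> = H b' \<and> loc (par \<nu>) = H b}"
proof -
  let ?A = "upmsg ` upset t b'"
  have "{Inr (Up (y # z # zs) (up_val ?A (y # z # zs)) (H b')) |c y z zs v fr.
      Inr (Up (c # y # z # zs) v fr) \<in> ?A \<and> length zs + t + 1 = lv \<and> z mod Hr = b}
      = upmsg ` {\<nu> \<in> nodes t. loc \<nu> = H b' \<and> loc (par \<nu>) = H b}" (is "?X = ?Y")
  proof (intro equalityI subsetI)
    fix x assume "x \<in> ?X"
    then obtain c y z zs v fr \<nu> where x: "x = Inr (Up (y # z # zs) (up_val ?A (y # z # zs)) (H b'))"
      "upmsg \<nu> = Inr (Up (c # y # z # zs) v fr)" "\<nu> \<in> upset t b'" "length zs + t + 1 = lv" "z mod Hr = b"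
      by (smt (verit) imageE mem_Collect_eq)
    obtain s where s: "s < t" "\<nu> \<in> nodes s" "loc (par \<nu>) = H b'" using x(3) by (auto simp: upset_def)
    have path: "npath a \<nu> = c # y # z # zs" using x(2) by (simp add: upmsg_def)
    \<comment> \<open>A node on level \<open>s\<close> has a path of \<open>Suc lv - s\<close>
      entries, so the length condition in \<open>msg_up\<close> picks the reports from level
      \<open>t - 1\<close>.\<close>
    have "Suc lv - s = 3 + length zs" using length_npath[of \<nu>] path nodes_level[OF s(2)] by simp
    hence t: "t = Suc s" using x(4) by linarith
    let ?\<mu> = "par \<nu>"
    have \<mu>: "?\<mu> \<in> nodes t" using par_in[OF s(2)] t by simp
    have pm: "npath a ?\<mu> = y # z # zs"
      using npath_Cons[of \<nu>] nodes_level[OF s(2)] path s(1) assms by simp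
    have ppm: "npath a (par ?\<mu>) = z # zs" "h a (par ?\<mu>) = z"
    proof -
      show 1: "npath a (par ?\<mu>) = z # zs"
        using npath_Cons[of ?\<mu>] nodes_level[OF \<mu>] pm assms by simp
      have "fst (par ?\<mu>) \<le> lv" using nodes_level[OF par_in[OF \<mu>]] assms by simp
      thus "h a (par ?\<mu>) = z" using npath_Cons[of "par ?\<mu>"] 1 by simp
    qed
    have "up_val ?A (npath a ?\<mu>) = val ?\<mu>"
      by (rule up_val_eq[where s = s and t = t]) (use \<mu> t s assms in auto)
    hence "x = upmsg ?\<mu>" using x(1) pm s(3) by (simp add: upmsg_def)
    moreover have "loc (par ?\<mu>) = H b" using loc_Suc[OF par_in[OF \<mu>]] ppm x(5) by simp
    ultimately show "x \<in> ?Y" using \<mu> s(3) by blast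
  next
    fix x assume "x \<in> ?Y"
    then obtain \<mu> where \<mu>: "x = upmsg \<mu>" "\<mu> \<in> nodes t" "loc \<mu> = H b'" "loc (par \<mu>) = H b" by blast
    obtain s where t: "t = Suc s" using \<mu> loc_0[of \<mu>] by (cases t) auto
    obtain \<nu> where \<nu>: "\<nu> \<in> nodes s" "par \<nu> = \<mu>" using par_surj \<mu>(2) t by blast
    have "\<nu> \<in> upset t b'" using \<nu> \<mu>(3) t by (auto simp: upset_def)
    hence in_A: "upmsg \<nu> \<in> ?A" by blast
    have p0: "npath a \<nu> = h a \<nu> # npath a \<mu>" using npath_Cons[of \<nu>] nodes_level[OF \<nu>(1)] \<nu>(2) t assms by simp
    have p1: "npath a \<mu> = h a \<mu> # npath a (par \<mu>)" using npath_Cons[of \<mu>] nodes_level[OF \<mu>(2)] assms by simp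
    have p2: "npath a (par \<mu>) = h a (par \<mu>) # npath a (par (par \<mu>))"
      using npath_Cons[of "par \<mu>"] nodes_level[OF par_in[OF \<mu>(2)]] assms by simp
    let ?zs = "npath a (par (par \<mu>))"
    have len: "length ?zs + t + 1 = lv"
      using length_npath[of "par (par \<mu>)"] nodes_level[OF par_in[OF par_in[OF \<mu>(2)]]] assms by simp
    have "up_val ?A (npath a \<mu>) = val \<mu>"
      by (rule up_val_eq[where s = s and t = t]) (use \<mu> t assms in auto)
    hence "x = Inr (Up (h a \<mu> # h a (par \<mu>) # ?zs) (up_val ?A (h a \<mu> # h a (par \<mu>) # ?zs)) (H b'))"
      using \<mu> p1 p2 by (simp add: upmsg_def)
    moreover have "Inr (Up (h a \<nu> # h a \<mu> # h a (par \<mu>) # ?zs) (val \<nu>) (loc \<nu>)) \<in> ?A"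
      using in_A p0 p1 p2 by (simp add: upmsg_def)
    moreover have "h a (par \<mu>) mod Hr = b" using \<mu>(4) loc_Suc[OF par_in[OF \<mu>(2)]] by simp
    ultimately show "x \<in> ?X" using len by blast
  qed
  thus ?thesis by (simp add: msg_up_def)
qed

end

section \<open>Routing along the hash trees\<close>

context alg_hash
begin

text \<open>Common form of the upward and downward rounds: each node of \<open>N\<close> causes one
  message, and old contents are kept. On the way down, the locations of node and parent exchange
  their roles.\<close>

lemma round_ok_routed:
  assumes iff: "\<And>b j c. b \<in> Ad \<Longrightarrow> j \<in> Ad \<Longrightarrow> c \<in> msg r (x b) b j (C b) \<longleftrightarrow>
      b = j \<and> c \<in> C b \<or> (\<exists>\<nu>\<in>N. src \<nu> = b \<and> dst \<nu> = j \<and> c = f \<nu>)"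
    and C: "\<And>b. finite (C b)" "\<And>b. card (C b) \<le> t0 * B + B"
    and src: "\<And>b. finite {\<nu> \<in> N. src \<nu> = b}" "\<And>b. card {\<nu> \<in> N. src \<nu> = b} \<le> t0 * B + B"
    and dst: "\<And>b. finite {\<nu> \<in> N. dst \<nu> = b}" "\<And>b. card {\<nu> \<in> N. dst \<nu> = b} \<le> t0 * B + B"
    and val: "\<And>b. b \<in> Ad \<Longrightarrow> C b \<subseteq> range Inl \<union> Inr ` Items" "\<And>\<nu>. \<nu> \<in> N \<Longrightarrow> f \<nu> \<in> Inr ` Items"
    and srcAd: "\<And>\<nu>. \<nu> \<in> N \<Longrightarrow> src \<nu> \<in> Ad"
    and C': "\<And>j. C' j = C j \<union> f ` {\<nu> \<in> N. dst \<nu> = j}"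
  shows "round_ok r x C C'"
proof (rule round_okI)
  have capB: "(t0 * B + B) + (t0 * B + B) \<le> cap"
  proof -
    have "(t0 * B + B) + (t0 * B + B) = (2 * t0 + 2) * B" by (simp add: algebra_simps)
    also have "\<dots> \<le> cap" using B_ge(2) by (intro cap_ge(1)) simp
    finally show ?thesis .
  qed
  fix b assume b: "b \<in> Ad"
  let ?Z = "Pair b ` C b \<union> (\<lambda>\<nu>. (dst \<nu>, f \<nu>)) ` {\<nu> \<in> N. src \<nu> = b}"
  show "\<exists>Z. {(j, c). j \<in> Ad \<and> c \<in> msg r (x b) b j (C b)} \<subseteq> Z \<and> finite Z \<and> card Z \<le> cap"
  proof (intro exI conjI)
    show "{(j, c). j \<in> Ad \<and> c \<in> msg r (x b) b j (C b)} \<subseteq> ?Z" using iff[OF b] by auto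
    show "finite ?Z" using C(1) src(1) by blast
    have "card ?Z \<le> card (Pair b ` C b) + card ((\<lambda>\<nu>. (dst \<nu>, f \<nu>)) ` {\<nu> \<in> N. src \<nu> = b})"
      by (rule card_Un_le)
    also have "\<dots> \<le> card (C b) + card {\<nu> \<in> N. src \<nu> = b}"
      using C(1) src(1) by (intro add_mono card_image_le)
    also have "\<dots> \<le> cap" using C(2)[of b] src(2)[of b] capB by linarith
    finally show "card ?Z \<le> cap" .
  qed
  let ?Z' = "Pair b ` C b \<union> (\<lambda>\<nu>. (src \<nu>, f \<nu>)) ` {\<nu> \<in> N. dst \<nu> = b}"
  show "\<exists>Z. {(j, c). j \<in> Ad \<and> c \<in> msg r (x j) j b (C j)} \<subseteq> Z \<and> finite Z \<and> card Z \<le> cap"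
  proof (intro exI conjI)
    show "{(j, c). j \<in> Ad \<and> c \<in> msg r (x j) j b (C j)} \<subseteq> ?Z'" using iff[OF _ b] by auto
    show "finite ?Z'" using C(1) dst(1) by blast
    have "card ?Z' \<le> card (Pair b ` C b) + card ((\<lambda>\<nu>. (src \<nu>, f \<nu>)) ` {\<nu> \<in> N. dst \<nu> = b})"
      by (rule card_Un_le)
    also have "\<dots> \<le> card (C b) + card {\<nu> \<in> N. dst \<nu> = b}"
      using C(1) dst(1) by (intro add_mono card_image_le)
    also have "\<dots> \<le> cap" using C(2)[of b] dst(2)[of b] capB by linarith
    finally show "card ?Z' \<le> cap" .
  qed
next
  fix b j assume bj: "b \<in> Ad" "j \<in> Ad"
  show "msg r (x b) b j (C b) \<subseteq> C b \<inter> range Inl \<union> Inr ` Items"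
  proof
    fix c assume "c \<in> msg r (x b) b j (C b)"
    then consider "c \<in> C b" | \<nu> where "\<nu> \<in> N" "c = f \<nu>" using iff[OF bj] by blast
    thus "c \<in> C b \<inter> range Inl \<union> Inr ` Items"
      by cases (use val(1)[OF bj(1)] val(2) in blast)+
  qed
next
  fix j assume j: "j \<in> Ad"
  show "(\<Union>b\<in>Ad. msg r (x b) b j (C b)) = C' j"
  proof (intro equalityI subsetI)
    fix c assume "c \<in> (\<Union>b\<in>Ad. msg r (x b) b j (C b))"
    then obtain b where "b \<in> Ad" "c \<in> msg r (x b) b j (C b)" by blast
    thus "c \<in> C' j" using iff[OF _ j] unfolding C' by blast
  next
    fix c assume "c \<in> C' j"
    then consider "c \<in> C j" | \<nu> where "\<nu> \<in> N" "dst \<nu> = j" "c = f \<nu>" unfolding C' by blast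
    thus "c \<in> (\<Union>b\<in>Ad. msg r (x b) b j (C b))"
    proof cases
      case 1 thus ?thesis using iff[OF j j] j by blast
    next
      case 2 thus ?thesis using iff[OF srcAd[OF 2(1)] j] srcAd[OF 2(1)] by blast
    qed
  qed
qed

lemma loc_par: "\<exists>b. loc (par \<nu>) = H b"
  by (cases \<nu>) (simp add: par_def loc_def)

lemma loc_JH: "(\<exists>q w. loc \<nu> = J q w) \<or> (\<exists>b. loc \<nu> = H b)"
  by (cases \<nu>) (simp add: loc_def)

lemma jb_props: "finite (jb q w)" "card (jb q w) \<le> 3" "q < Q \<Longrightarrow> jb q w \<subseteq> range Inl \<union> Inr ` Items"
  using card_pts_info[of w q] info_valid[of q] by (auto simp: jb_def pts_def)

lemma upmsg_valid: "\<nu> \<in> nodes t \<Longrightarrow> upmsg \<nu> \<in> Inr ` Items"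
  using npath_set[of \<nu> t] length_npath[of \<nu>] val_le[of \<nu>] loc_Ad[of \<nu> t] by (simp add: upmsg_def)

lemma small_B: "card Off + t0 \<le> B" "c \<le> 96 \<Longrightarrow> c \<le> t0 * B + B"
  using B_ge by auto

lemma cfgU_props: "t \<le> lv \<Longrightarrow> finite (cfgU t b)" "t \<le> lv \<Longrightarrow> card (cfgU t b) \<le> t0 * B + B"
  "t \<le> lv \<Longrightarrow> b \<in> Ad \<Longrightarrow> cfgU t b \<subseteq> range Inl \<union> Inr ` Items"
proof -
  assume t: "t \<le> lv"
  show "finite (cfgU t b)" using jb_props finite_upset by (auto simp: cfgU_def split: addr.splits)
  have "card (upmsg ` upset t b') \<le> t0 * B" for b'
    using card_image_le[OF finite_upset, of upmsg t b'] card_upset[OF t, of b'] by linarith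
  hence "card (upmsg ` upset t b') \<le> t0 * B + B" for b' by (meson le_add1 order_trans)
  moreover have "card (jb q w) \<le> t0 * B + B" for q w using jb_props(2)[of q w] small_B(2)[of 3] by linarith
  ultimately show "card (cfgU t b) \<le> t0 * B + B" by (simp add: cfgU_def split: addr.splits)
  assume b: "b \<in> Ad"
  have "upmsg ` upset t b' \<subseteq> Inr ` Items" for b' using upmsg_valid by (auto simp: upset_def)
  thus "cfgU t b \<subseteq> range Inl \<union> Inr ` Items"
    using b jb_props(3) by (cases b) (auto simp: cfgU_def)
qed

lemma msg_up_iff:
  assumes t: "t < lv" and b: "b \<in> Ad" and j: "j \<in> Ad"
  shows "c \<in> msg_up t b j (cfgU t b) \<longleftrightarrow>
      b = j \<and> c \<in> cfgU t b \<or> (\<exists>\<nu>\<in>nodes t. loc \<nu> = b \<and> loc (par \<nu>) = j \<and> c = upmsg \<nu>)"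
proof (cases j)
  case (H z)
  show ?thesis
  proof (cases b)
    case (J q w)
    hence "msg_up t b j (cfgU t b) = upmsg ` {\<nu> \<in> nodes t. loc \<nu> = b \<and> loc (par \<nu>) = j}"
      using msg_up_J[OF _ t, of q w z] b H by (simp add: cfgU_def)
    thus ?thesis using J H by auto
  next
    case (H z')
    hence "msg_up t b j (cfgU t b) = (if b = j then cfgU t b else {})
        \<union> upmsg ` {\<nu> \<in> nodes t. loc \<nu> = b \<and> loc (par \<nu>) = j}"
      using msg_up_H[OF t, of z' z] \<open>j = H z\<close> by (simp add: cfgU_def)
    thus ?thesis by auto
  next
    case (V b' l)
    thus ?thesis using H loc_JH by (auto simp: msg_up_def cfgU_def) (metis addr.distinct)+
  next
    case (K b')
    thus ?thesis using H loc_JH by (auto simp: msg_up_def cfgU_def) (metis addr.distinct)+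
  next
    case (Idle b')
    thus ?thesis using H loc_JH by (auto simp: msg_up_def cfgU_def) (metis addr.distinct)+
  qed
next
  case (J q w)
  have "loc (par \<nu>) \<noteq> j" for \<nu> using loc_par[of \<nu>] J by auto
  thus ?thesis using J by (cases b) (auto simp: msg_up_def cfgU_def)
next
  case (V b' l)
  have "loc (par \<nu>) \<noteq> j" for \<nu> using loc_par[of \<nu>] V by auto
  thus ?thesis using V by (cases b) (auto simp: msg_up_def cfgU_def)
next
  case (K b')
  have "loc (par \<nu>) \<noteq> j" for \<nu> using loc_par[of \<nu>] K by auto
  thus ?thesis using K by (cases b) (auto simp: msg_up_def cfgU_def)
next
  case (Idle b')
  have "loc (par \<nu>) \<noteq> j" for \<nu> using loc_par[of \<nu>] Idle by auto
  thus ?thesis using Idle by (cases b) (auto simp: msg_up_def cfgU_def)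
qed

lemma card_srcs: "finite {\<nu>. P' \<nu> \<and> (\<exists>s<lv. \<nu> \<in> nodes s) \<and> loc \<nu> = b}"
  "card {\<nu>. P' \<nu> \<and> (\<exists>s<lv. \<nu> \<in> nodes s) \<and> loc \<nu> = b} \<le> t0 * B + B"
proof -
  have sub: "{\<nu>. P' \<nu> \<and> (\<exists>s<lv. \<nu> \<in> nodes s) \<and> loc \<nu> = b} \<subseteq> locset b" by (auto simp: locset_def)
  show "finite {\<nu>. P' \<nu> \<and> (\<exists>s<lv. \<nu> \<in> nodes s) \<and> loc \<nu> = b}" by (rule finite_subset[OF sub finite_locset])
  show "card {\<nu>. P' \<nu> \<and> (\<exists>s<lv. \<nu> \<in> nodes s) \<and> loc \<nu> = b} \<le> t0 * B + B"
    using card_mono[OF finite_locset sub] card_locset[of b] small_B(1) by linarith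
qed

lemma card_dsts: "finite {\<nu>. P' \<nu> \<and> (\<exists>s<lv. \<nu> \<in> nodes s) \<and> loc (par \<nu>) = b}"
  "card {\<nu>. P' \<nu> \<and> (\<exists>s<lv. \<nu> \<in> nodes s) \<and> loc (par \<nu>) = b} \<le> t0 * B + B"
proof -
  have "\<exists>b'. {\<nu>. P' \<nu> \<and> (\<exists>s<lv. \<nu> \<in> nodes s) \<and> loc (par \<nu>) = b} \<subseteq> upset lv b'"
  proof (cases "\<exists>b'. b = H b'")
    case False
    hence "{\<nu>. P' \<nu> \<and> (\<exists>s<lv. \<nu> \<in> nodes s) \<and> loc (par \<nu>) = b} = {}" using loc_par by blast
    thus ?thesis by blast
  next
    case True
    then obtain b' where "b = H b'" by blast
    thus ?thesis by (intro exI[of _ b']) (auto simp: upset_def)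
  qed
  then obtain b' where sub: "{\<nu>. P' \<nu> \<and> (\<exists>s<lv. \<nu> \<in> nodes s) \<and> loc (par \<nu>) = b} \<subseteq> upset lv b'" by blast
  show "finite {\<nu>. P' \<nu> \<and> (\<exists>s<lv. \<nu> \<in> nodes s) \<and> loc (par \<nu>) = b}" by (rule finite_subset[OF sub finite_upset])
  show "card {\<nu>. P' \<nu> \<and> (\<exists>s<lv. \<nu> \<in> nodes s) \<and> loc (par \<nu>) = b} \<le> t0 * B + B"
    using card_mono[OF finite_upset sub] card_upset[of lv b'] by linarith
qed

lemma round_up:
  assumes t: "t < lv"
  shows "round_ok (T3 + t) x (cfgU t) (cfgU (Suc t))"
proof (rule round_ok_routed[where N = "nodes t" and src = loc and dst = "\<lambda>\<nu>. loc (par \<nu>)" and f = upmsg])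
  have msg: "msg (T3 + t) y = msg_up t" for y using t by (simp add: msg_def T3_def T2_def T4_def)
  show "c \<in> msg (T3 + t) (x b) b j (cfgU t b) \<longleftrightarrow>
      b = j \<and> c \<in> cfgU t b \<or> (\<exists>\<nu>\<in>nodes t. loc \<nu> = b \<and> loc (par \<nu>) = j \<and> c = upmsg \<nu>)"
    if "b \<in> Ad" "j \<in> Ad" for b j c unfolding msg by (rule msg_up_iff[OF t that])
  have s: "{\<nu> \<in> nodes t. loc \<nu> = b} = {\<nu>. \<nu> \<in> nodes t \<and> (\<exists>s<lv. \<nu> \<in> nodes s) \<and> loc \<nu> = b}"
   and d: "{\<nu> \<in> nodes t. loc (par \<nu>) = b} = {\<nu>. \<nu> \<in> nodes t \<and> (\<exists>s<lv. \<nu> \<in> nodes s) \<and> loc (par \<nu>) = b}" for b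
    using t by auto
  show "finite {\<nu> \<in> nodes t. loc \<nu> = b}" "card {\<nu> \<in> nodes t. loc \<nu> = b} \<le> t0 * B + B"
    "finite {\<nu> \<in> nodes t. loc (par \<nu>) = b}" "card {\<nu> \<in> nodes t. loc (par \<nu>) = b} \<le> t0 * B + B" for b
    unfolding s d by (rule card_srcs card_dsts)+
  show "cfgU (Suc t) j = cfgU t j \<union> upmsg ` {\<nu> \<in> nodes t. loc (par \<nu>) = j}" for j
  proof (cases "\<exists>b. j = H b")
    case True
    then obtain b where "j = H b" by blast
    thus ?thesis by (auto simp: cfgU_def upset_def less_Suc_eq)
  next
    case False
    hence "{\<nu> \<in> nodes t. loc (par \<nu>) = j} = {}" using loc_par by blast
    thus ?thesis using False by (auto simp: cfgU_def split: addr.splits)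
  qed
qed (use cfgU_props t upmsg_valid loc_Ad in auto)

subsection \<open>Broadcasting the results of the hash trees\<close>

text \<open>The root has prefix 0 because positions are below \<open>W = B ^ lv\<close>.\<close>

definition fin :: "nat \<Rightarrow> ('d \<Rightarrow> int) \<Rightarrow> nat" where "fin q c = val (lv, 0, q, c)"

definition res :: "'d node \<Rightarrow> nat" where "res = (\<lambda>(t, g, q, c). fin q c)"

definition downmsg :: "'d node \<Rightarrow> (real ^ 'd) + item" where
  "downmsg \<nu> = Inr (Down (h a \<nu>) (res \<nu>))"

text \<open>The nodes that know their answer after \<open>t\<close> rounds downwards: those on the
  \<open>t\<close> levels below the root.\<close>

definition dset :: "nat \<Rightarrow> 'd node set" where
  "dset t = {\<nu>. lv \<le> fst \<nu> + t \<and> (\<exists>s<lv. \<nu> \<in> nodes s)}"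

definition "cfgD t x = cfgU lv x \<union> downmsg ` {\<nu> \<in> dset t. loc \<nu> = x}"

lemma res_par: "res (par \<nu>) = res \<nu>" by (cases \<nu>) (simp add: res_def par_def)

lemma fin_le: "fin q c \<le> W" unfolding fin_def by (rule val_le)

lemma downmsg_valid: "\<nu> \<in> nodes t \<Longrightarrow> t \<le> lv \<Longrightarrow> downmsg \<nu> \<in> Inr ` Items"
  using h_less[of \<nu>] nodes_all[of \<nu> t] fin_le by (cases \<nu>) (simp add: downmsg_def res_def)

lemma val_top: "\<mu> \<in> nodes lv \<Longrightarrow> val \<mu> = res \<mu>"
  using pos_less by (auto simp: nodes_def node_def res_def fin_def W_def)

lemma dset_bounds: "finite {\<nu> \<in> dset t. loc \<nu> = b}" "card {\<nu> \<in> dset t. loc \<nu> = b} \<le> card Off + t0"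
proof -
  have sub: "{\<nu> \<in> dset t. loc \<nu> = b} \<subseteq> locset b" by (auto simp: dset_def locset_def)
  show "finite {\<nu> \<in> dset t. loc \<nu> = b}" by (rule finite_subset[OF sub finite_locset])
  show "card {\<nu> \<in> dset t. loc \<nu> = b} \<le> card Off + t0"
    using card_mono[OF finite_locset sub] card_locset[of b] by linarith
qed

lemma cfgD_props: "finite (cfgD t b)" "card (cfgD t b) \<le> t0 * B + B"
  "b \<in> Ad \<Longrightarrow> cfgD t b \<subseteq> range Inl \<union> Inr ` Items"
proof -
  show "finite (cfgD t b)" using cfgU_props(1) dset_bounds(1) by (simp add: cfgD_def)
  have "card (cfgU lv b) \<le> t0 * B + 3"
  proof -
    have "card (upmsg ` upset lv b') \<le> t0 * B + 3" for b'
      using card_image_le[OF finite_upset, of upmsg lv b'] card_upset[of lv b'] by linarith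
    moreover have "card (jb q w) \<le> t0 * B + 3" for q w using jb_props(2)[of q w] by linarith
    ultimately show ?thesis by (simp add: cfgU_def split: addr.splits)
  qed
  moreover have "card (downmsg ` {\<nu> \<in> dset t. loc \<nu> = b}) \<le> card Off + t0"
    using card_image_le[OF dset_bounds(1)[of t b], of downmsg] dset_bounds(2)[of t b] by linarith
  moreover have "card Off + t0 + 3 \<le> B" using B_ge(2,3) by simp
  ultimately show "card (cfgD t b) \<le> t0 * B + B"
    unfolding cfgD_def
    using card_Un_le[of "cfgU lv b" "downmsg ` {\<nu> \<in> dset t. loc \<nu> = b}"] by linarith
  assume "b \<in> Ad"
  moreover have "downmsg ` {\<nu> \<in> dset t. loc \<nu> = b} \<subseteq> Inr ` Items"
    using downmsg_valid by (force simp: dset_def)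
  ultimately show "cfgD t b \<subseteq> range Inl \<union> Inr ` Items"
    using cfgU_props(3)[of lv b] by (auto simp: cfgD_def)
qed

lemma upset_mem: "Inr (Up xs v fr) \<in> cfgD t (H b) \<longleftrightarrow> Inr (Up xs v fr) \<in> upmsg ` upset lv b"
  by (auto simp: cfgD_def cfgU_def downmsg_def)

lemma down_mem: "Inr (Down c r) \<in> cfgD t (H b) \<longleftrightarrow> Inr (Down c r) \<in> downmsg ` {\<nu> \<in> dset t. loc \<nu> = H b}"
  by (auto simp: cfgD_def cfgU_def upmsg_def)

text \<open>Answers arise in two ways, treated separately: from the root itself for nodes on level
  \<open>lv - 1\<close>, and by passing on an answer known for the parent. Answers sent earlier are
  sent again, which does not change a set.\<close>

lemma msg_down_H:
  assumes t: "t < lv"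
  shows "c \<in> msg_down (H b) j (cfgD t (H b)) \<longleftrightarrow>
      H b = j \<and> c \<in> cfgD t (H b) \<or> (\<exists>\<nu>\<in>dset (Suc t). loc (par \<nu>) = H b \<and> loc \<nu> = j \<and> c = downmsg \<nu>)"
proof -
  let ?A = "cfgD t (H b)"
  have top: "(\<exists>c' x v. c = Inr (Down c' (up_val ?A [x])) \<and> Inr (Up [c', x] v j) \<in> ?A) \<longleftrightarrow>
      (\<exists>\<nu>\<in>nodes (lv - 1). loc (par \<nu>) = H b \<and> loc \<nu> = j \<and> c = downmsg \<nu>)" (is "?l = ?r")
  proof
    assume ?l
    then obtain c' x v \<nu> where *: "c = Inr (Down c' (up_val ?A [x]))" "Inr (Up [c', x] v j) = upmsg \<nu>" "\<nu> \<in> upset lv b"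
      unfolding upset_mem by auto
    obtain s where s: "s < lv" "\<nu> \<in> nodes s" "loc (par \<nu>) = H b" using *(3) by (auto simp: upset_def)
    have path: "npath a \<nu> = [c', x]" "loc \<nu> = j" using *(2) by (auto simp: upmsg_def)
    \<comment> \<open>The two entries are the node and the root, so the node is on level
      \<open>lv - 1\<close>.\<close>
    have "Suc lv - s = 2" using length_npath[of \<nu>] path nodes_level[OF s(2)] by simp
    hence slv: "s = lv - 1" "Suc s = lv" by linarith+
    have \<mu>: "par \<nu> \<in> nodes (Suc s)" by (rule par_in[OF s(2)])
    have p: "npath a (par \<nu>) = [x]" "c' = h a \<nu>"
      using npath_Cons[of \<nu>] path nodes_level[OF s(2)] s(1) by auto
    have "up_val ?A (npath a (par \<nu>)) = val (par \<nu>)"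
      by (rule up_val_eq[OF \<mu> s(1) le_refl s(3)]) (rule upset_mem)
    also have "\<dots> = res \<nu>" using val_top \<mu> slv(2) res_par by simp
    finally have "c = downmsg \<nu>" using *(1) p by (simp add: downmsg_def)
    thus ?r using s slv path(2) by blast
  next
    assume ?r
    then obtain \<nu> where \<nu>: "\<nu> \<in> nodes (lv - 1)" "loc (par \<nu>) = H b" "loc \<nu> = j" "c = downmsg \<nu>" by blast
    have s: "lv - 1 < lv" "Suc (lv - 1) = lv" using lv_pos by auto
    have \<mu>: "par \<nu> \<in> nodes (Suc (lv - 1))" by (rule par_in[OF \<nu>(1)])
    have pm: "npath a (par \<nu>) = [h a (par \<nu>)]"
      using npath_Cons[of "par \<nu>"] nodes_level[OF \<mu>] s npath_Nil[of "par (par \<nu>)"]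
        nodes_level[OF par_in[OF \<mu>]] by simp
    have "up_val ?A (npath a (par \<nu>)) = val (par \<nu>)"
      by (rule up_val_eq[OF \<mu> s(1) le_refl \<nu>(2)]) (rule upset_mem)
    also have "\<dots> = res \<nu>" using val_top \<mu> s(2) res_par by simp
    finally have "c = Inr (Down (h a \<nu>) (up_val ?A [h a (par \<nu>)]))" using \<nu>(4) pm by (simp add: downmsg_def)
    moreover have "Inr (Up [h a \<nu>, h a (par \<nu>)] (val \<nu>) j) \<in> ?A"
    proof -
      have "\<nu> \<in> upset lv b" using \<nu> s(1) by (auto simp: upset_def)
      moreover have "upmsg \<nu> = Inr (Up [h a \<nu>, h a (par \<nu>)] (val \<nu>) j)"
        using npath_Cons[of \<nu>] nodes_level[OF \<nu>(1)] pm \<nu>(3) by (simp add: upmsg_def)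
      ultimately show ?thesis unfolding upset_mem by (metis imageI)
    qed
    ultimately show ?l by blast
  qed
  have rest: "(\<exists>c' x zs v r. c = Inr (Down c' r) \<and> Inr (Up (c' # x # zs) v j) \<in> ?A \<and> Inr (Down x r) \<in> ?A) \<longleftrightarrow>
      (\<exists>\<nu>. (\<exists>s. Suc s < lv \<and> \<nu> \<in> nodes s \<and> lv \<le> Suc s + t) \<and> loc (par \<nu>) = H b \<and> loc \<nu> = j \<and> c = downmsg \<nu>)"
    (is "?l = ?r")
  proof
    assume ?l
    then obtain c' x zs v r \<nu> \<mu> where *: "c = Inr (Down c' r)" "Inr (Up (c' # x # zs) v j) = upmsg \<nu>"
      "\<nu> \<in> upset lv b" "Inr (Down x r) = downmsg \<mu>" "\<mu> \<in> dset t" "loc \<mu> = H b"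
      unfolding upset_mem down_mem by auto
    obtain s where s: "s < lv" "\<nu> \<in> nodes s" "loc (par \<nu>) = H b" using *(3) by (auto simp: upset_def)
    have path: "npath a \<nu> = c' # x # zs" "loc \<nu> = j" using *(2) by (auto simp: upmsg_def)
    have c': "c' = h a \<nu>" "npath a (par \<nu>) = x # zs"
      using npath_Cons[of \<nu>] path nodes_level[OF s(2)] s(1) by auto
    have pn: "par \<nu> \<in> nodes (Suc s)" by (rule par_in[OF s(2)])
    have x: "x = h a (par \<nu>)" using npath_Cons[of "par \<nu>"] c' nodes_level[OF pn] s(1) by simp
    obtain s' where s': "s' < lv" "\<mu> \<in> nodes s'" using *(5) by (auto simp: dset_def)
    have s't: "lv \<le> s' + t" using *(5) nodes_level[OF s'(2)] by (simp add: dset_def)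
    have "h a (par \<nu>) = h a \<mu>" "r = res \<mu>" using *(4) x by (auto simp: downmsg_def)
    hence \<mu>: "par \<nu> = \<mu>" using h_eq[OF pn s'(2)] s(1) s'(1) by simp
    hence "s' = Suc s" using nodes_level[OF pn] nodes_level[OF s'(2)] by simp
    moreover have "c = downmsg \<nu>" using *(1) c'(1) \<open>r = res \<mu>\<close> \<mu> res_par[of \<nu>] by (simp add: downmsg_def)
    ultimately show ?r using s s' s't path(2) by blast
  next
    assume ?r
    then obtain \<nu> s where \<nu>: "Suc s < lv" "\<nu> \<in> nodes s" "lv \<le> Suc s + t" "loc (par \<nu>) = H b" "loc \<nu> = j" "c = downmsg \<nu>"
      by blast
    have pn: "par \<nu> \<in> nodes (Suc s)" by (rule par_in[OF \<nu>(2)])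
    have "npath a \<nu> = h a \<nu> # h a (par \<nu>) # npath a (par (par \<nu>))"
      using npath_Cons[of \<nu>] npath_Cons[of "par \<nu>"] nodes_level[OF \<nu>(2)] nodes_level[OF pn] \<nu>(1) by simp
    hence "upmsg \<nu> = Inr (Up (h a \<nu> # h a (par \<nu>) # npath a (par (par \<nu>))) (val \<nu>) j)"
      using \<nu>(5) by (simp add: upmsg_def)
    moreover have "\<nu> \<in> upset lv b" unfolding upset_def using \<nu>(1,2,4) Suc_lessD by blast
    ultimately have 1: "Inr (Up (h a \<nu> # h a (par \<nu>) # npath a (par (par \<nu>))) (val \<nu>) j) \<in> ?A"
      unfolding upset_mem by (metis imageI)
    have "par \<nu> \<in> dset t" unfolding dset_def using pn \<nu>(1,3) nodes_level[OF pn] by auto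
    moreover have "downmsg (par \<nu>) = Inr (Down (h a (par \<nu>)) (res \<nu>))" by (simp add: downmsg_def res_par)
    ultimately have 2: "Inr (Down (h a (par \<nu>)) (res \<nu>)) \<in> ?A"
      unfolding down_mem using \<nu>(4) by (auto intro!: image_eqI[of _ _ "par \<nu>"])
    have "c = Inr (Down (h a \<nu>) (res \<nu>))" using \<nu>(6) by (simp add: downmsg_def)
    thus ?l using 1 2 by blast
  qed
  have dS: "\<nu> \<in> dset (Suc t) \<longleftrightarrow> \<nu> \<in> nodes (lv - 1) \<or> (\<exists>s. Suc s < lv \<and> \<nu> \<in> nodes s \<and> lv \<le> Suc s + t)" for \<nu>
  proof
    assume "\<nu> \<in> dset (Suc t)"
    then obtain s where s0: "s < lv" "\<nu> \<in> nodes s" "lv \<le> fst \<nu> + Suc t" unfolding dset_def by blast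
    hence s: "s < lv" "\<nu> \<in> nodes s" "lv \<le> s + Suc t" using nodes_level[OF s0(2)] by simp_all
    show "\<nu> \<in> nodes (lv - 1) \<or> (\<exists>s. Suc s < lv \<and> \<nu> \<in> nodes s \<and> lv \<le> Suc s + t)"
    proof (cases "Suc s = lv")
      case True
      hence "s = lv - 1" by simp
      thus ?thesis using s by blast
    next
      case False
      hence "Suc s < lv" "lv \<le> Suc s + t" using s by auto
      thus ?thesis using s by blast
    qed
  next
    assume "\<nu> \<in> nodes (lv - 1) \<or> (\<exists>s. Suc s < lv \<and> \<nu> \<in> nodes s \<and> lv \<le> Suc s + t)"
    then obtain s where s: "s < lv" "\<nu> \<in> nodes s" "lv \<le> s + Suc t"
    proof
      assume "\<nu> \<in> nodes (lv - 1)"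
      thus ?thesis using that[of "lv - 1"] lv_pos by simp
    next
      assume "\<exists>s. Suc s < lv \<and> \<nu> \<in> nodes s \<and> lv \<le> Suc s + t"
      then obtain s1 where "Suc s1 < lv" "\<nu> \<in> nodes s1" "lv \<le> Suc s1 + t" by blast
      thus ?thesis using that[of s1] by simp
    qed
    thus "\<nu> \<in> dset (Suc t)" using nodes_level[OF s(2)] by (auto simp: dset_def)
  qed
  have "c \<in> msg_down (H b) j ?A \<longleftrightarrow> H b = j \<and> c \<in> ?A \<or>
      (\<exists>c' x v. c = Inr (Down c' (up_val ?A [x])) \<and> Inr (Up [c', x] v j) \<in> ?A) \<or>
      (\<exists>c' x zs v r. c = Inr (Down c' r) \<and> Inr (Up (c' # x # zs) v j) \<in> ?A \<and> Inr (Down x r) \<in> ?A)"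
    unfolding msg_down_def addr.case Un_iff mem_Collect_eq by (cases "j = H b") (simp_all add: eq_commute)
  also have "\<dots> \<longleftrightarrow> H b = j \<and> c \<in> ?A \<or> (\<exists>\<nu>\<in>dset (Suc t). loc (par \<nu>) = H b \<and> loc \<nu> = j \<and> c = downmsg \<nu>)"
    unfolding top rest Bex_def dS by blast
  finally show ?thesis .
qed

lemma round_down:
  assumes t: "t < lv"
  shows "round_ok (T4 + t) x (cfgD t) (cfgD (Suc t))"
proof (rule round_ok_routed[where N = "dset (Suc t)" and src = "\<lambda>\<nu>. loc (par \<nu>)" and dst = loc and f = downmsg])
  have msg: "msg (T4 + t) y = msg_down" for y using t by (simp add: msg_def T3_def T2_def T4_def T5_def)
  show "c \<in> msg (T4 + t) (x b) b j (cfgD t b) \<longleftrightarrow>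
      b = j \<and> c \<in> cfgD t b \<or> (\<exists>\<nu>\<in>dset (Suc t). loc (par \<nu>) = b \<and> loc \<nu> = j \<and> c = downmsg \<nu>)"
    if "b \<in> Ad" "j \<in> Ad" for b j c
  proof (cases "\<exists>b'. b = H b'")
    case True
    thus ?thesis unfolding msg using msg_down_H[OF t] by auto
  next
    case False
    hence "loc (par \<nu>) \<noteq> b" for \<nu> using loc_par[of \<nu>] by auto
    moreover have "cfgD t b = {}" if "\<And>q w. b \<noteq> J q w"
      using loc_JH False that by (cases b) (auto simp: cfgD_def cfgU_def, (metis addr.distinct)+)
    ultimately show ?thesis unfolding msg msg_down_def using False by (cases b) auto
  qed
  have s: "{\<nu> \<in> dset (Suc t). loc \<nu> = b} = {\<nu>. \<nu> \<in> dset (Suc t) \<and> (\<exists>s<lv. \<nu> \<in> nodes s) \<and> loc \<nu> = b}"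
   and d: "{\<nu> \<in> dset (Suc t). loc (par \<nu>) = b} = {\<nu>. \<nu> \<in> dset (Suc t) \<and> (\<exists>s<lv. \<nu> \<in> nodes s) \<and> loc (par \<nu>) = b}" for b
    by (auto simp: dset_def)
  show "finite {\<nu> \<in> dset (Suc t). loc \<nu> = b}" "card {\<nu> \<in> dset (Suc t). loc \<nu> = b} \<le> t0 * B + B"
    "finite {\<nu> \<in> dset (Suc t). loc (par \<nu>) = b}" "card {\<nu> \<in> dset (Suc t). loc (par \<nu>) = b} \<le> t0 * B + B" for b
    unfolding s d by (rule card_srcs card_dsts)+
  have "dset t \<subseteq> dset (Suc t)" by (auto simp: dset_def)
  thus "cfgD (Suc t) j = cfgD t j \<union> downmsg ` {\<nu> \<in> dset (Suc t). loc \<nu> = j}" for j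
    by (auto simp: cfgD_def)
  show "downmsg \<nu> \<in> Inr ` Items" if "\<nu> \<in> dset (Suc t)" for \<nu>
    using that downmsg_valid less_imp_le unfolding dset_def by blast
  show "loc (par \<nu>) \<in> Ad" if "\<nu> \<in> dset (Suc t)" for \<nu>
    using that loc_Ad par_in unfolding dset_def by blast
qed (use cfgD_props in auto)

end

lemma Min_Min:
  fixes Y :: "'g \<Rightarrow> nat set"
  assumes fin: "finite (\<Union>g\<in>G. Y g)" and ne: "(\<Union>g\<in>G. Y g) \<noteq> {}"
  shows "Min {Min (Y g) |g. g \<in> G \<and> Y g \<noteq> {}} = Min (\<Union>g\<in>G. Y g)"
proof (rule Min_eqI)
  have finY: "finite (Y g)" if "g \<in> G" for g using finite_subset[OF _ fin] that by blast
  have "Min (Y g) \<in> (\<Union>g\<in>G. Y g)" if "g \<in> G" "Y g \<noteq> {}" for g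
    using Min_in[OF finY[OF that(1)] that(2)] that(1) by blast
  hence sub: "{Min (Y g) |g. g \<in> G \<and> Y g \<noteq> {}} \<subseteq> (\<Union>g\<in>G. Y g)" by blast
  show "finite {Min (Y g) |g. g \<in> G \<and> Y g \<noteq> {}}" by (rule finite_subset[OF sub fin])
  show "Min (\<Union>g\<in>G. Y g) \<le> y" if "y \<in> {Min (Y g) |g. g \<in> G \<and> Y g \<noteq> {}}" for y
    using subsetD[OF sub that] fin by simp
  obtain g where g: "g \<in> G" "Min (\<Union>g\<in>G. Y g) \<in> Y g" using Min_in[OF fin ne] by blast
  have "Min (Y g) = Min (\<Union>g\<in>G. Y g)"
    by (rule Min_eqI) (use g finY fin in \<open>auto intro!: Min_le\<close>)
  thus "Min (\<Union>g\<in>G. Y g) \<in> {Min (Y g) |g. g \<in> G \<and> Y g \<noteq> {}}" using g by force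
qed

lemma mod_eq_close:
  fixes x y m :: int
  assumes "x mod m = y mod m" "\<bar>x - y\<bar> < m"
  shows "x = y"
proof (rule ccontr)
  assume "x \<noteq> y"
  have "m dvd x - y" using assms(1) by (simp add: mod_eq_dvd_iff)
  hence "\<bar>m\<bar> \<le> \<bar>x - y\<bar>" using \<open>x \<noteq> y\<close> dvd_imp_le_int[of "x - y" m] by simp
  thus False using assms(2) by linarith
qed

context alg_hash
begin

text \<open>For the end of the tree phase: the bucket machines send nothing, not even to themselves,
  and thereby clear their memories.\<close>

lemma round_ok_restrict:
  assumes "round_ok r x (onJ f) C'" "\<And>q w. C (J q w) = f q w"
    and "\<And>x b j A. (\<And>q w. b \<noteq> J q w) \<Longrightarrow> msg r x b j A = {}"
  shows "round_ok r x C C'"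
proof -
  have sent: "msg r (x b) b j (C b) = msg r (x b) b j (onJ f b)" for b j
    using assms(2,3) by (cases b) auto
  have val: "msg r (x b) b j (onJ f b) \<subseteq> C b \<inter> range Inl \<union> Inr ` Items"
    if "msg r (x b) b j (onJ f b) \<subseteq> onJ f b \<inter> range Inl \<union> Inr ` Items" for b j
    using that assms(2) by (cases b) auto
  have so: "step_ok r x (onJ f)" and su: "\<forall>j\<in>Ad. succ_conf r x (onJ f) j = C' j"
    using assms(1) by (simp_all add: round_ok_def)
  have "step_ok r x C"
    using so unfolding step_ok_def sent by (elim conjE, intro conjI) (assumption | intro ballI val, simp)+
  moreover have "\<forall>j\<in>Ad. succ_conf r x C j = C' j"
    using su unfolding succ_conf_def sent .
  ultimately show ?thesis by (simp add: round_ok_def)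
qed

subsection \<open>Selecting points at every candidate scale\<close>

text \<open>The set that the messages are to compute: from every selected cell the point with the
  smallest position.\<close>

definition F' :: "nat \<Rightarrow> (real ^ 'd) set" where
  "F' q = {p \<in> P. q < Q \<and> (\<exists>i\<in>sc q. pos p = fin q (key i p (\<lambda>_. 0)) \<and> cell i p \<in> sel (cell i ` P))}"

lemma F'_subset: "F' q \<subseteq> P" by (auto simp: F'_def)

lemma finite_F': "finite (F' q)" using F'_subset finP finite_subset by blast

lemma rad_less: "2 ^ L + 1 + int rad < 2 ^ kb"
proof -
  have "(3::nat) ^ CARD('d) \<ge> 1" by simp
  hence "rad \<ge> 2" unfolding rad_def by linarith
  then obtain r where r: "rad = Suc (Suc r)" by (metis add_2_eq_Suc le_Suc_ex)
  have "int r < 2 ^ r" by (simp add: of_nat_less_two_power)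
  moreover have "(1::int) \<le> 2 ^ r" by simp
  ultimately have "int (Suc (Suc r)) + 1 < 2 * (2 * 2 ^ r)" by (simp only: of_nat_Suc)
  hence "int rad + 1 < 2 * (2 * 2 ^ r)" by (simp only: r)
  also have "\<dots> = 2 ^ rad" using r by simp
  also have "\<dots> \<le> 2 ^ L * 2 ^ rad" by simp
  finally have "int rad + 1 < 2 ^ L * 2 ^ rad" .
  moreover have "(2::int) ^ L \<le> 2 ^ L * 2 ^ rad" by simp
  moreover have "(2::int) ^ kb = 2 ^ L * 2 ^ rad + 2 ^ L * 2 ^ rad" by (simp add: kb_def power_add)
  ultimately show ?thesis by linarith
qed

text \<open>Cells of input points differ by at most \<open>2 ^ L + 1\<close> and the offset adds at
  most \<open>rad\<close>, in total less than the modulus; so residues determine the cell.\<close>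

lemma key_eq_iff:
  assumes "p \<in> P" "p' \<in> P" "z \<in> Off"
  shows "key i p' (\<lambda>_. 0) = key i p z \<longleftrightarrow> cell i p' = (\<lambda>j. cell i p j + z j)"
proof
  assume eq: "key i p' (\<lambda>_. 0) = key i p z"
  show "cell i p' = (\<lambda>j. cell i p j + z j)"
  proof
    fix j
    have "\<bar>cell i p' j - cell i p j\<bar> \<le> 2 ^ L + 1" using cell_close[OF dist_le[OF assms(2,1)]] .
    moreover have "\<bar>z j\<bar> \<le> int rad" using assms(3) by (auto simp: Off_def Pi_iff abs_le_iff minus_le_iff)
    ultimately have "\<bar>cell i p' j - (cell i p j + z j)\<bar> < 2 ^ kb" using rad_less by linarith
    moreover have "cell i p' j mod 2 ^ kb = (cell i p j + z j) mod 2 ^ kb"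
      using fun_cong[OF eq, of j] by (simp add: key_def)
    ultimately show "cell i p' j = cell i p j + z j" by (rule mod_eq_close[rotated])
  qed
qed (simp add: key_def)

lemma fin_less_iff:
  assumes "i \<in> sc q"
  shows "fin q c < W \<longleftrightarrow> (\<exists>p\<in>P. key i p (\<lambda>_. 0) = c)"
proof -
  let ?M = "{pos p |p. p \<in> P \<and> (\<exists>i\<in>sc q. key i p (\<lambda>_. 0) = c) \<and> pos p div B ^ lv = 0}"
  have fin: "finite (insert W ?M)" by (simp add: finite_owners)
  have "fin q c < W \<longleftrightarrow> (\<exists>y\<in>insert W ?M. y < W)"
    unfolding fin_def val_def prod.case by (rule Min_less_iff[OF fin]) simp
  also have "\<dots> \<longleftrightarrow> (\<exists>p\<in>P. key i p (\<lambda>_. 0) = c)"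
  proof
    assume "\<exists>y\<in>insert W ?M. y < W"
    then obtain p i' where "p \<in> P" "i' \<in> sc q" "key i' p (\<lambda>_. 0) = c" by blast
    thus "\<exists>p\<in>P. key i p (\<lambda>_. 0) = c" using sc_unique[OF assms, of i'] by blast
  next
    assume "\<exists>p\<in>P. key i p (\<lambda>_. 0) = c"
    then obtain p where p: "p \<in> P" "key i p (\<lambda>_. 0) = c" by blast
    have "pos p div B ^ lv = 0" using pos_less[OF p(1)] by (simp add: W_def)
    hence "pos p \<in> ?M" using p assms by blast
    thus "\<exists>y\<in>insert W ?M. y < W" using pos_less[OF p(1)] by blast
  qed
  finally show ?thesis .
qed

lemma fin_attained:
  assumes "i \<in> sc q" "fin q c < W"
  shows "\<exists>p\<in>P. key i p (\<lambda>_. 0) = c \<and> pos p = fin q c"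
proof -
  let ?M = "{pos p |p. p \<in> P \<and> (\<exists>i\<in>sc q. key i p (\<lambda>_. 0) = c) \<and> pos p div B ^ lv = 0}"
  have "fin q c \<in> insert W ?M" unfolding fin_def val_def prod.case
    by (rule Min_in) (simp_all add: finite_owners)
  moreover have "fin q c \<noteq> W" using assms(2) by simp
  ultimately have "fin q c \<in> ?M" by blast
  then obtain p i' where p: "fin q c = pos p" "p \<in> P" "i' \<in> sc q" "key i' p (\<lambda>_. 0) = c"
    by blast
  thus ?thesis using sc_unique[OF assms(1) p(3)] by auto
qed

definition "fD q w = jb q w \<union> downmsg ` {\<nu> \<in> dset lv. loc \<nu> = J q w}"

lemma fD_mem: "Inl p \<in> fD q w \<longleftrightarrow> p \<in> P \<and> pos p = w" "Inr (Seed s) \<in> fD q w \<longleftrightarrow> s = a"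
  "Inr (Cand i) \<in> fD q w \<longleftrightarrow> i \<in> sc q"
  by (auto simp: fD_def jb_def pts_def info_def downmsg_def)

lemma fD_down:
  assumes "q < Q" "p \<in> P" "pos p = w" "i \<in> sc q" "z \<in> Off"
  shows "Inr (Down (h a (0, w, q, key i p z)) r) \<in> fD q w \<longleftrightarrow> r = fin q (key i p z)"
proof -
  let ?n = "node 0 q p i z"
  have n: "?n \<in> nodes 0" unfolding nodes_def using assms by blast
  have nd: "?n = (0, w, q, key i p z)" using assms(3) by (simp add: node_def)
  have "Inr (Down (h a (0, w, q, key i p z)) r) \<in> fD q w \<longleftrightarrow>
      Inr (Down (h a ?n) r) \<in> downmsg ` {\<nu> \<in> dset lv. loc \<nu> = J q w}"
    unfolding nd[symmetric] by (auto simp: fD_def jb_def pts_def info_def)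
  also have "\<dots> \<longleftrightarrow> r = fin q (key i p z)"
  proof
    assume "Inr (Down (h a ?n) r) \<in> downmsg ` {\<nu> \<in> dset lv. loc \<nu> = J q w}"
    then obtain \<nu> s where \<nu>: "h a ?n = h a \<nu>" "r = res \<nu>" "\<nu> \<in> nodes s" "s < lv"
      by (auto simp: downmsg_def dset_def)
    hence "?n = \<nu>" using h_eq[OF n \<nu>(3)] by simp
    thus "r = fin q (key i p z)" using \<nu>(2) by (auto simp: res_def node_def)
  next
    assume r: "r = fin q (key i p z)"
    have "?n \<in> dset lv" unfolding dset_def using n lv_pos by auto
    moreover have "loc ?n = J q w" using assms(3) by (simp add: loc_def node_def)
    moreover have "downmsg ?n = Inr (Down (h a ?n) r)" using r by (simp add: downmsg_def res_def node_def)
    ultimately show "Inr (Down (h a ?n) r) \<in> downmsg ` {\<nu> \<in> dset lv. loc \<nu> = J q w}"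
      by (auto intro!: image_eqI[of _ _ ?n])
  qed
  finally show ?thesis .
qed

text \<open>The answers reveal the occupied cells within distance \<open>rad = 2 * 3 ^ d\<close>,
  exactly the reach of the greedy rule. By \<open>sel_local\<close> the local decision agrees with
  the global one.\<close>

lemma flagged_iff:
  assumes q: "q < Q" and w: "p \<in> P" "pos p = w" "i \<in> sc q"
  shows "Inr (Down (h a (0, w, q, key i p (\<lambda>_. 0))) w) \<in> fD q w \<and>
     cell i p \<in> sel {c. \<exists>z\<in>Off. c = (\<lambda>j. cell i p j + z j) \<and>
         (\<exists>r<W. Inr (Down (h a (0, w, q, key i p z)) r) \<in> fD q w)} \<longleftrightarrow>
     pos p = fin q (key i p (\<lambda>_. 0)) \<and> cell i p \<in> sel (cell i ` P)"
proof -
  let ?S = "{c. \<exists>z\<in>Off. c = (\<lambda>j. cell i p j + z j) \<and>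
         (\<exists>r<W. Inr (Down (h a (0, w, q, key i p z)) r) \<in> fD q w)}"
  have mem: "(\<exists>r<W. Inr (Down (h a (0, w, q, key i p z)) r) \<in> fD q w) \<longleftrightarrow> (\<lambda>j. cell i p j + z j) \<in> cell i ` P"
    if z: "z \<in> Off" for z
  proof -
    have "(\<exists>r<W. Inr (Down (h a (0, w, q, key i p z)) r) \<in> fD q w) \<longleftrightarrow> fin q (key i p z) < W"
      using fD_down[OF q w(1,2,3) z] by simp
    also have "\<dots> \<longleftrightarrow> (\<exists>p'\<in>P. key i p' (\<lambda>_. 0) = key i p z)" by (rule fin_less_iff[OF w(3)])
    also have "\<dots> \<longleftrightarrow> (\<exists>p'\<in>P. cell i p' = (\<lambda>j. cell i p j + z j))"
      using key_eq_iff[OF w(1) _ z] by blast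
    also have "\<dots> \<longleftrightarrow> (\<lambda>j. cell i p j + z j) \<in> cell i ` P" by (auto simp: image_iff eq_commute)
    finally show ?thesis .
  qed
  have "?S = cell i ` P \<inter> box (cell i p) rad"
  proof (intro equalityI subsetI)
    fix c assume "c \<in> ?S"
    then obtain z where z: "z \<in> Off" "c = (\<lambda>j. cell i p j + z j)" "c \<in> cell i ` P" using mem by blast
    have "\<bar>z j\<bar> \<le> int rad" for j using z(1) by (auto simp: Off_def Pi_iff abs_le_iff minus_le_iff)
    thus "c \<in> cell i ` P \<inter> box (cell i p) rad" using z(2,3) by (simp add: box_def)
  next
    fix c assume c: "c \<in> cell i ` P \<inter> box (cell i p) rad"
    define z where "z = (\<lambda>j. c j - cell i p j)"
    have "\<bar>z j\<bar> \<le> int rad" for j using c by (simp add: box_def z_def)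
    hence "z \<in> Off" by (auto simp: Off_def abs_le_iff minus_le_iff)
    moreover have "c = (\<lambda>j. cell i p j + z j)" by (simp add: z_def)
    ultimately show "c \<in> ?S" using mem[of z] c by blast
  qed
  hence "cell i p \<in> sel ?S \<longleftrightarrow> cell i p \<in> sel (cell i ` P)"
    by (intro sel_local) (auto simp: rad_def)
  moreover have "Inr (Down (h a (0, w, q, key i p (\<lambda>_. 0))) w) \<in> fD q w \<longleftrightarrow> pos p = fin q (key i p (\<lambda>_. 0))"
    using fD_down[OF q w zero_Off] w(2) by simp
  ultimately show ?thesis by blast
qed

lemma flagged_eq: "flagged q w (fD q w) = {p \<in> F' q. pos p = w}"
proof (cases "q < Q")
  case True
  show ?thesis
  proof (intro set_eqI iffI)
    fix p assume "p \<in> flagged q w (fD q w)"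
    then obtain i where "p \<in> P" "pos p = w" "i \<in> sc q"
      "Inr (Down (h a (0, w, q, key i p (\<lambda>_. 0))) w) \<in> fD q w"
      "cell i p \<in> sel {c. \<exists>z\<in>Off. c = (\<lambda>j. cell i p j + z j) \<and>
         (\<exists>r<W. Inr (Down (h a (0, w, q, key i p z)) r) \<in> fD q w)}"
      unfolding flagged_def fD_mem by blast
    thus "p \<in> {p \<in> F' q. pos p = w}" using flagged_iff[OF True, of p w i] True by (auto simp: F'_def)
  next
    fix p assume "p \<in> {p \<in> F' q. pos p = w}"
    then obtain i where "p \<in> P" "pos p = w" "i \<in> sc q" "pos p = fin q (key i p (\<lambda>_. 0))"
      "cell i p \<in> sel (cell i ` P)" by (auto simp: F'_def)
    thus "p \<in> flagged q w (fD q w)"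
      unfolding flagged_def fD_mem mem_Collect_eq using flagged_iff[OF True, of p w i] by blast
  qed
next
  \<comment> \<open>The round lemmas quantify over all block numbers. Beyond \<open>Q\<close> there
    are no nodes, hence neither answers nor selected points.\<close>
  case False
  have "{\<nu> \<in> dset lv. loc \<nu> = J q w} = {}"
  proof -
    have "loc \<nu> \<noteq> J q w" if "\<nu> \<in> nodes s" for \<nu> s
      using loc_Ad[OF that] False by auto
    thus ?thesis by (auto simp: dset_def)
  qed
  hence "Inr (Down c r) \<notin> fD q w" for c r by (auto simp: fD_def jb_def pts_def info_def)
  thus ?thesis using False by (simp add: flagged_def F'_def)
qed

definition fp :: "nat \<Rightarrow> nat \<Rightarrow> 'd mem" where "fp q w = Inl ` {p \<in> F' q. pos p = w}"
definition cd :: "nat \<Rightarrow> 'd mem" where "cd q = (\<lambda>i. Inr (Cand i)) ` sc q"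
definition cnt :: "nat \<Rightarrow> nat \<Rightarrow> nat \<Rightarrow> nat" where "cnt t q g = card {p \<in> F' q. pos p div B ^ t = g}"
text \<open>Groups without selected points send nothing, so the presence of a \<open>Cnt\<close>
  item signals a positive count.\<close>

definition "cfgC t q w = fp q w \<union> cd q \<union> {Inr (Cnt g (cnt t q g)) |g. g div B = w \<and> cnt t q g > 0}"

lemma fp_props: "finite (fp q w)" "card (fp q w) \<le> 1" "fp q w \<subseteq> range Inl"
proof -
  have sub: "fp q w \<subseteq> pts w" using F'_subset by (auto simp: fp_def pts_def)
  show "finite (fp q w)" using finite_subset[OF sub card_pts(1)] .
  show "card (fp q w) \<le> 1" using card_mono[OF card_pts(1) sub] card_pts(2)[of w] by linarith
  show "fp q w \<subseteq> range Inl" by (auto simp: fp_def)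
qed

lemma cd_props: "finite (cd q)" "card (cd q) \<le> 1" "q < Q \<Longrightarrow> cd q \<subseteq> Inr ` Items"
proof -
  show "finite (cd q)" using card_sc by (simp add: cd_def)
  show "card (cd q) \<le> 1" using card_image_le[OF card_sc(1)] card_sc(2) order_trans unfolding cd_def by blast
  show "q < Q \<Longrightarrow> cd q \<subseteq> Inr ` Items" using sc_le by (auto simp: cd_def)
qed

lemma fpcd: "finite (fp q w \<union> cd q)" "card (fp q w \<union> cd q) \<le> 2 * B" "card (fp q w) \<le> 2 * B"
proof -
  show "finite (fp q w \<union> cd q)" using fp_props cd_props by simp
  show "card (fp q w \<union> cd q) \<le> 2 * B"
    using card_Un_le[of "fp q w" "cd q"] fp_props(2)[of q w] cd_props(2)[of q] B_pos by linarith
  show "card (fp q w) \<le> 2 * B" using fp_props(2)[of q w] B_pos by linarith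
qed

lemma cnt_pos: "cnt t q g > 0 \<longleftrightarrow> (\<exists>p\<in>F' q. pos p div B ^ t = g)"
  using finite_F' by (auto simp: cnt_def card_gt_0_iff)

lemma cnt_pos_less: "cnt t q g > 0 \<Longrightarrow> g < W"
proof -
  assume "cnt t q g > 0"
  then obtain p where p: "p \<in> F' q" "pos p div B ^ t = g" using cnt_pos by blast
  have "g \<le> pos p" using p(2) by auto
  thus ?thesis using pos_less[of p] p(1) F'_subset by force
qed

lemma cnt_le: "cnt t q g \<le> W"
proof -
  have "card (F' q) \<le> card {..<W}"
    by (rule card_inj_on_le[of pos])
       (use pos_less F'_subset inj_on_subset[OF pos_inj] in auto)
  moreover have "cnt t q g \<le> card (F' q)" unfolding cnt_def using finite_F' by (intro card_mono) auto
  ultimately show ?thesis by simp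
qed

lemma sum_cnt: "(\<Sum>g\<in>{g. g div B = w \<and> cnt t q g > 0}. cnt t q g) = cnt (Suc t) q w"
proof -
  have "(\<Sum>g\<in>{g. g div B = w \<and> cnt t q g > 0}. cnt t q g) = (\<Sum>g\<in>{g. g div B = w}. cnt t q g)"
    by (rule sum.mono_neutral_left) auto
  also have "\<dots> = card (\<Union>g\<in>{g. g div B = w}. {p \<in> F' q. pos p div B ^ t = g})"
    unfolding cnt_def by (rule card_UN_disjoint[symmetric]) (use finite_F' in auto)
  also have "(\<Union>g\<in>{g. g div B = w}. {p \<in> F' q. pos p div B ^ t = g}) = {p \<in> F' q. pos p div B ^ Suc t = w}"
    by (auto simp: div_mult2_eq[symmetric] mult.commute)
  finally show ?thesis by (simp add: cnt_def)
qed

lemma total_cfgC: "total (cfgC t q w) = cnt (Suc t) q w"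
proof -
  have "{(g, c). Inr (Cnt g c) \<in> cfgC t q w} = (\<lambda>g. (g, cnt t q g)) ` {g. g div B = w \<and> cnt t q g > 0}"
    by (auto simp: cfgC_def fp_def cd_def)
  hence "total (cfgC t q w) = (\<Sum>g\<in>{g. g div B = w \<and> cnt t q g > 0}. cnt t q g)"
    unfolding total_def by (simp add: sum.reindex inj_on_def)
  thus ?thesis by (simp add: sum_cnt)
qed

lemma cnt_0: "cnt 0 q g = (if \<exists>p\<in>F' q. pos p = g then 1 else 0)"
proof (cases "\<exists>p\<in>F' q. pos p = g")
  case True
  then obtain p where p: "p \<in> F' q" "pos p = g" by blast
  have "{p \<in> F' q. pos p div B ^ 0 = g} = {p}"
    using p F'_subset by (auto intro: inj_onD[OF pos_inj])
  thus ?thesis using True by (simp add: cnt_def)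
next
  case False
  hence *: "{p \<in> F' q. pos p div B ^ 0 = g} = {}" by auto
  have "cnt 0 q g = 0" unfolding cnt_def * by (rule card.empty)
  thus ?thesis using False by simp
qed

lemma Union_parent:
  assumes "q' < Q" "w' < W"
  shows "\<Union>{S q w |q w. q < Q \<and> w < W \<and> (q' = q \<and> w' = w div B)} = \<Union>{S q' w |w. w < W \<and> w' = w div B}"
    "\<Union>{S q w |q w. q < Q \<and> w < W \<and> (q' = q \<and> w' div B = w)} = S q' (w' div B)"
proof -
  show "\<Union>{S q w |q w. q < Q \<and> w < W \<and> (q' = q \<and> w' = w div B)} = \<Union>{S q' w |w. w < W \<and> w' = w div B}"
    using assms by blast
  have "w' div B < W" using assms(2) div_B_le[of w'] by linarith
  thus "\<Union>{S q w |q w. q < Q \<and> w < W \<and> (q' = q \<and> w' div B = w)} = S q' (w' div B)"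
    using assms by blast
qed

lemma parents [simp]: "finite {w. w' = w div B}" "card {w. w' = w div B} = B"
proof -
  have *: "{w. w' = w div B} = {w. w div B = w'}" by auto
  show "finite {w. w' = w div B}" "card {w. w' = w div B} = B" unfolding * by simp_all
qed

lemma card_parents [simp]: "card ({q'} \<times> {w. w' = w div B}) = B"
  by (simp add: card_cartesian_product_singleton)

lemma Union_if: "\<Union>{if R w then {f w} else {} |w. S w} = {f w |w. S w \<and> R w}"
proof -
  have "\<Union>{if R w then {f w} else {} |w. S w} = (\<Union>w\<in>{w. S w}. if R w then {f w} else {})" by blast
  thus ?thesis by (auto split: if_splits)
qed

lemma round_flag: "round_ok T5 x (onJ fD) (onJ (cfgC 0))"
proof (rule round_ok_tree[where M = "\<lambda>q w q' w' A. (if q' = q \<and> w' = w then Inl ` flagged q w A \<union> A \<inter> cands else {})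
       \<union> (if q' = q \<and> w' = w div B \<and> flagged q w A \<noteq> {} then {Inr (Cnt w 1)} else {})"
      and Kp = "\<lambda>q w. fp q w \<union> cd q" and S = "\<lambda>q w. if cnt 0 q w > 0 then {Inr (Cnt w 1)} else {}"
      and R = "\<lambda>q w q' w'. q' = q \<and> w' = w div B"])
  show "msg T5 x a j A = (case (a, j) of (J q w, J q' w') \<Rightarrow>
      (if q' = q \<and> w' = w then Inl ` flagged q w A \<union> A \<inter> cands else {})
       \<union> (if q' = q \<and> w' = w div B \<and> flagged q w A \<noteq> {} then {Inr (Cnt w 1)} else {})
      | _ \<Rightarrow> {})" for x a j A
    by (simp add: msg_def msg_flag_def T2_def T3_def T4_def T5_def)
  have c: "fD q w \<inter> cands = cd q" for q w
    using fD_mem(3) by (auto simp: cands_def cd_def)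
  have ne: "flagged q w (fD q w) \<noteq> {} \<longleftrightarrow> cnt 0 q w > 0" for q w
    unfolding flagged_eq cnt_0 by auto
  show "(if q' = q \<and> w' = w then Inl ` flagged q w (fD q w) \<union> fD q w \<inter> cands else {})
       \<union> (if q' = q \<and> w' = w div B \<and> flagged q w (fD q w) \<noteq> {} then {Inr (Cnt w 1)} else {}) =
      (if q' = q \<and> w' = w then fp q w \<union> cd q else {})
      \<union> (if q' = q \<and> w' = w div B then if cnt 0 q w > 0 then {Inr (Cnt w 1)} else {} else {})" for q w q' w'
    unfolding ne c by (simp add: flagged_eq fp_def)
  show "fp q w \<union> cd q \<union> \<Union> {if cnt 0 q' w' > 0 then {Inr (Cnt w' 1)} else {} |q' w'. q' < Q \<and> w' < W \<and> q = q' \<and> w = w' div B}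
      = cfgC 0 q w" if "q < Q" "w < W" for q w
  proof -
    have *: "\<Union>{if cnt 0 q w' > 0 then {Inr (Cnt w' 1)} else {} |w'. w' < W \<and> w = w' div B}
        = {Inr (Cnt g (cnt 0 q g)) |g. g div B = w \<and> cnt 0 q g > 0}"
      unfolding Union_if using cnt_pos_less[of 0 q] by (auto simp: cnt_0 split: if_splits)
    show ?thesis unfolding Union_parent(1)[OF that] cfgC_def by (simp only: *)
  qed
  show "fp q w \<union> cd q \<subseteq> fD q w \<inter> range Inl \<union> Inr ` Items" if "q < Q" for q w
  proof -
    have "fp q w \<subseteq> fD q w" using fD_mem(1) subsetD[OF F'_subset] by (auto simp: fp_def)
    thus ?thesis using fp_props(3) cd_props(3)[OF that] by blast
  qed
  show "(if cnt 0 q w > 0 then {Inr (Cnt w 1)} else {}) \<subseteq> fD q w \<inter> range Inl \<union> Inr ` Items" if "w < W" for q w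
    using that by auto
qed (use fpcd B_pos in auto)

lemma round_count:
  assumes "t < lv"
  shows "round_ok (T5 + 1 + t) x (onJ (cfgC t)) (onJ (cfgC (Suc t)))"
proof (rule round_ok_tree[where M = "\<lambda>q w q' w' A. (if q' = q \<and> w' = w then A \<inter> (range Inl \<union> cands) else {})
       \<union> (if q' = q \<and> w' = w div B \<and> (\<exists>g c. Inr (Cnt g c) \<in> A) then {Inr (Cnt w (total A))} else {})"
      and Kp = "\<lambda>q w. fp q w \<union> cd q"
      and S = "\<lambda>q w. if cnt (Suc t) q w > 0 then {Inr (Cnt w (cnt (Suc t) q w))} else {}"
      and R = "\<lambda>q w q' w'. q' = q \<and> w' = w div B"])
  show "msg (T5 + 1 + t) x a j A = (case (a, j) of (J q w, J q' w') \<Rightarrow>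
      (if q' = q \<and> w' = w then A \<inter> (range Inl \<union> cands) else {})
       \<union> (if q' = q \<and> w' = w div B \<and> (\<exists>g c. Inr (Cnt g c) \<in> A) then {Inr (Cnt w (total A))} else {})
      | _ \<Rightarrow> {})" for x a j A
    using assms by (simp add: msg_def msg_count_def T2_def T3_def T4_def T5_def T6_def)
  have c: "cfgC t q w \<inter> (range Inl \<union> cands) = fp q w \<union> cd q" for q w
    by (auto simp: cfgC_def fp_def cd_def cands_def)
  have dv: "y div B ^ Suc t = y div B ^ t div B" for y
    by (simp add: div_mult2_eq[symmetric] mult.commute)
  have ne: "(\<exists>g c. Inr (Cnt g c) \<in> cfgC t q w) \<longleftrightarrow> cnt (Suc t) q w > 0" for q w
  proof -
    have "(\<exists>g c. Inr (Cnt g c) \<in> cfgC t q w) \<longleftrightarrow> (\<exists>g. g div B = w \<and> cnt t q g > 0)"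
      by (auto simp: cfgC_def fp_def cd_def)
    also have "\<dots> \<longleftrightarrow> cnt (Suc t) q w > 0" unfolding cnt_pos dv by blast
    finally show ?thesis .
  qed
  show "(if q' = q \<and> w' = w then cfgC t q w \<inter> (range Inl \<union> cands) else {})
       \<union> (if q' = q \<and> w' = w div B \<and> (\<exists>g c. Inr (Cnt g c) \<in> cfgC t q w) then {Inr (Cnt w (total (cfgC t q w)))} else {}) =
      (if q' = q \<and> w' = w then fp q w \<union> cd q else {})
      \<union> (if q' = q \<and> w' = w div B then if cnt (Suc t) q w > 0 then {Inr (Cnt w (cnt (Suc t) q w))} else {} else {})" for q w q' w'
    unfolding ne c total_cfgC by simp
  show "fp q w \<union> cd q \<union> \<Union> {if cnt (Suc t) q' w' > 0 then {Inr (Cnt w' (cnt (Suc t) q' w'))} else {} |q' w'. q' < Q \<and> w' < W \<and> q = q' \<and> w = w' div B}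
      = cfgC (Suc t) q w" if "q < Q" "w < W" for q w
  proof -
    have *: "\<Union>{if cnt (Suc t) q w' > 0 then {Inr (Cnt w' (cnt (Suc t) q w'))} else {} |w'. w' < W \<and> w = w' div B}
        = {Inr (Cnt g (cnt (Suc t) q g)) |g. g div B = w \<and> cnt (Suc t) q g > 0}"
      unfolding Union_if using cnt_pos_less[of "Suc t" q] by auto
    show ?thesis unfolding Union_parent(1)[OF that] cfgC_def by (simp only: *)
  qed
  show "fp q w \<union> cd q \<subseteq> cfgC t q w \<inter> range Inl \<union> Inr ` Items" if "q < Q" for q w
    using fp_props(3) cd_props(3)[OF that] by (auto simp: cfgC_def)
  show "(if cnt (Suc t) q w > 0 then {Inr (Cnt w (cnt (Suc t) q w))} else {}) \<subseteq> cfgC t q w \<inter> range Inl \<union> Inr ` Items"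
    if "w < W" for q w using that cnt_le by auto
qed (use fpcd B_pos in auto)

subsection \<open>Choosing the smallest valid scale\<close>

definition Yset :: "nat \<Rightarrow> nat \<Rightarrow> nat set" where
  "Yset t g = {i * Q + q |q i. q < Q \<and> i \<in> sc q \<and> card (F' q) \<le> k \<and> q div B ^ t = g}"

text \<open>The tree over the blocks runs through slot 0 of each block; the selected points wait in
  their slots.\<close>

definition "cfgB t q w = fp q w \<union>
  (if w = 0 then {Inr (Best (Min (Yset t g))) |g. g div B = q \<and> Yset t g \<noteq> {}} else {})"

lemma Yset_less: "y \<in> Yset t g \<Longrightarrow> y < (L + 1) * Q"
proof -
  assume "y \<in> Yset t g"
  then obtain q i where y: "y = i * Q + q" "q < Q" "i \<in> sc q" by (auto simp: Yset_def)
  have "y < (i + 1) * Q" using y by simp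
  also have "\<dots> \<le> (L + 1) * Q" using sc_le[OF y(3,2)] by (intro mult_le_mono1) simp
  finally show ?thesis .
qed

lemma finite_Yset: "finite (Yset t g)"
  by (rule finite_subset[of _ "{..<(L + 1) * Q}"]) (use Yset_less in auto)

lemma Min_Yset_less: "Yset t g \<noteq> {} \<Longrightarrow> Min (Yset t g) < (L + 1) * Q"
  using Yset_less Min_in[OF finite_Yset] by blast

lemma Yset_Suc: "Yset (Suc t) q = (\<Union>g\<in>{g. g div B = q}. Yset t g)"
proof -
  have dv: "y div B ^ Suc t = y div B ^ t div B" for y
    by (simp add: div_mult2_eq[symmetric] mult.commute)
  show ?thesis unfolding Yset_def dv by blast
qed

lemma Yset_group_less: "Yset t g \<noteq> {} \<Longrightarrow> g < Q"
proof -
  assume "Yset t g \<noteq> {}"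
  then obtain q where "q < Q" "q div B ^ t = g" by (auto simp: Yset_def)
  thus ?thesis by (metis div_le_dividend le_less_trans)
qed

lemma Yset_0: "Yset 0 g = (if g < Q \<and> card (F' g) \<le> k then (\<lambda>i. i * Q + g) ` sc g else {})"
  by (auto simp: Yset_def)

text \<open>After \<open>lv\<close> rounds slot 0 still holds the counts of its children separately;
  \<open>total\<close> adds them up, which amounts to one more level.\<close>

lemma cnt_all: "cnt (Suc lv) q 0 = card (F' q)"
proof -
  have "pos p div B ^ Suc lv = 0" if "p \<in> F' q" for p
  proof -
    have "pos p < B ^ lv" using pos_less subsetD[OF F'_subset that] by (simp add: W_def)
    hence "pos p div B ^ lv div B = 0" by simp
    thus ?thesis by (simp add: div_mult2_eq[symmetric] mult.commute)
  qed
  hence "{p \<in> F' q. pos p div B ^ Suc lv = 0} = F' q" by blast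
  thus ?thesis by (simp only: cnt_def)
qed

lemma root_sets: "finite {(q' :: nat, w' :: nat). w = 0 \<and> w' = 0 \<and> q' = q div B}"
  "card {(q' :: nat, w' :: nat). w = 0 \<and> w' = 0 \<and> q' = q div B} \<le> B"
  "finite {(q :: nat, w :: nat). w = 0 \<and> w' = 0 \<and> q' = q div B}"
  "card {(q :: nat, w :: nat). w = 0 \<and> w' = 0 \<and> q' = q div B} \<le> B" for q w q' w' :: nat
proof -
  have 1: "{(q' :: nat, w' :: nat). w = 0 \<and> w' = 0 \<and> q' = q div B} \<subseteq> {(q div B, 0)}" by auto
  show "finite {(q' :: nat, w' :: nat). w = 0 \<and> w' = 0 \<and> q' = q div B}" by (rule finite_subset[OF 1]) simp
  have "card {(q' :: nat, w' :: nat). w = 0 \<and> w' = 0 \<and> q' = q div B} \<le> 1" using card_mono[OF _ 1] by simp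
  thus "card {(q' :: nat, w' :: nat). w = 0 \<and> w' = 0 \<and> q' = q div B} \<le> B" using B_pos by linarith
  have 2: "{(q :: nat, w :: nat). w = 0 \<and> w' = 0 \<and> q' = q div B} \<subseteq> (\<lambda>q. (q, 0)) ` {q. q' = q div B}" by auto
  show "finite {(q :: nat, w :: nat). w = 0 \<and> w' = 0 \<and> q' = q div B}" by (rule finite_subset[OF 2]) simp
  have "card {(q :: nat, w :: nat). w = 0 \<and> w' = 0 \<and> q' = q div B} \<le> card ((\<lambda>q. (q, 0::nat)) ` {q. q' = q div B})"
    by (rule card_mono[OF _ 2]) simp
  also have "\<dots> \<le> B" using card_image_le[OF parents(1), of "\<lambda>q. (q, 0::nat)" q'] by simp
  finally show "card {(q :: nat, w :: nat). w = 0 \<and> w' = 0 \<and> q' = q div B} \<le> B" .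
qed

lemma Union_root:
  assumes "w' < W" "\<And>q. S q \<noteq> {} \<Longrightarrow> q < Q"
  shows "\<Union>{S q |q w. q < Q \<and> w < W \<and> (w = 0 \<and> w' = 0 \<and> q' = q div B)}
     = (if w' = 0 then \<Union>{S g |g. g div B = q'} else {})"
proof (cases "w' = 0")
  case True
  have "S g \<subseteq> \<Union>{S q |q w. q < Q \<and> w < W \<and> (w = 0 \<and> w' = 0 \<and> q' = q div B)}" if "g div B = q'" for g
  proof (cases "S g = {}")
    case False
    hence "g < Q" by (rule assms(2))
    thus ?thesis using W_pos True that by blast
  qed simp
  thus ?thesis using True by auto
qed auto

lemma Union_singletons: "\<Union>{if Y g \<noteq> {} then {f g} else {} |g. S g} = {f g |g. S g \<and> Y g \<noteq> {}}"
  by (rule Union_if)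

lemma F'_empty: "\<not> q < Q \<Longrightarrow> F' q = {}" by (simp add: F'_def)

lemma Yset_0_Min: "Yset 0 g \<noteq> {} \<Longrightarrow> Yset 0 g = {Min (Yset 0 g)}"
proof -
  assume ne: "Yset 0 g \<noteq> {}"
  then obtain i where "i \<in> sc g" by (auto simp: Yset_0 split: if_splits)
  hence "sc g = {i}" using sc_unique by blast
  hence "Yset 0 g = {i * Q + g}" using ne by (auto simp: Yset_0 split: if_splits)
  thus ?thesis by simp
qed

text \<open>The configuration is cut to \<open>q < Q\<close> because \<open>sc q\<close> may be
  nonempty beyond \<open>Q\<close>, whereas \<open>Yset\<close> admits only existing blocks.\<close>

lemma round_valid: "round_ok T6 x (onJ (\<lambda>q w. if q < Q then cfgC lv q w else {})) (onJ (cfgB 0))"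
proof (rule round_ok_tree[where M = "\<lambda>q w q' w' A. (if q' = q \<and> w' = w then A \<inter> range Inl else {})
       \<union> (if w = 0 \<and> w' = 0 \<and> q' = q div B \<and> total A \<le> k then {Inr (Best (i * Q + q)) |i. Inr (Cand i) \<in> A} else {})"
      and Kp = "\<lambda>q w. fp q w" and S = "\<lambda>q w. (\<lambda>b. Inr (Best b)) ` Yset 0 q"
      and R = "\<lambda>q w q' w'. w = 0 \<and> w' = 0 \<and> q' = q div B"])
  let ?f = "\<lambda>q w. if q < Q then cfgC lv q w else {}"
  show "msg T6 x a j A = (case (a, j) of (J q w, J q' w') \<Rightarrow>
      (if q' = q \<and> w' = w then A \<inter> range Inl else {})
       \<union> (if w = 0 \<and> w' = 0 \<and> q' = q div B \<and> total A \<le> k then {Inr (Best (i * Q + q)) |i. Inr (Cand i) \<in> A} else {})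
      | _ \<Rightarrow> {})" for x a j A
    by (simp add: msg_def msg_valid_def T2_def T3_def T4_def T5_def T6_def)
  have Inl: "?f q w \<inter> range Inl = fp q w" for q w
    using F'_empty by (auto simp: cfgC_def fp_def cd_def)
  have best: "(if w = 0 \<and> w' = 0 \<and> q' = q div B \<and> total (?f q w) \<le> k
      then {Inr (Best (i * Q + q)) |i. Inr (Cand i) \<in> ?f q w} else {})
      = (if w = 0 \<and> w' = 0 \<and> q' = q div B then (\<lambda>b. Inr (Best b)) ` Yset 0 q else {})" for q w q' w'
  proof (cases "q < Q \<and> w = 0")
    case True
    hence tot: "total (?f q w) = card (F' q)" by (simp add: total_cfgC cnt_all)
    have "Inr (Cand i) \<in> ?f q w \<longleftrightarrow> i \<in> sc q" for i
      using True by (auto simp: cfgC_def fp_def cd_def)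
    thus ?thesis unfolding tot using True by (auto simp: Yset_0)
  qed (auto simp: Yset_0)
  show "(if q' = q \<and> w' = w then ?f q w \<inter> range Inl else {})
       \<union> (if w = 0 \<and> w' = 0 \<and> q' = q div B \<and> total (?f q w) \<le> k
          then {Inr (Best (i * Q + q)) |i. Inr (Cand i) \<in> ?f q w} else {}) =
      (if q' = q \<and> w' = w then fp q w else {})
       \<union> (if w = 0 \<and> w' = 0 \<and> q' = q div B then (\<lambda>b. Inr (Best b)) ` Yset 0 q else {})" for q w q' w'
    unfolding best Inl ..
  show "fp q w \<union> \<Union>{(\<lambda>b. Inr (Best b)) ` Yset 0 q' |q' w'. q' < Q \<and> w' < W \<and> (w' = 0 \<and> w = 0 \<and> q = q' div B)}
      = cfgB 0 q w" if "q < Q" "w < W" for q w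
  proof -
    have *: "(\<lambda>b. Inr (Best b)) ` Yset 0 g = (if Yset 0 g \<noteq> {} then {Inr (Best (Min (Yset 0 g)))} else {})" for g
    proof (cases "Yset 0 g = {}")
      case False
      then obtain y where "Yset 0 g = {y}" using Yset_0_Min[OF False] by blast
      thus ?thesis by simp
    qed simp
    have "(\<Union>{(\<lambda>b. Inr (Best b)) ` Yset 0 q' |q' w'. q' < Q \<and> w' < W \<and> (w' = 0 \<and> w = 0 \<and> q = q' div B)} :: 'd mem)
        = (if w = 0 then \<Union>{(\<lambda>b. Inr (Best b)) ` Yset 0 g |g. g div B = q} else {})"
      by (rule Union_root[OF that(2)]) (auto intro: Yset_group_less)
    also have "\<Union>{(\<lambda>b. Inr (Best b)) ` Yset 0 g |g. g div B = q}
        = {Inr (Best (Min (Yset 0 g))) |g. g div B = q \<and> Yset 0 g \<noteq> {}}"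
      unfolding * by (rule Union_singletons)
    finally show ?thesis by (simp only: cfgB_def)
  qed
  show "fp q w \<subseteq> ?f q w \<inter> range Inl \<union> Inr ` Items" for q w using Inl[of q w] by blast
  show "(\<lambda>b. Inr (Best b)) ` Yset 0 q \<subseteq> ?f q w \<inter> range Inl \<union> Inr ` Items" for q w
    using Yset_less[of _ 0 q] by auto
  show "finite ((\<lambda>b. Inr (Best b)) ` Yset 0 q)" for q using finite_Yset by simp
  show "card ((\<lambda>b. Inr (Best b)) ` Yset 0 q) \<le> 4" for q
  proof -
    have "card (Yset 0 q) \<le> 1"
    proof (cases "Yset 0 q = {}")
      case False
      then obtain y where "Yset 0 q = {y}" using Yset_0_Min[OF False] by blast
      thus ?thesis by simp
    qed simp
    thus ?thesis by (intro order_trans[OF card_image_le[OF finite_Yset]]) simp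
  qed
qed (use fp_props fpcd root_sets in auto)

lemma round_best:
  assumes "t < 2 * lv"
  shows "round_ok (T6 + 1 + t) x (onJ (cfgB t)) (onJ (cfgB (Suc t)))"
proof (rule round_ok_tree[where M = "\<lambda>q w q' w' A. (if q' = q \<and> w' = w then A \<inter> range Inl else {})
       \<union> (if w = 0 \<and> w' = 0 \<and> q' = q div B \<and> (\<exists>b. Inr (Best b) \<in> A) then {Inr (Best (Min {b. Inr (Best b) \<in> A}))} else {})"
      and Kp = "\<lambda>q w. fp q w"
      and S = "\<lambda>q w. if Yset (Suc t) q \<noteq> {} then {Inr (Best (Min (Yset (Suc t) q)))} else {}"
      and R = "\<lambda>q w q' w'. w = 0 \<and> w' = 0 \<and> q' = q div B"])
  show "msg (T6 + 1 + t) x a j A = (case (a, j) of (J q w, J q' w') \<Rightarrow>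
      (if q' = q \<and> w' = w then A \<inter> range Inl else {})
       \<union> (if w = 0 \<and> w' = 0 \<and> q' = q div B \<and> (\<exists>b. Inr (Best b) \<in> A) then {Inr (Best (Min {b. Inr (Best b) \<in> A}))} else {})
      | _ \<Rightarrow> {})" for x a j A
    using assms by (simp add: msg_def msg_best_def T2_def T3_def T4_def T5_def T6_def T7_def)
  have Inl: "cfgB t q w \<inter> range Inl = fp q w" for q w by (auto simp: cfgB_def fp_def)
  have set: "{b. Inr (Best b) \<in> cfgB t q 0} = {Min (Yset t g) |g. g \<in> {g. g div B = q} \<and> Yset t g \<noteq> {}}" for q
    by (auto simp: cfgB_def fp_def)
  have ne: "(\<exists>b. Inr (Best b) \<in> cfgB t q 0) \<longleftrightarrow> Yset (Suc t) q \<noteq> {}" for q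
    unfolding Yset_Suc by (auto simp: cfgB_def fp_def)
  have min: "Min {b. Inr (Best b) \<in> cfgB t q 0} = Min (Yset (Suc t) q)" if "Yset (Suc t) q \<noteq> {}" for q
    unfolding set Yset_Suc using finite_Yset[of "Suc t" q] that by (intro Min_Min) (simp_all add: Yset_Suc)
  have best: "(if w = 0 \<and> w' = 0 \<and> q' = q div B \<and> (\<exists>b. Inr (Best b) \<in> cfgB t q w)
      then {Inr (Best (Min {b. Inr (Best b) \<in> cfgB t q w}))} else {})
      = (if w = 0 \<and> w' = 0 \<and> q' = q div B
         then if Yset (Suc t) q \<noteq> {} then {Inr (Best (Min (Yset (Suc t) q)))} else {} else {})" for q w q' w'
    using ne[of q] min[of q] by (cases "w = 0") auto
  show "(if q' = q \<and> w' = w then cfgB t q w \<inter> range Inl else {})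
       \<union> (if w = 0 \<and> w' = 0 \<and> q' = q div B \<and> (\<exists>b. Inr (Best b) \<in> cfgB t q w)
          then {Inr (Best (Min {b. Inr (Best b) \<in> cfgB t q w}))} else {}) =
      (if q' = q \<and> w' = w then fp q w else {})
       \<union> (if w = 0 \<and> w' = 0 \<and> q' = q div B
         then if Yset (Suc t) q \<noteq> {} then {Inr (Best (Min (Yset (Suc t) q)))} else {} else {})" for q w q' w'
    unfolding best Inl ..
  show "fp q w \<union> \<Union>{if Yset (Suc t) q' \<noteq> {} then {Inr (Best (Min (Yset (Suc t) q')))} else {} |q' w'. q' < Q \<and> w' < W \<and> (w' = 0 \<and> w = 0 \<and> q = q' div B)}
      = cfgB (Suc t) q w" if "q < Q" "w < W" for q w
  proof -
    have "(\<Union>{if Yset (Suc t) q' \<noteq> {} then {Inr (Best (Min (Yset (Suc t) q')))} else {} |q' w'. q' < Q \<and> w' < W \<and> (w' = 0 \<and> w = 0 \<and> q = q' div B)} :: 'd mem)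
        = (if w = 0 then \<Union>{if Yset (Suc t) g \<noteq> {} then {Inr (Best (Min (Yset (Suc t) g)))} else {} |g. g div B = q} else {})"
      by (rule Union_root[OF that(2)]) (auto intro: Yset_group_less split: if_splits)
    thus ?thesis by (simp only: cfgB_def Union_singletons)
  qed
  show "fp q w \<subseteq> cfgB t q w \<inter> range Inl \<union> Inr ` Items" for q w using Inl[of q w] by blast
  show "(if Yset (Suc t) q \<noteq> {} then {Inr (Best (Min (Yset (Suc t) q)))} else {}) \<subseteq> cfgB t q w \<inter> range Inl \<union> Inr ` Items" for q w
    using Min_Yset_less[of "Suc t" q] by auto
qed (use fp_props fpcd root_sets in auto)

definition "qs = Min (Yset (2 * lv) 0) mod Q"
definition "cfgW t q w = fp q w \<union> (if q = qs \<and> w < B ^ t then {Inr Win} else {})"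

lemma qs_less: "qs < Q" using Q_pos by (simp add: qs_def)

lemma Yset_root: "Yset (2 * lv) g \<noteq> {} \<Longrightarrow> g = 0"
proof -
  assume "Yset (2 * lv) g \<noteq> {}"
  then obtain q where q: "q < Q" "q div B ^ (2 * lv) = g" by (auto simp: Yset_def)
  have "q < B ^ (2 * lv)" using q(1) Q_le(1) unfolding BB by linarith
  thus ?thesis using q(2) by simp
qed

text \<open>Nonemptiness ensures that the minimum encodes an actual candidate; it is supplied by
  \<open>selection_correct\<close>.\<close>

lemma round_announce:
  assumes ne: "Yset (2 * lv) 0 \<noteq> {}"
  shows "round_ok T7 x (onJ (cfgB (2 * lv))) (onJ (cfgW 0))"
proof (rule round_ok_tree[where M = "\<lambda>q w q' w' A. (if q' = q \<and> w' = w then A \<inter> range Inl else {})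
       \<union> (if q = 0 \<and> w = 0 \<and> w' = 0 \<and> (\<exists>b. Inr (Best b) \<in> A \<and> q' = b mod Q) then {Inr Win} else {})"
      and Kp = "\<lambda>q w. fp q w" and S = "\<lambda>q w. {Inr Win}"
      and R = "\<lambda>q w q' w'. q = 0 \<and> w = 0 \<and> w' = 0 \<and> q' = qs"])
  show "msg T7 x a j A = (case (a, j) of (J q w, J q' w') \<Rightarrow>
      (if q' = q \<and> w' = w then A \<inter> range Inl else {})
       \<union> (if q = 0 \<and> w = 0 \<and> w' = 0 \<and> (\<exists>b. Inr (Best b) \<in> A \<and> q' = b mod Q) then {Inr Win} else {})
      | _ \<Rightarrow> {})" for x a j A
    by (simp add: msg_def msg_announce_def T2_def T3_def T4_def T5_def T6_def T7_def)
  have Inl: "cfgB (2 * lv) q w \<inter> range Inl = fp q w" for q w by (auto simp: cfgB_def fp_def)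
  have "Inr (Best b) \<in> cfgB (2 * lv) 0 0 \<longleftrightarrow> b = Min (Yset (2 * lv) 0)" for b
    using ne Yset_root by (auto simp: cfgB_def fp_def)
  hence best: "(if q = 0 \<and> w = 0 \<and> w' = 0 \<and> (\<exists>b. Inr (Best b) \<in> cfgB (2 * lv) q w \<and> q' = b mod Q) then {Inr Win} else {})
      = (if q = 0 \<and> w = 0 \<and> w' = 0 \<and> q' = qs then {Inr Win} else {})" for q w q' w'
    by (auto simp: qs_def)
  show "(if q' = q \<and> w' = w then cfgB (2 * lv) q w \<inter> range Inl else {})
       \<union> (if q = 0 \<and> w = 0 \<and> w' = 0 \<and> (\<exists>b. Inr (Best b) \<in> cfgB (2 * lv) q w \<and> q' = b mod Q) then {Inr Win} else {}) =
      (if q' = q \<and> w' = w then fp q w else {})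
       \<union> (if q = 0 \<and> w = 0 \<and> w' = 0 \<and> q' = qs then {Inr Win} else {})" for q w q' w'
    unfolding best Inl ..
  show "fp q w \<union> \<Union>{{Inr Win} |q' w'. q' < Q \<and> w' < W \<and> (q' = 0 \<and> w' = 0 \<and> w = 0 \<and> q = qs)}
      = cfgW 0 q w" for q w
    using Q_pos W_pos by (auto simp: cfgW_def)
  show "fp q w \<subseteq> cfgB (2 * lv) q w \<inter> range Inl \<union> Inr ` Items" for q w using Inl[of q w] by blast
  have 1: "{(q' :: nat, w' :: nat). q = 0 \<and> w = 0 \<and> w' = 0 \<and> q' = qs} \<subseteq> {(qs, 0)}"
    "{(q :: nat, w :: nat). q = 0 \<and> w = 0 \<and> w' = 0 \<and> q' = qs} \<subseteq> {(0, 0)}" for q w q' w' :: nat by auto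
  show "finite {(q' :: nat, w' :: nat). q = 0 \<and> w = 0 \<and> w' = 0 \<and> q' = qs}" "finite {(q :: nat, w :: nat). q = 0 \<and> w = 0 \<and> w' = 0 \<and> q' = qs}"
    for q w q' w' :: nat using finite_subset[OF 1(1)] finite_subset[OF 1(2)] by auto
  show "card {(q' :: nat, w' :: nat). q = 0 \<and> w = 0 \<and> w' = 0 \<and> q' = qs} \<le> B" for q w :: nat
    by (rule order_trans[OF card_mono[OF _ 1(1)]]) (use B_pos in auto)
  show "card {(q :: nat, w :: nat). q = 0 \<and> w = 0 \<and> w' = 0 \<and> q' = qs} \<le> B" for q' w' :: nat
    by (rule order_trans[OF card_mono[OF _ 1(2)]]) (use B_pos in auto)
qed (use fp_props fpcd in auto)

lemma round_win:
  assumes "t < lv"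
  shows "round_ok (T7 + 1 + t) x (onJ (cfgW t)) (onJ (cfgW (Suc t)))"
proof (rule round_ok_tree[where M = "\<lambda>q w q' w' A. (if q' = q \<and> w' = w then A \<inter> range Inl else {})
       \<union> (if q' = q \<and> w' div B = w \<and> Inr Win \<in> A then {Inr Win} else {})"
      and Kp = "\<lambda>q w. fp q w" and S = "\<lambda>q w. if q = qs \<and> w < B ^ t then {Inr Win} else {}"
      and R = "\<lambda>q w q' w'. q' = q \<and> w' div B = w"])
  show "msg (T7 + 1 + t) x a j A = (case (a, j) of (J q w, J q' w') \<Rightarrow>
      (if q' = q \<and> w' = w then A \<inter> range Inl else {})
       \<union> (if q' = q \<and> w' div B = w \<and> Inr Win \<in> A then {Inr Win} else {})
      | _ \<Rightarrow> {})" for x a j A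
    using assms by (simp add: msg_def msg_win_def T2_def T3_def T4_def T5_def T6_def T7_def T8_def)
  have Inl: "cfgW t q w \<inter> range Inl = fp q w" for q w by (auto simp: cfgW_def fp_def)
  have win: "Inr Win \<in> cfgW t q w \<longleftrightarrow> q = qs \<and> w < B ^ t" for q w by (auto simp: cfgW_def fp_def)
  show "(if q' = q \<and> w' = w then cfgW t q w \<inter> range Inl else {})
       \<union> (if q' = q \<and> w' div B = w \<and> Inr Win \<in> cfgW t q w then {Inr Win} else {}) =
      (if q' = q \<and> w' = w then fp q w else {})
       \<union> (if q' = q \<and> w' div B = w then if q = qs \<and> w < B ^ t then {Inr Win} else {} else {})" for q w q' w'
    unfolding Inl win by auto
  show "fp q w \<union> \<Union>{if q' = qs \<and> w' < B ^ t then {Inr Win} else {} |q' w'. q' < Q \<and> w' < W \<and> (q = q' \<and> w div B = w')}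
      = cfgW (Suc t) q w" if "q < Q" "w < W" for q w
    unfolding Union_parent(2)[OF that] using div_B_less[of w t] by (simp add: cfgW_def)
  show "fp q w \<subseteq> cfgW t q w \<inter> range Inl \<union> Inr ` Items" for q w using Inl[of q w] by blast
qed (use fp_props fpcd B_pos in auto)

lemma round_output: "round_ok T8 x (onJ (cfgW lv)) (onJ (\<lambda>q w. if q = qs then fp q w else {}))"
proof (rule round_ok_tree[where M = "\<lambda>q w q' w' A. if q' = q \<and> w' = w \<and> Inr Win \<in> A then A \<inter> range Inl else {}"
      and Kp = "\<lambda>q w. if q = qs \<and> w < W then fp q w else {}" and S = "\<lambda>q w. {}" and R = "\<lambda>q w q' w'. False"])
  show "msg T8 x a j A = (case (a, j) of (J q w, J q' w') \<Rightarrow>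
      if q' = q \<and> w' = w \<and> Inr Win \<in> A then A \<inter> range Inl else {} | _ \<Rightarrow> {})" for x a j A
    by (simp add: msg_def msg_output_def T2_def T3_def T4_def T5_def T6_def T7_def T8_def)
  have Inl: "cfgW lv q w \<inter> range Inl = fp q w" for q w by (auto simp: cfgW_def fp_def)
  have win: "Inr Win \<in> cfgW lv q w \<longleftrightarrow> q = qs \<and> w < W" for q w by (auto simp: cfgW_def fp_def W_def)
  show "(if q' = q \<and> w' = w \<and> Inr Win \<in> cfgW lv q w then cfgW lv q w \<inter> range Inl else {}) =
      (if q' = q \<and> w' = w then if q = qs \<and> w < W then fp q w else {} else {}) \<union> (if False then {} else {})" for q w q' w'
    unfolding Inl win by auto
  show "(if q = qs \<and> w < W then fp q w else {}) \<subseteq> cfgW lv q w \<inter> range Inl \<union> Inr ` Items" for q w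
    using Inl[of q w] by auto
qed (use fp_props fpcd in auto)

end

context alg_hash
begin

subsection \<open>Correctness of the selection\<close>

lemma F'_covers:
  assumes q: "q < Q" and i: "i \<in> sc q"
  shows "sel (cell i ` P) \<subseteq> cell i ` F' q"
proof
  fix c assume c: "c \<in> sel (cell i ` P)"
  obtain p0 where p0: "p0 \<in> P" "c = cell i p0" using subsetD[OF sel_subset c] by auto
  let ?k = "key i p0 (\<lambda>_. 0)"
  have "fin q ?k < W" using fin_less_iff[OF i] p0(1) by blast
  then obtain p where p: "p \<in> P" "key i p (\<lambda>_. 0) = ?k" "pos p = fin q ?k" using fin_attained[OF i] by blast
  have "cell i p = c" using key_eq_iff[OF p0(1) p(1) zero_Off] p(2) p0(2) by simp
  moreover have "pos p = fin q (key i p (\<lambda>_. 0))" using p(2,3) by simp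
  hence "p \<in> F' q" unfolding F'_def using p(1) q i c calculation by blast
  ultimately show "c \<in> cell i ` F' q" by blast
qed

lemma card_F'_le:
  assumes i: "i \<in> sc q"
  shows "card (F' q) \<le> card (sel (cell i ` P))"
proof (rule card_inj_on_le)
  have F: "pos p = fin q (key i p (\<lambda>_. 0)) \<and> cell i p \<in> sel (cell i ` P) \<and> p \<in> P" if "p \<in> F' q" for p
    using that sc_unique[OF i] by (auto simp: F'_def)
  show "inj_on (cell i) (F' q)"
  proof (rule inj_onI)
    fix p p' assume p: "p \<in> F' q" "p' \<in> F' q" "cell i p = cell i p'"
    have "key i p (\<lambda>_. 0) = key i p' (\<lambda>_. 0)" using p(3) by (simp add: key_def)
    hence "pos p = pos p'" using F[OF p(1)] F[OF p(2)] by simp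
    thus "p = p'" using F[OF p(1)] F[OF p(2)] inj_onD[OF pos_inj] by blast
  qed
  show "cell i ` F' q \<subseteq> sel (cell i ` P)" using F by blast
  show "finite (sel (cell i ` P))" using finite_subset[OF sel_subset] finP by blast
qed

lemma scale_bounds:
  assumes "p \<in> P" "p' \<in> P" "p \<noteq> p'"
  shows "dist p p' \<le> 2 ^ scale p p'" "2 ^ scale p p' \<le> 2 * dist p p'"
proof -
  have d: "dist p p' \<ge> 1" using dist_ge[OF assms] .
  have eq: "dist p p' = 2 powr log 2 (dist p p')" by (rule powr_log_cancel[symmetric]) (use d in auto)
  have l: "0 \<le> log 2 (dist p p')" using d by (subst zero_le_log_cancel_iff) auto
  have "2 powr log 2 (dist p p') \<le> 2 powr real (scale p p')"
    unfolding scale_def by (intro powr_mono) linarith+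
  thus "dist p p' \<le> 2 ^ scale p p'" using eq by (simp add: powr_realpow)
  have "2 powr real (scale p p') \<le> 2 powr (log 2 (dist p p') + 1)"
    unfolding scale_def using l by (intro powr_mono) linarith+
  also have "\<dots> = 2 * dist p p'" by (simp add: powr_add eq[symmetric])
  finally show "2 ^ scale p p' \<le> 2 * dist p p'" by (simp add: powr_realpow)
qed

lemma scale_available:
  assumes "p \<in> P" "p' \<in> P" "p \<noteq> p'"
  shows "\<exists>q<Q. scale p p' \<in> sc q"
proof (cases big)
  case True
  let ?q = "pos p * W + pos p'"
  have p: "pos p < W" "pos p' < W" using assms pos_less by auto
  have "?q < pos p * W + W" using p by simp
  also have "\<dots> = (pos p + 1) * W" by simp
  also have "\<dots> \<le> W * W" using p by (intro mult_le_mono1) simp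
  finally have "?q < Q" using big_Q[OF True] by simp
  moreover have "?q div W = pos p" "?q mod W = pos p'" using p W_pos by simp_all
  hence "scale p p' \<in> sc ?q" using True assms by (auto simp: sc_def)
  ultimately show ?thesis by blast
next
  case False
  thus ?thesis using scale_le[OF assms] not_big_Q[OF False] by (auto simp: sc_def)
qed

lemma Yset_all: "q < Q \<Longrightarrow> i \<in> sc q \<Longrightarrow> card (F' q) \<le> k \<Longrightarrow> i * Q + q \<in> Yset (2 * lv) 0"
proof -
  assume q: "q < Q" "i \<in> sc q" "card (F' q) \<le> k"
  have "q < B ^ (2 * lv)" using q(1) Q_le(1) unfolding BB by linarith
  hence "q div B ^ (2 * lv) = 0" by simp
  thus ?thesis unfolding Yset_def using q by blast
qed

text \<open>The scale \<open>i0\<close> of the optimum is available and valid, so the smallest valid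
  scale \<open>i\<close> is at most \<open>i0\<close>. Validity is tested by counting, hence
  \<open>i\<close> may well be below the scale of the optimum. The constant 6 is 3 from conflicting
  cells times 2 from rounding the optimum up to a power of two.\<close>

lemma selection_correct:
  assumes k: "0 < k" "k < card P"
  shows "Yset (2 * lv) 0 \<noteq> {}" "F' qs \<subseteq> P" "F' qs \<noteq> {}" "card (F' qs) \<le> k"
    "kcenter_cost P (F' qs) \<le> 6 * real CARD('d) * kcenter_opt P k"
proof -
  obtain S p p' where S: "S \<subseteq> P" "card S = k" "kcenter_cost P S = kcenter_opt P k"
    and p: "p \<in> P" "p' \<in> P" "p \<noteq> p'" "kcenter_opt P k = dist p p'"
    using kcenter_opt_attained[OF finP k] by metis
  define i0 where "i0 = scale p p'"
  have sb: "dist p p' \<le> 2 ^ i0" "2 ^ i0 \<le> 2 * dist p p'" using scale_bounds[OF p(1-3)] by (simp_all add: i0_def)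
  obtain q0 where q0: "q0 < Q" "i0 \<in> sc q0" using scale_available[OF p(1-3)] i0_def by blast
  have "S \<noteq> {}" using S(2) k by auto
  hence "card (sel (cell i0 ` P)) \<le> k"
    using card_sel_le[OF finP S(1), of i0] S p(4) sb(1) by simp
  hence "card (F' q0) \<le> k" using card_F'_le[OF q0(2)] by linarith
  hence y0: "i0 * Q + q0 \<in> Yset (2 * lv) 0" using Yset_all q0 by blast
  thus ne: "Yset (2 * lv) 0 \<noteq> {}" by blast
  obtain i q where iq: "Min (Yset (2 * lv) 0) = i * Q + q" "q < Q" "i \<in> sc q" "card (F' q) \<le> k"
    using Min_in[OF finite_Yset ne] unfolding Yset_def by blast
  have qs: "qs = q" using iq by (simp add: qs_def)
  have "i * Q + q \<le> i0 * Q + q0" using Min_le[OF finite_Yset y0] iq(1) by simp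
  \<comment> \<open>The scale is the leading digit of the code, because
    \<open>q0 < Q\<close>.\<close>
  hence "i \<le> i0"
  proof -
    assume le: "i * Q + q \<le> i0 * Q + q0"
    have "i * Q < Suc i0 * Q" using le q0(1) by simp
    thus ?thesis using mult_less_cancel2[of i Q "Suc i0"] by simp
  qed
  show "F' qs \<subseteq> P" by (rule F'_subset)
  show "card (F' qs) \<le> k" using iq qs by simp
  have neP: "P \<noteq> {}" using p by auto
  note cov = cost_of_representatives[OF finP neP F'_subset F'_covers[OF iq(2,3)]]
  show "F' qs \<noteq> {}" using cov(1) qs by simp
  have "kcenter_cost P (F' qs) \<le> 3 * real CARD('d) * 2 ^ i" using cov(2) qs by simp
  also have "\<dots> \<le> 3 * real CARD('d) * 2 ^ i0"
    using \<open>i \<le> i0\<close> by (intro mult_left_mono power_increasing) auto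
  also have "\<dots> \<le> 3 * real CARD('d) * (2 * dist p p')" using sb(2) by (intro mult_left_mono) auto
  finally show "kcenter_cost P (F' qs) \<le> 6 * real CARD('d) * kcenter_opt P k" using p(4) by simp
qed

subsection \<open>The run\<close>

text \<open>Between two phases this is the final configuration of the earlier one. The lemmas
  \<open>agree_M\<close>, \<open>agree_I\<close>, \<open>agree_U\<close> and \<open>agree_C\<close>
  identify it, on the existing machines, with the initial configuration of the later one.\<close>

definition traj :: "nat \<Rightarrow> addr \<Rightarrow> 'd mem" where
  "traj r = (if r \<le> T2 then onJ (cfgM (r - 2)) else if r = T2 + 1 then cfgK
     else if r \<le> T3 then onJ (cfgI (r - (T2 + 2))) else if r \<le> T4 then cfgU (r - T3)
     else if r \<le> T5 then cfgD (r - T4) else if r \<le> T6 then onJ (cfgC (r - (T5 + 1)))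
     else if r \<le> T7 then onJ (cfgB (r - (T6 + 1))) else if r \<le> T8 then onJ (cfgW (r - (T7 + 1)))
     else onJ (\<lambda>q w. if q = qs then fp q w else {}))"

lemma msg_flag_other: "(\<And>q w. b \<noteq> J q w) \<Longrightarrow> msg T5 x b j A = {}"
proof -
  assume *: "\<And>q w. b \<noteq> J q w"
  have "msg T5 x b j A = msg_flag b j A" by (simp add: msg_def T2_def T3_def T4_def T5_def)
  also have "\<dots> = {}"
  proof (cases b)
    case (J q w)
    with * show ?thesis by blast
  qed (simp_all add: msg_flag_def)
  finally show ?thesis .
qed

lemma agree_M: "j \<in> Ad \<Longrightarrow> onJ (cfgM (2 * lv)) j = onJ (\<lambda>q w. base w) j"
proof (cases j)
  case (J q w)
  assume "j \<in> Ad"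
  hence "q < B ^ (2 * lv)" using J Q_le(1) unfolding BB by simp
  thus ?thesis using J by (simp add: cfgM_def)
qed simp_all

lemma agree_I: "j \<in> Ad \<Longrightarrow> onJ (cfgI lv) j = cfgU 0 j"
  by (cases j) (auto simp: cfgI_def cfgU_def jb_def upset_def W_def)

lemma agree_U: "cfgU lv j = cfgD 0 j"
proof -
  have "{\<nu> \<in> dset 0. loc \<nu> = j} = {}" using nodes_level by (fastforce simp: dset_def)
  thus ?thesis by (simp only: cfgD_def image_empty Un_empty_right)
qed

lemma agree_C: "j \<in> Ad \<Longrightarrow> onJ (cfgC lv) j = onJ (\<lambda>q w. if q < Q then cfgC lv q w else {}) j"
  by (cases j) auto

lemma traj_stepI:
  assumes "rep s C" "\<And>x. round_ok r' x C C'" "r = r'" "traj (Suc r) = C'"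
  shows "\<exists>C. rep s C \<and> (\<forall>x. round_ok r x C (traj (Suc r)))"
  using assms by blast

text \<open>The existential \<open>C\<close> absorbs the change of description between phases: it
  may differ from \<open>traj r\<close> outside \<open>Ad\<close>, which no represented memory can
  tell.\<close>

lemma traj_step:
  assumes ne: "Yset (2 * lv) 0 \<noteq> {}" and r: "2 \<le> r" "r \<le> T8" and rep: "rep s (traj r)"
  shows "\<exists>C. rep s C \<and> (\<forall>x. round_ok r x C (traj (Suc r)))"
proof -
  note Ts = T2_def T3_def T4_def T5_def T6_def T7_def T8_def
  consider (M) "r < T2" | (P) "r = T2" | (C) "r = T2 + 1" | (I) "T2 + 2 \<le> r" "r < T3" | (U) "T3 \<le> r" "r < T4"
    | (D) "T4 \<le> r" "r < T5" | (F) "r = T5" | (N) "T5 + 1 \<le> r" "r < T6" | (V) "r = T6"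
    | (B) "T6 + 1 \<le> r" "r < T7" | (A) "r = T7" | (W) "T7 + 1 \<le> r" "r < T8" | (O) "r = T8"
    using r by linarith
  thus ?thesis
  proof cases
    case M
    define t where "t = r - 2"
    have t: "r = 2 + t" "t < 2 * lv" using M r by (simp_all add: t_def Ts)
    have "traj r = onJ (cfgM t)" "traj (Suc r) = onJ (cfgM (Suc t))" using t by (simp_all add: traj_def Ts)
    thus ?thesis using rep t(1) by (intro traj_stepI[OF _ round_copy[OF t(2)]]) simp_all
  next
    case P
    have "rep s (onJ (\<lambda>q w. base w))"
      by (rule rep_cong[OF rep]) (use agree_M P in \<open>simp add: traj_def Ts\<close>)
    moreover have "traj (Suc r) = cfgK" using P by (simp add: traj_def Ts)
    ultimately show ?thesis using P by (intro traj_stepI[OF _ round_pairs])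
  next
    case C
    have "traj r = cfgK" "traj (Suc r) = onJ (cfgI 0)" using C by (simp_all add: traj_def Ts)
    thus ?thesis using rep C by (intro traj_stepI[OF _ round_cands]) simp_all
  next
    case I
    define t where "t = r - (T2 + 2)"
    have t: "r = T2 + 2 + t" "t < lv" using I by (simp_all add: t_def Ts)
    have "traj r = onJ (cfgI t)" "traj (Suc r) = onJ (cfgI (Suc t))" using t by (simp_all add: traj_def Ts)
    thus ?thesis using rep t(1) by (intro traj_stepI[OF _ round_info[OF t(2)]]) simp_all
  next
    case U
    define t where "t = r - T3"
    have t: "r = T3 + t" "t < lv" using U by (simp_all add: t_def Ts)
    have "rep s (cfgU t)"
      by (rule rep_cong[OF rep]) (use agree_I t in \<open>cases t; simp add: traj_def Ts\<close>)
    moreover have "traj (Suc r) = cfgU (Suc t)" using t by (simp add: traj_def Ts)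
    ultimately show ?thesis using t(1) by (intro traj_stepI[OF _ round_up[OF t(2)]])
  next
    case D
    define t where "t = r - T4"
    have t: "r = T4 + t" "t < lv" using D by (simp_all add: t_def Ts)
    have "rep s (cfgD t)"
      by (rule rep_cong[OF rep]) (use agree_U lv_pos t in \<open>cases t; simp add: traj_def Ts\<close>)
    moreover have "traj (Suc r) = cfgD (Suc t)" using t by (simp add: traj_def Ts)
    ultimately show ?thesis using t(1) by (intro traj_stepI[OF _ round_down[OF t(2)]])
  next
    case F
    have "traj r = cfgD lv" "traj (Suc r) = onJ (cfgC 0)" using F lv_pos by (simp_all add: traj_def Ts)
    moreover have step: "round_ok T5 x (cfgD lv) (onJ (cfgC 0))" for x
      by (rule round_ok_restrict[OF round_flag]) (simp_all add: cfgD_def cfgU_def fD_def msg_flag_other)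
    ultimately show ?thesis using rep F by (intro traj_stepI[OF _ step]) simp_all
  next
    case N
    define t where "t = r - (T5 + 1)"
    have t: "r = T5 + 1 + t" "t < lv" using N by (simp_all add: t_def Ts)
    have "traj r = onJ (cfgC t)" "traj (Suc r) = onJ (cfgC (Suc t))" using t by (simp_all add: traj_def Ts)
    thus ?thesis using rep t(1) by (intro traj_stepI[OF _ round_count[OF t(2)]]) simp_all
  next
    case V
    have "rep s (onJ (\<lambda>q w. if q < Q then cfgC lv q w else {}))"
      by (rule rep_cong[OF rep]) (use agree_C V in \<open>simp add: traj_def Ts\<close>)
    moreover have "traj (Suc r) = onJ (cfgB 0)" using V by (simp add: traj_def Ts)
    ultimately show ?thesis using V by (intro traj_stepI[OF _ round_valid])
  next
    case B
    define t where "t = r - (T6 + 1)"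
    have t: "r = T6 + 1 + t" "t < 2 * lv" using B by (simp_all add: t_def Ts)
    have "traj r = onJ (cfgB t)" "traj (Suc r) = onJ (cfgB (Suc t))" using t by (simp_all add: traj_def Ts)
    thus ?thesis using rep t(1) by (intro traj_stepI[OF _ round_best[OF t(2)]]) simp_all
  next
    case A
    have "traj r = onJ (cfgB (2 * lv))" "traj (Suc r) = onJ (cfgW 0)" using A by (simp_all add: traj_def Ts)
    thus ?thesis using rep A by (intro traj_stepI[OF _ round_announce[OF ne]]) simp_all
  next
    case W
    define t where "t = r - (T7 + 1)"
    have t: "r = T7 + 1 + t" "t < lv" using W by (simp_all add: t_def Ts)
    have "traj r = onJ (cfgW t)" "traj (Suc r) = onJ (cfgW (Suc t))" using t by (simp_all add: traj_def Ts)
    thus ?thesis using rep t(1) by (intro traj_stepI[OF _ round_win[OF t(2)]]) simp_all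
  next
    case O
    have "traj r = onJ (cfgW lv)" "traj (Suc r) = onJ (\<lambda>q w. if q = qs then fp q w else {})"
      using O by (simp_all add: traj_def Ts)
    thus ?thesis using rep O by (intro traj_stepI[OF _ round_output]) simp_all
  qed
qed

lemma traj_final_output:
  assumes "rep s (traj (Suc T8))"
  shows "mpc_output program s = F' qs"
proof -
  have traj: "traj (Suc T8) = onJ (\<lambda>q w. if q = qs then fp q w else {})"
    by (simp add: traj_def T2_def T3_def T4_def T5_def T6_def T7_def T8_def)
  have set: "set (s (enc j)) = enc_cell ` traj (Suc T8) j" if "j \<in> Ad" for j
    using assms that by (auto simp: rep_def)
  have "p \<in> mpc_output program s \<longleftrightarrow> (\<exists>j\<in>Ad. Inl p \<in> traj (Suc T8) j)" for p
  proof
    assume "p \<in> mpc_output program s"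
    then obtain i where i: "i < card Ad" "Pt p \<in> set (s i)"
      by (auto simp: mpc_output_def program_def)
    then obtain j where j: "j \<in> Ad" "i = enc j" using enc by (auto simp: bij_betw_def image_iff)
    then obtain c where "c \<in> traj (Suc T8) j" "enc_cell c = Pt p" using i set by (auto dest: sym)
    moreover hence "c = Inl p" by (cases c) (auto simp: enc_cell_def)
    ultimately show "\<exists>j\<in>Ad. Inl p \<in> traj (Suc T8) j" using j by blast
  next
    assume "\<exists>j\<in>Ad. Inl p \<in> traj (Suc T8) j"
    then obtain j where j: "j \<in> Ad" "Inl p \<in> traj (Suc T8) j" by blast
    hence "Pt p \<in> set (s (enc j))" unfolding set[OF j(1)] by (auto simp: enc_cell_def intro!: image_eqI[of _ _ "Inl p"])
    thus "p \<in> mpc_output program s" using enc_less[OF j(1)] by (auto simp: mpc_output_def program_def)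
  qed
  also have "(\<exists>j\<in>Ad. Inl p \<in> traj (Suc T8) j) \<longleftrightarrow> p \<in> F' qs" for p
  proof
    assume "\<exists>j\<in>Ad. Inl p \<in> traj (Suc T8) j"
    then obtain j where j: "Inl p \<in> onJ (\<lambda>q w. if q = qs then fp q w else {}) j" unfolding traj by blast
    thus "p \<in> F' qs" by (cases j) (auto simp: fp_def split: if_splits)
  next
    assume p: "p \<in> F' qs"
    hence "pos p < W" using pos_less F'_subset by blast
    hence "J qs (pos p) \<in> Ad" using qs_less by simp
    moreover have "Inl p \<in> traj (Suc T8) (J qs (pos p))" unfolding traj using p by (simp add: fp_def)
    ultimately show "\<exists>j\<in>Ad. Inl p \<in> traj (Suc T8) j" by blast
  qed
  finally show ?thesis by blast
qed

end

section \<open>Random scattering and seeds\<close>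

context alg_params
begin

text \<open>A superset of the nodes that depends only on parameters known to the program, so the
  hash family can be fixed before the points are known.\<close>

definition univ :: "'d node set" where
  "univ = {..lv} \<times> {..<W} \<times> {..<Q} \<times> (UNIV \<rightarrow> {0..<2 ^ kb})"

end

context alg_run
begin

lemma allnodes_univ: "allnodes \<subseteq> univ"
proof
  fix \<nu> assume "\<nu> \<in> allnodes"
  then obtain t where t: "t \<le> lv" "\<nu> \<in> nodes t" by (auto simp: allnodes_def)
  then obtain q p i z where *: "q < Q" "p \<in> P" "\<nu> = node t q p i z" unfolding nodes_def by blast
  have "pos p div B ^ t < W" using pos_less[OF *(2)] by (meson div_le_dividend le_less_trans)
  moreover have "key i p z \<in> UNIV \<rightarrow> {0..<2 ^ kb}" by (auto simp: key_def)
  ultimately show "\<nu> \<in> univ" using t *(1,3) by (simp add: node_def univ_def)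
qed

text \<open>A block has at most one scale, so the choice of the candidate contributes no more than
  the factor \<open>Q\<close>.\<close>

lemma card_allnodes: "card allnodes \<le> card P * Q * card Off * (lv + 1)"
proof -
  let ?S = "SIGMA q:{..<Q}. sc q"
  let ?f = "\<lambda>(t, z, p, q, i). node t q p i z"
  have sub: "allnodes \<subseteq> ?f ` ({..lv} \<times> Off \<times> P \<times> ?S)"
    unfolding allnodes_def nodes_def by (auto intro!: image_eqI[where x = "(_, _, _, _, _)"])
  have finS: "finite ?S" using card_sc(1) by simp
  have "card ?S = (\<Sum>q<Q. card (sc q))" using card_sc(1) by (intro card_SigmaI) auto
  also have "\<dots> \<le> Q" using sum_bounded_above[of "{..<Q}" "\<lambda>q. card (sc q)" 1] card_sc(2) by simp
  finally have cS: "card ?S \<le> Q" .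
  have fin: "finite ({..lv} \<times> Off \<times> P \<times> ?S)" using finite_Off finP finS by simp
  have "card allnodes \<le> card (?f ` ({..lv} \<times> Off \<times> P \<times> ?S))"
    using fin by (intro card_mono[OF _ sub]) simp
  also have "\<dots> \<le> card ({..lv} \<times> Off \<times> P \<times> ?S)" using fin by (rule card_image_le)
  also have "\<dots> = (lv + 1) * (card Off * (card P * card ?S))" by (simp add: card_cartesian_product)
  also have "\<dots> \<le> (lv + 1) * (card Off * (card P * Q))" using cS by (intro mult_le_mono) auto
  finally show ?thesis by (simp add: mult_ac)
qed

end

locale alg_input = alg_params k L B m F h
  for k L B m F :: nat and h :: "nat \<Rightarrow> 'd::finite node \<Rightarrow> nat" +
  fixes P :: "(real ^ 'd) set"
  assumes finP: "finite P" and F_pos: "F > 0"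
    and B_large: "8 * (t0 + 2) * (card Off + 6) \<le> B" and B_Off: "card Off * (lv + 1) \<le> B"
    and dist_ge: "p \<in> P \<Longrightarrow> q \<in> P \<Longrightarrow> p \<noteq> q \<Longrightarrow> 1 \<le> dist p q"
    and dist_le: "p \<in> P \<Longrightarrow> q \<in> P \<Longrightarrow> dist p q \<le> 2 ^ L"
    and card_P: "card P < B ^ (m + 1)" and k: "0 < k" "k < card P"
    and h_range: "\<nu> \<in> univ \<Longrightarrow> h a \<nu> < Hr * ss"
    and h_family: "S \<subseteq> univ \<Longrightarrow> card S \<le> ss \<Longrightarrow>
        real (card {a. a < F \<and> \<not> (inj_on (h a) S \<and> (\<forall>b. card {x\<in>S. h a x mod Hr = b} \<le> t0))})
          \<le> 5 / real B * real F"
begin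

lemma B_pos: "B > 0"
proof -
  have "8 * 2 * 6 \<le> 8 * (t0 + 2) * (card Off + 6)" by (intro mult_le_mono) auto
  thus ?thesis using B_large by linarith
qed

lemma t0_le_B: "t0 + 16 \<le> B"
proof -
  have "8 * (t0 + 2) * 1 \<le> 8 * (t0 + 2) * (card Off + 6)" by (intro mult_le_mono) auto
  from order_trans[OF this B_large] show ?thesis by simp
qed

lemma B_le_cap: "B \<le> cap" using B_pos by (simp add: cap_def power2_eq_square)

lemma QJ_pos: "Q > 0" "J 0 0 \<in> Ad"
  using B_pos by (auto simp: Q_def W_def)

definition scattered :: "(nat \<Rightarrow> nat \<Rightarrow> (real ^ 'd) set) \<Rightarrow> bool" where
  "scattered Vp \<longleftrightarrow> (\<forall>b l. finite (Vp b l) \<and> card (Vp b l) \<le> t0) \<and>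
     (\<forall>b l b' l' p. p \<in> Vp b l \<longrightarrow> p \<in> Vp b' l' \<longrightarrow> b = b' \<and> l = l') \<and>
     (\<forall>b l p. p \<in> Vp b l \<longrightarrow> b < B ^ (m + 2) \<and> l < B ^ 2 \<and> p \<in> P) \<and> (\<forall>p\<in>P. \<exists>b l. p \<in> Vp b l)"

definition cfgV :: "(nat \<Rightarrow> nat \<Rightarrow> (real ^ 'd) set) \<Rightarrow> addr \<Rightarrow> 'd mem" where
  "cfgV Vp j = (case j of V b l \<Rightarrow> Inl ` Vp b l | _ \<Rightarrow> {})"

definition slot_of :: "(nat \<Rightarrow> nat \<Rightarrow> (real ^ 'd) set) \<Rightarrow> real ^ 'd \<Rightarrow> nat" where
  "slot_of Vp p = (SOME w. \<exists>b l. p \<in> Vp b l \<and> w = slot b l (idx (Vp b l) p))"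

lemma scatteredD:
  assumes "scattered Vp"
  shows "finite (Vp b l)" "card (Vp b l) \<le> t0"
    "p \<in> Vp b l \<Longrightarrow> b < B ^ (m + 2)" "p \<in> Vp b l \<Longrightarrow> l < B ^ 2" "p \<in> Vp b l \<Longrightarrow> p \<in> P"
  using assms unfolding scattered_def by simp_all

lemma scattered_unique: "scattered Vp \<Longrightarrow> p \<in> Vp b l \<Longrightarrow> p \<in> Vp b' l' \<Longrightarrow> b' = b \<and> l' = l"
  unfolding scattered_def by metis

lemma slot_of_eq: "scattered Vp \<Longrightarrow> p \<in> Vp b l \<Longrightarrow> slot_of Vp p = slot b l (idx (Vp b l) p)"
proof -
  assume V: "scattered Vp" and p: "p \<in> Vp b l"
  have "b' = b \<and> l' = l" if "p \<in> Vp b' l'" for b' l' by (rule scattered_unique[OF V p that])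
  thus ?thesis unfolding slot_of_def using p by (intro some_equality) blast+
qed

lemma mult_add_eq:
  fixes l l' M b b' :: nat
  assumes "l < M" "l' < M" "b * M + l = b' * M + l'"
  shows "b = b' \<and> l = l'"
proof -
  have "(b * M + l) div M = b" "(b' * M + l') div M = b'" using assms(1,2) by simp_all
  thus ?thesis using assms(3) by simp
qed

lemma slot_inj:
  assumes "slot b l i = slot b' l' i'" "l < B ^ 2" "l' < B ^ 2" "i < B" "i' < B"
  shows "b = b'" "l = l'" "i = i'"
  using mult_add_eq[of i B i' "b * B ^ 2 + l" "b' * B ^ 2 + l'"] mult_add_eq[of l "B ^ 2" l' b b'] assms
  by (simp_all only: slot_def simp_thms)

lemma idx_less: "finite A \<Longrightarrow> p \<in> A \<Longrightarrow> idx A p < card A"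
  using bij_betw_apply[OF idx_bij, of A p] by simp

lemma idx_inj: "finite A \<Longrightarrow> p \<in> A \<Longrightarrow> p' \<in> A \<Longrightarrow> idx A p = idx A p' \<Longrightarrow> p = p'"
  using idx_bij[of A] by (auto simp: bij_betw_def dest: inj_onD)

lemma alg_run_slot:
  assumes V: "scattered Vp" and a: "a < F"
  shows "alg_run L B m F P (slot_of Vp) a"
proof
  have home: "\<exists>b l. p \<in> Vp b l \<and> b < B ^ (m + 2) \<and> l < B ^ 2 \<and> idx (Vp b l) p < t0
      \<and> slot_of Vp p = slot b l (idx (Vp b l) p)" if p: "p \<in> P" for p
  proof -
    obtain b l where bl: "p \<in> Vp b l" using V p unfolding scattered_def by blast
    note * = scatteredD(1,2)[OF V, of b l] scatteredD(3,4)[OF V bl]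
    show ?thesis
      by (intro exI conjI, rule bl, rule *, rule *, rule less_le_trans[OF idx_less[OF *(1) bl] *(2)], rule slot_of_eq[OF V bl])
  qed
  show "inj_on (slot_of Vp) P"
  proof (rule inj_onI)
    fix p p' assume p: "p \<in> P" "p' \<in> P" "slot_of Vp p = slot_of Vp p'"
    obtain b l where bl: "p \<in> Vp b l" "l < B ^ 2" "idx (Vp b l) p < t0" "slot_of Vp p = slot b l (idx (Vp b l) p)"
      using home[OF p(1)] by blast
    obtain b' l' where bl': "p' \<in> Vp b' l'" "l' < B ^ 2" "idx (Vp b' l') p' < t0" "slot_of Vp p' = slot b' l' (idx (Vp b' l') p')"
      using home[OF p(2)] by blast
    have eq: "slot b l (idx (Vp b l) p) = slot b' l' (idx (Vp b' l') p')" using bl(4) bl'(4) p(3) by simp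
    have lt: "idx (Vp b l) p < B" "idx (Vp b' l') p' < B" using bl(3) bl'(3) t0_le_B by linarith+
    note si = slot_inj[OF eq bl(2) bl'(2) lt]
    have fin: "finite (Vp b l)" by (rule scatteredD[OF V])
    have "p' \<in> Vp b l" using bl'(1) by (simp only: si(1,2))
    moreover have "idx (Vp b l) p = idx (Vp b l) p'" by (rule trans[OF si(3)]) (simp only: si(1,2))
    ultimately show "p = p'" by (rule idx_inj[OF fin bl(1)])
  qed
  show "slot_of Vp p < W" if pP: "p \<in> P" for p
  proof -
    obtain b l where bl: "b < B ^ (m + 2)" "l < B ^ 2" "idx (Vp b l) p < t0" "slot_of Vp p = slot b l (idx (Vp b l) p)"
      using home[OF pP] by blast
    have i: "idx (Vp b l) p < B" using bl(3) t0_le_B by linarith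
    have "b * B ^ 2 + l < Suc b * B ^ 2" using bl(2) by simp
    also have "\<dots> \<le> B ^ (m + 2) * B ^ 2" using bl(1) by (intro mult_le_mono1) simp
    finally have 1: "Suc (b * B ^ 2 + l) \<le> B ^ (m + 2) * B ^ 2" by simp
    have "slot_of Vp p < Suc (b * B ^ 2 + l) * B" using i bl(4) by (simp add: slot_def)
    also have "\<dots> \<le> (B ^ (m + 2) * B ^ 2) * B" using 1 by (intro mult_le_mono1)
    also have "\<dots> = W" by (simp add: W_def lv_def power_add eval_nat_numeral mult_ac)
    finally show ?thesis .
  qed
qed (use finP a B_large dist_ge dist_le in auto)

lemma round_split:
  assumes V: "scattered Vp" and a: "x (J 0 0) < F"
  shows "round_ok 1 x (cfgV Vp) (alg_run.onJ (alg_run.cfgM B P (slot_of Vp) (x (J 0 0)) 0))"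
proof -
  interpret R: alg_run k L B m F h P "slot_of Vp" "x (J 0 0)" by (rule alg_run_slot[OF V a])
  have msg: "msg 1 = msg_split" by (rule ext) (simp add: msg_def)
  note finV = scatteredD(1)[OF V] and cV = scatteredD(2)[OF V]
  have VP: "p \<in> P" "b < B ^ (m + 2)" "l < B ^ 2" if "p \<in> Vp b l" for p b l
    using scatteredD(3-5)[OF V that] by simp_all
  have pts: "points (Inl ` A) = A" for A :: "(real ^ 'd) set" by (auto simp: points_def)
  have mV: "msg_split y (V b l) j (cfgV Vp (V b l)) =
      {Inl p |p. p \<in> Vp b l \<and> j = J 0 (slot_of Vp p)}" for y b l j
  proof (cases j)
    case (J q w)
    thus ?thesis using slot_of_eq[OF V] by (auto simp: msg_split_def cfgV_def pts)
  qed (auto simp: msg_split_def)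
  have mJ: "msg_split y (J q w) j (cfgV Vp (J q w)) =
      (if q = 0 \<and> w = 0 \<and> j = J 0 0 then {Inr (Seed y)} else {})" for y q w j
    by (cases j) (auto simp: msg_split_def)
  have mO: "msg_split y b j A = {}" if "\<And>b' l. b \<noteq> V b' l" "\<And>q w. b \<noteq> J q w" for y b j A
    using that by (cases b) (auto simp: msg_split_def)
  have small: "2 \<le> cap" "t0 \<le> cap" using B_le_cap t0_le_B by linarith+
  show ?thesis
  proof (rule round_okI, unfold msg)
    fix b assume b: "b \<in> Ad"
    show "\<exists>Z. {(j, c). j \<in> Ad \<and> c \<in> msg_split (x b) b j (cfgV Vp b)} \<subseteq> Z \<and> finite Z \<and> card Z \<le> cap"
    proof (cases b)
      case (V b' l)
      let ?Z = "(\<lambda>p. (J 0 (slot_of Vp p), Inl p)) ` Vp b' l"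
      have "{(j, c). j \<in> Ad \<and> c \<in> msg_split (x b) b j (cfgV Vp b)} \<subseteq> ?Z" unfolding V mV by auto
      moreover have "card ?Z \<le> cap" using card_image_le[OF finV] cV small(2) order_trans by meson
      ultimately show ?thesis using finV by blast
    next
      case (J q w)
      have "{(j, c). j \<in> Ad \<and> c \<in> msg_split (x b) b j (cfgV Vp b)} \<subseteq> {(J 0 0, Inr (Seed (x b)))}"
        unfolding J mJ by (auto split: if_splits)
      thus ?thesis using small(1) by (intro exI[of _ "{(J 0 0, Inr (Seed (x b)))}"]) simp
    qed (auto simp: mO intro!: exI[of _ "{}"])
  next
    fix j assume j: "j \<in> Ad"
    show "\<exists>Z. {(b, c). b \<in> Ad \<and> c \<in> msg_split (x b) b j (cfgV Vp b)} \<subseteq> Z \<and> finite Z \<and> card Z \<le> cap"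
    proof (cases "\<exists>w. j = J 0 w")
      case True
      then obtain w where w: "j = J 0 w" by blast
      \<comment> \<open>A point has a unique sender because the sets \<open>Vp b l\<close> are
        disjoint; this bounds what a slot receives.\<close>
      define hm where "hm = (\<lambda>p. SOME y. \<exists>b l. p \<in> Vp b l \<and> y = V b l)"
      have hm: "hm p = V b l" if p: "p \<in> Vp b l" for p b l
        unfolding hm_def
      proof (rule some_equality)
        fix y assume "\<exists>b l. p \<in> Vp b l \<and> y = V b l"
        then obtain b' l' where "p \<in> Vp b' l'" "y = V b' l'" by blast
        thus "y = V b l" using scattered_unique[OF V p] by simp
      qed (use p in blast)
      let ?Z = "{(J 0 0, Inr (Seed (x (J 0 0))))} \<union> (\<lambda>c. (hm (projl c), c)) ` R.pts w"
      have "{(b, c). b \<in> Ad \<and> c \<in> msg_split (x b) b j (cfgV Vp b)} \<subseteq> ?Z"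
      proof
        fix z assume "z \<in> {(b, c). b \<in> Ad \<and> c \<in> msg_split (x b) b j (cfgV Vp b)}"
        then obtain b c where z: "z = (b, c)" "c \<in> msg_split (x b) b j (cfgV Vp b)" by auto
        show "z \<in> ?Z"
        proof (cases b)
          case (V b' l)
          then obtain p where p: "p \<in> Vp b' l" "c = Inl p" "w = slot_of Vp p" using z w mV by auto
          hence "c \<in> R.pts w" using VP by (auto simp: R.pts_def)
          thus ?thesis using z V hm[OF p(1)] p(2) by (auto intro!: image_eqI[of _ _ c])
        next
          case (J q w')
          thus ?thesis using z mJ by (auto split: if_splits)
        qed (use z mO in auto)
      qed
      moreover have "card ?Z \<le> 2"
        using card_image_le[OF R.card_pts(1)[of w], of "\<lambda>c. (hm (projl c), c)"] R.card_pts[of w]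
        by (simp add: card_insert_if)
      ultimately show ?thesis using small(1) R.card_pts(1) by (intro exI[of _ ?Z]) auto
    next
      case False
      have "msg_split (x b) b j (cfgV Vp b) = {}" for b
        using False mO by (cases b) (auto simp: mV mJ)
      thus ?thesis by (intro exI[of _ "{}"]) auto
    qed
  next
    fix b j assume bj: "b \<in> Ad" "j \<in> Ad"
    show "msg_split (x b) b j (cfgV Vp b) \<subseteq> cfgV Vp b \<inter> range Inl \<union> Inr ` Items"
    proof (cases b)
      case (V b' l)
      show ?thesis unfolding V mV by (auto simp: cfgV_def)
    next
      case (J q w)
      show ?thesis unfolding J mJ using a J by (auto split: if_splits)
    qed (use mO in auto)
  next
    fix j assume j: "j \<in> Ad"
    show "(\<Union>b\<in>Ad. msg_split (x b) b j (cfgV Vp b)) = R.onJ (R.cfgM 0) j" (is "?L = _")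
    proof (cases "\<exists>w. j = J 0 w")
      case True
      then obtain w where w: "j = J 0 w" by blast
      show ?thesis
      proof (intro equalityI subsetI)
        fix c assume "c \<in> ?L"
        then obtain b where b: "b \<in> Ad" "c \<in> msg_split (x b) b j (cfgV Vp b)" by blast
        show "c \<in> R.onJ (R.cfgM 0) j"
        proof (cases b)
          case (V b' l)
          thus ?thesis using b mV w VP by (auto simp: R.cfgM_def R.base_def R.pts_def)
        next
          case (J q w')
          thus ?thesis using b mJ w by (auto simp: R.cfgM_def R.base_def split: if_splits)
        qed (use b mO in auto)
      next
        fix c assume "c \<in> R.onJ (R.cfgM 0) j"
        then consider p where "c = Inl p" "p \<in> P" "slot_of Vp p = w" | "w = 0" "c = Inr (Seed (x (J 0 0)))"
          using w by (auto simp: R.cfgM_def R.base_def R.pts_def split: if_splits)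
        thus "c \<in> ?L"
        proof cases
          case 1
          obtain b l where bl: "p \<in> Vp b l" using V 1(2) unfolding scattered_def by blast
          hence "V b l \<in> Ad" using VP by simp
          moreover have "c \<in> msg_split (x (V b l)) (V b l) j (cfgV Vp (V b l))" unfolding mV using 1 bl w by blast
          ultimately show ?thesis by blast
        next
          case 2
          thus ?thesis using QJ_pos(2) mJ w by (intro UN_I[of "J 0 0"]) auto
        qed
      qed
    next
      case False
      have "msg_split (x b) b j (cfgV Vp b) = {}" for b
        using False mO by (cases b) (auto simp: mV mJ)
      moreover have "R.onJ (R.cfgM 0) j = {}" using False by (cases j) (auto simp: R.cfgM_def)
      ultimately show ?thesis by simp
    qed
  qed
qed

end

section \<open>Random distribution of an arbitrarily placed input\<close>

locale alg_placed = alg_input k L B m F h P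
  for k L B m F :: nat and h :: "nat \<Rightarrow> 'd::finite node \<Rightarrow> nat" and P :: "(real ^ 'd) set" +
  fixes s :: "'d config"
  assumes placement: "input_placement program P s"
begin

definition "pa a = {p. Pt p \<in> set (s (enc a))}"
definition "cfg0 a = (Inl ` pa a :: 'd mem)"
definition "NE = {a \<in> Ad. pa a \<noteq> {}}"

lemma count_concat: "count (mset (concat (map s [0..<M]))) c = (\<Sum>i<M. count (mset (s i)) c)"
  by (induction M) auto

lemma count_input: "(\<Sum>i<card Ad. count (mset (s i)) c) = (if c \<in> Pt ` P then 1 else 0)"
proof -
  have "(\<Sum>i<card Ad. count (mset (s i)) c) = count (image_mset Pt (mset_set P)) c"
    unfolding count_concat[symmetric] using placement by (simp add: input_placement_def program_def)
  also have "image_mset Pt (mset_set P) = mset_set (Pt ` P)"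
    by (rule image_mset_mset_set) (simp add: inj_on_def)
  finally show ?thesis using finP by (simp add: count_mset_set')
qed

lemma count_once:
  assumes "i < card Ad"
  shows "count (mset (s i)) c \<le> (if c \<in> Pt ` P then 1 else 0)"
  unfolding count_input[symmetric] using assms by (intro member_le_sum) auto

lemma set_input: "i < card Ad \<Longrightarrow> set (s i) \<subseteq> Pt ` P"
proof
  fix c assume "i < card Ad" "c \<in> set (s i)"
  thus "c \<in> Pt ` P" using count_once[of i c] count_mset_gt_0[of c "s i"] by (auto split: if_splits)
qed

lemma pa_unique:
  assumes a: "a \<in> Ad" "p \<in> pa a" and a': "a' \<in> Ad" "p \<in> pa a'"
  shows "a = a'"
proof (rule ccontr)
  assume "a \<noteq> a'"
  hence ne: "enc a \<noteq> enc a'" using a(1) a'(1) inj_enc by (auto dest: inj_onD)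
  have "1 \<le> count (mset (s (enc a))) (Pt p)" "1 \<le> count (mset (s (enc a'))) (Pt p)"
    using a(2) a'(2) by (simp_all add: pa_def Suc_le_eq)
  moreover have "(\<Sum>i\<in>{enc a, enc a'}. count (mset (s i)) (Pt p))
      = count (mset (s (enc a))) (Pt p) + count (mset (s (enc a'))) (Pt p)" using ne by simp
  ultimately have "2 \<le> (\<Sum>i\<in>{enc a, enc a'}. count (mset (s i)) (Pt p))" by linarith
  also have "\<dots> \<le> (\<Sum>i<card Ad. count (mset (s i)) (Pt p))"
    using a(1) a'(1) enc_less by (intro sum_mono2) auto
  also have "\<dots> \<le> 1" unfolding count_input by simp
  finally show False by simp
qed

lemma pa_subset: "a \<in> Ad \<Longrightarrow> pa a \<subseteq> P"
  using set_input[OF enc_less] by (auto simp: pa_def)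

lemma finite_pa: "a \<in> Ad \<Longrightarrow> finite (pa a)"
  using pa_subset finP finite_subset by blast

lemma pa_cover: "p \<in> P \<Longrightarrow> \<exists>a\<in>Ad. p \<in> pa a"
proof -
  assume "p \<in> P"
  hence "(\<Sum>i<card Ad. count (mset (s i)) (Pt p)) \<noteq> 0" unfolding count_input by simp
  then obtain i where "i \<in> {..<card Ad}" and i: "count (mset (s i)) (Pt p) \<noteq> 0"
    by (rule sum.not_neutral_contains_not_neutral)
  then obtain a where "a \<in> Ad" "i = enc a" using enc by (auto simp: bij_betw_def)
  thus ?thesis using i by (auto simp: pa_def)
qed

lemma card_pa: "a \<in> Ad \<Longrightarrow> card (pa a) \<le> cap"
proof -
  assume a: "a \<in> Ad"
  have "num_words xs = CARD('d) * length xs" if "set xs \<subseteq> range Pt" for xs :: "'d cell list"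
    using that by (induction xs) (auto simp: num_words_def)
  hence "num_words (s (enc a)) = CARD('d) * length (s (enc a))"
    using set_input[OF enc_less[OF a]] by blast
  moreover have "num_words (s (enc a)) \<le> CARD('d) * cap"
    using placement enc_less[OF a] by (simp add: input_placement_def program_def)
  ultimately have len: "length (s (enc a)) \<le> cap" by simp
  have "card (pa a) = card (Pt ` pa a)" by (rule card_image[symmetric]) (simp add: inj_on_def)
  also have "\<dots> \<le> card (set (s (enc a)))" by (rule card_mono) (auto simp: pa_def)
  also have "\<dots> \<le> cap" using card_length[of "s (enc a)"] len by linarith
  finally show ?thesis .
qed

lemma rep_cfg0: "rep s cfg0"
proof -
  have "set (s (enc a)) = Pt ` pa a" if "a \<in> Ad" for a
    using set_input[OF enc_less[OF that]] by (auto simp: pa_def)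
  thus ?thesis by (auto simp: rep_def cfg0_def valid_def enc_cell_def image_image)
qed

text \<open>Only machines that hold points matter for the random distribution. There are at most
  \<open>n\<close> of them, although there are more machines than points.\<close>

lemma card_NE: "card NE \<le> card P"
proof (rule card_inj_on_le[OF _ _ finP])
  let ?f = "\<lambda>a. SOME p. p \<in> pa a"
  have f: "?f a \<in> pa a" if "a \<in> NE" for a using that by (auto simp: NE_def some_in_eq)
  show "inj_on ?f NE"
  proof (rule inj_onI)
    fix a a' assume "a \<in> NE" "a' \<in> NE" "?f a = ?f a'"
    thus "a = a'" using f[of a] f[of a'] by (intro pa_unique[of a "?f a" a']) (auto simp: NE_def)
  qed
  show "?f ` NE \<subseteq> P" using f pa_subset by (fastforce simp: NE_def)
qed

definition Vs :: "(addr \<Rightarrow> nat) \<Rightarrow> nat \<Rightarrow> nat \<Rightarrow> (real ^ 'd) set" where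
  "Vs x b l = {p. \<exists>a\<in>Ad. x a = b \<and> p \<in> pa a \<and> idx (pa a) p = l}"

definition "balanced x \<longleftrightarrow> (\<forall>a\<in>Ad. x a < B ^ (m + 2)) \<and> (\<forall>b. card {a \<in> NE. x a = b} \<le> t0)"

lemma finite_NE: "finite NE" using finAd by (simp add: NE_def)

text \<open>A machine has only one point with index \<open>l\<close>, so points in column
  \<open>l\<close> of a row correspond to distinct machines that chose the row.\<close>

lemma Vs_bounds: "finite (Vs x b l)" "card (Vs x b l) \<le> card {a \<in> NE. x a = b}"
proof -
  let ?g = "\<lambda>a. SOME p. p \<in> pa a \<and> idx (pa a) p = l"
  have sub: "Vs x b l \<subseteq> ?g ` {a \<in> NE. x a = b}"
  proof
    fix p assume "p \<in> Vs x b l"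
    then obtain a where a: "a \<in> Ad" "x a = b" "p \<in> pa a" "idx (pa a) p = l" by (auto simp: Vs_def)
    have "?g a = p"
      by (rule some_equality) (use a idx_inj[OF finite_pa[OF a(1)]] in auto)
    thus "p \<in> ?g ` {a \<in> NE. x a = b}" using a by (auto simp: NE_def intro!: image_eqI[of _ _ a])
  qed
  have fin: "finite {a \<in> NE. x a = b}" using finite_NE by simp
  show "finite (Vs x b l)" using finite_subset[OF sub] fin by simp
  show "card (Vs x b l) \<le> card {a \<in> NE. x a = b}"
    using card_mono[OF _ sub] card_image_le[OF fin, of ?g] fin by (meson finite_imageI order_trans)
qed

lemma scattered_Vs: "balanced x \<Longrightarrow> scattered (Vs x)"
  unfolding scattered_def
proof (intro conjI allI impI ballI)
  assume x: "balanced x"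
  fix b l
  show "finite (Vs x b l)" by (rule Vs_bounds)
  show "card (Vs x b l) \<le> t0" using Vs_bounds(2)[of x b l] x unfolding balanced_def by (meson order_trans)
  fix b' l' p assume p: "p \<in> Vs x b l"
  then obtain a where a: "a \<in> Ad" "x a = b" "p \<in> pa a" "idx (pa a) p = l" by (auto simp: Vs_def)
  { assume "p \<in> Vs x b' l'"
    then obtain a' where a': "a' \<in> Ad" "x a' = b'" "p \<in> pa a'" "idx (pa a') p = l'" by (auto simp: Vs_def)
    have "a = a'" by (rule pa_unique[OF a(1,3) a'(1,3)])
    thus "b = b'" "l = l'" using a a' by auto }
  show "b < B ^ (m + 2)" using x a unfolding balanced_def by blast
  show "l < B ^ 2" using idx_less[OF finite_pa[OF a(1)] a(3)] card_pa[OF a(1)] a(4) by (simp add: cap_def)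
  show "p \<in> P" using pa_subset a by blast
next
  fix p assume "p \<in> P"
  then obtain a where "a \<in> Ad" "p \<in> pa a" using pa_cover by blast
  thus "\<exists>b l. p \<in> Vs x b l"
    unfolding Vs_def
    by (intro exI[of _ "x a"] exI[of _ "idx (pa a) p"] CollectI bexI[of _ a] conjI refl)
qed

lemma round_scatter:
  assumes x: "balanced x"
  shows "round_ok 0 x cfg0 (cfgV (Vs x))"
proof -
  have msg: "msg 0 = msg_scatter" by (rule ext) (simp add: msg_def)
  have pts: "points (Inl ` A) = A" for A :: "(real ^ 'd) set" by (auto simp: points_def)
  have mV: "msg_scatter (x a) a (V b l) (cfg0 a) = {Inl p |p. x a = b \<and> p \<in> pa a \<and> idx (pa a) p = l}" for a b l
    by (auto simp: msg_scatter_def cfg0_def pts)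
  have mO: "msg_scatter y a j A = {}" if "\<And>b l. j \<noteq> V b l" for y a j A
    using that by (cases j) (auto simp: msg_scatter_def)
  have t0cap: "t0 \<le> cap" using t0_le_B B_le_cap by linarith
  show ?thesis
  proof (rule round_okI, unfold msg)
    fix a assume a: "a \<in> Ad"
    let ?Z = "(\<lambda>p. (V (x a) (idx (pa a) p), Inl p)) ` pa a"
    have "{(j, c). j \<in> Ad \<and> c \<in> msg_scatter (x a) a j (cfg0 a)} \<subseteq> ?Z"
    proof
      fix z assume "z \<in> {(j, c). j \<in> Ad \<and> c \<in> msg_scatter (x a) a j (cfg0 a)}"
      then obtain j c where z: "z = (j, c)" "c \<in> msg_scatter (x a) a j (cfg0 a)" by auto
      thus "z \<in> ?Z" using mO[of j "x a" a "cfg0 a"] by (cases j) (auto simp: mV)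
    qed
    moreover have "card ?Z \<le> cap" using card_image_le[OF finite_pa[OF a]] card_pa[OF a] order_trans by meson
    ultimately show "\<exists>Z. {(j, c). j \<in> Ad \<and> c \<in> msg_scatter (x a) a j (cfg0 a)} \<subseteq> Z \<and> finite Z \<and> card Z \<le> cap"
      using finite_pa[OF a] by blast
  next
    fix j assume j: "j \<in> Ad"
    show "\<exists>Z. {(a, c). a \<in> Ad \<and> c \<in> msg_scatter (x a) a j (cfg0 a)} \<subseteq> Z \<and> finite Z \<and> card Z \<le> cap"
    proof (cases j)
      case (V b l)
      let ?g = "\<lambda>a. SOME p. p \<in> pa a \<and> idx (pa a) p = l"
      let ?Z = "(\<lambda>a. (a, Inl (?g a))) ` {a \<in> NE. x a = b}"
      have fin: "finite {a \<in> NE. x a = b}" using finite_NE by simp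
      have "{(a, c). a \<in> Ad \<and> c \<in> msg_scatter (x a) a j (cfg0 a)} \<subseteq> ?Z"
      proof
        fix z assume "z \<in> {(a, c). a \<in> Ad \<and> c \<in> msg_scatter (x a) a j (cfg0 a)}"
        then obtain a p where z: "z = (a, Inl p)" "a \<in> Ad" "x a = b" "p \<in> pa a" "idx (pa a) p = l"
          unfolding V mV by auto
        have "?g a = p" by (rule some_equality) (use z idx_inj[OF finite_pa[OF z(2)]] in auto)
        thus "z \<in> ?Z" using z by (auto simp: NE_def intro!: image_eqI[of _ _ a])
      qed
      moreover have "card {a \<in> NE. x a = b} \<le> cap"
        using x t0cap order_trans unfolding balanced_def by blast
      hence "card ?Z \<le> cap" by (rule order_trans[OF card_image_le[OF fin]])
      ultimately show ?thesis using fin by blast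
    qed (auto simp: mO intro!: exI[of _ "{}"])
  next
    fix a j assume "a \<in> Ad" "j \<in> Ad"
    show "msg_scatter (x a) a j (cfg0 a) \<subseteq> cfg0 a \<inter> range Inl \<union> Inr ` Items"
    proof (cases j)
      case (V b l)
      show ?thesis unfolding V mV by (auto simp: cfg0_def)
    qed (simp_all add: mO)
  next
    fix j assume "j \<in> Ad"
    show "(\<Union>a\<in>Ad. msg_scatter (x a) a j (cfg0 a)) = cfgV (Vs x) j"
    proof (cases j)
      case (V b l)
      show ?thesis unfolding V mV by (auto simp: cfgV_def Vs_def)
    qed (auto simp: mO cfgV_def)
  qed
qed

text \<open>Fewer than \<open>B ^ (m + 1)\<close> machines choose among \<open>B ^ (m + 2)\<close>
  rows. The union bound gives \<open>B\<close> to the power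
  \<open>(m + 1) * (t0 + 1) - (m + 2) * t0 = m + 1 - t0\<close>, which is at most -1 since
  \<open>t0 \<ge> m + 2\<close>.\<close>

lemma prob_balanced: "measure_pmf.prob (draw 0) {f. balanced (\<lambda>a. f (enc a))} \<ge> 1 - 1 / real B"
proof -
  let ?c = "B ^ (m + 2)" and ?S = "enc ` NE" and ?U = "{..<card Ad}"
  have c: "?c > 0" using B_pos by simp
  \<comment> \<open>The factor 1 fits the draw to \<open>prob_crowded\<close> with
    \<open>c' = 1\<close>: the drawn number is the row and nothing else.\<close>
  have draw: "draw 0 = Pi_pmf ?U 0 (\<lambda>_. pmf_of_set {..<?c * 1})" by (simp add: draw_def rnd_def)
  have S: "?S \<subseteq> ?U" using enc_less by (auto simp: NE_def)
  have injNE: "inj_on enc NE" by (rule inj_on_subset[OF inj_enc]) (auto simp: NE_def)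
  have cardS: "card ?S < B ^ (m + 1)" using card_image[OF injNE] card_NE card_P by simp
  have "measure_pmf.prob (draw 0) {f. crowded t0 ?c ?S f} \<le> real (card ?S) ^ Suc t0 / real ?c ^ t0"
    unfolding draw by (rule prob_crowded[OF _ S c]) auto
  also have "\<dots> \<le> (real B ^ (m + 1)) ^ Suc t0 / real ?c ^ t0"
  proof (intro divide_right_mono power_mono)
    have "real (card ?S) \<le> real (B ^ (m + 1))" using cardS by (simp only: of_nat_le_iff)
    thus "real (card ?S) \<le> real B ^ (m + 1)" by simp
  qed auto
  also have "\<dots> \<le> 1 / real B"
  proof -
    have "real B * (real B ^ (m + 1)) ^ Suc t0 = real B ^ (1 + (m + 1) * Suc t0)"
      by (simp only: power_add power_mult power_one_right)
    also have "\<dots> \<le> real B ^ ((m + 2) * t0)"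
    proof (rule power_increasing)
      have "(m + 2) * t0 = (m + 1) * t0 + t0" by (simp add: algebra_simps)
      moreover have "m + 2 \<le> t0" by (simp add: t0_def)
      ultimately show "1 + (m + 1) * Suc t0 \<le> (m + 2) * t0" by simp
      show "1 \<le> real B" using B_pos by simp
    qed
    finally have "real B * (real B ^ (m + 1)) ^ Suc t0 \<le> real ?c ^ t0"
      by (simp only: power_mult of_nat_power)
    moreover have "real ?c ^ t0 > 0" using B_pos by simp
    ultimately show ?thesis using B_pos by (simp add: field_simps del: of_nat_power power_Suc)
  qed
  finally have bad: "measure_pmf.prob (draw 0) {f. crowded t0 ?c ?S f} \<le> 1 / real B" .
  have "1 - measure_pmf.prob (draw 0) {f. crowded t0 ?c ?S f} = measure_pmf.prob (draw 0) (- {f. crowded t0 ?c ?S f})"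
    using measure_pmf.prob_compl[of "{f. crowded t0 ?c ?S f}" "draw 0"] by (simp add: Compl_eq_Diff_UNIV)
  \<comment> \<open>On the support all numbers are below the number of rows, so that residues are
    the numbers themselves.\<close>
  also have "\<dots> = measure_pmf.prob (draw 0) (- {f. crowded t0 ?c ?S f} \<inter> set_pmf (draw 0))"
    by (simp add: measure_Int_set_pmf)
  also have "\<dots> \<le> measure_pmf.prob (draw 0) {f. balanced (\<lambda>a. f (enc a))}"
  proof (intro measure_pmf.finite_measure_mono subsetI)
    fix f assume f: "f \<in> - {f. crowded t0 ?c ?S f} \<inter> set_pmf (draw 0)"
    have "0 \<in> {..<?c * 1}" using c by simp
    hence "{..<?c * 1} \<noteq> {}" by blast
    hence "set_pmf (pmf_of_set {..<?c * 1}) = {..<?c * 1}" by (intro set_pmf_of_set) simp_all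
    moreover have "f \<in> PiE_dflt ?U 0 (set_pmf \<circ> (\<lambda>_. pmf_of_set {..<?c * 1}))"
      using f set_Pi_pmf_subset'[of ?U] unfolding draw by fast
    ultimately have lt: "f (enc a) < ?c" if "a \<in> Ad" for a
      using enc_less[OF that] by (auto simp: PiE_dflt_def)
    have "card {a \<in> NE. f (enc a) = b} \<le> t0" for b
    proof -
      have "enc ` {a \<in> NE. f (enc a) = b} \<subseteq> {i \<in> ?S. f i mod ?c = b}"
        using lt by (auto simp: NE_def)
      hence "card (enc ` {a \<in> NE. f (enc a) = b}) \<le> card {i \<in> ?S. f i mod ?c = b}"
        using finite_NE by (intro card_mono) auto
      moreover have "card (enc ` {a \<in> NE. f (enc a) = b}) = card {a \<in> NE. f (enc a) = b}"
        by (rule card_image) (rule inj_on_subset[OF injNE], auto)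
      moreover have "card {i \<in> ?S. f i mod ?c = b} \<le> t0"
        by (rule not_crowdedD) (use f finite_NE c in auto)
      ultimately show ?thesis by linarith
    qed
    thus "f \<in> {f. balanced (\<lambda>a. f (enc a))}" using lt by (simp add: balanced_def)
  qed simp
  finally show ?thesis using bad by linarith
qed

end

section \<open>The draw of the hash function\<close>

context alg_input
begin

definition seed_ok :: "(nat \<Rightarrow> nat \<Rightarrow> (real ^ 'd) set) \<Rightarrow> nat \<Rightarrow> bool" where
  "seed_ok Vp a \<longleftrightarrow> a < F \<and> alg_hash L B m F h P (slot_of Vp) a"

text \<open>The slots are fixed before the seed is drawn, so the guarantee that the family gives for
  each fixed set of nodes applies to the nodes of this scattering.\<close>

lemma prob_seed:
  assumes V: "scattered Vp"
  shows "measure_pmf.prob (draw 1) {f. seed_ok Vp (f (enc (J 0 0)))} \<ge> 1 - 5 / real B"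
proof -
  define N where "N = alg_run.allnodes L B m P (slot_of Vp)"
  define bad where "bad = {a. a < F \<and> \<not> (inj_on (h a) N \<and> (\<forall>b. card {x\<in>N. h a x mod Hr = b} \<le> t0))}"
  interpret R0: alg_run k L B m F h P "slot_of Vp" 0 by (rule alg_run_slot[OF V F_pos])
  have "card N \<le> ss"
  proof -
    have "card N \<le> card P * Q * card Off * (lv + 1)" unfolding N_def by (rule R0.card_allnodes)
    also have "\<dots> = Q * (card P * (card Off * (lv + 1)))" by (simp only: mult_ac)
    \<comment> \<open>The last factor \<open>B\<close> accounts for the offsets and the
      levels.\<close>
    also have "\<dots> \<le> Q * (B ^ (m + 1) * B)" using card_P B_Off by (intro mult_le_mono) auto
    also have "\<dots> = ss" by (simp add: ss_def)
    finally show ?thesis .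
  qed
  hence bad: "real (card bad) \<le> 5 / real B * real F"
    unfolding bad_def using h_family[of N] R0.allnodes_univ unfolding N_def by blast
  have ok: "seed_ok Vp a" if "a < F" "a \<notin> bad" for a
  proof -
    interpret R: alg_run k L B m F h P "slot_of Vp" a by (rule alg_run_slot[OF V that(1)])
    have "alg_hash L B m F h P (slot_of Vp) a"
    proof
      fix \<nu> assume "\<nu> \<in> R.allnodes"
      thus "h a \<nu> < Hr * ss" using R.allnodes_univ h_range by blast
    qed (use that in \<open>auto simp: bad_def N_def\<close>)
    thus ?thesis using that(1) by (simp add: seed_ok_def)
  qed
  have "draw 1 = Pi_pmf {..<card Ad} 0 (\<lambda>_. pmf_of_set {..<F})" by (simp add: draw_def rnd_def)
  \<comment> \<open>Every machine draws in this round, but only the number drawn by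
    \<open>J 0 0\<close> is read, and it is uniform.\<close>
  hence comp: "map_pmf (\<lambda>f. f (enc (J 0 0))) (draw 1) = pmf_of_set {..<F}"
    using enc_less[OF QJ_pos(2)] by (simp add: Pi_pmf_component)
  have "measure_pmf.prob (draw 1) {f. seed_ok Vp (f (enc (J 0 0)))}
      = measure_pmf.prob (map_pmf (\<lambda>f. f (enc (J 0 0))) (draw 1)) {a. seed_ok Vp a}"
    by (simp add: vimage_def)
  also have "\<dots> = real (card ({..<F} \<inter> {a. seed_ok Vp a})) / real F"
    unfolding comp using F_pos by (subst measure_pmf_of_set) (auto simp: lessThan_empty_iff)
  also have "\<dots> \<ge> 1 - 5 / real B"
  proof -
    have "card ({..<F} - bad) \<le> card ({..<F} \<inter> {a. seed_ok Vp a})" using ok by (intro card_mono) auto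
    moreover have "card ({..<F} - bad) = F - card bad"
      by (subst card_Diff_subset) (auto simp: bad_def)
    ultimately have "real F - real (card bad) \<le> real (card ({..<F} \<inter> {a. seed_ok Vp a}))" by linarith
    hence "real F - 5 / real B * real F \<le> real (card ({..<F} \<inter> {a. seed_ok Vp a}))" using bad by linarith
    thus ?thesis using F_pos by (simp add: field_simps)
  qed
  finally show ?thesis .
qed

end

section \<open>From single rounds to the whole run\<close>

context alg_placed
begin

text \<open>Slots and seed exist from round 2 on; they are quantified away, and the trajectory
  determined by them is followed.\<close>

definition good :: "nat \<Rightarrow> 'd config \<Rightarrow> bool" where
  "good r t = (if r = 0 then t = s else if r = 1 then \<exists>Vp. scattered Vp \<and> rep t (cfgV Vp)
     else \<exists>pos a. alg_hash L B m F h P pos a \<and> rep t (alg_hash.traj k L B m h P pos a r))"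

lemma program_machine: "program = machine" by (simp add: program_def)

lemma program_success:
  "measure_pmf.prob (mpc_run program s) {Some t |t. let T = mpc_output program t in
      T \<subseteq> P \<and> T \<noteq> {} \<and> kcenter_cost P T \<le> 6 * real CARD('d) * kcenter_opt P k \<and> card T \<le> k}
    \<ge> 1 - 6 / real B"
proof -
  \<comment> \<open>Only the scattering and the draw of the seed can fail.\<close>
  define eps where "eps = (\<lambda>r::nat. if r = 0 then 1 / real B else if r = 1 then 5 / real B else 0)"
  have "measure_pmf.prob (mpc_run_upto program s (Suc T8)) {Some t |t. good (Suc T8) t} \<ge> 1 - (\<Sum>r<Suc T8. eps r)"
  proof (rule mpc_run_upto_prob)
    show "good 0 s" by (simp add: good_def)
    show "eps r \<ge> 0" for r by (simp add: eps_def)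
    fix r t assume r: "r < Suc T8" and t: "good r t"
    consider "r = 0" | "r = 1" | "r \<ge> 2" by linarith
    thus "measure_pmf.prob (mpc_round program r t) {Some u |u. good (Suc r) u} \<ge> 1 - eps r"
      unfolding program_machine
    proof cases
      case 1
      have ts: "t = s" using t 1 by (simp add: good_def)
      have ok: "round_ok 0 (\<lambda>a. f (enc a)) cfg0 (cfgV (Vs (\<lambda>a. f (enc a))))"
        if "f \<in> {f. balanced (\<lambda>a. f (enc a))}" for f using round_scatter that by simp
      show "measure_pmf.prob (mpc_round machine r t) {Some u |u. good (Suc r) u} \<ge> 1 - eps r"
        unfolding 1 ts
      proof (rule prob_round[OF rep_cfg0, where E = "{f. balanced (\<lambda>a. f (enc a))}"])
        fix f assume f: "f \<in> {f. balanced (\<lambda>a. f (enc a))}"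
        show "step_ok 0 (\<lambda>a. f (enc a)) cfg0" using ok[OF f] by (simp add: round_ok_def)
        fix u assume "rep u (succ_conf 0 (\<lambda>a. f (enc a)) cfg0)"
        hence "rep u (cfgV (Vs (\<lambda>a. f (enc a))))" by (rule rep_cong) (use ok[OF f] in \<open>simp add: round_ok_def\<close>)
        moreover have "scattered (Vs (\<lambda>a. f (enc a)))" using scattered_Vs f by simp
        ultimately show "good (Suc 0) u" unfolding good_def by auto
      qed (use prob_balanced in \<open>simp add: eps_def\<close>)
    next
      case 2
      obtain Vp where Vp: "scattered Vp" "rep t (cfgV Vp)" using t 2 by (auto simp: good_def)
      show "measure_pmf.prob (mpc_round machine r t) {Some u |u. good (Suc r) u} \<ge> 1 - eps r"
        unfolding 2
      proof (rule prob_round[OF Vp(2), where E = "{f. seed_ok Vp (f (enc (J 0 0)))}"])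
        fix f assume f: "f \<in> {f. seed_ok Vp (f (enc (J 0 0)))}"
        define a where "a = f (enc (J 0 0))"
        have a: "a < F" "alg_hash L B m F h P (slot_of Vp) a" using f by (simp_all add: seed_ok_def a_def)
        interpret A: alg_hash k L B m F h P "slot_of Vp" a by (rule a(2))
        have ok: "round_ok 1 (\<lambda>a. f (enc a)) (cfgV Vp) (A.onJ (A.cfgM 0))"
          using round_split[OF Vp(1), of "\<lambda>a. f (enc a)"] a(1) unfolding a_def by simp
        show "step_ok 1 (\<lambda>a. f (enc a)) (cfgV Vp)" using ok by (simp add: round_ok_def)
        fix u assume "rep u (succ_conf 1 (\<lambda>a. f (enc a)) (cfgV Vp))"
        hence "rep u (A.onJ (A.cfgM 0))" by (rule rep_cong) (use ok in \<open>simp add: round_ok_def\<close>)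
        moreover have "A.traj 2 = A.onJ (A.cfgM 0)" by (simp add: A.traj_def T2_def)
        ultimately have "rep u (A.traj 2)" by simp
        thus "good (Suc 1) u" unfolding good_def using a(2) by (simp add: numeral_2_eq_2) blast
      qed (use prob_seed[OF Vp(1)] in \<open>simp add: eps_def\<close>)
    next
      case 3
      obtain pos a where pa: "alg_hash L B m F h P pos a" "rep t (alg_hash.traj k L B m h P pos a r)"
        using t 3 by (auto simp: good_def)
      interpret A: alg_hash k L B m F h P pos a by (rule pa(1))
      obtain C where C: "rep t C" "\<And>x. round_ok r x C (A.traj (Suc r))"
        using A.traj_step[OF A.selection_correct(1)[OF k] 3 _ pa(2)] r by auto
      show "measure_pmf.prob (mpc_round machine r t) {Some u |u. good (Suc r) u} \<ge> 1 - eps r"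
      proof (rule prob_round[OF C(1), where E = UNIV])
        fix f
        show "step_ok r (\<lambda>a. f (enc a)) C" using C(2) by (simp add: round_ok_def)
        fix u assume "rep u (succ_conf r (\<lambda>a. f (enc a)) C)"
        hence "rep u (A.traj (Suc r))" by (rule rep_cong) (use C(2) in \<open>simp add: round_ok_def\<close>)
        thus "good (Suc r) u" unfolding good_def using 3 pa(1) by auto
      qed (use 3 in \<open>simp add: eps_def\<close>)
    qed
  qed
  also have "mpc_run_upto program s (Suc T8) = mpc_run program s"
    unfolding mpc_run_def program_machine by (simp only: machine_simps)
  also have "(\<Sum>r<Suc T8. eps r) = 6 / real B"
  proof -
    have "(\<Sum>r<Suc T8. eps r) = (\<Sum>r\<in>{0, 1}. eps r)"
      by (rule sum.mono_neutral_right) (auto simp: eps_def T8_def T7_def T6_def T5_def)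
    also have "\<dots> = 6 / real B" by (simp add: eps_def add_divide_distrib[symmetric])
    finally show ?thesis .
  qed
  finally have "1 - 6 / real B \<le> measure_pmf.prob (mpc_run program s) {Some t |t. good (Suc T8) t}" .
  also have "\<dots> \<le> measure_pmf.prob (mpc_run program s) {Some t |t. let T = mpc_output program t in
      T \<subseteq> P \<and> T \<noteq> {} \<and> kcenter_cost P T \<le> 6 * real CARD('d) * kcenter_opt P k \<and> card T \<le> k}"
  proof (intro measure_pmf.finite_measure_mono subsetI)
    fix z assume "z \<in> {Some t |t. good (Suc T8) t}"
    then obtain t where t: "z = Some t" "good (Suc T8) t" by blast
    have "T8 > 0" by (simp add: T8_def)
    then obtain pos a where pa: "alg_hash L B m F h P pos a" "rep t (alg_hash.traj k L B m h P pos a (Suc T8))"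
      using t(2) by (auto simp: good_def)
    interpret A: alg_hash k L B m F h P pos a by (rule pa(1))
    have "mpc_output program t = A.F' A.qs" by (rule A.traj_final_output[OF pa(2)])
    thus "z \<in> {Some t |t. let T = mpc_output program t in
      T \<subseteq> P \<and> T \<noteq> {} \<and> kcenter_cost P T \<le> 6 * real CARD('d) * kcenter_opt P k \<and> card T \<le> k}"
      using t(1) A.selection_correct[OF k] by (simp add: Let_def)
  qed simp
  finally show ?thesis .
qed

end

section \<open>Parameters\<close>

lemma two_powr_ge:
  fixes z :: real
  assumes z: "z \<ge> 1"
  shows "z + 1 \<le> 2 powr z"
proof -
  have "(2::real) / 3 * (z - 1) \<le> ln 2 * (z - 1)"
    using ln2_ge_two_thirds z by (intro mult_right_mono) auto
  also have "1 + ln 2 * (z - 1) \<le> exp (ln 2 * (z - 1))" by (rule exp_ge_add_one_self)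
  finally have "1 + 2 / 3 * (z - 1) \<le> exp (ln 2 * (z - 1))" by linarith
  also have "exp (ln 2 * (z - 1)) = 2 powr (z - 1)" by (simp add: powr_def mult.commute)
  finally have "2 * (1 + 2 / 3 * (z - 1)) \<le> 2 * 2 powr (z - 1)" by (intro mult_left_mono) simp_all
  also have "2 * 2 powr (z - 1) = 2 powr z" by (simp add: powr_diff)
  also have "2 * (1 + 2 / 3 * (z - 1)) = z + 1 + (z - 1) / 3" by (simp add: field_simps)
  finally have "z + 1 + (z - 1) / 3 \<le> 2 powr z" .
  moreover have "0 \<le> (z - 1) / 3" using z by simp
  ultimately show ?thesis by linarith
qed

lemma iter_log_gt_1: "i < log_star x \<Longrightarrow> iter_log i x > 1"
  using not_less_Least[of i "\<lambda>i. iter_log i x \<le> 1"] by (simp add: log_star_def)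

text \<open>As long as the result exceeds 1, a logarithm lowers the value by at least 1
  (\<open>two_powr_ge\<close>). Hence \<open>\<alpha> + c0 \<le> log_star n\<close> yields a lower
  bound on \<open>n\<close>, through which \<open>c0\<close> enforces that \<open>n\<close> is
  sufficiently large.\<close>

lemma log_star_large: "i < log_star x \<Longrightarrow> x > real i + 1"
proof -
  assume i: "i < log_star x"
  have "x \<ge> iter_log j x + real j" if "j \<le> i" for j
    using that
  proof (induction j)
    case 0 thus ?case by (simp add: iter_log_def)
  next
    case (Suc j)
    have g: "iter_log j x > 1" "iter_log (Suc j) x > 1" using Suc.prems i by (auto intro: iter_log_gt_1)
    have "iter_log (Suc j) x = log 2 (iter_log j x)" by (simp add: iter_log_def)
    hence "2 powr iter_log (Suc j) x = iter_log j x" using g by simp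
    hence "iter_log (Suc j) x + 1 \<le> iter_log j x" using two_powr_ge[of "iter_log (Suc j) x"] g by simp
    thus ?case using Suc by simp
  qed
  from this[of i] show ?thesis using iter_log_gt_1[OF i] by simp
qed

text \<open>Rounding the root down costs at most a factor \<open>2 ^ m\<close>, which one more
  factor \<open>B \<ge> 2 ^ m\<close> absorbs.\<close>

lemma nth_root_bounds:
  fixes n m b0 :: nat
  assumes m: "m > 0" and n: "n \<ge> b0 ^ m" and b0: "b0 \<ge> 2 ^ m" "b0 > 0"
  defines "B \<equiv> nat \<lfloor>real n powr (1 / real m)\<rfloor>"
  shows "B \<ge> b0" "B ^ m \<le> n" "n < B ^ (m + 1)" "real B \<le> real n powr (1 / real m)"
proof -
  let ?r = "real n powr (1 / real m)"
  have npos: "n > 0" using n b0 by (metis gr0I less_le_trans zero_less_power)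
  have rm: "?r ^ m = real n"
    using m npos by (simp add: powr_realpow[symmetric] powr_powr)
  have "real B = of_int \<lfloor>?r\<rfloor>" unfolding B_def by simp
  hence Br: "real B \<le> ?r" "?r < real B + 1" by linarith+
  show "real B \<le> ?r" by (rule Br)
  have "real (B ^ m) \<le> ?r ^ m" using Br(1) by (simp add: power_mono)
  thus "B ^ m \<le> n" unfolding rm by (simp only: of_nat_le_iff)
  have "real (b0 ^ m) \<le> ?r ^ m" unfolding rm using n by (simp only: of_nat_le_iff)
  hence "real b0 \<le> ?r" using m power_mono_iff[of "real b0" ?r m] by simp
  thus Bb: "B \<ge> b0" unfolding B_def by linarith
  have "?r ^ m < (real B + 1) ^ m" using Br m by (intro power_strict_mono) auto
  hence "real n < (real B + 1) ^ m" by (simp only: rm)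
  also have "\<dots> \<le> (2 * real B) ^ m" using Bb b0 by (intro power_mono) auto
  also have "\<dots> = real (2 ^ m * B ^ m)" by (simp add: power_mult_distrib)
  also have "\<dots> \<le> real (B * B ^ m)" using Bb b0(1) by (simp only: of_nat_le_iff) (intro mult_le_mono1, linarith)
  finally have "real n < real (B ^ (m + 1))" by simp
  thus "n < B ^ (m + 1)" by (simp only: of_nat_less_iff)
qed

section \<open>Sizes of the hash family, the set of machines and the set of items\<close>

context alg_params
begin

text \<open>Bounds the logarithm of \<open>card univ\<close>, with \<open>x \<le> 2 ^ x\<close> for
  all factors but the keys. Crude, but the number of seeds stays polynomial in the number of
  machines.\<close>

definition "seed_bits = kb * CARD('d) + (lv + 1) + W + Q"

text \<open>With \<open>B * ss * seed_bits\<close> functions the additive term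
  \<open>seed_bits * ss\<close> of \<open>hash_family\<close> is a \<open>1 / B\<close> fraction of
  the list, and \<open>1 / B + 4 / B\<close> is the \<open>5 / B\<close> of the statement.\<close>

lemma hash_exists:
  assumes B: "B > 0"
  shows "\<exists>g :: nat \<Rightarrow> 'd node \<Rightarrow> nat. (\<forall>a. \<forall>\<nu>\<in>univ. g a \<nu> < Hr * ss) \<and>
    (\<forall>S\<subseteq>univ. card S \<le> ss \<longrightarrow>
      real (card {a. a < B * ss * seed_bits \<and> \<not> (inj_on (g a) S \<and> (\<forall>b. card {x\<in>S. g a x mod Hr = b} \<le> t0))})
        \<le> 5 / real B * real (B * ss * seed_bits))"
proof -
  have W: "W > 0" using B by (simp add: W_def)
  have Q: "Q > 0" using W by (simp add: Q_def)
  have ss: "ss > 0" and Hr: "Hr > 0" using B Q by (simp_all add: ss_def Hr_def)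
  have Hr_ss: "Hr = ss * B" by (simp add: Hr_def ss_def eval_nat_numeral mult_ac)
  have fin: "finite univ" unfolding univ_def by (intro finite_cartesian_product finite_funs) auto
  have le2: "x \<le> 2 ^ x" for x :: nat using less_exp[of x] by simp
  have "card univ = (lv + 1) * (W * (Q * (2 ^ kb) ^ CARD('d)))"
    unfolding univ_def by (simp add: card_cartesian_product card_funs nat_power_eq)
  also have "\<dots> \<le> 2 ^ (lv + 1) * (2 ^ W * (2 ^ Q * (2 ^ kb) ^ CARD('d)))"
    by (intro mult_le_mono le2 le_refl)
  also have "\<dots> = 2 ^ seed_bits" by (simp only: seed_bits_def power_add power_mult) (simp only: mult_ac)
  finally have cu: "card univ \<le> 2 ^ seed_bits" .
  \<comment> \<open>Since \<open>Hr = ss * B\<close>, dividing by \<open>ss ^ t0\<close> leaves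
    \<open>B * ss \<le> B ^ t0\<close>, for which \<open>t0\<close> was chosen.\<close>
  have load: "real B * real ss ^ Suc t0 \<le> real Hr ^ t0"
  proof -
    have "ss \<le> (W * W) * B ^ (m + 2)" unfolding ss_def by (intro mult_le_mono1) (simp add: Q_def)
    hence "B * ss \<le> B * ((W * W) * B ^ (m + 2))" by (rule mult_le_mono2)
    also have "\<dots> = B ^ t0"
    proof -
      have "t0 = 1 + (lv + lv + (m + 2))" by (simp add: t0_def lv_def)
      thus ?thesis by (simp only: power_add W_def power_one_right)
    qed
    finally have "ss ^ t0 * (B * ss) \<le> ss ^ t0 * B ^ t0" by (rule mult_le_mono2)
    hence "B * ss ^ Suc t0 \<le> Hr ^ t0" by (simp add: Hr_ss power_mult_distrib mult_ac)
    hence "real (B * ss ^ Suc t0) \<le> real (Hr ^ t0)" by (simp only: of_nat_le_iff)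
    thus ?thesis by (simp only: of_nat_mult of_nat_power)
  qed
  have inj: "real B * real ss ^ 2 \<le> real (Hr * ss)" by (simp add: Hr_ss power2_eq_square)
  obtain g :: "nat \<Rightarrow> 'd node \<Rightarrow> nat" where g: "\<forall>a. \<forall>x\<in>univ. g a x < Hr * ss"
    "\<And>S. S \<subseteq> univ \<Longrightarrow> card S \<le> ss \<Longrightarrow>
        real (card {a. a < B * ss * seed_bits \<and> \<not> (inj_on (g a) S \<and> (\<forall>b. card {x\<in>S. g a x mod Hr = b} \<le> t0))})
          \<le> real (seed_bits * ss) + 4 / real B * real (B * ss * seed_bits)"
    using hash_family[OF fin cu ss B Hr ss load inj, of "B * ss * seed_bits"] by blast
  have "real (seed_bits * ss) + 4 / real B * real (B * ss * seed_bits) = 5 / real B * real (B * ss * seed_bits)"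
    using B by simp
  thus ?thesis using g by (intro exI[of _ g]) simp
qed

definition "Mx = card Ad"

text \<open>Whatever is stored in a word has to be bounded by a power of the number of machines. The
  bound for \<open>L + 1\<close> is due to the idle machines.\<close>

lemma card_Ad_ge: "L + 1 \<le> Mx" "Q \<le> Mx" "Hr \<le> Mx" "B ^ (m + 4) \<le> Mx"
proof -
  have sub: "card (f ` A) \<le> Mx" if "f ` A \<subseteq> Ad" for f :: "'x \<Rightarrow> addr" and A
    unfolding Mx_def by (rule card_mono[OF finite_Ad that])
  have "card (Idle ` {..<L + 1}) \<le> Mx" by (rule sub) auto
  thus "L + 1 \<le> Mx" by (simp add: card_image inj_on_def)
  have "card (K ` {..<Q}) \<le> Mx" by (rule sub) auto
  thus "Q \<le> Mx" by (simp add: card_image inj_on_def)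
  have "card (H ` {..<Hr}) \<le> Mx" by (rule sub) auto
  thus "Hr \<le> Mx" by (simp add: card_image inj_on_def)
  have "card ((\<lambda>(b, l). V b l) ` ({..<B ^ (m + 2)} \<times> {..<B ^ 2})) \<le> Mx" by (rule sub) auto
  moreover have "inj_on (\<lambda>(b, l). V b l) ({..<B ^ (m + 2)} \<times> {..<B ^ 2})" by (auto simp: inj_on_def)
  ultimately have "B ^ (m + 2) * B ^ 2 \<le> Mx" by (simp add: card_image card_cartesian_product)
  moreover have "B ^ (m + 2) * B ^ 2 = B ^ (m + 4)" by (simp add: power_add eval_nat_numeral mult_ac)
  ultimately show "B ^ (m + 4) \<le> Mx" by simp
qed

lemma card_Ad_le:
  assumes B: "B > 0"
  shows "Mx \<le> 5 * (L + 1) * B ^ (m + 5)"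
proof -
  let ?Y = "(L + 1) * B ^ (m + 5)"
  have Q: "Q \<le> L + 1" by (simp add: Q_def)
  have p: "B ^ i \<le> B ^ (m + 5)" if "i \<le> m + 5" for i using that B by (intro power_increasing) auto
  have im: "card (f ` A) \<le> card A" if "finite A" for f :: "'x \<Rightarrow> addr" and A
    using that by (rule card_image_le)
  have "card ((\<lambda>(b, l). V b l) ` ({..<B ^ (m + 2)} \<times> {..<B ^ 2})) \<le> ?Y"
  proof -
    have "card ((\<lambda>(b, l). V b l) ` ({..<B ^ (m + 2)} \<times> {..<B ^ 2})) \<le> B ^ (m + 2) * B ^ 2"
      by (rule order_trans[OF im]) (simp_all add: card_cartesian_product)
    also have "\<dots> = 1 * B ^ (m + 4)" by (simp add: power_add eval_nat_numeral mult_ac)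
    also have "\<dots> \<le> ?Y" using p[of "m + 4"] by (intro mult_le_mono) auto
    finally show ?thesis .
  qed
  moreover have "card ((\<lambda>(q, w). J q w) ` ({..<Q} \<times> {..<W})) \<le> ?Y"
  proof -
    have "card ((\<lambda>(q, w). J q w) ` ({..<Q} \<times> {..<W})) \<le> Q * W"
      by (rule order_trans[OF im]) (simp_all add: card_cartesian_product)
    also have "\<dots> \<le> ?Y" using Q by (intro mult_le_mono) (auto simp: W_def lv_def)
    finally show ?thesis .
  qed
  moreover have "card (K ` {..<Q}) \<le> ?Y"
  proof -
    have "card (K ` {..<Q}) \<le> Q * 1" using im[of "{..<Q}" K] by simp
    also have "\<dots> \<le> ?Y" using Q p[of 0] by (intro mult_le_mono) auto
    finally show ?thesis .
  qed
  moreover have "card (H ` {..<Hr}) \<le> ?Y"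
  proof -
    have "card (H ` {..<Hr}) \<le> Q * B ^ (m + 3)" using im[of "{..<Hr}" H] by (simp add: Hr_def)
    also have "\<dots> \<le> ?Y" using Q p[of "m + 3"] by (intro mult_le_mono) auto
    finally show ?thesis .
  qed
  moreover have "card (Idle ` {..<L + 1}) \<le> ?Y"
  proof -
    have "card (Idle ` {..<L + 1}) \<le> (L + 1) * 1" using im[of "{..<L + 1}" Idle] by simp
    also have "\<dots> \<le> ?Y" using p[of 0] by (intro mult_le_mono) auto
    finally show ?thesis .
  qed
  moreover have "Mx \<le> card ((\<lambda>(b, l). V b l) ` ({..<B ^ (m + 2)} \<times> {..<B ^ 2}))
      + card ((\<lambda>(q, w). J q w) ` ({..<Q} \<times> {..<W})) + card (K ` {..<Q}) + card (H ` {..<Hr}) + card (Idle ` {..<L + 1})"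
    unfolding Mx_def Ad_def by (intro order_trans[OF card_Un_le] add_mono order_refl)
  ultimately have "Mx \<le> ?Y + ?Y + ?Y + ?Y + ?Y" by linarith
  also have "\<dots> = 5 * (L + 1) * B ^ (m + 5)" by (simp add: algebra_simps)
  finally show ?thesis .
qed

text \<open>Words of logarithmic length require an exponent that depends only on \<open>m\<close>.
  Decisive are the \<open>Up\<close> items: a path of at most \<open>lv + 1\<close> hash values,
  each below \<open>Mx ^ 2\<close>, with a position and an address.\<close>

lemma card_Items_le:
  assumes F: "F = B * ss * seed_bits" and B: "lv + 9 \<le> B" "CARD('d) \<le> B" "rad \<le> B"
  shows "card Items \<le> Mx ^ (3 * lv + 9)"
proof -
  have BM: "B \<le> Mx"
    using card_Ad_ge(4) B(1) by (intro order_trans[OF self_le_power[of B "m + 4"]]) auto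
  have M9: "9 \<le> Mx" "lv + 9 \<le> Mx" using BM B by linarith+
  have W: "W \<le> Mx ^ 2"
  proof -
    have "W = B ^ (m + 4) * B" by (simp add: W_def lv_def power_add eval_nat_numeral mult_ac)
    also have "\<dots> \<le> Mx * Mx" using card_Ad_ge(4) BM by (intro mult_le_mono)
    finally show ?thesis by (simp add: power2_eq_square)
  qed
  have ss: "ss \<le> Mx"
  proof -
    have "ss \<le> Hr" unfolding ss_def Hr_def using B(1) by (intro mult_le_mono2 power_increasing) auto
    thus ?thesis using card_Ad_ge(3) by linarith
  qed
  have Hs: "Hr * ss \<le> Mx ^ 2" using card_Ad_ge(3) ss by (simp add: power2_eq_square mult_le_mono)
  have mono: "Mx ^ i \<le> Mx ^ j" if "i \<le> j" for i j using that M9(1) by (intro power_increasing) auto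
  \<comment> \<open>One more factor \<open>Mx \<ge> 9\<close> absorbs sums of up to nine
    terms.\<close>
  have up: "9 * Mx ^ i \<le> Mx ^ Suc i" for i using M9(1) by simp
  have sb: "seed_bits \<le> Mx ^ 3"
  proof -
    have "kb * CARD('d) \<le> (Mx + Mx) * Mx"
      unfolding kb_def using card_Ad_ge(1) B BM by (intro mult_le_mono) linarith+
    also have "\<dots> = 2 * Mx ^ 2" by (simp add: power2_eq_square)
    finally have "seed_bits \<le> 2 * Mx ^ 2 + Mx + Mx ^ 2 + Mx"
      unfolding seed_bits_def using W card_Ad_ge(2) M9(2) by linarith
    also have "\<dots> \<le> 9 * Mx ^ 2" using mono[of 1 2] by simp
    also have "\<dots> \<le> Mx ^ 3" using up[of 2] by (simp add: eval_nat_numeral)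
    finally show ?thesis .
  qed
  have cF: "F \<le> Mx ^ 5"
  proof -
    have "F \<le> Mx * Mx * Mx ^ 3" unfolding F using BM ss sb by (intro mult_le_mono)
    thus ?thesis by (simp add: eval_nat_numeral mult_ac)
  qed
  have W1: "Suc W \<le> Mx ^ 3"
  proof -
    have "1 \<le> Mx ^ 2" using M9(1) by simp
    hence "Suc W \<le> Mx ^ 2 + 1 * Mx ^ 2" using W by linarith
    thus ?thesis using up[of 2] by (simp add: eval_nat_numeral)
  qed
  let ?Y = "Mx ^ (3 * lv + 8)"
  have Y: "Mx ^ i \<le> ?Y" if "i \<le> 3 * lv + 8" for i using mono[OF that] .
  let ?ls = "{xs. set xs \<subseteq> {..<Hr * ss} \<and> length xs \<le> Suc lv}"
  have ls: "card ?ls \<le> Mx ^ (2 * lv + 3)"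
  proof -
    have "card ?ls = (\<Sum>i\<le>Suc lv. (Hr * ss) ^ i)" by (subst card_lists_length_le) auto
    also have "\<dots> \<le> (\<Sum>i\<le>Suc lv. Mx ^ (2 * Suc lv))"
    proof (rule sum_mono)
      fix i assume i: "i \<in> {..Suc lv}"
      have "(Hr * ss) ^ i \<le> (Mx ^ 2) ^ i" using Hs by (rule power_mono) simp
      also have "\<dots> = Mx ^ (2 * i)" by (simp add: power_mult)
      also have "\<dots> \<le> Mx ^ (2 * Suc lv)" using i by (intro mono) simp
      finally show "(Hr * ss) ^ i \<le> Mx ^ (2 * Suc lv)" .
    qed
    also have "\<dots> = (lv + 2) * Mx ^ (2 * Suc lv)" by simp
    also have "\<dots> \<le> Mx * Mx ^ (2 * Suc lv)" using M9(2) by (intro mult_le_mono1) simp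
    also have "\<dots> = Mx ^ (2 * lv + 3)" by (simp add: eval_nat_numeral)
    finally show ?thesis .
  qed
  have finls: "finite ?ls" by (rule finite_lists_length_le) simp
  have c1: "card (Seed ` {..<F}) \<le> ?Y"
    using card_image_le[of "{..<F}" Seed] cF Y[of 5] by simp
  have c2: "card (Cand ` {..L}) \<le> ?Y"
    using card_image_le[of "{..L}" Cand] card_Ad_ge(1) Y[of 1] by simp
  have c3: "card ((\<lambda>(xs, v, a). Up xs v a) ` (?ls \<times> {..W} \<times> Ad)) \<le> ?Y"
  proof -
    have "card ((\<lambda>(xs, v, a). Up xs v a) ` (?ls \<times> {..W} \<times> Ad)) \<le> card ?ls * (Suc W * Mx)"
      by (rule order_trans[OF card_image_le]) (use finls finite_Ad in \<open>simp_all add: card_cartesian_product Mx_def\<close>)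
    also have "\<dots> \<le> Mx ^ (2 * lv + 3) * (Mx ^ 3 * Mx ^ 1)" using ls W1 by (intro mult_le_mono) auto
    also have "\<dots> = Mx ^ (2 * lv + 7)" by (simp only: power_add[symmetric]) (simp add: add.commute)
    also have "\<dots> \<le> ?Y" by (intro Y) simp
    finally show ?thesis .
  qed
  have c4: "card ((\<lambda>(c, r). Down c r) ` ({..<Hr * ss} \<times> {..W})) \<le> ?Y"
  proof -
    have "card ((\<lambda>(c, r). Down c r) ` ({..<Hr * ss} \<times> {..W})) \<le> Hr * ss * Suc W"
      by (rule order_trans[OF card_image_le]) (simp_all add: card_cartesian_product)
    also have "\<dots> \<le> Mx ^ 2 * Mx ^ 3" using Hs W1 by (intro mult_le_mono)
    also have "\<dots> = Mx ^ 5" by (simp only: power_add[symmetric]) simp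
    finally show ?thesis using Y[of 5] by simp
  qed
  have c5: "card ((\<lambda>(g, c). Cnt g c) ` ({..<W} \<times> {..W})) \<le> ?Y"
  proof -
    have "card ((\<lambda>(g, c). Cnt g c) ` ({..<W} \<times> {..W})) \<le> W * Suc W"
      by (rule order_trans[OF card_image_le]) (simp_all add: card_cartesian_product)
    also have "\<dots> \<le> Mx ^ 2 * Mx ^ 3" using W W1 by (intro mult_le_mono)
    also have "\<dots> = Mx ^ 5" by (simp only: power_add[symmetric]) simp
    finally show ?thesis using Y[of 5] by simp
  qed
  have c6: "card (Best ` {..<(L + 1) * Q}) \<le> ?Y"
  proof -
    have "card (Best ` {..<(L + 1) * Q}) \<le> (L + 1) * Q" by (rule order_trans[OF card_image_le]) simp_all
    also have "\<dots> \<le> Mx * Mx" using card_Ad_ge by (intro mult_le_mono)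
    also have "\<dots> = Mx ^ 2" by (simp add: power2_eq_square)
    finally show ?thesis using Y[of 2] by simp
  qed
  have c7: "card {Win} \<le> ?Y" using Y[of 0] by simp
  have "card Items \<le> card (Seed ` {..<F}) + card (Cand ` {..L})
     + card ((\<lambda>(xs, v, a). Up xs v a) ` (?ls \<times> {..W} \<times> Ad))
     + card ((\<lambda>(c, r). Down c r) ` ({..<Hr * ss} \<times> {..W})) + card ((\<lambda>(g, c). Cnt g c) ` ({..<W} \<times> {..W}))
     + card (Best ` {..<(L + 1) * Q}) + card {Win}"
    unfolding Items_def by (intro order_trans[OF card_Un_le] add_mono order_refl)
  also have "\<dots> \<le> 9 * ?Y" using c1 c2 c3 c4 c5 c6 c7 by linarith
  also have "\<dots> \<le> Mx ^ (3 * lv + 9)" using up[of "3 * lv + 8"] by (simp add: eval_nat_numeral)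
  finally show ?thesis .
qed

lemma width_le:
  assumes F: "F = B * ss * seed_bits" and B: "lv + 9 \<le> B" "CARD('d) \<le> B" "rad \<le> B"
  shows "real (mpc_width program) \<le> real (3 * lv + 10) * log 2 (real (global_space program))"
proof -
  have BM: "B \<le> Mx"
    using card_Ad_ge(4) B(1) by (intro order_trans[OF self_le_power[of B "m + 4"]]) auto
  have M: "2 \<le> Mx" using BM B by linarith
  have glob: "global_space program = CARD('d) * cap * Mx"
    by (simp add: global_space_def program_def Mx_def)
  have "1 \<le> CARD('d) * cap" using B(1) by (simp add: cap_def Suc_le_eq)
  hence "1 * Mx \<le> CARD('d) * cap * Mx" by (rule mult_le_mono1)
  hence "Mx \<le> global_space program" unfolding glob by simp
  hence lM: "log 2 (real Mx) \<le> log 2 (real (global_space program))" using M by simp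
  have "log 2 2 \<le> log 2 (real Mx)" using M by (subst log_le_cancel_iff) auto
  hence l1: "1 \<le> log 2 (real Mx)" by simp
  have "real (card Items) \<le> real (Mx ^ (3 * lv + 9))" using card_Items_le[OF F B] by (simp only: of_nat_le_iff)
  hence "log 2 (real (card Items)) \<le> log 2 (real Mx ^ (3 * lv + 9))"
    using card_Items_pos M by (subst log_le_cancel_iff) auto
  also have "\<dots> = real (3 * lv + 9) * log 2 (real Mx)" using M by (simp add: log_nat_power)
  finally have "real wd \<le> real (3 * lv + 9) * log 2 (real Mx) + 1"
  proof -
    assume *: "log 2 (real (card Items)) \<le> real (3 * lv + 9) * log 2 (real Mx)"
    have "0 \<le> log 2 (real (card Items))" using card_Items_pos by simp
    thus ?thesis unfolding wd_def using * by linarith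
  qed
  also have "\<dots> \<le> real (3 * lv + 9) * log 2 (real Mx) + log 2 (real Mx)" using l1 by simp
  also have "\<dots> = real (3 * lv + 10) * log 2 (real Mx)" by (simp add: algebra_simps)
  also have "\<dots> \<le> real (3 * lv + 10) * log 2 (real (global_space program))"
    using lM by (intro mult_left_mono) auto
  finally show ?thesis by (simp add: program_def)
qed

lemma program_simps:
  "mpc_rounds program = 9 * m + 53" "mpc_space program = CARD('d) * B ^ 2" "mpc_machines program = Mx"
proof -
  have "mpc_rounds program = Suc T8" "mpc_space program = CARD('d) * cap" "mpc_machines program = card Ad"
    unfolding program_def by (rule machine_simps)+
  thus "mpc_rounds program = 9 * m + 53" "mpc_space program = CARD('d) * B ^ 2" "mpc_machines program = Mx"
    by (simp_all add: Mx_def cap_def T8_def T7_def T6_def T5_def T4_def T3_def T2_def lv_def)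
qed

text \<open>One point per machine; so the quantification over all placements is not vacuous.\<close>

lemma placement_exists:
  assumes P: "finite P" "card P < B ^ (m + 1)" and B: "B > 0"
  shows "\<exists>s. input_placement program (P :: (real ^ 'd) set) s"
proof -
  let ?n = "card P"
  obtain f where f: "bij_betw f {0..<?n} P" using ex_bij_betw_nat_finite[OF P(1)] by blast
  have "B ^ (m + 1) \<le> B ^ (m + 4)" using B by (intro power_increasing) auto
  hence n: "?n \<le> Mx" using P(2) card_Ad_ge(4) by linarith
  define s where "s = (\<lambda>i. if i < ?n then [Pt (f i)] else [])"
  have "[0..<Mx] = [0..<?n] @ [?n..<Mx]" using upt_add_eq_append[of 0 ?n "Mx - ?n"] n by simp
  moreover have "concat (map s [0..<?n]) = map (Pt \<circ> f) [0..<?n]"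
  proof -
    have "concat (map s [0..<?n]) = concat (map (\<lambda>i. [Pt (f i)]) [0..<?n])"
      by (intro arg_cong[of _ _ concat] map_cong) (auto simp: s_def)
    also have "\<dots> = map (Pt \<circ> f) [0..<?n]" by (induction "[0..<?n]" rule: list.induct) (simp_all add: concat_map_singleton o_def)
    finally show ?thesis .
  qed
  moreover have "concat (map s [?n..<Mx]) = []" by (simp add: s_def)
  ultimately have "mset (concat (map s [0..<Mx])) = image_mset Pt (image_mset f (mset [0..<?n]))"
    by (simp add: multiset.map_comp)
  also have "image_mset f (mset [0..<?n]) = mset_set P"
    using f image_mset_mset_set[of f "{0..<?n}"] by (simp add: bij_betw_def)
  finally have "mset (concat (map s [0..<Mx])) = image_mset Pt (mset_set P)" .
  moreover have "num_words (s i) \<le> CARD('d) * B ^ 2" for i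
    using B by (simp add: s_def num_words_def)
  moreover have "s i = []" if "i \<ge> Mx" for i using that n by (simp add: s_def)
  ultimately show ?thesis by (intro exI[of _ s]) (simp add: input_placement_def program_simps)
qed

end

section \<open>The asymptotic bounds\<close>

definition branching :: "nat \<Rightarrow> nat \<Rightarrow> nat" where
  "branching m n = nat \<lfloor>real n powr (1 / real m)\<rfloor>"

text \<open>The sum of all lower bounds on the branching factor, so that each follows by dropping
  the others: traffic, number of nodes, rounding of the root, word width, and 36 for the success
  probability.\<close>

definition min_branching :: "'d::finite itself \<Rightarrow> nat \<Rightarrow> nat" where
  "min_branching d m =
     8 * (alg_params.t0 m + 2) * (card (alg_params.Off :: ('d \<Rightarrow> int) set) + 6)
     + card (alg_params.Off :: ('d \<Rightarrow> int) set) * (alg_params.lv m + 1)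
     + 2 ^ m + alg_params.lv m + CARD('d) + alg_params.rad TYPE('d) + 36"

text \<open>The summands guarantee the branching factor, a diameter above 2 by
  \<open>packing_bound\<close>, and \<open>log log n \<ge> 1\<close>.\<close>

definition min_size :: "'d::finite itself \<Rightarrow> nat \<Rightarrow> nat" where
  "min_size d m = min_branching d m ^ m + (8 * CARD('d) + 3) ^ CARD('d) + 16"

definition seed_count :: "'d::finite itself \<Rightarrow> nat \<Rightarrow> nat \<Rightarrow> nat \<Rightarrow> nat" where
  "seed_count d L B m = B * alg_params.ss L B m * alg_params.seed_bits d L B m"

definition good_hash :: "nat \<Rightarrow> nat \<Rightarrow> nat \<Rightarrow> (nat \<Rightarrow> 'd::finite node \<Rightarrow> nat) \<Rightarrow> bool" where
  "good_hash L B m g \<longleftrightarrow>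
     (\<forall>a. \<forall>\<nu>\<in>alg_params.univ L B m. g a \<nu> < alg_params.Hr L B m * alg_params.ss L B m) \<and>
     (\<forall>S\<subseteq>alg_params.univ L B m. card S \<le> alg_params.ss L B m \<longrightarrow>
        real (card {a. a < seed_count TYPE('d) L B m \<and>
            \<not> (inj_on (g a) S \<and> (\<forall>b. card {x\<in>S. g a x mod alg_params.Hr L B m = b} \<le> alg_params.t0 m))})
          \<le> 5 / real B * real (seed_count TYPE('d) L B m))"

text \<open>The hash family is chosen from \<open>n\<close>, \<open>L\<close> and \<open>m\<close>
  alone, so it is part of the program and independent of the points.\<close>

definition algorithm :: "nat \<Rightarrow> nat \<Rightarrow> nat \<Rightarrow> nat \<Rightarrow> 'd::finite mpc" where
  "algorithm m n k L = alg_params.program k L (branching m n) m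
     (seed_count TYPE('d) L (branching m n) m) (SOME g. good_hash L (branching m n) m g)"

lemma good_hash_exists: "B > 0 \<Longrightarrow> \<exists>g :: nat \<Rightarrow> 'd::finite node \<Rightarrow> nat. good_hash L B m g"
  unfolding good_hash_def seed_count_def by (rule alg_params.hash_exists)

lemma branching_bounds:
  assumes m: "m > 0" and n: "n \<ge> min_size d m"
  shows "min_branching d m \<le> branching m n" "n < branching m n ^ (m + 1)"
    "real (branching m n) \<le> real n powr (1 / real m)"
proof -
  have "n \<ge> min_branching d m ^ m" using n by (simp add: min_size_def)
  moreover have "min_branching d m \<ge> 2 ^ m" "min_branching d m > 0"
    by (simp_all add: min_branching_def)
  ultimately show "min_branching d m \<le> branching m n" "n < branching m n ^ (m + 1)"
    "real (branching m n) \<le> real n powr (1 / real m)"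
    unfolding branching_def using nth_root_bounds[OF m, of "min_branching d m" n] by simp_all
qed

text \<open>\<open>B ^ 2\<close> points on each of at most \<open>5 * (L + 1) * B ^ (m + 5)\<close>
  machines: the exponent \<open>1 + 7 / m\<close> is \<open>(m + 5 + 2) / m\<close>.\<close>

lemma algorithm_resources:
  fixes m n k L :: nat
  assumes m: "m > 0" and n: "n \<ge> min_size TYPE('d::finite) m"
  defines "A \<equiv> algorithm m n k L :: 'd mpc"
  shows "mpc_rounds A = 9 * m + 53"
    "real (mpc_space A) \<le> real CARD('d) * real n powr (2 / real m)"
    "real (global_space A) \<le> 5 * real CARD('d) * (real L + 1) * real n powr (1 + 7 / real m)"
    "real (mpc_width A) \<le> real (3 * alg_params.lv m + 10) * log 2 (real (global_space A))"
proof -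
  let ?B = "branching m n"
  note b = branching_bounds[OF m n]
  have npos: "n > 0" using n by (simp add: min_size_def)
  have pw: "real (?B ^ i) \<le> real n powr (real i / real m)" for i
  proof -
    have "real (?B ^ i) \<le> (real n powr (1 / real m)) ^ i" using b(3) by (simp add: power_mono)
    also have "\<dots> = real n powr (real i / real m)"
      using npos by (simp add: powr_realpow[symmetric] powr_powr)
    finally show ?thesis .
  qed
  have sp: "mpc_space A = CARD('d) * ?B ^ 2" and mach: "mpc_machines A = alg_params.Mx L ?B m"
    unfolding A_def algorithm_def by (rule alg_params.program_simps)+
  show "mpc_rounds A = 9 * m + 53" unfolding A_def algorithm_def by (rule alg_params.program_simps)
  show "real (mpc_space A) \<le> real CARD('d) * real n powr (2 / real m)"
    unfolding sp using pw[of 2] by (simp add: mult_left_mono)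
  have Bpos: "?B > 0" using b(1) by (simp add: min_branching_def)
  have "global_space A \<le> CARD('d) * ?B ^ 2 * (5 * (L + 1) * ?B ^ (m + 5))"
    unfolding global_space_def sp mach using alg_params.card_Ad_le[OF Bpos] by (rule mult_le_mono2)
  also have "\<dots> = 5 * CARD('d) * (L + 1) * ?B ^ (m + 7)"
  proof -
    have "?B ^ 2 * ?B ^ (m + 5) = ?B ^ (m + 7)" by (simp only: power_add[symmetric]) (simp add: add.commute)
    from this[symmetric] show ?thesis by (simp only: mult_ac)
  qed
  finally have "real (global_space A) \<le> real (5 * CARD('d) * (L + 1) * ?B ^ (m + 7))"
    by (simp only: of_nat_le_iff)
  also have "\<dots> = 5 * real CARD('d) * (real L + 1) * real (?B ^ (m + 7))"
    by (simp only: of_nat_mult of_nat_add of_nat_1 of_nat_numeral)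
  also have "\<dots> \<le> 5 * real CARD('d) * (real L + 1) * real n powr (real (m + 7) / real m)"
    by (rule mult_left_mono[OF pw]) simp
  also have "real (m + 7) / real m = 1 + 7 / real m" using m by (simp add: add_divide_distrib)
  finally show "real (global_space A) \<le> 5 * real CARD('d) * (real L + 1) * real n powr (1 + 7 / real m)" .
  show "real (mpc_width A) \<le> real (3 * alg_params.lv m + 10) * log 2 (real (global_space A))"
    unfolding A_def algorithm_def
  proof (rule alg_params.width_le)
    show "alg_params.lv m + 9 \<le> ?B" "CARD('d) \<le> ?B" "alg_params.rad TYPE('d) \<le> ?B"
      using b(1) unfolding min_branching_def by linarith+
  qed (simp add: seed_count_def)
qed

text \<open>As \<open>packing_bound\<close> forces a diameter above 2, its logarithm exceeds 1, and
  the square covers both the rounding and the summand in \<open>L + 1\<close>.\<close>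

lemma scale_bounds:
  fixes P :: "(real ^ 'd::finite) set"
  assumes fin: "finite P" and md: "min_pairwise_dist P = 1" and n: "card P > (8 * CARD('d) + 3) ^ CARD('d)"
  defines "L \<equiv> nat \<lceil>log 2 (diameter P)\<rceil>"
  shows "p \<in> P \<Longrightarrow> q \<in> P \<Longrightarrow> p \<noteq> q \<Longrightarrow> 1 \<le> dist p q" "p \<in> P \<Longrightarrow> q \<in> P \<Longrightarrow> dist p q \<le> 2 ^ L"
    "real L + 1 \<le> 3 * (log 2 (diameter P))\<^sup>2"
proof -
  show ge: "1 \<le> dist p q" if "p \<in> P" "q \<in> P" "p \<noteq> q" for p q
    using min_pairwise_dist_le[OF fin that] md by simp
  have D: "diameter P > 2" using packing_bound[OF fin ge] n by fastforce
  have l1: "log 2 (diameter P) > 1" using D by (simp add: less_log_iff)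
  have Ll: "log 2 (diameter P) \<le> real L" "real L \<le> log 2 (diameter P) + 1"
    unfolding L_def using l1 by linarith+
  have "diameter P \<le> 2 powr real L" using Ll(1) D by (simp add: log_le_iff)
  hence "diameter P \<le> 2 ^ L" by (simp add: powr_realpow)
  thus "dist p q \<le> 2 ^ L" if "p \<in> P" "q \<in> P"
    using diameter_bounded_bound[OF finite_imp_bounded[OF fin] that] by simp
  have "1 * log 2 (diameter P) \<le> log 2 (diameter P) * log 2 (diameter P)"
    using l1 by (intro mult_right_mono) auto
  thus "real L + 1 \<le> 3 * (log 2 (diameter P))\<^sup>2" using Ll l1 unfolding power2_eq_square by linarith
qed

text \<open>The failure probability \<open>6 / B\<close> is at most \<open>1 / sqrt B\<close> as
  \<open>B \<ge> 36\<close>, and \<open>n < B ^ (m + 1)\<close> turns \<open>sqrt B\<close> into a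
  power of \<open>n\<close>. The halved exponent pays for the factor 6.\<close>

lemma algorithm_correct:
  fixes P :: "(real ^ 'd::finite) set"
  assumes m: "m > 0" and n: "card P > min_size TYPE('d) m"
    and fin: "finite P" and md: "min_pairwise_dist P = 1" and k: "0 < k" "k < card P"
  defines "A \<equiv> algorithm m (card P) k (nat \<lceil>log 2 (diameter P)\<rceil>) :: 'd mpc"
  shows "\<exists>s. input_placement A P s"
    and "input_placement A P s \<Longrightarrow> measure_pmf.prob (mpc_run A s) {Some t |t. let T = mpc_output A t in
      T \<subseteq> P \<and> T \<noteq> {} \<and> kcenter_cost P T \<le> 6 * real CARD('d) * kcenter_opt P k \<and> card T \<le> k}
      \<ge> 1 - 1 / real (card P) powr (1 / (2 * (real m + 1)))"
proof -
  let ?n = "card P" let ?B = "branching m ?n" let ?L = "nat \<lceil>log 2 (diameter P)\<rceil>"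
  let ?h = "SOME g :: nat \<Rightarrow> 'd node \<Rightarrow> nat. good_hash ?L ?B m g"
  let ?F = "seed_count TYPE('d) ?L ?B m"
  note b = branching_bounds[OF m less_imp_le[OF n]]
  have B36: "?B \<ge> 36" using b(1) unfolding min_branching_def by linarith
  hence Bpos: "?B > 0" by simp
  show "\<exists>s. input_placement A P s"
    unfolding A_def algorithm_def by (rule alg_params.placement_exists[OF fin b(2) Bpos])
  have h: "good_hash ?L ?B m ?h" using good_hash_exists[OF Bpos] by (rule someI_ex)
  have Fpos: "?F > 0"
    using Bpos by (simp add: seed_count_def alg_params.ss_def alg_params.Q_def alg_params.W_def
        alg_params.seed_bits_def)
  have n': "?n > (8 * CARD('d) + 3) ^ CARD('d)" using n by (simp add: min_size_def)
  have inp: "alg_input k ?L ?B m ?F ?h P"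
  proof
    show "8 * (alg_params.t0 m + 2) * (card (alg_params.Off :: ('d \<Rightarrow> int) set) + 6) \<le> ?B"
      "card (alg_params.Off :: ('d \<Rightarrow> int) set) * (alg_params.lv m + 1) \<le> ?B"
      using b(1) unfolding min_branching_def by linarith+
    show "1 \<le> dist p q" if "p \<in> P" "q \<in> P" "p \<noteq> q" for p q
      using scale_bounds(1)[OF fin md n' that] .
    show "dist p q \<le> 2 ^ ?L" if "p \<in> P" "q \<in> P" for p q
      using scale_bounds(2)[OF fin md n' that] .
    show "?h a \<nu> < alg_params.Hr ?L ?B m * alg_params.ss ?L ?B m" if "\<nu> \<in> alg_params.univ ?L ?B m" for a \<nu>
      using h that unfolding good_hash_def by blast
    show "real (card {a. a < ?F \<and> \<not> (inj_on (?h a) S \<and>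
         (\<forall>b. card {x\<in>S. ?h a x mod alg_params.Hr ?L ?B m = b} \<le> alg_params.t0 m))}) \<le> 5 / real ?B * real ?F"
      if "S \<subseteq> alg_params.univ ?L ?B m" "card S \<le> alg_params.ss ?L ?B m" for S
      using h that unfolding good_hash_def by blast
  qed (use fin Fpos b(2) k in auto)
  assume s: "input_placement A P s"
  have pl: "alg_placed k ?L ?B m ?F ?h P s"
    using inp s unfolding alg_placed_def alg_placed_axioms_def A_def algorithm_def by blast
  have npos: "real ?n > 0" using n by simp
  have "real ?n powr (1 / (2 * (real m + 1))) \<le> real (?B ^ (m + 1)) powr (1 / (2 * (real m + 1)))"
    by (intro powr_mono2 of_nat_mono less_imp_le[OF b(2)]) auto
  also have "real (?B ^ (m + 1)) = real ?B powr real (m + 1)"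
    using Bpos by (subst powr_realpow) auto
  also have "(real ?B powr real (m + 1)) powr (1 / (2 * (real m + 1))) = real ?B powr (1 / 2)"
  proof -
    have "real (m + 1) * (1 / (2 * (real m + 1))) = 1 / 2" by (simp add: field_simps)
    thus ?thesis by (simp only: powr_powr)
  qed
  also have "\<dots> = sqrt (real ?B)" by (simp add: powr_half_sqrt)
  finally have root: "real ?n powr (1 / (2 * (real m + 1))) \<le> sqrt (real ?B)" .
  have "sqrt 36 \<le> sqrt (real ?B)" using B36 by (intro real_sqrt_le_mono) linarith
  moreover have "sqrt (36 :: real) = 6" by (rule real_sqrt_unique) auto
  ultimately have "6 * sqrt (real ?B) \<le> sqrt (real ?B) * sqrt (real ?B)" by (intro mult_right_mono) auto
  also have "\<dots> = real ?B" by simp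
  finally have "6 * (real ?n powr (1 / (2 * (real m + 1)))) \<le> real ?B" using root by linarith
  hence "6 / real ?B \<le> 1 / real ?n powr (1 / (2 * (real m + 1)))"
    using Bpos npos by (simp add: field_simps)
  thus "measure_pmf.prob (mpc_run A s) {Some t |t. let T = mpc_output A t in
      T \<subseteq> P \<and> T \<noteq> {} \<and> kcenter_cost P T \<le> 6 * real CARD('d) * kcenter_opt P k \<and> card T \<le> k}
      \<ge> 1 - 1 / real ?n powr (1 / (2 * (real m + 1)))"
    using alg_placed.program_success[OF pl] unfolding A_def algorithm_def by linarith
qed

section \<open>Uniform asymptotic bounds and the final assembly\<close>

lemma bigo_principalI:
  fixes f g :: "'a \<Rightarrow> real"
  assumes "\<And>x. x \<in> A \<Longrightarrow> \<bar>f x\<bar> \<le> C * \<bar>g x\<bar>"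
  shows "f \<in> O[principal A](g)"
  using assms by (intro bigoI[of _ C]) (simp add: eventually_principal)

lemma soft_OI: "g \<in> O[F](f) \<Longrightarrow> g \<in> soft_O F f"
  unfolding soft_O_def by (auto intro!: exI[of _ 0])

lemma soft_Theta_refl: "f \<in> soft_Theta F f"
  unfolding soft_Theta_def by (auto intro!: soft_OI exI[of _ 0])

lemma kcenter_opt_nonneg:
  assumes "finite P" "0 < k" "k < card P"
  shows "0 \<le> kcenter_opt P k"
  using kcenter_opt_attained[OF assms] by (metis zero_le_dist)

theorem mainTheorem2:
  fixes \<delta> \<rho> :: real
  assumes "0 < \<delta>" and "\<delta> < 1" and "0 < \<rho>"
  shows "\<exists>(c::real) (c0::nat). \<forall>\<kappa>>0.
    \<exists>(alg :: nat \<Rightarrow> nat \<Rightarrow> nat \<Rightarrow> nat \<Rightarrow> 'd::finite mpc) \<beta> g h (\<gamma>::real).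
      let I = kcenter_instances c c0 \<kappa>; F = principal I in
        (\<lambda>x. real (mpc_rounds (alg_for alg x))) \<in> O[F](\<lambda>(P, k, \<alpha>). log 2 (log 2 (card P))) \<and>
        (\<lambda>x. real (mpc_space (alg_for alg x))) \<in> O[F](\<lambda>(P, k, \<alpha>). card P powr \<delta>) \<and>
        (\<lambda>x. real (global_space (alg_for alg x)))
          \<in> soft_O F (\<lambda>(P, k, \<alpha>). card P powr (1 + \<rho>) * (log 2 (diameter P))\<^sup>2) \<and>
        (\<lambda>x. real (mpc_width (alg_for alg x)))
          \<in> O[F](\<lambda>x. log 2 (global_space (alg_for alg x))) \<and>
        \<beta> \<in> O[F](\<lambda>(P, k, \<alpha>). \<alpha> + iter_log (\<alpha> + 1) (card P)) \<and>
        g \<in> soft_Theta F (\<lambda>(P, k, \<alpha>). iter_log \<alpha> (card P)) \<and>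
        h \<in> soft_Theta F (\<lambda>(P, k, \<alpha>). iter_log \<alpha> (card P) ^ 3) \<and>
        \<gamma> > 0 \<and>
        (\<forall>(P, k, \<alpha>) \<in> I.
          let A = alg_for alg (P, k, \<alpha>) in
            (\<exists>s. input_placement A P s) \<and>
            (\<forall>s. input_placement A P s \<longrightarrow>
              measure_pmf.prob (mpc_run A s)
                {Some t | t. let T = mpc_output A t in
                   T \<subseteq> P \<and> T \<noteq> {} \<and>
                   kcenter_cost P T \<le> \<beta> (P, k, \<alpha>) * kcenter_opt P k \<and>
                   card T \<le> k * (1 + 1 / g (P, k, \<alpha>)) + h (P, k, \<alpha>)}
              \<ge> 1 - 1 / card P powr \<gamma>))"
proof -
  \<comment> \<open>Local space \<open>B ^ 2\<close> requires \<open>2 / m \<le> \<delta>\<close>,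
    and global space requires \<open>7 / m \<le> \<rho>\<close>.\<close>
  define m where "m = nat \<lceil>2 / \<delta>\<rceil> + nat \<lceil>7 / \<rho>\<rceil> + 1"
  \<comment> \<open>By \<open>log_star_large\<close>, this makes \<open>n\<close> exceed
    \<open>min_size\<close>.\<close>
  define c0 where "c0 = min_size TYPE('d) m"
  define alg :: "nat \<Rightarrow> nat \<Rightarrow> nat \<Rightarrow> nat \<Rightarrow> 'd mpc" where "alg = (\<lambda>n k \<alpha>. algorithm m n k)"
  define \<beta> :: "(real ^ 'd) set \<times> nat \<times> nat \<Rightarrow> real" where
    "\<beta> = (\<lambda>(P, k, \<alpha>). 6 * real CARD('d) * (real \<alpha> + iter_log (\<alpha> + 1) (real (card P))))"
  define g :: "(real ^ 'd) set \<times> nat \<times> nat \<Rightarrow> real" where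
    "g = (\<lambda>(P, k, \<alpha>). iter_log \<alpha> (real (card P)))"
  define h :: "(real ^ 'd) set \<times> nat \<times> nat \<Rightarrow> real" where
    "h = (\<lambda>(P, k, \<alpha>). iter_log \<alpha> (real (card P)) ^ 3)"
  define \<gamma> where "\<gamma> = 1 / (2 * (real m + 1))"
  have m: "m > 0" by (simp add: m_def)
  have "2 / \<delta> \<le> real m" "7 / \<rho> \<le> real m" unfolding m_def by linarith+
  hence md: "2 / real m \<le> \<delta>" "7 / real m \<le> \<rho>"
    using m assms by (simp_all add: field_simps)
  show ?thesis
  \<comment> \<open>With exponent 0 the lower bound on \<open>k\<close> is the constant \<kappa>,
    whose positivity gives \<open>k > 0\<close>.\<close>
  proof (rule exI[of _ 0], rule exI[of _ c0], intro allI impI)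
    fix \<kappa> :: real assume \<kappa>: "\<kappa> > 0"
    define I where "I = (kcenter_instances 0 c0 \<kappa> :: ((real ^ 'd) set \<times> nat \<times> nat) set)"
    have I: "finite P" "min_pairwise_dist P = 1" "0 < k" "k < card P" "card P > min_size TYPE('d) m"
      "iter_log \<alpha> (real (card P)) > 1" "iter_log (\<alpha> + 1) (real (card P)) > 1" "\<alpha> \<ge> 1"
      if "(P, k, \<alpha>) \<in> I" for P k \<alpha>
    proof -
      have i: "finite P" "min_pairwise_dist P = 1" "k < card P"
        "\<kappa> * log 2 (real (card P)) powr 0 \<le> real k" "1 \<le> \<alpha>" "\<alpha> + c0 \<le> log_star (real (card P))"
        using that by (auto simp: I_def kcenter_instances_def)
      show "finite P" "min_pairwise_dist P = 1" "k < card P" "\<alpha> \<ge> 1" by (fact i)+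
      have c0: "c0 \<ge> 16" by (simp add: c0_def min_size_def)
      have "real (card P) > real c0 + 1" by (rule log_star_large) (use i in linarith)
      thus n: "card P > min_size TYPE('d) m" unfolding c0_def[symmetric] by linarith
      \<comment> \<open>\<open>c0 \<ge> 16\<close> leaves room for the index
        \<open>\<alpha> + 1\<close> below \<open>log_star n\<close>.\<close>
      show "iter_log \<alpha> (real (card P)) > 1" "iter_log (\<alpha> + 1) (real (card P)) > 1"
        by (rule iter_log_gt_1, use i c0 in linarith)+
      have "real (card P) > 1" using n by (simp add: min_size_def)
      hence "log 2 (real (card P)) > 0" by simp
      thus "0 < k" using i(4) \<kappa> by simp
    qed
    have n16: "card P > 16" if "(P, k, \<alpha>) \<in> I" for P k \<alpha>
      using I(5)[OF that] by (simp add: min_size_def)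
    have alg_for: "alg_for alg (P, k, \<alpha>) = algorithm m (card P) k (nat \<lceil>log 2 (diameter P)\<rceil>)" for P k \<alpha>
      by (simp add: alg_for_def alg_def)
    note res = algorithm_resources[OF m less_imp_le[OF I(5)]]
    have rounds: "(\<lambda>x. real (mpc_rounds (alg_for alg x)))
        \<in> O[principal I](\<lambda>(P, k, \<alpha>). log 2 (log 2 (real (card P))))"
    proof (rule bigo_principalI[where C = "real (9 * m + 53)"], clarify)
      fix P :: "(real ^ 'd) set" and k \<alpha> assume x: "(P, k, \<alpha>) \<in> I"
      \<comment> \<open>For \<open>n > 16\<close> the double logarithm is at least 1, so a constant
        number of rounds is within the bound.\<close>
      have "log 2 (2 ^ 4) \<le> log 2 (real (card P))" using n16[OF x] by (subst log_le_cancel_iff) auto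
      moreover have "log 2 ((2::real) ^ 4) = real 4" by (subst log_nat_power) auto
      ultimately have "2 \<le> log 2 (real (card P))" by linarith
      hence "log 2 2 \<le> log 2 (log 2 (real (card P)))" by (subst log_le_cancel_iff) auto
      hence l: "1 \<le> log 2 (log 2 (real (card P)))" by simp
      have "real (9 * m + 53) * 1 \<le> real (9 * m + 53) * log 2 (log 2 (real (card P)))"
        using l by (intro mult_left_mono) auto
      thus "\<bar>real (mpc_rounds (alg_for alg (P, k, \<alpha>)))\<bar> \<le> real (9 * m + 53) * \<bar>log 2 (log 2 (real (card P)))\<bar>"
        unfolding alg_for res(1)[OF x] using l by simp
    qed
    have space: "(\<lambda>x. real (mpc_space (alg_for alg x))) \<in> O[principal I](\<lambda>(P, k, \<alpha>). real (card P) powr \<delta>)"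
    proof (rule bigo_principalI[where C = "real CARD('d)"], clarify)
      fix P :: "(real ^ 'd) set" and k \<alpha> assume x: "(P, k, \<alpha>) \<in> I"
      have "real (card P) powr (2 / real m) \<le> real (card P) powr \<delta>"
        using n16[OF x] md(1) by (intro powr_mono) auto
      hence "real CARD('d) * real (card P) powr (2 / real m) \<le> real CARD('d) * real (card P) powr \<delta>"
        by (rule mult_left_mono) simp
      thus "\<bar>real (mpc_space (alg_for alg (P, k, \<alpha>)))\<bar> \<le> real CARD('d) * \<bar>real (card P) powr \<delta>\<bar>"
        unfolding alg_for using order_trans[OF res(2)[OF x]] by simp
    qed
    have glob: "(\<lambda>x. real (global_space (alg_for alg x)))
        \<in> soft_O (principal I) (\<lambda>(P, k, \<alpha>). real (card P) powr (1 + \<rho>) * (log 2 (diameter P))\<^sup>2)"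
    proof (rule soft_OI, rule bigo_principalI[where C = "15 * real CARD('d)"], clarify)
      fix P :: "(real ^ 'd) set" and k \<alpha> assume x: "(P, k, \<alpha>) \<in> I"
      let ?L = "nat \<lceil>log 2 (diameter P)\<rceil>"
      have n': "(8 * CARD('d) + 3) ^ CARD('d) < card P" using I(5)[OF x] by (simp add: min_size_def)
      have "real (global_space (alg_for alg (P, k, \<alpha>)))
          \<le> 5 * real CARD('d) * (real ?L + 1) * real (card P) powr (1 + 7 / real m)"
        unfolding alg_for by (rule res(3)[OF x])
      also have "\<dots> \<le> 5 * real CARD('d) * (3 * (log 2 (diameter P))\<^sup>2) * real (card P) powr (1 + \<rho>)"
        using scale_bounds(3)[OF I(1,2)[OF x] n'] n16[OF x] md(2)
        by (intro mult_mono powr_mono) auto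
      also have "\<dots> = 15 * real CARD('d) * \<bar>real (card P) powr (1 + \<rho>) * (log 2 (diameter P))\<^sup>2\<bar>" by simp
      finally show "\<bar>real (global_space (alg_for alg (P, k, \<alpha>)))\<bar>
          \<le> 15 * real CARD('d) * \<bar>real (card P) powr (1 + \<rho>) * (log 2 (diameter P))\<^sup>2\<bar>" by simp
    qed
    have width: "(\<lambda>x. real (mpc_width (alg_for alg x))) \<in> O[principal I](\<lambda>x. log 2 (real (global_space (alg_for alg x))))"
    proof (rule bigo_principalI[where C = "real (3 * alg_params.lv m + 10)"], clarify)
      fix P :: "(real ^ 'd) set" and k \<alpha> assume x: "(P, k, \<alpha>) \<in> I"
      have "real (mpc_width (alg_for alg (P, k, \<alpha>)))
          \<le> real (3 * alg_params.lv m + 10) * log 2 (real (global_space (alg_for alg (P, k, \<alpha>))))"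
        unfolding alg_for by (rule res(4)[OF x])
      also have "\<dots> \<le> real (3 * alg_params.lv m + 10) * \<bar>log 2 (real (global_space (alg_for alg (P, k, \<alpha>))))\<bar>"
        by (intro mult_left_mono) auto
      finally show "\<bar>real (mpc_width (alg_for alg (P, k, \<alpha>)))\<bar>
          \<le> real (3 * alg_params.lv m + 10) * \<bar>log 2 (real (global_space (alg_for alg (P, k, \<alpha>))))\<bar>" by simp
    qed
    have beta: "\<beta> \<in> O[principal I](\<lambda>(P, k, \<alpha>). real \<alpha> + iter_log (\<alpha> + 1) (real (card P)))"
      by (rule bigo_principalI[where C = "6 * real CARD('d)"], clarify) (simp add: \<beta>_def abs_mult)
    have correct: "(\<exists>s. input_placement A P s) \<and> (\<forall>s. input_placement A P s \<longrightarrow>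
              measure_pmf.prob (mpc_run A s)
                {Some t | t. let T = mpc_output A t in
                   T \<subseteq> P \<and> T \<noteq> {} \<and>
                   kcenter_cost P T \<le> \<beta> (P, k, \<alpha>) * kcenter_opt P k \<and>
                   real (card T) \<le> real k * (1 + 1 / g (P, k, \<alpha>)) + h (P, k, \<alpha>)}
              \<ge> 1 - 1 / real (card P) powr \<gamma>)"
      if x: "(P, k, \<alpha>) \<in> I" and A: "A = alg_for alg (P, k, \<alpha>)" for P k \<alpha> A
    proof (intro conjI allI impI)
      note cor = algorithm_correct[OF m I(5,1-4)[OF x], folded alg_for[of P k \<alpha>] A]
      show "\<exists>s. input_placement A P s" by (rule cor(1))
      fix s assume s: "input_placement A P s"
      \<comment> \<open>The factor in \<beta> exceeds 1 by the choice of \<open>c0\<close>, so a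
        constant-factor approximation meets the bound on the cost.\<close>
      have "1 * kcenter_opt P k \<le> (real \<alpha> + iter_log (\<alpha> + 1) (real (card P))) * kcenter_opt P k"
        using I(7,8)[OF x] kcenter_opt_nonneg[OF I(1,3,4)[OF x]] by (intro mult_right_mono) auto
      hence "6 * real CARD('d) * (1 * kcenter_opt P k)
          \<le> 6 * real CARD('d) * ((real \<alpha> + iter_log (\<alpha> + 1) (real (card P))) * kcenter_opt P k)"
        by (rule mult_left_mono) simp
      hence b: "6 * real CARD('d) * kcenter_opt P k \<le> \<beta> (P, k, \<alpha>) * kcenter_opt P k"
        by (simp add: \<beta>_def mult_ac)
      \<comment> \<open>Both correction terms are nonnegative, so at most \<open>k\<close> centers
        meet the bound on their number.\<close>
      have "0 \<le> real k * (1 / g (P, k, \<alpha>))" "0 \<le> h (P, k, \<alpha>)"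
        using I(6)[OF x] by (simp_all add: g_def h_def)
      hence kk: "real k \<le> real k * (1 + 1 / g (P, k, \<alpha>)) + h (P, k, \<alpha>)" by (simp add: distrib_left)
      have "1 - 1 / real (card P) powr \<gamma> \<le> measure_pmf.prob (mpc_run A s)
          {Some t |t. let T = mpc_output A t in T \<subseteq> P \<and> T \<noteq> {} \<and>
             kcenter_cost P T \<le> 6 * real CARD('d) * kcenter_opt P k \<and> card T \<le> k}"
        unfolding \<gamma>_def by (rule cor(2)[OF s])
      also have "\<dots> \<le> measure_pmf.prob (mpc_run A s)
                {Some t | t. let T = mpc_output A t in
                   T \<subseteq> P \<and> T \<noteq> {} \<and>
                   kcenter_cost P T \<le> \<beta> (P, k, \<alpha>) * kcenter_opt P k \<and>
                   real (card T) \<le> real k * (1 + 1 / g (P, k, \<alpha>)) + h (P, k, \<alpha>)}"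
      proof (intro measure_pmf.finite_measure_mono subsetI)
        fix z assume "z \<in> {Some t |t. let T = mpc_output A t in T \<subseteq> P \<and> T \<noteq> {} \<and>
             kcenter_cost P T \<le> 6 * real CARD('d) * kcenter_opt P k \<and> card T \<le> k}"
        then obtain t where t: "z = Some t" "mpc_output A t \<subseteq> P" "mpc_output A t \<noteq> {}"
          "kcenter_cost P (mpc_output A t) \<le> 6 * real CARD('d) * kcenter_opt P k" "card (mpc_output A t) \<le> k"
          by (auto simp: Let_def)
        have "kcenter_cost P (mpc_output A t) \<le> \<beta> (P, k, \<alpha>) * kcenter_opt P k" using t(4) b by linarith
        moreover have "real (card (mpc_output A t)) \<le> real k * (1 + 1 / g (P, k, \<alpha>)) + h (P, k, \<alpha>)"
          using t(5) kk by linarith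
        ultimately show "z \<in> {Some t | t. let T = mpc_output A t in
                   T \<subseteq> P \<and> T \<noteq> {} \<and>
                   kcenter_cost P T \<le> \<beta> (P, k, \<alpha>) * kcenter_opt P k \<and>
                   real (card T) \<le> real k * (1 + 1 / g (P, k, \<alpha>)) + h (P, k, \<alpha>)}"
          using t(1-3) by (simp add: Let_def)
      qed simp
      finally show "1 - 1 / real (card P) powr \<gamma> \<le> measure_pmf.prob (mpc_run A s)
                {Some t | t. let T = mpc_output A t in
                   T \<subseteq> P \<and> T \<noteq> {} \<and>
                   kcenter_cost P T \<le> \<beta> (P, k, \<alpha>) * kcenter_opt P k \<and>
                   real (card T) \<le> real k * (1 + 1 / g (P, k, \<alpha>)) + h (P, k, \<alpha>)}" .
    qed
    have gam: "\<gamma> > 0" by (simp add: \<gamma>_def)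
    have gT: "g \<in> soft_Theta (principal I) (\<lambda>(P, k, \<alpha>). iter_log \<alpha> (real (card P)))"
      unfolding g_def by (rule soft_Theta_refl)
    have hT: "h \<in> soft_Theta (principal I) (\<lambda>(P, k, \<alpha>). iter_log \<alpha> (real (card P)) ^ 3)"
      unfolding h_def by (rule soft_Theta_refl)
    show "\<exists>(alg :: nat \<Rightarrow> nat \<Rightarrow> nat \<Rightarrow> nat \<Rightarrow> 'd mpc) \<beta> g h (\<gamma>::real).
      let I = kcenter_instances 0 c0 \<kappa>; F = principal I in
        (\<lambda>x. real (mpc_rounds (alg_for alg x))) \<in> O[F](\<lambda>(P, k, \<alpha>). log 2 (log 2 (card P))) \<and>
        (\<lambda>x. real (mpc_space (alg_for alg x))) \<in> O[F](\<lambda>(P, k, \<alpha>). card P powr \<delta>) \<and>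
        (\<lambda>x. real (global_space (alg_for alg x)))
          \<in> soft_O F (\<lambda>(P, k, \<alpha>). card P powr (1 + \<rho>) * (log 2 (diameter P))\<^sup>2) \<and>
        (\<lambda>x. real (mpc_width (alg_for alg x)))
          \<in> O[F](\<lambda>x. log 2 (global_space (alg_for alg x))) \<and>
        \<beta> \<in> O[F](\<lambda>(P, k, \<alpha>). \<alpha> + iter_log (\<alpha> + 1) (card P)) \<and>
        g \<in> soft_Theta F (\<lambda>(P, k, \<alpha>). iter_log \<alpha> (card P)) \<and>
        h \<in> soft_Theta F (\<lambda>(P, k, \<alpha>). iter_log \<alpha> (card P) ^ 3) \<and>
        \<gamma> > 0 \<and>
        (\<forall>(P, k, \<alpha>) \<in> I.
          let A = alg_for alg (P, k, \<alpha>) in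
            (\<exists>s. input_placement A P s) \<and>
            (\<forall>s. input_placement A P s \<longrightarrow>
              measure_pmf.prob (mpc_run A s)
                {Some t | t. let T = mpc_output A t in
                   T \<subseteq> P \<and> T \<noteq> {} \<and>
                   kcenter_cost P T \<le> \<beta> (P, k, \<alpha>) * kcenter_opt P k \<and>
                   card T \<le> k * (1 + 1 / g (P, k, \<alpha>)) + h (P, k, \<alpha>)}
              \<ge> 1 - 1 / card P powr \<gamma>))"
      unfolding Let_def I_def[symmetric]
    proof (intro exI conjI)
      show "\<forall>(P, k, \<alpha>) \<in> I. (\<exists>s. input_placement (alg_for alg (P, k, \<alpha>)) P s) \<and>
            (\<forall>s. input_placement (alg_for alg (P, k, \<alpha>)) P s \<longrightarrow>
              measure_pmf.prob (mpc_run (alg_for alg (P, k, \<alpha>)) s)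
                {Some t | t. 
                   mpc_output (alg_for alg (P, k, \<alpha>)) t \<subseteq> P \<and> mpc_output (alg_for alg (P, k, \<alpha>)) t \<noteq> {} \<and>
                   kcenter_cost P (mpc_output (alg_for alg (P, k, \<alpha>)) t) \<le> \<beta> (P, k, \<alpha>) * kcenter_opt P k \<and>
                   card (mpc_output (alg_for alg (P, k, \<alpha>)) t) \<le> k * (1 + 1 / g (P, k, \<alpha>)) + h (P, k, \<alpha>)}
              \<ge> 1 - 1 / card P powr \<gamma>)"
        using correct[OF _ refl] unfolding Let_def by blast
    qed (rule rounds space glob width beta gT hT gam)+
  qed
qed

end
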